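(* Let $H$ be the Hopf algebra over $\Bbbk=\mathbb C$ associated to a group datum $(G,\chi,g,1)$ of non-nilpotent type, as in the context. The stable Green ring $r_{st}(H)$, with its $\mathbb Z$-basis of isomorphism classes of indecomposable non-projective $H$-modules, is a transitive fusion ring.
   Context: Let $\Bbbk=\mathbb C$; modules are finite-dimensional left modules. Fix a finite group $G$, a $\Bbbk$-linear character $\chi$ of $G$ and a central element $g\in G$; let $n\ge 2$ be the order of $q=\chi(g)$, and assume $\chi^n=1$ and $g^n\neq 1$. $H$ is the Hopf algebra generated as an algebra by $y$ and $G$, with $\Bbbk G$ as a subalgebra and relations $y^n=g^n-1$, $yh=\chi(h)hy$ for $h\in G$; $\Delta(y)=y\otimes g+1\otimes y$, $\varepsilon(y)=0$, $S(y)=-yg^{-1}$, and the elements of $G$ are group-like. It has $\Bbbk$-basis $\{y^ih\mid h\in G,\ 0\le i\le n-1\}$. The stable category of $H$ has the same objects as $H$-mod and morphism spaces $\mathrm{Hom}_H(X,Y)/\mathcal P(X,Y)$, where $\mathcal P(X,Y)$ is the subspace of morphisms factoring through projective modules; it is monoidal with the tensor product of $H$-mod. The stable Green ring $r_{st}(H)$ is its Green ring; equivalently $r_{st}(H)\cong r(H)/\mathcal P$, where $r(H)$ is the Green ring of $H$ (generated by isomorphism classes modulo direct sums, with product given by $\otimes$) and $\mathcal P$ is the ideal spanned by the classes of indecomposable projective modules. It has a $\mathbb Z$-basis consisting of the isomorphism classes of indecomposable non-projective $H$-modules. Fusion ring: let $R$ be a unital associative ring which is free as a $\mathbb Z$-module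 with a finite basis $B=\{b_i\mid i\in I\}$ containing $1$. $R$ is a fusion ring if (1) $b_ib_j=\sum_kp_{ij}^kb_k$ with $p_{ij}^k\in\mathbb Z_+$ (nonnegative integers) for all $i,j\in I$; (2) there is a subset $I_0\subset I$ with $\sum_{i\in I_0}b_i=1$; (3) letting $\psi:R\to\mathbb Z$ be the group homomorphism with $\psi(b_i)=1$ if $i\in I_0$ and $0$ otherwise, there is an involution $i\mapsto i^*$ of $I$ such that the induced map $\sum_ip_ib_i\mapsto\sum_ip_ib_{i^*}$ ($p_i\in\mathbb Z$) is an anti-involution of the ring $R$ and $\psi(b_ib_j)=1$ if $i=j^*$ and $0$ otherwise. The fusion ring $R$ is transitive if for any $b_i$ and $b_j$ there exist $b_k$ and $b_l$ such that $b_ib_k$ and $b_lb_i$ involve $b_j$ with a nonzero coefficient. *)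

theory Defs
  imports
    "HOL-Algebra.QuotRing"
    "HOL-Library.Poly_Mapping"
    "Jordan_Normal_Form.Matrix"
begin

section \<open>Fusion rings\<close>

text \<open>The basis is a family indexed by \<open>I\<close>; uniqueness of the coordinates forces it to be injective.\<close>

definition is_Z_basis :: "('r, 'm) ring_scheme \<Rightarrow> 'i set \<Rightarrow> ('i \<Rightarrow> 'r) \<Rightarrow> bool" where
  "is_Z_basis R I b \<longleftrightarrow> finite I \<and> b \<in> I \<rightarrow> carrier R \<and>
     (\<forall>x\<in>carrier R. \<exists>!c :: 'i \<Rightarrow> int. c \<in> extensional I \<and> x = (\<Oplus>\<^bsub>R\<^esub>i\<in>I. [c i] \<cdot>\<^bsub>R\<^esub> b i))"

definition coords :: "('r, 'm) ring_scheme \<Rightarrow> 'i set \<Rightarrow> ('i \<Rightarrow> 'r) \<Rightarrow> 'r \<Rightarrow> 'i \<Rightarrow> int" where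
  "coords R I b x = (THE c. c \<in> extensional I \<and> x = (\<Oplus>\<^bsub>R\<^esub>i\<in>I. [c i] \<cdot>\<^bsub>R\<^esub> b i))"

text \<open>\<open>structure_const R I b i j k\<close> is \<open>p\<^sub>i\<^sub>j\<^sup>k\<close>.\<close>

definition structure_const ::
    "('r, 'm) ring_scheme \<Rightarrow> 'i set \<Rightarrow> ('i \<Rightarrow> 'r) \<Rightarrow> 'i \<Rightarrow> 'i \<Rightarrow> 'i \<Rightarrow> int" where
  "structure_const R I b i j k = coords R I b (b i \<otimes>\<^bsub>R\<^esub> b j) k"

text \<open>The additive map with \<open>\<psi> (b i) = 1\<close> for \<open>i \<in> I0\<close> and \<open>\<psi> (b i) = 0\<close> otherwise.\<close>

definition fusion_psi ::
    "('r, 'm) ring_scheme \<Rightarrow> 'i set \<Rightarrow> ('i \<Rightarrow> 'r) \<Rightarrow> 'i set \<Rightarrow> 'r \<Rightarrow> int" where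
  "fusion_psi R I b I0 x = (\<Sum>i\<in>I0. coords R I b x i)"

definition star_map ::
    "('r, 'm) ring_scheme \<Rightarrow> 'i set \<Rightarrow> ('i \<Rightarrow> 'r) \<Rightarrow> ('i \<Rightarrow> 'i) \<Rightarrow> 'r \<Rightarrow> 'r" where
  "star_map R I b s x = (\<Oplus>\<^bsub>R\<^esub>i\<in>I. [coords R I b x i] \<cdot>\<^bsub>R\<^esub> b (s i))"

definition anti_involution :: "('r, 'm) ring_scheme \<Rightarrow> ('r \<Rightarrow> 'r) \<Rightarrow> bool" where
  "anti_involution R f \<longleftrightarrow> f \<in> carrier R \<rightarrow> carrier R \<and>
     f \<one>\<^bsub>R\<^esub> = \<one>\<^bsub>R\<^esub> \<and>
     (\<forall>x\<in>carrier R. f (f x) = x) \<and>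
     (\<forall>x\<in>carrier R. \<forall>y\<in>carrier R. f (x \<oplus>\<^bsub>R\<^esub> y) = f x \<oplus>\<^bsub>R\<^esub> f y) \<and>
     (\<forall>x\<in>carrier R. \<forall>y\<in>carrier R. f (x \<otimes>\<^bsub>R\<^esub> y) = f y \<otimes>\<^bsub>R\<^esub> f x)"

definition fusion_ring :: "('r, 'm) ring_scheme \<Rightarrow> 'i set \<Rightarrow> ('i \<Rightarrow> 'r) \<Rightarrow> bool" where
  "fusion_ring R I b \<longleftrightarrow> ring R \<and> is_Z_basis R I b \<and> \<one>\<^bsub>R\<^esub> \<in> b ` I \<and>
     (\<forall>i\<in>I. \<forall>j\<in>I. \<forall>k\<in>I. structure_const R I b i j k \<ge> 0) \<and>
     (\<exists>I0\<subseteq>I. (\<Oplus>\<^bsub>R\<^esub>i\<in>I0. b i) = \<one>\<^bsub>R\<^esub> \<and>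
        (\<exists>s. (\<forall>i\<in>I. s i \<in> I \<and> s (s i) = i) \<and>
             anti_involution R (star_map R I b s) \<and>
             (\<forall>i\<in>I. \<forall>j\<in>I. fusion_psi R I b I0 (b i \<otimes>\<^bsub>R\<^esub> b j) = (if i = s j then 1 else 0))))"

definition transitive_fusion_ring :: "('r, 'm) ring_scheme \<Rightarrow> 'i set \<Rightarrow> ('i \<Rightarrow> 'r) \<Rightarrow> bool" where
  "transitive_fusion_ring R I b \<longleftrightarrow> fusion_ring R I b \<and>
     (\<forall>i\<in>I. \<forall>j\<in>I. (\<exists>k\<in>I. structure_const R I b i k j \<noteq> 0) \<and>
                   (\<exists>l\<in>I. structure_const R I b l i j \<noteq> 0))"


section \<open>Monoid rings and free algebras\<close>

definition monoid_ring :: "('a, 'm) monoid_scheme \<Rightarrow> ('a \<Rightarrow>\<^sub>0 'k::comm_ring_1) ring" where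
  "monoid_ring M =
     \<lparr>carrier = {p. Poly_Mapping.keys p \<subseteq> carrier M},
      monoid.mult = (\<lambda>p q. \<Sum>a\<in>Poly_Mapping.keys p. \<Sum>b\<in>Poly_Mapping.keys q.
                Poly_Mapping.single (a \<otimes>\<^bsub>M\<^esub> b) (Poly_Mapping.lookup p a * Poly_Mapping.lookup q b)),
      one = Poly_Mapping.single \<one>\<^bsub>M\<^esub> 1,
      zero = 0,
      add = (+)\<rparr>"

definition free_monoid :: "'a set \<Rightarrow> 'a list monoid" where
  "free_monoid A = \<lparr>carrier = lists A, monoid.mult = (@), one = []\<rparr>"

text \<open>The algebra map from a free algebra to the \<open>\<complex>\<close>-algebra \<open>A\<close>, whose scalars are embedded
  by \<open>s\<close>, that sends each generator \<open>a\<close> to \<open>\<phi> a\<close>.\<close>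

definition free_alg_ext ::
    "('b, 'm) ring_scheme \<Rightarrow> (complex \<Rightarrow> 'b) \<Rightarrow> ('a \<Rightarrow> 'b) \<Rightarrow> ('a list \<Rightarrow>\<^sub>0 complex) \<Rightarrow> 'b" where
  "free_alg_ext A s \<phi> p =
     (\<Oplus>\<^bsub>A\<^esub>w\<in>Poly_Mapping.keys p. s (Poly_Mapping.lookup p w) \<otimes>\<^bsub>A\<^esub> foldr (\<lambda>a x. \<phi> a \<otimes>\<^bsub>A\<^esub> x) w \<one>\<^bsub>A\<^esub>)"

text \<open>The element \<open>p \<otimes> q\<close> of the tensor product of two free algebras.\<close>

definition pure_tensor ::
    "('a \<Rightarrow>\<^sub>0 complex) \<Rightarrow> ('b \<Rightarrow>\<^sub>0 complex) \<Rightarrow> ('a \<times> 'b \<Rightarrow>\<^sub>0 complex)" where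
  "pure_tensor p q =
     (\<Sum>u\<in>Poly_Mapping.keys p. \<Sum>v\<in>Poly_Mapping.keys q. Poly_Mapping.single (u, v) (Poly_Mapping.lookup p u * Poly_Mapping.lookup q v))"

definition complex_ring :: "complex ring" where
  "complex_ring = \<lparr>carrier = UNIV, monoid.mult = (*), one = 1, zero = 0, add = (+)\<rparr>"

definition opposite_ring :: "('r, 'm) ring_scheme \<Rightarrow> ('r, 'm) ring_scheme" where
  "opposite_ring R = R\<lparr>monoid.mult := (\<lambda>x y. y \<otimes>\<^bsub>R\<^esub> x)\<rparr>"

text \<open>Matrix of \<open>A \<otimes> B\<close> in the lexicographically ordered basis of the \<open>e\<^sub>i \<otimes> f\<^sub>j\<close>.\<close>

definition kronecker :: "complex mat \<Rightarrow> complex mat \<Rightarrow> complex mat" where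
  "kronecker A B = mat (dim_row A * dim_row B) (dim_col A * dim_col B)
     (\<lambda>(i, j). A $$ (i div dim_row B, j div dim_col B) * B $$ (i mod dim_row B, j mod dim_col B))"


section \<open>The Hopf algebra of a group datum\<close>

datatype 'g gen = Y | Grp 'g

type_synonym 'g free_elt = "'g gen list \<Rightarrow>\<^sub>0 complex"
type_synonym 'g hopf_elt = "'g free_elt set"
type_synonym 'g hopf2_elt = "('g gen list \<times> 'g gen list \<Rightarrow>\<^sub>0 complex) set"

text \<open>A module of dimension \<open>d\<close> is \<open>\<complex>\<^sup>d\<close> with an algebra homomorphism from \<open>H\<close> to the
  \<open>d \<times> d\<close> matrices; every finite-dimensional module is isomorphic to one of this form.\<close>

type_synonym 'g hopf_mod = "nat \<times> ('g hopf_elt \<Rightarrow> complex mat)"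

abbreviation mdim :: "'g hopf_mod \<Rightarrow> nat" where "mdim \<equiv> fst"
abbreviation act :: "'g hopf_mod \<Rightarrow> 'g hopf_elt \<Rightarrow> complex mat" where "act \<equiv> snd"

abbreviation word :: "'g gen list \<Rightarrow> 'g free_elt" where
  "word w \<equiv> Poly_Mapping.single w 1"

locale group_data =
  fixes G :: "('g, 'm) monoid_scheme" (structure)
    and \<chi> :: "'g \<Rightarrow> complex"
    and g :: 'g
    and n :: nat
begin

subsection \<open>The algebra, by generators and relations\<close>

definition words :: "'g gen list monoid" where
  "words = free_monoid (insert Y (Grp ` carrier G))"

definition free_alg :: "'g free_elt ring" where
  "free_alg = monoid_ring words"

definition relators :: "'g free_elt set" where
  "relators =
     {word [] - word [Grp \<one>]} \<union>
     {word [Grp h, Grp k] - word [Grp (h \<otimes> k)] | h k. h \<in> carrier G \<and> k \<in> carrier G} \<union>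
     {word [Y, Grp h] - Poly_Mapping.single [Grp h, Y] (\<chi> h) | h. h \<in> carrier G} \<union>
     {word (replicate n Y) - (word [Grp (g [^] n)] - word [])}"

definition relator_ideal :: "'g free_elt set" where
  "relator_ideal = Idl\<^bsub>free_alg\<^esub> relators"

definition H :: "'g hopf_elt ring" where
  "H = free_alg Quot relator_ideal"

definition cls :: "'g free_elt \<Rightarrow> 'g hopf_elt" where
  "cls t = relator_ideal +>\<^bsub>free_alg\<^esub> t"

definition scalar :: "complex \<Rightarrow> 'g hopf_elt" where
  "scalar c = cls (Poly_Mapping.single [] c)"

subsection \<open>The Hopf structure\<close>

text \<open>\<open>HH\<close> is \<open>H \<otimes> H\<close>: with \<open>T\<close> the free algebra and \<open>J\<close> the ideal of relators, it is the
  quotient of \<open>T \<otimes> T\<close>, the monoid algebra on pairs of words, by \<open>J \<otimes> T + T \<otimes> J\<close>.\<close>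

definition free_alg2 :: "('g gen list \<times> 'g gen list \<Rightarrow>\<^sub>0 complex) ring" where
  "free_alg2 = monoid_ring (words \<times>\<times> words)"

definition relator_ideal2 :: "('g gen list \<times> 'g gen list \<Rightarrow>\<^sub>0 complex) set" where
  "relator_ideal2 = Idl\<^bsub>free_alg2\<^esub>
     ((\<lambda>t. pure_tensor t (word [])) ` relator_ideal \<union> (\<lambda>t. pure_tensor (word []) t) ` relator_ideal)"

definition HH :: "'g hopf2_elt ring" where
  "HH = free_alg2 Quot relator_ideal2"

definition cls2 :: "('g gen list \<times> 'g gen list \<Rightarrow>\<^sub>0 complex) \<Rightarrow> 'g hopf2_elt" where
  "cls2 t = relator_ideal2 +>\<^bsub>free_alg2\<^esub> t"

definition scalar2 :: "complex \<Rightarrow> 'g hopf2_elt" where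
  "scalar2 c = cls2 (Poly_Mapping.single ([], []) c)"

fun comult_gen :: "'g gen \<Rightarrow> 'g hopf2_elt" where
  "comult_gen Y =
     cls2 (pure_tensor (word [Y]) (word [Grp g]) + pure_tensor (word []) (word [Y]))"
| "comult_gen (Grp h) = cls2 (pure_tensor (word [Grp h]) (word [Grp h]))"

fun counit_gen :: "'g gen \<Rightarrow> complex" where
  "counit_gen Y = 0"
| "counit_gen (Grp h) = 1"

fun antipode_gen :: "'g gen \<Rightarrow> 'g hopf_elt" where
  "antipode_gen Y = cls (- word [Y, Grp (inv g)])"
| "antipode_gen (Grp h) = cls (word [Grp (inv h)])"

text \<open>Elements of \<open>H\<close> are cosets; the extensions of these assignments are constant on them.
  The antipode, which plays no role in the definition of the Green ring, is recorded only to
  complete the Hopf algebra.\<close>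

definition comult :: "'g hopf_elt \<Rightarrow> 'g hopf2_elt" where
  "comult X = the_elem (free_alg_ext HH scalar2 comult_gen ` X)"

definition counit :: "'g hopf_elt \<Rightarrow> complex" where
  "counit X = the_elem (free_alg_ext complex_ring (\<lambda>c. c) counit_gen ` X)"

definition antipode :: "'g hopf_elt \<Rightarrow> 'g hopf_elt" where
  "antipode X = the_elem (free_alg_ext (opposite_ring H) scalar antipode_gen ` X)"

subsection \<open>Finite-dimensional modules\<close>

definition is_module :: "'g hopf_mod \<Rightarrow> bool" where
  "is_module M \<longleftrightarrow> act M \<in> Ring.ring_hom H (ring_mat TYPE(complex) (mdim M) ()) \<and>
     (\<forall>c. act M (scalar c) = c \<cdot>\<^sub>m 1\<^sub>m (mdim M))"

definition homs :: "'g hopf_mod \<Rightarrow> 'g hopf_mod \<Rightarrow> complex mat set" where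
  "homs M N =
     {F \<in> carrier_mat (mdim N) (mdim M). \<forall>x\<in>carrier H. F * act M x = act N x * F}"

definition mod_iso :: "'g hopf_mod \<Rightarrow> 'g hopf_mod \<Rightarrow> bool" where
  "mod_iso M N \<longleftrightarrow> (\<exists>F\<in>homs M N. \<exists>F'\<in>homs N M. F' * F = 1\<^sub>m (mdim M) \<and> F * F' = 1\<^sub>m (mdim N))"

definition direct_sum :: "'g hopf_mod \<Rightarrow> 'g hopf_mod \<Rightarrow> 'g hopf_mod" where
  "direct_sum M N = (mdim M + mdim N,
     \<lambda>x. four_block_mat (act M x) (0\<^sub>m (mdim M) (mdim N)) (0\<^sub>m (mdim N) (mdim M)) (act N x))"

text \<open>The action of \<open>H \<otimes> H\<close> on \<open>M \<otimes> N\<close>.\<close>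

definition outer_act :: "'g hopf_mod \<Rightarrow> 'g hopf_mod \<Rightarrow> 'g hopf2_elt \<Rightarrow> complex mat" where
  "outer_act M N X = the_elem ((\<lambda>t.
     \<Oplus>\<^bsub>ring_mat TYPE(complex) (mdim M * mdim N) ()\<^esub>p\<in>Poly_Mapping.keys t.
       Poly_Mapping.lookup t p \<cdot>\<^sub>m kronecker (act M (cls (word (fst p)))) (act N (cls (word (snd p))))) ` X)"

definition tensor :: "'g hopf_mod \<Rightarrow> 'g hopf_mod \<Rightarrow> 'g hopf_mod" where
  "tensor M N = (mdim M * mdim N, \<lambda>x. outer_act M N (comult x))"

definition trivial_mod :: "'g hopf_mod" where
  "trivial_mod = (1, \<lambda>x. counit x \<cdot>\<^sub>m 1\<^sub>m 1)"

definition indecomposable :: "'g hopf_mod \<Rightarrow> bool" where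
  "indecomposable M \<longleftrightarrow> is_module M \<and> mdim M \<noteq> 0 \<and>
     (\<forall>A B. is_module A \<and> is_module B \<and> mod_iso M (direct_sum A B) \<longrightarrow> mdim A = 0 \<or> mdim B = 0)"

definition surjective :: "complex mat \<Rightarrow> bool" where
  "surjective F \<longleftrightarrow> (\<forall>v\<in>carrier_vec (dim_row F). \<exists>u\<in>carrier_vec (dim_col F). F *\<^sub>v u = v)"

definition projective :: "'g hopf_mod \<Rightarrow> bool" where
  "projective P \<longleftrightarrow> is_module P \<and>
     (\<forall>A B. \<forall>E\<in>homs A B. \<forall>F\<in>homs P B. is_module A \<and> is_module B \<and> surjective E \<longrightarrow>
        (\<exists>F'\<in>homs P A. E * F' = F))"

subsection \<open>The stable category and its Green ring\<close>

definition proj_homs :: "'g hopf_mod \<Rightarrow> 'g hopf_mod \<Rightarrow> complex mat set" where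
  "proj_homs M N = {B * A | A B. \<exists>P. projective P \<and> A \<in> homs M P \<and> B \<in> homs P N}"

text \<open>Isomorphism in the stable category: mutually inverse up to \<^const>\<open>proj_homs\<close>.\<close>

definition stable_iso :: "'g hopf_mod \<Rightarrow> 'g hopf_mod \<Rightarrow> bool" where
  "stable_iso M N \<longleftrightarrow> (\<exists>F\<in>homs M N. \<exists>F'\<in>homs N M.
     F' * F - 1\<^sub>m (mdim M) \<in> proj_homs M M \<and> F * F' - 1\<^sub>m (mdim N) \<in> proj_homs N N)"

definition stable_class :: "'g hopf_mod \<Rightarrow> 'g hopf_mod set" where
  "stable_class M = {N. is_module N \<and> stable_iso M N}"

definition stable_classes :: "'g hopf_mod set monoid" where
  "stable_classes =
     \<lparr>carrier = {stable_class M | M. is_module M},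
      monoid.mult = (\<lambda>A B. \<Union>M\<in>A. \<Union>N\<in>B. stable_class (tensor M N)),
      one = stable_class trivial_mod\<rparr>"

definition stable_free_ring :: "('g hopf_mod set \<Rightarrow>\<^sub>0 int) ring" where
  "stable_free_ring = monoid_ring stable_classes"

definition direct_sum_ideal :: "('g hopf_mod set \<Rightarrow>\<^sub>0 int) set" where
  "direct_sum_ideal = Idl\<^bsub>stable_free_ring\<^esub>
     {Poly_Mapping.single (stable_class (direct_sum M N)) 1
        - Poly_Mapping.single (stable_class M) 1 - Poly_Mapping.single (stable_class N) 1
      | M N. is_module M \<and> is_module N}"

definition stable_green_ring :: "('g hopf_mod set \<Rightarrow>\<^sub>0 int) set ring" where
  "stable_green_ring = stable_free_ring Quot direct_sum_ideal"

definition iso_class :: "'g hopf_mod \<Rightarrow> 'g hopf_mod set" where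
  "iso_class M = {N. is_module N \<and> mod_iso M N}"

definition nonproj_indec_classes :: "'g hopf_mod set set" where
  "nonproj_indec_classes = {iso_class M | M. indecomposable M \<and> \<not> projective M}"

text \<open>The element of the stable Green ring given by an isomorphism class of \<open>H\<close>-modules.\<close>

definition green_class :: "'g hopf_mod set \<Rightarrow> ('g hopf_mod set \<Rightarrow>\<^sub>0 int) set" where
  "green_class C =
     direct_sum_ideal +>\<^bsub>stable_free_ring\<^esub> Poly_Mapping.single (\<Union>M\<in>C. stable_class M) 1"

end

text \<open>Group data \<open>(G, \<chi>, g, 1)\<close> of non-nilpotent type with \<open>n\<close> the order of \<open>\<chi> g\<close>.\<close>

locale nonnilpotent_group_datum = group_data G \<chi> g n + group G
  for G :: "('g, 'm) monoid_scheme" (structure)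
    and \<chi> :: "'g \<Rightarrow> complex" and g :: 'g and n :: nat +
  assumes finite_G: "finite (carrier G)"
    and \<chi>_mult: "\<lbrakk>h \<in> carrier G; k \<in> carrier G\<rbrakk> \<Longrightarrow> \<chi> (h \<otimes> k) = \<chi> h * \<chi> k"
    and \<chi>_one: "\<chi> \<one> = 1"
    and g_closed: "g \<in> carrier G"
    and g_central: "h \<in> carrier G \<Longrightarrow> g \<otimes> h = h \<otimes> g"
    and n_ge_2: "2 \<le> n"
    and q_pow_n: "\<chi> g ^ n = 1"
    and q_pow_less: "\<lbrakk>0 < m; m < n\<rbrakk> \<Longrightarrow> \<chi> g ^ m \<noteq> 1"
    and \<chi>_pow_n: "h \<in> carrier G \<Longrightarrow> \<chi> h ^ n = 1"
    and g_pow_n: "g [^] n \<noteq> \<one>"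

end

theory Submission
  imports Defs "Jordan_Normal_Form.Schur_Decomposition" "Jordan_Normal_Form.Spectral_Radius"
begin

text \<open>Endomorphism rings of indecomposable modules are local, so for a non-projective indecomposable
  \<open>M\<close> the rank of the trace pairing of \<open>Hom(M, X)\<close> with \<open>Hom(X, M)\<close> is the multiplicity of \<open>M\<close> in
  \<open>X\<close>. It ignores maps through projectives, hence descends to the stable Green ring, and these
  functionals are dual to the classes of the \<open>M\<close>.

  What is special to \<open>H\<close> is seen by averaging linear maps, first over \<open>G\<close> and then over the powers
  of \<open>y\<close>. A module on which \<open>y\<^sup>n\<^sup>-\<^sup>1\<close> is detected by such a map has a projective summand, so \<open>y\<close> is
  nilpotent of some index \<open>l < n\<close> on \<open>M\<close>. Averaging over the powers \<open>y\<^sup>i\<close> with \<open>i < l\<close> then shows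
  that suitable matrix coefficients of \<open>y\<^sup>l\<^sup>-\<^sup>1\<close> are biorthogonal functions on \<open>G\<close>, so that there are only
  finitely many \<open>M\<close>, and that the trace of \<open>g\<close> on \<open>M\<close> is not zero. By the latter the trivial module is
  a summand of \<open>M \<otimes> N\<close> exactly when \<open>N\<close> is the dual of \<open>M\<close>, and then it occurs once.\<close>

section \<open>Matrices\<close>

text \<open>The average over powers of y is \<open>rel_trace\<close>: a linear map T of the right
  weight under G goes to the sum of the y^i T y^(l-1-i). Its commutator with y telescopes to y^l T -
  T y^l, which vanishes for l = n because y^n = g^n - 1 and \<chi>(g^n) = 1, and for nilpotency
  index l because both terms are zero. Pairing with a map K such that y K = c K y multiplies a trace
  by 1 + c + ... + c^(l-1). For c = 1 this is l; for c = q it is a q-integer, nonzero because 0 < l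
  < n, which is why l < n has to be established before the trace of g is examined. The element g
  matters because conjugation by it is the square of the antipode; this makes its trace a quantum
  dimension. Indecomposable modules are not classified, and decompositions are not shown to be
  unique beforehand: a decomposition exists by induction on the dimension, and uniqueness of
  coordinates comes from the dual functionals alone.\<close>

lemma index_mult_sum:
  "i < dim_row A \<Longrightarrow> j < dim_col B \<Longrightarrow> dim_col A = dim_row B \<Longrightarrow>
    (A * B) $$ (i, j) = (\<Sum>k<dim_row B. A $$ (i, k) * B $$ (k, j))"
  by (simp add: scalar_prod_def atLeast0LessThan)

lemma mat_assoc:
  fixes A B C :: "'a::semiring_0 mat"
  shows "dim_col A = dim_row B \<Longrightarrow> dim_col B = dim_row C \<Longrightarrow> A * B * C = A * (B * C)"
  by (rule assoc_mult_mat[of _ "dim_row A" "dim_row B" _ "dim_row C" _ "dim_col C"]) auto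

lemma mat_distrib_left:
  fixes A B C :: "'a::semiring_0 mat"
  shows "dim_col A = dim_row B \<Longrightarrow> dim_row B = dim_row C \<Longrightarrow> dim_col B = dim_col C \<Longrightarrow>
    A * (B + C) = A * B + A * C"
  by (rule mult_add_distrib_mat[of _ "dim_row A" "dim_row B" _ "dim_col B"]) auto

lemma mat_distrib_right:
  fixes A B C :: "'a::semiring_0 mat"
  shows "dim_col A = dim_row C \<Longrightarrow> dim_row A = dim_row B \<Longrightarrow> dim_col A = dim_col B \<Longrightarrow>
    (A + B) * C = A * C + B * C"
  by (rule add_mult_distrib_mat[of _ "dim_row A" "dim_row C" _ _ "dim_col C"]) auto

lemma mat_diff_left:
  fixes A B C :: "'a::ring mat"
  shows "dim_col A = dim_row B \<Longrightarrow> dim_row B = dim_row C \<Longrightarrow> dim_col B = dim_col C \<Longrightarrow>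
    A * (B - C) = A * B - A * C"
  by (rule mult_minus_distrib_mat[of _ "dim_row A" "dim_row B" _ "dim_col B"]) auto

lemma mat_diff_right:
  fixes A B C :: "'a::ring mat"
  shows "dim_col A = dim_row C \<Longrightarrow> dim_row A = dim_row B \<Longrightarrow> dim_col A = dim_col B \<Longrightarrow>
    (A - B) * C = A * C - B * C"
  by (rule minus_mult_distrib_mat[of _ "dim_row A" "dim_row C" _ _ "dim_col C"]) auto

lemma mat_smult_right:
  fixes A B :: "'a::comm_semiring_0 mat"
  shows "dim_col A = dim_row B \<Longrightarrow> A * (c \<cdot>\<^sub>m B) = c \<cdot>\<^sub>m (A * B)"
  by (rule mult_smult_distrib[of _ "dim_row A" "dim_row B" _ "dim_col B"]) auto

lemma mat_smult_left:
  fixes A B :: "'a::comm_semiring_0 mat"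
  shows "dim_col A = dim_row B \<Longrightarrow> c \<cdot>\<^sub>m A * B = c \<cdot>\<^sub>m (A * B)"
  by (rule mult_smult_assoc_mat[of _ "dim_row A" "dim_row B" _ "dim_col B"]) auto

lemmas mat_dist = mat_distrib_left mat_distrib_right mat_diff_left mat_diff_right
  mat_smult_left mat_smult_right

lemma smult_smult_mat: "c \<cdot>\<^sub>m (d \<cdot>\<^sub>m A) = (c * d) \<cdot>\<^sub>m (A :: 'a::semigroup_mult mat)"
  by (rule eq_matI) (auto simp: mult.assoc)

lemma one_smult_mat [simp]: "1 \<cdot>\<^sub>m (A :: 'a::monoid_mult mat) = A"
  by (rule eq_matI) auto

lemma mat_smult_add: "dim_row A = dim_row B \<Longrightarrow> dim_col A = dim_col B \<Longrightarrow>
    c \<cdot>\<^sub>m (A + B) = c \<cdot>\<^sub>m A + c \<cdot>\<^sub>m (B :: 'a::semiring mat)"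
  by (rule eq_matI) (auto simp: distrib_left)

lemma minus_self_mat: "A - A = 0\<^sub>m (dim_row A) (dim_col (A :: 'a::group_add mat))"
  by (rule eq_matI) auto

subsection \<open>Powers\<close>

lemma pow_mat_Suc_left: "A \<in> carrier_mat n n \<Longrightarrow> A ^\<^sub>m Suc k = A * A ^\<^sub>m k"
  for A :: "'a::semiring_1 mat"
proof (induction k)
  case (Suc k)
  then show ?case by (metis assoc_mult_mat pow_carrier_mat pow_mat.simps(2))
qed auto

lemma pow_mat_add: "A \<in> carrier_mat n n \<Longrightarrow> A ^\<^sub>m (i + j) = A ^\<^sub>m i * A ^\<^sub>m j"
  for A :: "'a::semiring_1 mat"
proof (induction j)
  case (Suc j)
  then show ?case by (simp add: mat_assoc)
qed auto

lemma pow_mat_intertwine: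
  fixes A B F :: "'a::semiring_1 mat"
  assumes "A \<in> carrier_mat n n" "B \<in> carrier_mat m m" "F \<in> carrier_mat m n" "F * A = B * F"
  shows "F * A ^\<^sub>m k = B ^\<^sub>m k * F"
proof (induction k)
  case (Suc k)
  have "F * A ^\<^sub>m Suc k = F * A ^\<^sub>m k * A" using assms by (simp add: mat_assoc)
  also have "\<dots> = B ^\<^sub>m k * (F * A)" using Suc assms by (simp add: mat_assoc)
  also have "\<dots> = B ^\<^sub>m Suc k * F" using assms by (simp add: mat_assoc)
  finally show ?case .
qed (use assms in auto)

subsection \<open>Finite sums of matrices\<close>

definition msum :: "nat \<Rightarrow> nat \<Rightarrow> ('i \<Rightarrow> 'a::comm_monoid_add mat) \<Rightarrow> 'i set \<Rightarrow> 'a mat" where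
  "msum r c f I = mat r c (\<lambda>ij. \<Sum>a\<in>I. f a $$ ij)"

lemma msum_dim [simp]: "dim_row (msum r c f I) = r" "dim_col (msum r c f I) = c"
  by (auto simp: msum_def)

lemma msum_carrier [simp]: "msum r c f I \<in> carrier_mat r c"
  by (auto simp: msum_def)

lemma msum_index: "i < r \<Longrightarrow> j < c \<Longrightarrow> msum r c f I $$ (i, j) = (\<Sum>a\<in>I. f a $$ (i, j))"
  by (simp add: msum_def)

lemma msum_cong: "r = r' \<Longrightarrow> c = c' \<Longrightarrow> I = J \<Longrightarrow> (\<And>a. a \<in> J \<Longrightarrow> f a = f' a) \<Longrightarrow>
    msum r c f I = msum r' c' f' J"
  unfolding msum_def by (auto intro!: eq_matI sum.cong)

lemma msum_empty [simp]: "msum r c f {} = 0\<^sub>m r c"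
  by (auto simp: msum_def)

lemma msum_insert: "finite I \<Longrightarrow> a \<notin> I \<Longrightarrow> f a \<in> carrier_mat r c \<Longrightarrow>
    msum r c f (insert a I) = f a + msum r c f I"
  by (auto simp: msum_def)

lemma msum_mult_left:
  fixes A :: "'a::semiring_0 mat"
  assumes "dim_col A = r" "\<And>a. a \<in> I \<Longrightarrow> f a \<in> carrier_mat r c"
  shows "A * msum r c f I = msum (dim_row A) c (\<lambda>a. A * f a) I"
proof (rule eq_matI)
  fix i j assume ij: "i < dim_row (msum (dim_row A) c (\<lambda>a. A * f a) I)"
    "j < dim_col (msum (dim_row A) c (\<lambda>a. A * f a) I)"
  have "(A * msum r c f I) $$ (i, j) = (\<Sum>k<r. \<Sum>a\<in>I. A $$ (i, k) * f a $$ (k, j))"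
    using ij assms(1) by (simp add: index_mult_sum msum_index sum_distrib_left del: index_mult_mat(1))
  also have "\<dots> = (\<Sum>a\<in>I. \<Sum>k<r. A $$ (i, k) * f a $$ (k, j))" by (rule sum.swap)
  also have "\<dots> = (\<Sum>a\<in>I. (A * f a) $$ (i, j))"
  proof (rule sum.cong)
    fix a assume "a \<in> I"
    then show "(\<Sum>k<r. A $$ (i, k) * f a $$ (k, j)) = (A * f a) $$ (i, j)"
      using ij assms(1) assms(2)[of a] carrier_matD[of "f a" r c] by (simp add: index_mult_sum del: index_mult_mat(1))
  qed simp
  finally show "(A * msum r c f I) $$ (i, j) = msum (dim_row A) c (\<lambda>a. A * f a) I $$ (i, j)"
    using ij by (simp add: msum_index)
qed auto

lemma msum_mult_right:
  fixes A :: "'a::semiring_0 mat"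
  assumes "dim_row A = c" "\<And>a. a \<in> I \<Longrightarrow> f a \<in> carrier_mat r c"
  shows "msum r c f I * A = msum r (dim_col A) (\<lambda>a. f a * A) I"
proof (rule eq_matI)
  fix i j assume ij: "i < dim_row (msum r (dim_col A) (\<lambda>a. f a * A) I)"
    "j < dim_col (msum r (dim_col A) (\<lambda>a. f a * A) I)"
  have "(msum r c f I * A) $$ (i, j) = (\<Sum>k<c. \<Sum>a\<in>I. f a $$ (i, k) * A $$ (k, j))"
    using ij assms(1) by (simp add: index_mult_sum msum_index sum_distrib_right del: index_mult_mat(1))
  also have "\<dots> = (\<Sum>a\<in>I. \<Sum>k<c. f a $$ (i, k) * A $$ (k, j))" by (rule sum.swap)
  also have "\<dots> = (\<Sum>a\<in>I. (f a * A) $$ (i, j))"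
  proof (rule sum.cong)
    fix a assume "a \<in> I"
    then show "(\<Sum>k<c. f a $$ (i, k) * A $$ (k, j)) = (f a * A) $$ (i, j)"
      using ij assms(1) assms(2)[of a] carrier_matD[of "f a" r c] by (simp add: index_mult_sum del: index_mult_mat(1))
  qed simp
  finally show "(msum r c f I * A) $$ (i, j) = msum r (dim_col A) (\<lambda>a. f a * A) I $$ (i, j)"
    using ij by (simp add: msum_index)
qed auto

lemma msum_reindex: "bij_betw h I J \<Longrightarrow> msum r c f J = msum r c (\<lambda>a. f (h a)) I"
  unfolding msum_def by (auto intro!: eq_matI sum.reindex_bij_betw[symmetric])

lemma msum_smult: "(\<And>a. a \<in> I \<Longrightarrow> f a \<in> carrier_mat r c) \<Longrightarrow>
    x \<cdot>\<^sub>m msum r c f I = msum r c (\<lambda>a. x \<cdot>\<^sub>m f a) I"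
  for x :: "'a::semiring_0"
proof (rule eq_matI)
  fix i j assume f: "\<And>a. a \<in> I \<Longrightarrow> f a \<in> carrier_mat r c"
    and ij: "i < dim_row (msum r c (\<lambda>a. x \<cdot>\<^sub>m f a) I)" "j < dim_col (msum r c (\<lambda>a. x \<cdot>\<^sub>m f a) I)"
  have "\<And>a. a \<in> I \<Longrightarrow> i < dim_row (f a) \<and> j < dim_col (f a)" using f ij by fastforce
  then show "(x \<cdot>\<^sub>m msum r c f I) $$ (i, j) = msum r c (\<lambda>a. x \<cdot>\<^sub>m f a) I $$ (i, j)"
    using ij by (simp add: msum_index sum_distrib_left)
qed auto

lemma msum_const: "finite I \<Longrightarrow> A \<in> carrier_mat r c \<Longrightarrow> msum r c (\<lambda>_. A) I = of_nat (card I) \<cdot>\<^sub>m A"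
  for A :: "'a::semiring_1 mat"
  by (rule eq_matI) (auto simp: msum_index)

subsection \<open>Trace\<close>

definition tr :: "'a::comm_monoid_add mat \<Rightarrow> 'a" where
  "tr A = (\<Sum>i<dim_row A. A $$ (i, i))"

lemma tr_mult_comm:
  fixes A B :: "'a::comm_semiring_0 mat"
  assumes "dim_row A = dim_col B" "dim_col A = dim_row B"
  shows "tr (A * B) = tr (B * A)"
proof -
  have "tr (A * B) = (\<Sum>i<dim_row A. \<Sum>k<dim_row B. A $$ (i, k) * B $$ (k, i))"
    using assms by (simp add: tr_def index_mult_sum del: index_mult_mat(1))
  also have "\<dots> = (\<Sum>k<dim_row B. \<Sum>i<dim_row A. A $$ (i, k) * B $$ (k, i))" by (rule sum.swap)
  also have "\<dots> = tr (B * A)"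
    using assms by (simp add: tr_def index_mult_sum mult.commute del: index_mult_mat(1))
  finally show ?thesis .
qed

lemma tr_add: "dim_row A = dim_row B \<Longrightarrow> dim_col B = dim_row B \<Longrightarrow> tr (A + B) = tr A + tr B"
  by (simp add: tr_def sum.distrib)

lemma tr_diff: "dim_row A = dim_row B \<Longrightarrow> dim_col B = dim_row B \<Longrightarrow>
    tr (A - B) = tr A - tr (B :: 'a::ab_group_add mat)"
  by (simp add: tr_def sum_subtractf)

lemma tr_smult: "dim_col A = dim_row A \<Longrightarrow> tr (c \<cdot>\<^sub>m A) = c * tr (A :: 'a::semiring_0 mat)"
  by (simp add: tr_def sum_distrib_left)

lemma tr_one [simp]: "tr (1\<^sub>m n :: 'a::semiring_1 mat) = of_nat n"
  by (simp add: tr_def)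

lemma tr_zero [simp]: "tr (0\<^sub>m n n) = 0"
  by (simp add: tr_def)

lemma tr_transpose: "dim_row A = dim_col A \<Longrightarrow> tr (transpose_mat A) = tr A"
  by (simp add: tr_def)

lemma tr_msum: "(\<And>a. a \<in> I \<Longrightarrow> f a \<in> carrier_mat r r) \<Longrightarrow> tr (msum r r f I) = (\<Sum>a\<in>I. tr (f a))"
proof -
  assume f: "\<And>a. a \<in> I \<Longrightarrow> f a \<in> carrier_mat r r"
  have "tr (msum r r f I) = (\<Sum>a\<in>I. \<Sum>i<r. f a $$ (i, i))"
    by (simp add: tr_def msum_index sum.swap[of _ I])
  also have "\<dots> = (\<Sum>a\<in>I. tr (f a))"
    using f by (intro sum.cong) (auto simp: tr_def dest!: f)
  finally show ?thesis .
qed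

text \<open>Every root \<open>e\<close> of the characteristic polynomial has an eigenvector, on
  which \<open>A ^\<^sub>m k = 0\<close> forces \<open>e ^ k = 0\<close>. So the Schur form has zero
  diagonal, and the trace is invariant under similarity.\<close>

lemma trace_nilpotent:
  fixes A :: "complex mat"
  assumes A: "A \<in> carrier_mat n n" and k: "A ^\<^sub>m k = 0\<^sub>m n n"
  shows "tr A = 0"
proof -
  obtain es where es: "char_poly A = (\<Prod>e\<leftarrow>es. [:- e, 1:])" "length es = n"
    using char_poly_factorized[OF A] by metis
  obtain B P Q where BPQ: "schur_decomposition A es = (B, P, Q)" by (cases "schur_decomposition A es")
  note sd = schur_decomposition[OF A es(1) BPQ]
  note w = similar_mat_witD2[OF A conjunct1[OF sd]]
  have "e = 0" if e: "e \<in> set es" for e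
  proof -
    have "poly (char_poly A) e = 0" unfolding es(1) using e
      by (induction es) auto
    then have "eigenvalue A e" using eigenvalue_root_char_poly[OF A] by simp
    then obtain v where v: "v \<in> carrier_vec n" "v \<noteq> 0\<^sub>v n" "A *\<^sub>v v = e \<cdot>\<^sub>v v"
      unfolding eigenvalue_def eigenvector_def using A by auto
    have "A ^\<^sub>m j *\<^sub>v v = e ^ j \<cdot>\<^sub>v v" for j
    proof (induction j)
      case (Suc j)
      have "A ^\<^sub>m Suc j *\<^sub>v v = A ^\<^sub>m j *\<^sub>v (A *\<^sub>v v)" using A v(1) by (simp add: assoc_mult_mat_vec[of _ n n])
      also have "\<dots> = e \<cdot>\<^sub>v (A ^\<^sub>m j *\<^sub>v v)" unfolding v(3) using A v(1) by (intro mult_mat_vec[of _ n n]) auto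
      finally show ?case using Suc by (simp add: smult_smult_assoc)
    qed (use A v in auto)
    moreover have "0\<^sub>m n n *\<^sub>v v = 0\<^sub>v n" by (rule eq_vecI) (use v(1) in auto)
    ultimately have z: "e ^ k \<cdot>\<^sub>v v = 0\<^sub>v n" using k by metis
    obtain i where i: "i < n" "v $ i \<noteq> 0" using v(1,2) by (auto simp: vec_eq_iff)
    have "e ^ k * v $ i = 0" using arg_cong[OF z, of "\<lambda>w. w $ i"] v(1) i(1) by simp
    then show "e = 0" using i(2) by simp
  qed
  moreover have "diag_mat B = es" using sd by auto
  ultimately have "tr B = 0" using w
    by (auto simp: tr_def diag_mat_def intro!: sum.neutral)
  moreover have "tr A = tr B"
  proof -
    have "tr A = tr (P * (B * Q))" using w by (simp add: mat_assoc)
    also have "\<dots> = tr (B * Q * P)" using w by (intro tr_mult_comm) auto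
    also have "\<dots> = tr B" using w by (simp add: mat_assoc)
    finally show ?thesis .
  qed
  ultimately show ?thesis by simp
qed

subsection \<open>Splitting idempotents and linear dependence of powers\<close>

text \<open>An invertible \<open>P\<close> clears the last row of \<open>P * C\<close>, so the last
  column of its inverse \<open>Q\<close> contributes nothing to \<open>C = Q * (P * C)\<close> and
  may be dropped.\<close>

lemma singular_mat_factor:
  fixes C :: "'a::field mat"
  assumes C: "C \<in> carrier_mat r r" and det: "det C = 0"
  obtains C1 C2 where "0 < r" "C1 \<in> carrier_mat r (r - 1)" "C2 \<in> carrier_mat (r - 1) r" "C = C1 * C2"
proof -
  obtain P where P: "P \<in> Units (ring_mat TYPE('a) r ())" and row: "row (P * C) (r - 1) = 0\<^sub>v r"
    and r: "0 < r"
    using det_zero_imp_zero_row[OF C det, of "()"] by auto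
  obtain Q where Pc: "P \<in> carrier_mat r r" and Q: "Q \<in> carrier_mat r r" "Q * P = 1\<^sub>m r"
    using P unfolding Units_def ring_mat_def by auto
  define C1 where "C1 = mat r (r - 1) (\<lambda>(i, j). Q $$ (i, j))"
  define C2 where "C2 = mat (r - 1) r (\<lambda>(i, j). (P * C) $$ (i, j))"
  have "C = Q * (P * C)" using Q C Pc by (simp flip: mat_assoc)
  also have "\<dots> = C1 * C2"
  proof (rule eq_matI)
    fix i j assume ij: "i < dim_row (C1 * C2)" "j < dim_col (C1 * C2)"
    then have ij': "i < r" "j < r" by (auto simp: C1_def C2_def)
    have z: "(P * C) $$ (r - 1, j) = 0"
    proof -
      have "row (P * C) (r - 1) $ j = (P * C) $$ (r - 1, j)"
        using r ij' Pc C by (intro index_row) auto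
      then show ?thesis using row ij' by simp
    qed
    have "(Q * (P * C)) $$ (i, j) = (\<Sum>k<Suc (r - 1). Q $$ (i, k) * (P * C) $$ (k, j))"
      using ij' Pc C Q r by (simp add: index_mult_sum del: index_mult_mat(1) sum.lessThan_Suc)
    also have "\<dots> = (\<Sum>k<r - 1. Q $$ (i, k) * (P * C) $$ (k, j))" using z by simp
    also have "\<dots> = (\<Sum>k<r - 1. C1 $$ (i, k) * C2 $$ (k, j))"
      using ij' by (intro sum.cong) (simp_all add: C1_def C2_def)
    also have "\<dots> = (C1 * C2) $$ (i, j)"
      using ij by (subst index_mult_sum) (auto simp: C1_def C2_def)
    finally show "(Q * (P * C)) $$ (i, j) = (C1 * C2) $$ (i, j)" .
  qed (use Q Pc C in \<open>auto simp: C1_def C2_def\<close>)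
  finally have e: "C = C1 * C2" .
  show ?thesis by (rule that[OF r _ _ e]) (simp_all add: C1_def C2_def)
qed

text \<open>Take the least \<open>r\<close> through which \<open>E\<close> factors as
  \<open>B * A\<close>. If \<open>C = A * B\<close> were singular,
  \<open>singular_mat_factor\<close> would lower \<open>r\<close>. So \<open>C\<close> is
  invertible, and idempotency of \<open>E\<close>, in the form \<open>C * C * C = C * C\<close>,
  leaves \<open>C = 1\<^sub>m r\<close>.\<close>

lemma idempotent_mat_splits:
  fixes E :: "'a::field mat"
  assumes E: "E \<in> carrier_mat d d" and idem: "E * E = E"
  obtains r A B where "A \<in> carrier_mat r d" "B \<in> carrier_mat d r" "B * A = E" "A * B = 1\<^sub>m r"
proof -
  define P where "P r \<longleftrightarrow> (\<exists>A B. A \<in> carrier_mat r d \<and> B \<in> carrier_mat d r \<and> B * A = E)" for r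
  have "P d" unfolding P_def using E by (intro exI[of _ "1\<^sub>m d"] exI[of _ E]) auto
  then have Pr: "P (LEAST r. P r)" by (rule LeastI)
  define r where "r = (LEAST r. P r)"
  obtain A B where AB: "A \<in> carrier_mat r d" "B \<in> carrier_mat d r" "B * A = E"
    using Pr unfolding P_def r_def by auto
  define C where "C = A * B"
  have C: "C \<in> carrier_mat r r" using AB by (simp add: C_def)
  have "B * C * A = (B * A) * (B * A)" using AB(1,2) by (simp add: C_def mat_assoc)
  then have BCA: "B * C * A = B * A" using AB(3) idem by simp
  have "det C \<noteq> 0"
  proof
    assume "det C = 0"
    from singular_mat_factor[OF C this] obtain C1 C2 where
      C12: "0 < r" "C1 \<in> carrier_mat r (r - 1)" "C2 \<in> carrier_mat (r - 1) r" "C = C1 * C2" .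
    have "(B * C1) * (C2 * A) = B * (C1 * C2) * A" using C12(2,3) AB(1,2) by (simp add: mat_assoc)
    also have "\<dots> = E" using C12(4) BCA AB(3) by simp
    finally have "(B * C1) * (C2 * A) = E" .
    then have "P (r - 1)" unfolding P_def using AB C12
      by (intro exI[of _ "C2 * A"] exI[of _ "B * C1"]) auto
    then have "r \<le> r - 1" unfolding r_def by (rule Least_le)
    then show False using C12 by simp
  qed
  then obtain D where D: "D \<in> carrier_mat r r" "D * C = 1\<^sub>m r" "C * D = 1\<^sub>m r"
    using det_non_zero_imp_unit[OF C, of "()"] unfolding Units_def ring_mat_def by auto
  have "C * C * C = C * C"
  proof -
    have "C * C * C = A * (B * C * A) * B" using AB(1,2) by (simp add: C_def mat_assoc)
    also have "\<dots> = C * C" unfolding BCA using AB(1,2) by (simp add: C_def mat_assoc)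
    finally show ?thesis .
  qed
  then have "D * (C * C * C) * D = D * (C * C) * D" by simp
  moreover have "D * (C * C * C) * D = C"
  proof -
    have "D * (C * C * C) * D = (D * C) * (C * (C * D))" using C D(1) by (simp add: mat_assoc)
    also have "\<dots> = C" unfolding D(2,3) using C by simp
    finally show ?thesis .
  qed
  moreover have "D * (C * C) * D = (D * C) * (C * D)" using C D(1) by (simp add: mat_assoc)
  ultimately have "C = 1\<^sub>m r" using D by simp
  then show ?thesis using that AB by (simp add: C_def)
qed

text \<open>There are d*d + 1 powers but only d*d entries: writing the powers as columns and padding
  by a zero row gives a singular square matrix, whose kernel vector holds the coefficients. An
  annihilating polynomial is what \<open>fitting\<close> starts from.\<close>

lemma powers_linearly_dependent:
  fixes X :: "'a::field mat"
  assumes X: "X \<in> carrier_mat d d"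
  obtains N f k where "k < N" "f k \<noteq> 0" "msum d d (\<lambda>i. f i \<cdot>\<^sub>m X ^\<^sub>m i) {..<N} = 0\<^sub>m d d"
proof -
  define N where "N = Suc (d * d)"
  define A where "A = mat N N (\<lambda>(r, i). if r < d * d then (X ^\<^sub>m i) $$ (r div d, r mod d) else 0)"
  have A: "A \<in> carrier_mat N N" by (simp add: A_def)
  have "A = mat\<^sub>r N N (\<lambda>i. if i = d * d then 0\<^sub>v N else row A i)"
    by (rule eq_matI) (auto simp: A_def N_def)
  then have "det A = 0"
    using det_row_0[of "d * d" N "row A"] A by (auto simp: N_def)
  then obtain v where v: "v \<in> carrier_vec N" "v \<noteq> 0\<^sub>v N" "A *\<^sub>v v = 0\<^sub>v N"
    using det_0_iff_vec_prod_zero_field[OF A] by auto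
  obtain k where k: "k < N" "v $ k \<noteq> 0" using v by (auto simp: vec_eq_iff)
  have "msum d d (\<lambda>i. v $ i \<cdot>\<^sub>m X ^\<^sub>m i) {..<N} = 0\<^sub>m d d"
  proof (rule eq_matI)
    fix i j assume "i < dim_row (0\<^sub>m d d :: 'a mat)" "j < dim_col (0\<^sub>m d d :: 'a mat)"
    then have ij: "i < d" "j < d" by auto
    define r where "r = i * d + j"
    have "i * d + j < i * d + d" using ij by simp
    also have "i * d + d = Suc i * d" by simp
    also have "\<dots> \<le> d * d" using ij by (intro mult_le_mono1) simp
    finally have r: "r < d * d" "r div d = i" "r mod d = j" using ij by (auto simp: r_def)
    have "0 = (A *\<^sub>v v) $ r" using v r by (simp add: N_def)
    also have "\<dots> = (\<Sum>l<N. A $$ (r, l) * v $ l)"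
      using v(1) A r by (simp add: scalar_prod_def atLeast0LessThan N_def)
    also have "\<dots> = (\<Sum>l<N. (v $ l \<cdot>\<^sub>m X ^\<^sub>m l) $$ (i, j))"
      using r X ij by (intro sum.cong) (auto simp: A_def N_def)
    finally show "msum d d (\<lambda>i. v $ i \<cdot>\<^sub>m X ^\<^sub>m i) {..<N} $$ (i, j) = 0\<^sub>m d d $$ (i, j)"
      using ij by (simp add: msum_index)
  qed auto
  then show ?thesis using that[of k N "\<lambda>i. v $ i"] k by simp
qed

subsection \<open>Kronecker products\<close>

lemma sum_div_mod:
  fixes f :: "nat \<Rightarrow> nat \<Rightarrow> 'a::comm_monoid_add"
  shows "(\<Sum>k<a * b. f (k div b) (k mod b)) = (\<Sum>i<a. \<Sum>j<b. f i j)"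
proof -
  have "(\<Sum>k<a * b. f (k div b) (k mod b)) = (\<Sum>i<a. \<Sum>k\<in>{i * b..<i * b + b}. f (k div b) (k mod b))"
    by (rule sum.nat_group[symmetric])
  also have "\<dots> = (\<Sum>i<a. \<Sum>j<b. f i j)"
  proof (rule sum.cong)
    fix i
    have "(\<Sum>k\<in>{i * b..<i * b + b}. f (k div b) (k mod b)) = (\<Sum>j\<in>{0..<b}. f ((j + i * b) div b) ((j + i * b) mod b))"
      using sum.shift_bounds_nat_ivl[of "\<lambda>k. f (k div b) (k mod b)" 0 "i * b" b] by (simp add: add.commute)
    also have "\<dots> = (\<Sum>j<b. f i j)" by (intro sum.cong) auto
    finally show "(\<Sum>k\<in>{i * b..<i * b + b}. f (k div b) (k mod b)) = (\<Sum>j<b. f i j)" .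
  qed simp
  finally show ?thesis .
qed

lemma div_mod_bounds:
  assumes "(i::nat) < a * b" shows "i div b < a" "i mod b < b"
  using assms by (auto simp: less_mult_imp_div_less) (cases "b = 0", auto)

lemma kronecker_dim [simp]:
  "dim_row (kronecker A B) = dim_row A * dim_row B"
  "dim_col (kronecker A B) = dim_col A * dim_col B"
  by (auto simp: kronecker_def)

lemma kronecker_carrier [simp]:
  "A \<in> carrier_mat a b \<Longrightarrow> B \<in> carrier_mat c d \<Longrightarrow> kronecker A B \<in> carrier_mat (a * c) (b * d)"
  by (auto simp: kronecker_def)

lemma kronecker_index:
  "i < dim_row A * dim_row B \<Longrightarrow> j < dim_col A * dim_col B \<Longrightarrow>
    kronecker A B $$ (i, j) = A $$ (i div dim_row B, j div dim_col B) * B $$ (i mod dim_row B, j mod dim_col B)"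
  by (simp add: kronecker_def)

lemma kronecker_mult:
  assumes "dim_col A = dim_row C" "dim_col B = dim_row D"
  shows "kronecker A B * kronecker C D = kronecker (A * C) (B * D)"
proof (rule eq_matI)
  fix i j assume "i < dim_row (kronecker (A * C) (B * D))" "j < dim_col (kronecker (A * C) (B * D))"
  then have ij: "i < dim_row A * dim_row B" "j < dim_col C * dim_col D" by auto
  note b = div_mod_bounds[OF ij(1)] div_mod_bounds[OF ij(2)]
  define i1 i2 j1 j2 where "i1 = i div dim_row B" "i2 = i mod dim_row B" "j1 = j div dim_col D" "j2 = j mod dim_col D"
  note defs = this
  have "(kronecker A B * kronecker C D) $$ (i, j) =
    (\<Sum>k<dim_row C * dim_row D. kronecker A B $$ (i, k) * kronecker C D $$ (k, j))"
    using ij assms by (simp add: index_mult_sum del: index_mult_mat(1))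
  also have "\<dots> = (\<Sum>k<dim_row C * dim_row D.
      (A $$ (i1, k div dim_row D) * B $$ (i2, k mod dim_row D)) *
      (C $$ (k div dim_row D, j1) * D $$ (k mod dim_row D, j2)))"
    using ij assms by (intro sum.cong) (auto simp: kronecker_index defs)
  also have "\<dots> = (\<Sum>k<dim_row C. \<Sum>l<dim_row D.
      (A $$ (i1, k) * B $$ (i2, l)) * (C $$ (k, j1) * D $$ (l, j2)))"
    by (rule sum_div_mod)
  also have "\<dots> = (\<Sum>k<dim_row C. A $$ (i1, k) * C $$ (k, j1)) * (\<Sum>l<dim_row D. B $$ (i2, l) * D $$ (l, j2))"
    by (simp add: sum_product ac_simps)
  also have "\<dots> = (A * C) $$ (i1, j1) * (B * D) $$ (i2, j2)"
    using b assms by (simp add: index_mult_sum defs del: index_mult_mat(1))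
  also have "\<dots> = kronecker (A * C) (B * D) $$ (i, j)"
    using ij by (simp add: kronecker_index defs)
  finally show "(kronecker A B * kronecker C D) $$ (i, j) = kronecker (A * C) (B * D) $$ (i, j)" .
qed auto

lemma kronecker_one [simp]: "kronecker (1\<^sub>m a) (1\<^sub>m b) = 1\<^sub>m (a * b)"
proof (rule eq_matI)
  fix i j assume "i < dim_row (1\<^sub>m (a * b) :: complex mat)" "j < dim_col (1\<^sub>m (a * b) :: complex mat)"
  then have ij: "i < a * b" "j < a * b" by auto
  have "i div b = j div b \<and> i mod b = j mod b \<longleftrightarrow> i = j"
    by (metis div_mult_mod_eq)
  then show "kronecker (1\<^sub>m a) (1\<^sub>m b) $$ (i, j) = 1\<^sub>m (a * b) $$ (i, j)"
    using ij div_mod_bounds[OF ij(1)] div_mod_bounds[OF ij(2)] by (auto simp: kronecker_index)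
qed auto

lemma kronecker_unit_left [simp]: "kronecker (1\<^sub>m (Suc 0)) A = A"
  by (rule eq_matI) (auto simp: kronecker_index)

lemma kronecker_unit_right [simp]: "kronecker A (1\<^sub>m (Suc 0)) = A"
  by (rule eq_matI) (auto simp: kronecker_index)

lemma kronecker_assoc: "kronecker (kronecker A B) C = kronecker A (kronecker B C)"
proof (rule eq_matI)
  have m: "k mod (b * c) div c = k div c mod b" "k mod (b * c) mod c = k mod c" "k div (b * c) = k div c div b"
    for k b c :: nat
  proof -
    have e: "k mod (b * c) = c * (k div c mod b) + k mod c"
      using mod_mult2_eq[of k c b] by (simp only: mult.commute[of b c])
    show "k mod (b * c) div c = k div c mod b" "k mod (b * c) mod c = k mod c"
      unfolding e by (cases "c = 0"; simp)+
    show "k div (b * c) = k div c div b"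
      by (simp only: mult.commute[of b c] div_mult2_eq)
  qed
  fix i j assume "i < dim_row (kronecker A (kronecker B C))" "j < dim_col (kronecker A (kronecker B C))"
  then have ij: "i < dim_row A * dim_row B * dim_row C" "j < dim_col A * dim_col B * dim_col C"
    and ij': "i < dim_row A * (dim_row B * dim_row C)" "j < dim_col A * (dim_col B * dim_col C)"
    by (auto simp: mult.assoc)
  note b = div_mod_bounds[OF ij(1)] div_mod_bounds[OF ij(2)] div_mod_bounds[OF ij'(1)] div_mod_bounds[OF ij'(2)]
  show "kronecker (kronecker A B) C $$ (i, j) = kronecker A (kronecker B C) $$ (i, j)"
    using ij ij' b by (simp add: kronecker_index m)
qed (auto simp: mult.assoc)

lemma kronecker_add_left: "dim_row A = dim_row B \<Longrightarrow> dim_col A = dim_col B \<Longrightarrow>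
    kronecker (A + B) C = kronecker A C + kronecker B C"
  by (rule eq_matI) (auto simp: kronecker_index distrib_right div_mod_bounds)

lemma kronecker_add_right: "dim_row A = dim_row B \<Longrightarrow> dim_col A = dim_col B \<Longrightarrow>
    kronecker C (A + B) = kronecker C A + kronecker C B"
  by (rule eq_matI) (auto simp: kronecker_index distrib_left div_mod_bounds)

lemma kronecker_diff_left: "dim_row A = dim_row B \<Longrightarrow> dim_col A = dim_col B \<Longrightarrow>
    kronecker (A - B) C = kronecker A C - kronecker B C"
  by (rule eq_matI) (auto simp: kronecker_index left_diff_distrib div_mod_bounds)

lemma kronecker_diff_right: "dim_row A = dim_row B \<Longrightarrow> dim_col A = dim_col B \<Longrightarrow>
    kronecker C (A - B) = kronecker C A - kronecker C B"
  by (rule eq_matI) (auto simp: kronecker_index right_diff_distrib div_mod_bounds)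

lemma kronecker_smult_left: "kronecker (x \<cdot>\<^sub>m A) B = x \<cdot>\<^sub>m kronecker A B"
  by (rule eq_matI) (auto simp: kronecker_index div_mod_bounds)

lemma kronecker_smult_right: "kronecker A (x \<cdot>\<^sub>m B) = x \<cdot>\<^sub>m kronecker A B"
  by (rule eq_matI) (auto simp: kronecker_index div_mod_bounds)

lemma kronecker_zero [simp]: "kronecker (0\<^sub>m a b) C = 0\<^sub>m (a * dim_row C) (b * dim_col C)"
    "kronecker C (0\<^sub>m a b) = 0\<^sub>m (dim_row C * a) (dim_col C * b)"
  by (rule eq_matI; auto simp: kronecker_index div_mod_bounds)+

lemma kronecker_transpose: "transpose_mat (kronecker A B) = kronecker (transpose_mat A) (transpose_mat B)"
  by (rule eq_matI) (auto simp: kronecker_index div_mod_bounds)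

section \<open>Monoid rings\<close>

lemma sum_single_lookup: "(\<Sum>a\<in>Poly_Mapping.keys p. Poly_Mapping.single a (Poly_Mapping.lookup p a)) = p"
proof (rule poly_mapping_eqI)
  fix k
  show "Poly_Mapping.lookup (\<Sum>a\<in>Poly_Mapping.keys p. Poly_Mapping.single a (Poly_Mapping.lookup p a)) k = Poly_Mapping.lookup p k"
    by (cases "k \<in> Poly_Mapping.keys p")
      (auto simp: lookup_sum lookup_single when_def in_keys_iff if_distrib cong: if_cong)
qed

text \<open>Reduces statements that are additive in a formal sum to monomials. Keeping the support
  inside \<open>S\<close> makes carrier conditions available in the induction.\<close>

lemma poly_mapping_span_induct [consumes 1, case_names zero single add]:
  fixes p :: "'a \<Rightarrow>\<^sub>0 'b::comm_monoid_add"
  assumes "Poly_Mapping.keys p \<subseteq> S" "P 0" "\<And>a x. a \<in> S \<Longrightarrow> P (Poly_Mapping.single a x)"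
    "\<And>p q. Poly_Mapping.keys p \<subseteq> S \<Longrightarrow> Poly_Mapping.keys q \<subseteq> S \<Longrightarrow> P p \<Longrightarrow> P q \<Longrightarrow> P (p + q)"
  shows "P p"
proof -
  have "finite T \<Longrightarrow> T \<subseteq> S \<Longrightarrow> P (\<Sum>a\<in>T. Poly_Mapping.single a (f a)) \<and>
      Poly_Mapping.keys (\<Sum>a\<in>T. Poly_Mapping.single a (f a)) \<subseteq> S" for T and f :: "'a \<Rightarrow> 'b"
  proof (induction T rule: finite_induct)
    case (insert a T)
    let ?q = "\<Sum>a\<in>T. Poly_Mapping.single a (f a)"
    have "Poly_Mapping.keys (Poly_Mapping.single a (f a)) \<subseteq> S" using insert by auto
    then show ?case using insert assms(3)[of a "f a"] assms(4)[of "Poly_Mapping.single a (f a)" ?q]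
        keys_add[of "Poly_Mapping.single a (f a)" ?q] by auto
  qed (use assms in auto)
  from this[of "Poly_Mapping.keys p" "Poly_Mapping.lookup p"] show ?thesis
    using assms(1) by (simp add: sum_single_lookup)
qed

definition pm_sum :: "('a \<Rightarrow> 'k \<Rightarrow> 'b) \<Rightarrow> ('a \<Rightarrow>\<^sub>0 'k::zero) \<Rightarrow> 'b::comm_monoid_add" where
  "pm_sum F p = (\<Sum>a\<in>Poly_Mapping.keys p. F a (Poly_Mapping.lookup p a))"

text \<open>Supports may shrink under addition, so additivity of a sum over the support is not
  immediate. It holds here because \<open>F a 0 = 0\<close> follows, and the sum may be extended to
  any finite superset of the support.\<close>

locale additive_coeff =
  fixes F :: "'a \<Rightarrow> 'k::ab_group_add \<Rightarrow> 'b::ab_group_add"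
  assumes coeff_add: "F a (x + y) = F a x + F a y"
begin

lemma coeff_zero [simp]: "F a 0 = 0"
  using coeff_add[of a 0 0] by simp

lemma pm_sum_superset: "finite S \<Longrightarrow> Poly_Mapping.keys p \<subseteq> S \<Longrightarrow>
    pm_sum F p = (\<Sum>a\<in>S. F a (Poly_Mapping.lookup p a))"
  unfolding pm_sum_def by (rule sum.mono_neutral_left) (auto simp: in_keys_iff)

lemma pm_sum_zero [simp]: "pm_sum F 0 = 0"
  by (simp add: pm_sum_def)

lemma pm_sum_single [simp]: "pm_sum F (Poly_Mapping.single a x) = F a x"
  by (simp add: pm_sum_def)

lemma pm_sum_add: "pm_sum F (p + q) = pm_sum F p + pm_sum F q"
proof -
  let ?S = "Poly_Mapping.keys p \<union> Poly_Mapping.keys q"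
  have "pm_sum F (p + q) = (\<Sum>a\<in>?S. F a (Poly_Mapping.lookup (p + q) a))"
    by (rule pm_sum_superset) (auto simp: keys_add)
  also have "\<dots> = (\<Sum>a\<in>?S. F a (Poly_Mapping.lookup p a)) + (\<Sum>a\<in>?S. F a (Poly_Mapping.lookup q a))"
    by (simp add: lookup_add coeff_add sum.distrib)
  also have "\<dots> = pm_sum F p + pm_sum F q"
    by (simp add: pm_sum_superset[of ?S])
  finally show ?thesis .
qed

lemma pm_sum_uminus: "pm_sum F (- p) = - pm_sum F p"
  using pm_sum_add[of "- p" p] by (simp add: eq_neg_iff_add_eq_0)

lemma pm_sum_diff: "pm_sum F (p - q) = pm_sum F p - pm_sum F q"
  using pm_sum_add[of p "- q"] by (simp add: pm_sum_uminus)

end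

lemma pm_sum_add_fun: "pm_sum (\<lambda>a x. F a x + G a x) p = pm_sum F p + pm_sum G p"
  by (simp add: pm_sum_def sum.distrib)

lemma monoid_ring_simps:
  "carrier (monoid_ring M) = {p. Poly_Mapping.keys p \<subseteq> carrier M}"
  "add (monoid_ring M) = (+)" "zero (monoid_ring M) = 0"
  "one (monoid_ring M) = Poly_Mapping.single \<one>\<^bsub>M\<^esub> 1"
  "p \<otimes>\<^bsub>monoid_ring M\<^esub> q = pm_sum (\<lambda>a x. pm_sum (\<lambda>b y. Poly_Mapping.single (a \<otimes>\<^bsub>M\<^esub> b) (x * y)) q) p"
  by (auto simp: monoid_ring_def pm_sum_def)

context
  fixes M :: "('a, 'm) monoid_scheme" and TYPE_k :: "'k::comm_ring_1 itself"
begin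

abbreviation "mr_mult \<equiv> monoid.mult (monoid_ring M :: ('a \<Rightarrow>\<^sub>0 'k) ring)"

lemma mr_mult_inner: "additive_coeff (\<lambda>b y. Poly_Mapping.single (a \<otimes>\<^bsub>M\<^esub> b) (x * y))" for x :: 'k
  by unfold_locales (simp add: distrib_left single_add)

lemma mr_mult_outer: "additive_coeff (\<lambda>a x. pm_sum (\<lambda>b y. Poly_Mapping.single (a \<otimes>\<^bsub>M\<^esub> b) (x * y)) q)" for q :: "'a \<Rightarrow>\<^sub>0 'k"
  by unfold_locales (simp add: distrib_right single_add pm_sum_add_fun)

lemma mr_mult_add_left: "mr_mult (p + p') q = mr_mult p q + mr_mult p' q"
  by (simp add: monoid_ring_simps additive_coeff.pm_sum_add[OF mr_mult_outer])

lemma mr_mult_add_right: "mr_mult p (q + q') = mr_mult p q + mr_mult p q'"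
  by (simp add: monoid_ring_simps additive_coeff.pm_sum_add[OF mr_mult_inner] pm_sum_add_fun)

lemma mr_mult_zero [simp]: "mr_mult 0 q = 0" "mr_mult p 0 = 0"
  using mr_mult_add_left[of 0 0 q] mr_mult_add_right[of p 0 0] by auto

lemma mr_mult_single [simp]:
  "mr_mult (Poly_Mapping.single a x) (Poly_Mapping.single b y) = Poly_Mapping.single (a \<otimes>\<^bsub>M\<^esub> b) (x * y)"
  by (subst monoid_ring_simps(5), subst additive_coeff.pm_sum_single[OF mr_mult_outer],
      subst additive_coeff.pm_sum_single[OF mr_mult_inner], rule refl)

lemma monoid_ring_ring:
  assumes "monoid M"
  shows "ring (monoid_ring M :: ('a \<Rightarrow>\<^sub>0 'k) ring)"
proof -
  interpret monoid M by fact
  let ?R = "monoid_ring M :: ('a \<Rightarrow>\<^sub>0 'k) ring"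
  have closed: "mr_mult p q \<in> carrier ?R" if "p \<in> carrier ?R" "q \<in> carrier ?R" for p q
  proof -
    have "Poly_Mapping.keys p \<subseteq> carrier M" "Poly_Mapping.keys q \<subseteq> carrier M"
      using that by (auto simp: monoid_ring_simps)
    then show ?thesis
    proof (induction p rule: poly_mapping_span_induct)
      case (single a x)
      from single(2) show ?case
      proof (induction q rule: poly_mapping_span_induct)
        case (single b y)
        then show ?case using \<open>a \<in> carrier M\<close> by (auto simp: monoid_ring_simps(1))
      next
        case (add q q')
        then show ?case using keys_add[of "mr_mult (Poly_Mapping.single a x) q" "mr_mult (Poly_Mapping.single a x) q'"]
          by (auto simp: mr_mult_add_right monoid_ring_simps(1))
      qed (auto simp: monoid_ring_simps(1))
    next
      case (add p p')
      then show ?case using keys_add[of "mr_mult p q" "mr_mult p' q"]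
        by (auto simp: mr_mult_add_left monoid_ring_simps(1))
    qed (auto simp: monoid_ring_simps(1))
  qed
  have one: "mr_mult (Poly_Mapping.single \<one>\<^bsub>M\<^esub> 1) p = p \<and> mr_mult p (Poly_Mapping.single \<one>\<^bsub>M\<^esub> 1) = p"
    if "Poly_Mapping.keys p \<subseteq> carrier M" for p
    using that by (induction p rule: poly_mapping_span_induct)
      (auto simp: mr_mult_add_left mr_mult_add_right)
  have assoc: "mr_mult (mr_mult p q) r = mr_mult p (mr_mult q r)"
    if "Poly_Mapping.keys p \<subseteq> carrier M" "Poly_Mapping.keys q \<subseteq> carrier M" "Poly_Mapping.keys r \<subseteq> carrier M" for p q r
    using that
  proof (induction p rule: poly_mapping_span_induct)
    case (single a x)
    from single(2-) show ?case
    proof (induction q rule: poly_mapping_span_induct)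
      case (single b y)
      from single(2) show ?case
      proof (induction r rule: poly_mapping_span_induct)
        case (single c z)
        then show ?case using \<open>a \<in> carrier M\<close> \<open>b \<in> carrier M\<close> by (simp add: m_assoc mult.assoc)
      qed (auto simp: mr_mult_add_right)
    qed (auto simp: mr_mult_add_left mr_mult_add_right)
  qed (auto simp: mr_mult_add_left)
  show ?thesis
  proof (rule ringI)
    show "abelian_group ?R"
    proof (rule abelian_groupI)
      fix x assume "x \<in> carrier ?R"
      then show "\<exists>y\<in>carrier ?R. y \<oplus>\<^bsub>?R\<^esub> x = \<zero>\<^bsub>?R\<^esub>"
        by (intro bexI[of _ "- x"]) (auto simp: monoid_ring_simps keys_minus)
    qed (auto simp: monoid_ring_simps dest: set_mp[OF keys_add])
    show "monoid ?R"
      by (rule monoidI) (use closed one assoc in \<open>auto simp: monoid_ring_simps(1,4)\<close>)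
  qed (simp_all add: monoid_ring_simps(2) mr_mult_add_left mr_mult_add_right)
qed

lemma monoid_ring_uminus:
  assumes "monoid M" "p \<in> carrier (monoid_ring M)"
  shows "\<ominus>\<^bsub>monoid_ring M\<^esub> p = - (p :: 'a \<Rightarrow>\<^sub>0 'k)"
proof -
  interpret ring "monoid_ring M :: ('a \<Rightarrow>\<^sub>0 'k) ring" using monoid_ring_ring assms by blast
  show ?thesis
    by (rule minus_equality) (use assms in \<open>auto simp: monoid_ring_simps keys_minus\<close>)
qed

lemma monoid_ring_minus:
  assumes "monoid M" "p \<in> carrier (monoid_ring M)" "q \<in> carrier (monoid_ring M)"
  shows "p \<ominus>\<^bsub>monoid_ring M\<^esub> q = p - (q :: 'a \<Rightarrow>\<^sub>0 'k)"
  by (simp add: a_minus_def monoid_ring_uminus[OF assms(1,3)] monoid_ring_simps(2))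

end

definition mr_ext :: "('b, 'n) ring_scheme \<Rightarrow> ('k \<Rightarrow> 'b) \<Rightarrow> ('a \<Rightarrow> 'b) \<Rightarrow> ('a \<Rightarrow>\<^sub>0 'k::zero) \<Rightarrow> 'b" where
  "mr_ext A s \<mu> p = (\<Oplus>\<^bsub>A\<^esub>w\<in>Poly_Mapping.keys p. s (Poly_Mapping.lookup p w) \<otimes>\<^bsub>A\<^esub> \<mu> w)"

text \<open>A ring with a homomorphism from the scalars into its centre, that is, an algebra. One
  interface serves all targets of the universal property of \<open>H\<close>: matrix rings,
  \<open>HH\<close> and the complex numbers.\<close>

locale central_scalars = ring A for A :: "('b, 'n) ring_scheme" (structure) +
  fixes s :: "'k::comm_ring_1 \<Rightarrow> 'b"
  assumes s_closed [simp]: "s x \<in> carrier A"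
    and s_add: "s (x + y) = s x \<oplus> s y"
    and s_mult: "s (x * y) = s x \<otimes> s y"
    and s_one [simp]: "s 1 = \<one>"
    and s_central: "b \<in> carrier A \<Longrightarrow> s x \<otimes> b = b \<otimes> s x"
begin

lemma s_zero [simp]: "s 0 = \<zero>"
  using s_add[of 0 0] by (metis add.r_cancel_one add_0 s_closed)

lemma s_comm_left: "b \<in> carrier A \<Longrightarrow> c \<in> carrier A \<Longrightarrow> b \<otimes> (s x \<otimes> c) = s x \<otimes> (b \<otimes> c)"
  by (metis m_assoc s_central s_closed)

lemma mr_ext_superset:
  assumes "finite S" "Poly_Mapping.keys p \<subseteq> S" "\<And>w. w \<in> S \<Longrightarrow> \<mu> w \<in> carrier A"
  shows "mr_ext A s \<mu> p = (\<Oplus>w\<in>S. s (Poly_Mapping.lookup p w) \<otimes> \<mu> w)"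
  unfolding mr_ext_def
  by (rule add.finprod_mono_neutral_cong_left) (use assms in \<open>auto simp: in_keys_iff\<close>)

lemma mr_ext_closed:
  "(\<And>w. w \<in> Poly_Mapping.keys p \<Longrightarrow> \<mu> w \<in> carrier A) \<Longrightarrow> mr_ext A s \<mu> p \<in> carrier A"
  unfolding mr_ext_def by (intro finsum_closed) auto

lemma mr_ext_zero [simp]: "mr_ext A s \<mu> 0 = \<zero>"
  by (simp add: mr_ext_def)

lemma mr_ext_single: "\<mu> a \<in> carrier A \<Longrightarrow> mr_ext A s \<mu> (Poly_Mapping.single a x) = s x \<otimes> \<mu> a"
  by (cases "x = 0") (auto simp: mr_ext_def)

lemma mr_ext_add:
  assumes "\<And>w. w \<in> Poly_Mapping.keys p \<union> Poly_Mapping.keys q \<Longrightarrow> \<mu> w \<in> carrier A"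
  shows "mr_ext A s \<mu> (p + q) = mr_ext A s \<mu> p \<oplus> mr_ext A s \<mu> q"
proof -
  let ?S = "Poly_Mapping.keys p \<union> Poly_Mapping.keys q"
  have "mr_ext A s \<mu> (p + q) = (\<Oplus>w\<in>?S. s (Poly_Mapping.lookup (p + q) w) \<otimes> \<mu> w)"
    by (rule mr_ext_superset) (use keys_add[of p q] assms in auto)
  also have "\<dots> = (\<Oplus>w\<in>?S. s (Poly_Mapping.lookup p w) \<otimes> \<mu> w \<oplus> s (Poly_Mapping.lookup q w) \<otimes> \<mu> w)"
    by (rule finsum_cong') (use assms in \<open>auto simp: lookup_add s_add l_distr\<close>)
  also have "\<dots> = (\<Oplus>w\<in>?S. s (Poly_Mapping.lookup p w) \<otimes> \<mu> w) \<oplus> (\<Oplus>w\<in>?S. s (Poly_Mapping.lookup q w) \<otimes> \<mu> w)"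
    by (rule finsum_addf) (use assms in auto)
  also have "\<dots> = mr_ext A s \<mu> p \<oplus> mr_ext A s \<mu> q"
    using mr_ext_superset[of ?S p \<mu>] mr_ext_superset[of ?S q \<mu>] assms by auto
  finally show ?thesis .
qed

lemma mr_ext_hom:
  assumes M: "monoid M" and \<mu>: "\<mu> \<in> carrier M \<rightarrow> carrier A" "\<mu> \<one>\<^bsub>M\<^esub> = \<one>"
    "\<And>u v. u \<in> carrier M \<Longrightarrow> v \<in> carrier M \<Longrightarrow> \<mu> (u \<otimes>\<^bsub>M\<^esub> v) = \<mu> u \<otimes> \<mu> v"
  shows "mr_ext A s \<mu> \<in> Ring.ring_hom (monoid_ring M) A"
proof -
  let ?f = "mr_ext A s \<mu>"
  let ?R = "monoid_ring M :: ('a \<Rightarrow>\<^sub>0 'k) ring"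
  interpret R: ring ?R by (rule monoid_ring_ring[OF M])
  interpret M: monoid M by (rule M)
  have cl: "?f p \<in> carrier A" if "Poly_Mapping.keys p \<subseteq> carrier M" for p
    using mr_ext_closed[of p \<mu>] \<mu> that by blast
  have ad: "?f (p + q) = ?f p \<oplus> ?f q" if "Poly_Mapping.keys p \<subseteq> carrier M" "Poly_Mapping.keys q \<subseteq> carrier M" for p q
    using mr_ext_add[of p q \<mu>] \<mu> that by blast
  have mult_closed: "Poly_Mapping.keys (monoid.mult ?R p q) \<subseteq> carrier M"
    if "Poly_Mapping.keys p \<subseteq> carrier M" "Poly_Mapping.keys q \<subseteq> carrier M" for p q
    using that R.m_closed[of p q] by (simp add: monoid_ring_simps(1))
  have "?f (monoid.mult ?R p q) = ?f p \<otimes> ?f q" if "Poly_Mapping.keys p \<subseteq> carrier M" "Poly_Mapping.keys q \<subseteq> carrier M" for p q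
    using that
  proof (induction p rule: poly_mapping_span_induct)
    case (single a x)
    from single(2) show ?case
    proof (induction q rule: poly_mapping_span_induct)
      case (single b y)
      have c: "\<mu> a \<in> carrier A" "\<mu> b \<in> carrier A" "a \<otimes>\<^bsub>M\<^esub> b \<in> carrier M"
        using single \<open>a \<in> carrier M\<close> \<mu>(1) by auto
      have "?f (monoid.mult ?R (Poly_Mapping.single a x) (Poly_Mapping.single b y)) = s (x * y) \<otimes> (\<mu> a \<otimes> \<mu> b)"
        using c \<mu>(3) single(1) \<open>a \<in> carrier M\<close> by (simp add: mr_ext_single)
      also have "\<dots> = (s x \<otimes> \<mu> a) \<otimes> (s y \<otimes> \<mu> b)"
        using c by (simp add: m_assoc s_mult s_comm_left[of "\<mu> a" "\<mu> b" y])
      finally show ?case using c by (simp add: mr_ext_single)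
    next
      case (add q q')
      have k: "Poly_Mapping.keys (Poly_Mapping.single a x) \<subseteq> carrier M" using single by auto
      then show ?case using add mult_closed[of "Poly_Mapping.single a x"] cl
        by (simp add: mr_mult_add_right ad r_distr del: keys_single)
    qed (use single cl[of "Poly_Mapping.single a x"] in auto)
  next
    case (add p p')
    then show ?case using mult_closed cl by (simp add: mr_mult_add_left ad l_distr)
  qed (use cl in auto)
  then show ?thesis using cl ad \<mu>
    by (intro ring_hom_memI) (auto simp: monoid_ring_simps(1,2,4) mr_ext_single Pi_iff)
qed

end

section \<open>Quotients\<close>

lemma ring_hom_kills_genideal:
  assumes R: "ring R" and A: "ring A" and f: "f \<in> Ring.ring_hom R A" and S: "S \<subseteq> carrier R"
    "\<And>x. x \<in> S \<Longrightarrow> f x = \<zero>\<^bsub>A\<^esub>" and x: "x \<in> Idl\<^bsub>R\<^esub> S"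
  shows "f x = \<zero>\<^bsub>A\<^esub>"
proof -
  interpret ring_hom_ring R A f by (rule ring_hom_ringI2[OF R A f])
  have "S \<subseteq> a_kernel R A f"
    using S unfolding a_kernel_def' by blast
  then have "Idl\<^bsub>R\<^esub> S \<subseteq> a_kernel R A f"
    by (rule R.genideal_minimal[OF kernel_is_ideal])
  then show ?thesis using x unfolding a_kernel_def' by blast
qed

text \<open>A homomorphism that kills the ideal is constant on cosets, so the image of a coset is a
  singleton. This matches the way \<open>comult\<close>, \<open>counit\<close> and
  \<open>outer_act\<close> are defined by \<open>the_elem\<close>.\<close>

lemma quotient_lift:
  assumes R: "ring R" and A: "ring A" and f: "f \<in> Ring.ring_hom R A" and I: "ideal I R"
    and z: "\<And>x. x \<in> I \<Longrightarrow> f x = \<zero>\<^bsub>A\<^esub>"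
  shows "t \<in> carrier R \<Longrightarrow> the_elem (f ` (I +>\<^bsub>R\<^esub> t)) = f t"
    and "(\<lambda>X. the_elem (f ` X)) \<in> Ring.ring_hom (R Quot I) A"
proof -
  interpret ring_hom_ring R A f by (rule ring_hom_ringI2[OF R A f])
  interpret I: ideal I R by (rule I)
  interpret Q: ring "R Quot I" by (rule I.quotient_is_ring)
  have im: "f ` (I +>\<^bsub>R\<^esub> t) = {f t}" if t: "t \<in> carrier R" for t
  proof (intro equalityI subsetI)
    fix y assume "y \<in> f ` (I +>\<^bsub>R\<^esub> t)"
    then obtain i where "i \<in> I" "y = f (i \<oplus>\<^bsub>R\<^esub> t)" by (auto simp: a_r_coset_def')
    then show "y \<in> {f t}" using t z[of i] I.Icarr by simp
  next
    fix y assume "y \<in> {f t}"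
    then show "y \<in> f ` (I +>\<^bsub>R\<^esub> t)" using I.a_rcos_self[OF t] by auto
  qed
  show e: "the_elem (f ` (I +>\<^bsub>R\<^esub> t)) = f t" if "t \<in> carrier R" for t
    using im[OF that] by simp
  have rep: "\<exists>t\<in>carrier R. X = I +>\<^bsub>R\<^esub> t" if "X \<in> carrier (R Quot I)" for X
    using that by (auto simp: FactRing_def A_RCOSETS_def')
  show "(\<lambda>X. the_elem (f ` X)) \<in> Ring.ring_hom (R Quot I) A"
  proof (rule ring_hom_memI)
    fix X assume "X \<in> carrier (R Quot I)"
    then obtain t where "t \<in> carrier R" "X = I +>\<^bsub>R\<^esub> t" using rep by auto
    then show "the_elem (f ` X) \<in> carrier A" by (simp add: e)
  next
    fix X Y assume "X \<in> carrier (R Quot I)" "Y \<in> carrier (R Quot I)"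
    then obtain t u where t: "t \<in> carrier R" "X = I +>\<^bsub>R\<^esub> t" "u \<in> carrier R" "Y = I +>\<^bsub>R\<^esub> u" using rep by metis
    then show "the_elem (f ` (X \<otimes>\<^bsub>R Quot I\<^esub> Y)) = the_elem (f ` X) \<otimes>\<^bsub>A\<^esub> the_elem (f ` Y)"
      by (simp add: FactRing_def I.rcoset_mult_add e)
    show "the_elem (f ` (X \<oplus>\<^bsub>R Quot I\<^esub> Y)) = the_elem (f ` X) \<oplus>\<^bsub>A\<^esub> the_elem (f ` Y)"
      using t by (simp add: FactRing_def I.a_rcos_sum e)
  next
    show "the_elem (f ` \<one>\<^bsub>R Quot I\<^esub>) = \<one>\<^bsub>A\<^esub>" by (simp add: FactRing_def e)
  qed
qed

section \<open>The quantum binomial theorem\<close>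

text \<open>Gaussian binomial coefficients by the q-Pascal rule; being free of division, the
  recursion makes sense at roots of unity.\<close>

fun qbinom :: "'a::comm_ring_1 \<Rightarrow> nat \<Rightarrow> nat \<Rightarrow> 'a" where
  "qbinom q m 0 = 1"
| "qbinom q 0 (Suc k) = 0"
| "qbinom q (Suc m) (Suc k) = qbinom q m k + q ^ Suc k * qbinom q m (Suc k)"

lemma qbinom_eq_0: "m < k \<Longrightarrow> qbinom q m k = 0"
  by (induction q m k rule: qbinom.induct) auto

lemma qbinom_self [simp]: "qbinom q m m = 1"
  by (induction m) (auto simp: qbinom_eq_0)

text \<open>The q-analogue of (k+1) C(m+1,k+1) = (m+1) C(m,k), with denominators cleared.\<close>

lemma qbinom_absorb: "(1 - q ^ Suc k) * qbinom q (Suc m) (Suc k) = (1 - q ^ Suc m) * qbinom q m k"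
proof (induction m arbitrary: k)
  case 0
  then show ?case by (cases k) auto
next
  case (Suc m)
  \<comment> \<open>For k <= m+1 this is q^k times the companion identity (1 - q^(m+1-k)) [m+1,k] =
    (1 - q^(m+1)) [m,k]. It is exactly the discrepancy left after the induction hypothesis has been
    used.\<close>
  have *: "(q ^ Suc m - q ^ k) * qbinom q (Suc m) k + q ^ k * (1 - q ^ Suc m) * qbinom q m k = 0"
  proof (cases k)
    case (Suc j)
    define a b c where "a = qbinom q m j" "b = qbinom q m (Suc j)" "c = qbinom q (Suc m) (Suc j)"
    have c: "c = a + q ^ Suc j * b" by (simp add: a_b_c_def)
    have ih: "(1 - q ^ Suc j) * c = (1 - q ^ Suc m) * a"
      using Suc.IH[of j] by (simp add: a_b_c_def)
    have "(q ^ Suc m - q ^ Suc j) * c + q ^ Suc j * (1 - q ^ Suc m) * b =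
      (1 - q ^ Suc j) * c - (1 - q ^ Suc m) * c + (1 - q ^ Suc m) * (q ^ Suc j * b)"
      by (simp add: algebra_simps)
    also have "\<dots> = ((1 - q ^ Suc j) * c - (1 - q ^ Suc m) * a) + (1 - q ^ Suc m) * ((a + q ^ Suc j * b) - c)"
      by (simp add: algebra_simps)
    also have "\<dots> = 0" by (simp only: ih c[symmetric]) simp
    finally show ?thesis by (simp add: Suc a_b_c_def)
  qed simp
  have "(1 - q ^ Suc k) * qbinom q (Suc (Suc m)) (Suc k) =
    (1 - q ^ Suc k) * qbinom q (Suc m) k + q ^ Suc k * ((1 - q ^ Suc k) * qbinom q (Suc m) (Suc k))"
    by (simp only: qbinom.simps) (simp add: algebra_simps)
  also have "\<dots> = (1 - q ^ Suc k) * qbinom q (Suc m) k + q ^ Suc k * ((1 - q ^ Suc m) * qbinom q m k)"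
    by (simp only: Suc.IH)
  also have "\<dots> = (1 - q ^ Suc (Suc m)) * qbinom q (Suc m) k +
     q * ((q ^ Suc m - q ^ k) * qbinom q (Suc m) k + q ^ k * (1 - q ^ Suc m) * qbinom q m k)"
    by (simp add: algebra_simps)
  also have "\<dots> = (1 - q ^ Suc (Suc m)) * qbinom q (Suc m) k" using * by simp
  finally show ?case .
qed

text \<open>In \<open>qbinom_absorb\<close> with m + 1 = n the factor 1 - q^n on the right is zero,
  while 1 - q^k on the left is not.\<close>

lemma qbinom_root_of_unity:
  fixes q :: "'a::idom"
  assumes "q ^ n = 1" "\<And>m. 0 < m \<Longrightarrow> m < n \<Longrightarrow> q ^ m \<noteq> 1" "0 < k" "k < n"
  shows "qbinom q n k = 0"
proof -
  obtain k' n' where "k = Suc k'" "n = Suc n'" using assms(3,4) by (metis gr0_implies_Suc less_trans)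
  then show ?thesis using qbinom_absorb[of q k' n'] assms(1) assms(2)[of k] assms(3,4) by auto
qed

context central_scalars
begin

lemma q_commute_pow:
  assumes a: "a \<in> carrier A" and b: "b \<in> carrier A" and ba: "b \<otimes> a = s q \<otimes> (a \<otimes> b)"
  shows "b \<otimes> a [^] (k::nat) = s (q ^ k) \<otimes> (a [^] k \<otimes> b)"
proof (induction k)
  case (Suc k)
  have "b \<otimes> a [^] Suc k = (b \<otimes> a [^] k) \<otimes> a" using a b by (simp add: m_assoc)
  also have "\<dots> = s (q ^ k) \<otimes> (a [^] k \<otimes> (b \<otimes> a))" using a b by (simp add: Suc m_assoc)
  also have "\<dots> = s (q ^ k) \<otimes> (s q \<otimes> (a [^] k \<otimes> (a \<otimes> b)))" using a b by (simp add: ba s_comm_left[of "a [^] k"])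
  also have "\<dots> = s (q ^ Suc k) \<otimes> (a [^] Suc k \<otimes> b)"
    using a b by (simp add: m_assoc[symmetric] s_mult[symmetric] mult.commute)
  finally show ?case .
qed (use b in simp)

lemma q_binomial:
  assumes a: "a \<in> carrier A" and b: "b \<in> carrier A" and ba: "b \<otimes> a = s q \<otimes> (a \<otimes> b)"
  shows "(a \<oplus> b) [^] (m::nat) = (\<Oplus>k\<in>{..m}. s (qbinom q m k) \<otimes> (a [^] k \<otimes> b [^] (m - k)))"
proof (induction m)
  case 0
  then show ?case by simp
next
  case (Suc m)
  define T where "T k = s (qbinom q m k) \<otimes> (a [^] k \<otimes> b [^] (m - k))" for k
  \<comment> \<open>\<open>U\<close> and \<open>V\<close> collect the terms in which the additional
    factor is \<open>a\<close> or \<open>b\<close>: the former shifts the index by one, the latter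
    is moved past \<open>a [^] k\<close> at the cost of q^k. Their sum is the q-Pascal rule.\<close>
  define U where "U k = (case k of 0 \<Rightarrow> \<zero> | Suc j \<Rightarrow> a \<otimes> T j)" for k
  define V where "V k = (if k \<le> m then b \<otimes> T k else \<zero>)" for k
  have T: "T k \<in> carrier A" for k using a b by (simp add: T_def)
  then have U: "U k \<in> carrier A" and V: "V k \<in> carrier A" for k using a b by (auto simp: U_def V_def split: nat.split)
  have UV: "U k \<oplus> V k = s (qbinom q (Suc m) k) \<otimes> (a [^] k \<otimes> b [^] (Suc m - k))" if "k \<le> Suc m" for k
  proof -
    have v: "V k = s (q ^ k * qbinom q m k) \<otimes> (a [^] k \<otimes> b [^] (Suc m - k))"
    proof (cases "k \<le> m")
      case True
      have "V k = s (qbinom q m k) \<otimes> ((b \<otimes> a [^] k) \<otimes> b [^] (m - k))"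
        using True a b by (simp add: V_def T_def s_comm_left[of b] m_assoc)
      also have "\<dots> = s (qbinom q m k) \<otimes> (s (q ^ k) \<otimes> (a [^] k \<otimes> (b \<otimes> b [^] (m - k))))"
        using a b by (simp add: q_commute_pow[OF a b ba] m_assoc)
      also have "b \<otimes> b [^] (m - k) = b [^] (Suc m - k)"
        using b True by (metis Suc_diff_le nat_pow_Suc2)
      finally show ?thesis using a b by (simp add: m_assoc[symmetric] s_mult[symmetric] mult.commute)
    next
      case False
      then show ?thesis using a b by (simp add: V_def qbinom_eq_0)
    qed
    show ?thesis
    proof (cases k)
      case 0
      then show ?thesis using a b v by (simp add: U_def)
    next
      case (Suc j)
      have "U k = s (qbinom q m j) \<otimes> (a [^] k \<otimes> b [^] (Suc m - k))"
      proof -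
        have "a \<otimes> (a [^] j \<otimes> b [^] (m - j)) = a [^] Suc j \<otimes> b [^] (m - j)"
          using a b by (simp only: m_assoc[symmetric] nat_pow_closed nat_pow_Suc2)
        then show ?thesis using a b Suc by (simp only: U_def T_def) (simp add: s_comm_left[of a])
      qed
      then show ?thesis unfolding v unfolding Suc using a b by (simp add: s_add l_distr del: nat_pow_Suc)
    qed
  qed
  have "(a \<oplus> b) [^] Suc m = (a \<oplus> b) \<otimes> (\<Oplus>k\<in>{..m}. T k)"
  proof -
    have "(a \<oplus> b) [^] Suc m = (a \<oplus> b) \<otimes> (a \<oplus> b) [^] m"
      by (rule nat_pow_Suc2) (use a b in simp)
    then show ?thesis unfolding Suc.IH T_def .
  qed
  also have "\<dots> = a \<otimes> (\<Oplus>k\<in>{..m}. T k) \<oplus> b \<otimes> (\<Oplus>k\<in>{..m}. T k)"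
    using a b T by (simp add: l_distr finsum_closed)
  also have "a \<otimes> (\<Oplus>k\<in>{..m}. T k) = (\<Oplus>k\<in>{..m}. a \<otimes> T k)"
    using a T by (intro finsum_rdistr) auto
  also have "\<dots> = (\<Oplus>k\<in>{..Suc m}. U k)"
    using U T a by (subst finsum_Suc2) (auto simp: U_def)
  also have "b \<otimes> (\<Oplus>k\<in>{..m}. T k) = (\<Oplus>k\<in>{..m}. b \<otimes> T k)"
    using b T by (intro finsum_rdistr) auto
  also have "\<dots> = (\<Oplus>k\<in>{..m}. V k)"
    using b T by (intro finsum_cong') (auto simp: V_def)
  also have "\<dots> = (\<Oplus>k\<in>{..Suc m}. V k)"
  proof -
    have "(\<Oplus>k\<in>{..Suc m}. V k) = V (Suc m) \<oplus> (\<Oplus>k\<in>{..m}. V k)"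
      using V by (intro finsum_Suc) auto
    moreover have "V (Suc m) = \<zero>" by (simp add: V_def)
    moreover have "(\<Oplus>k\<in>{..m}. V k) \<in> carrier A" using V by (intro finsum_closed) auto
    ultimately show ?thesis by simp
  qed
  also have "(\<Oplus>k\<in>{..Suc m}. U k) \<oplus> (\<Oplus>k\<in>{..Suc m}. V k) = (\<Oplus>k\<in>{..Suc m}. U k \<oplus> V k)"
    using U V by (intro finsum_addf[symmetric]) auto
  also have "\<dots> = (\<Oplus>k\<in>{..Suc m}. s (qbinom q (Suc m) k) \<otimes> (a [^] k \<otimes> b [^] (Suc m - k)))"
    using a b UV by (intro finsum_cong') auto
  finally show ?case .
qed

end

text \<open>The q-binomial analogue of the Frobenius identity in characteristic p: all inner
  coefficients vanish. It is what makes the coproduct compatible with y^n = g^n - 1.\<close>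

lemma (in central_scalars) q_frobenius:
  fixes q :: "'k"
  assumes a: "a \<in> carrier A" and b: "b \<in> carrier A" and ba: "b \<otimes> a = s q \<otimes> (a \<otimes> b)"
    and n: "0 < n" and qb: "\<And>k. 0 < k \<Longrightarrow> k < n \<Longrightarrow> qbinom q n k = 0"
  shows "(a \<oplus> b) [^] n = a [^] n \<oplus> b [^] n"
proof -
  have "(a \<oplus> b) [^] n = (\<Oplus>k\<in>{..n}. s (qbinom q n k) \<otimes> (a [^] k \<otimes> b [^] (n - k)))"
    by (rule q_binomial[OF a b ba])
  also have "\<dots> = (\<Oplus>k\<in>{0, n}. s (qbinom q n k) \<otimes> (a [^] k \<otimes> b [^] (n - k)))"
  proof (rule add.finprod_mono_neutral_cong_right)
    show "s (qbinom q n i) \<otimes> (a [^] i \<otimes> b [^] (n - i)) = \<zero>" if "i \<in> {..n} - {0, n}" for i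
      using that a b qb[of i] by auto
  qed (use a b in auto)
  also have "\<dots> = b [^] n \<oplus> a [^] n" using a b n by simp
  finally show ?thesis using a b by (simp add: a_comm)
qed

section \<open>Modules in terms of generators\<close>

lemma monoid_ring_central_scalars:
  assumes M: "monoid M"
  shows "central_scalars (monoid_ring M) (\<lambda>c::'k::comm_ring_1. Poly_Mapping.single \<one>\<^bsub>M\<^esub> c)"
proof -
  interpret M: monoid M by (rule M)
  interpret ring "monoid_ring M :: ('a \<Rightarrow>\<^sub>0 'k) ring" by (rule monoid_ring_ring[OF M])
  show ?thesis
  proof
    fix b :: "'a \<Rightarrow>\<^sub>0 'k" and x
    assume "b \<in> carrier (monoid_ring M)"
    then have "Poly_Mapping.keys b \<subseteq> carrier M" by (simp add: monoid_ring_simps)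
    then show "mr_mult M (Poly_Mapping.single \<one>\<^bsub>M\<^esub> x) b = mr_mult M b (Poly_Mapping.single \<one>\<^bsub>M\<^esub> x)"
      by (induction b rule: poly_mapping_span_induct)
        (auto simp: mr_mult_add_left mr_mult_add_right mult.commute)
  qed (auto simp: monoid_ring_simps(1,2,4) single_add)
qed

lemma carrier_quotient: "carrier (R Quot I) = (\<lambda>t. I +>\<^bsub>R\<^esub> t) ` carrier R"
  by (auto simp: FactRing_def A_RCOSETS_def')

lemma quotient_central_scalars:
  assumes "central_scalars R s" and I: "ideal I R"
  shows "central_scalars (R Quot I) (\<lambda>c. I +>\<^bsub>R\<^esub> s c)"
proof -
  interpret central_scalars R s by fact
  note Q = ideal.quotient_is_ring[OF I]
  note h = ideal.rcos_ring_hom[OF I]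
  note hm = ring_hom_mult[OF h] and ha = ring_hom_add[OF h]
  have "(I +>\<^bsub>R\<^esub> s x) \<otimes>\<^bsub>R Quot I\<^esub> b = b \<otimes>\<^bsub>R Quot I\<^esub> (I +>\<^bsub>R\<^esub> s x)"
    if "b \<in> carrier (R Quot I)" for x b
  proof -
    from that have "b \<in> (\<lambda>t. I +>\<^bsub>R\<^esub> t) ` carrier R" unfolding carrier_quotient .
    then obtain t where t: "t \<in> carrier R" "b = I +>\<^bsub>R\<^esub> t" by (elim imageE)
    have "s x \<otimes>\<^bsub>R\<^esub> t = t \<otimes>\<^bsub>R\<^esub> s x" by (rule s_central[OF t(1)])
    then show ?thesis unfolding t(2) using hm[OF s_closed t(1), of x] hm[OF t(1) s_closed, of x] by metis
  qed
  moreover have "I +>\<^bsub>R\<^esub> s x \<in> carrier (R Quot I)" for x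
    by (rule ring_hom_closed[OF h s_closed])
  moreover have "I +>\<^bsub>R\<^esub> s (x + y) = (I +>\<^bsub>R\<^esub> s x) \<oplus>\<^bsub>R Quot I\<^esub> (I +>\<^bsub>R\<^esub> s y)" for x y
    unfolding s_add by (rule ha[OF s_closed s_closed])
  moreover have "I +>\<^bsub>R\<^esub> s (x * y) = (I +>\<^bsub>R\<^esub> s x) \<otimes>\<^bsub>R Quot I\<^esub> (I +>\<^bsub>R\<^esub> s y)" for x y
    unfolding s_mult by (rule hm[OF s_closed s_closed])
  moreover have "I +>\<^bsub>R\<^esub> s 1 = \<one>\<^bsub>R Quot I\<^esub>"
    unfolding s_one by (rule ring_hom_one[OF h])
  ultimately show ?thesis
    by (intro central_scalars.intro[OF Q] central_scalars_axioms.intro)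
qed

abbreviation mat_scalar :: "nat \<Rightarrow> complex \<Rightarrow> complex mat" where
  "mat_scalar d \<equiv> \<lambda>c. c \<cdot>\<^sub>m 1\<^sub>m d"

abbreviation cmats :: "nat \<Rightarrow> complex mat ring" where
  "cmats d \<equiv> ring_mat TYPE(complex) d ()"

lemma smult_one_mult_mat [simp]: "dim_row A = d \<Longrightarrow> (c \<cdot>\<^sub>m 1\<^sub>m d) * A = c \<cdot>\<^sub>m (A :: 'a::comm_semiring_1 mat)"
  "dim_col A = d \<Longrightarrow> A * (c \<cdot>\<^sub>m 1\<^sub>m d) = c \<cdot>\<^sub>m (A :: 'a::comm_semiring_1 mat)"
  by (simp_all add: mat_smult_left mat_smult_right)

lemma cmats_central_scalars: "central_scalars (cmats d) (mat_scalar d)"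
proof -
  interpret ring "cmats d" by (rule ring_mat)
  show ?thesis
    by unfold_locales (auto simp: ring_mat_simps smult_smult_mat add_smult_distrib_right_mat intro!: eq_matI simp: algebra_simps)
qed

lemma complex_ring_central_scalars: "central_scalars complex_ring (\<lambda>c. c)"
proof -
  interpret ring complex_ring
    by (rule ringI; (rule abelian_groupI | rule monoidI)?)
      (auto simp: complex_ring_def algebra_simps intro: exI[of _ "- _"])
  show ?thesis by unfold_locales (auto simp: complex_ring_def)
qed

lemma foldr_mult_append:
  assumes "monoid A" "\<And>a. a \<in> set u \<union> set v \<Longrightarrow> \<phi> a \<in> carrier A"
  shows "foldr (\<lambda>a x. \<phi> a \<otimes>\<^bsub>A\<^esub> x) u \<one>\<^bsub>A\<^esub> \<in> carrier A"
    and "foldr (\<lambda>a x. \<phi> a \<otimes>\<^bsub>A\<^esub> x) (u @ v) \<one>\<^bsub>A\<^esub> =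
      foldr (\<lambda>a x. \<phi> a \<otimes>\<^bsub>A\<^esub> x) u \<one>\<^bsub>A\<^esub> \<otimes>\<^bsub>A\<^esub> foldr (\<lambda>a x. \<phi> a \<otimes>\<^bsub>A\<^esub> x) v \<one>\<^bsub>A\<^esub>"
proof -
  interpret monoid A by fact
  have c: "(\<And>a. a \<in> set w \<Longrightarrow> \<phi> a \<in> carrier A) \<Longrightarrow> foldr (\<lambda>a x. \<phi> a \<otimes>\<^bsub>A\<^esub> x) w \<one>\<^bsub>A\<^esub> \<in> carrier A" for w
    by (induction w) auto
  show "foldr (\<lambda>a x. \<phi> a \<otimes>\<^bsub>A\<^esub> x) u \<one>\<^bsub>A\<^esub> \<in> carrier A" using assms by (intro c) auto
  show "foldr (\<lambda>a x. \<phi> a \<otimes>\<^bsub>A\<^esub> x) (u @ v) \<one>\<^bsub>A\<^esub> =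
      foldr (\<lambda>a x. \<phi> a \<otimes>\<^bsub>A\<^esub> x) u \<one>\<^bsub>A\<^esub> \<otimes>\<^bsub>A\<^esub> foldr (\<lambda>a x. \<phi> a \<otimes>\<^bsub>A\<^esub> x) v \<one>\<^bsub>A\<^esub>"
    using assms(2) by (induction u) (auto simp: m_assoc c)
qed

context nonnilpotent_group_datum
begin

abbreviation gens :: "'g gen set" where "gens \<equiv> insert Y (Grp ` carrier G)"

lemma words_simps: "carrier words = lists gens" "u \<otimes>\<^bsub>words\<^esub> v = u @ v" "\<one>\<^bsub>words\<^esub> = []"
  by (auto simp: words_def free_monoid_def)

lemma words_monoid: "monoid words"
  by (rule monoidI) (auto simp: words_simps)

lemma free_alg_ring: "ring free_alg"
  unfolding free_alg_def by (rule monoid_ring_ring[OF words_monoid])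

lemma carrier_free_alg: "t \<in> carrier free_alg \<longleftrightarrow> Poly_Mapping.keys t \<subseteq> lists gens"
  by (simp add: free_alg_def monoid_ring_simps words_simps)

lemma single_free_alg: "w \<in> lists gens \<Longrightarrow> Poly_Mapping.single w c \<in> carrier free_alg"
  by (simp add: carrier_free_alg)

lemma diff_free_alg: "s \<in> carrier free_alg \<Longrightarrow> t \<in> carrier free_alg \<Longrightarrow>
    s - t \<in> carrier free_alg \<and> s \<ominus>\<^bsub>free_alg\<^esub> t = s - t"
  using monoid_ring_minus[OF words_monoid, of s t] ring.ring_simprules(4)[OF free_alg_ring, of s t]
  by (simp add: free_alg_def)

lemma relators_free_alg: "relators \<subseteq> carrier free_alg"
  using g_closed unfolding relators_def
  by (auto intro!: diff_free_alg[THEN conjunct1] single_free_alg simp: in_set_replicate)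

lemma relator_ideal: "ideal relator_ideal free_alg"
  unfolding relator_ideal_def by (rule ring.genideal_ideal[OF free_alg_ring relators_free_alg])

lemma relators_in_ideal: "relators \<subseteq> relator_ideal"
  unfolding relator_ideal_def by (rule ring.genideal_self[OF free_alg_ring relators_free_alg])

lemma H_ring: "ring H"
  unfolding H_def by (rule ideal.quotient_is_ring[OF relator_ideal])

lemma cls_hom: "cls \<in> Ring.ring_hom free_alg H"
  using ideal.rcos_ring_hom[OF relator_ideal] unfolding H_def cls_def[abs_def] .

lemma carrier_H: "carrier H = cls ` carrier free_alg"
  by (auto simp: H_def cls_def FactRing_def A_RCOSETS_def')

lemma free_alg_mult: "Poly_Mapping.single u x \<otimes>\<^bsub>free_alg\<^esub> Poly_Mapping.single v y = Poly_Mapping.single (u @ v) (x * y)"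
  by (simp add: free_alg_def words_simps)

definition satisfies_relations :: "('b, 'c) ring_scheme \<Rightarrow> (complex \<Rightarrow> 'b) \<Rightarrow> ('g gen \<Rightarrow> 'b) \<Rightarrow> bool" where
  "satisfies_relations A s \<phi> \<longleftrightarrow> (\<forall>a\<in>gens. \<phi> a \<in> carrier A) \<and> \<phi> (Grp \<one>) = \<one>\<^bsub>A\<^esub> \<and>
    (\<forall>h\<in>carrier G. \<forall>k\<in>carrier G. \<phi> (Grp h) \<otimes>\<^bsub>A\<^esub> \<phi> (Grp k) = \<phi> (Grp (h \<otimes> k))) \<and>
    (\<forall>h\<in>carrier G. \<phi> Y \<otimes>\<^bsub>A\<^esub> \<phi> (Grp h) = s (\<chi> h) \<otimes>\<^bsub>A\<^esub> (\<phi> (Grp h) \<otimes>\<^bsub>A\<^esub> \<phi> Y)) \<and>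
    \<phi> Y [^]\<^bsub>A\<^esub> n = \<phi> (Grp (g [^] n)) \<ominus>\<^bsub>A\<^esub> \<one>\<^bsub>A\<^esub>"

lemma free_alg_ext_hom:
  assumes A: "central_scalars A s" and \<phi>: "\<forall>a\<in>gens. \<phi> a \<in> carrier A"
  shows "free_alg_ext A s \<phi> \<in> Ring.ring_hom free_alg A"
    and "w \<in> lists gens \<Longrightarrow> free_alg_ext A s \<phi> (Poly_Mapping.single w c) =
      s c \<otimes>\<^bsub>A\<^esub> foldr (\<lambda>a x. \<phi> a \<otimes>\<^bsub>A\<^esub> x) w \<one>\<^bsub>A\<^esub>"
proof -
  interpret central_scalars A s by (rule A)
  let ?\<mu> = "\<lambda>w. foldr (\<lambda>a x. \<phi> a \<otimes>\<^bsub>A\<^esub> x) w \<one>\<^bsub>A\<^esub>"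
  have e: "free_alg_ext A s \<phi> = mr_ext A s ?\<mu>" by (simp add: fun_eq_iff free_alg_ext_def mr_ext_def)
  have cl: "?\<mu> w \<in> carrier A" if "w \<in> lists gens" for w
    using that \<phi> by (intro foldr_mult_append[of A w "[]", OF monoid_axioms]) auto
  have "?\<mu> (u @ v) = ?\<mu> u \<otimes>\<^bsub>A\<^esub> ?\<mu> v" if "u \<in> lists gens" "v \<in> lists gens" for u v
    using that \<phi> by (intro foldr_mult_append(2)[OF monoid_axioms]) auto
  then show "free_alg_ext A s \<phi> \<in> Ring.ring_hom free_alg A"
    unfolding e free_alg_def using cl by (intro mr_ext_hom[OF words_monoid]) (auto simp: words_simps)
  show "free_alg_ext A s \<phi> (Poly_Mapping.single w c) = s c \<otimes>\<^bsub>A\<^esub> ?\<mu> w" if "w \<in> lists gens"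
    unfolding e using cl[OF that] by (rule mr_ext_single)
qed

text \<open>The universal property of \<open>H\<close> as an algebra with generators and relations;
  \<open>comult\<close>, \<open>counit\<close> and the modules \<open>mk_mod\<close> come from
  it.\<close>

lemma H_lift:
  assumes A: "central_scalars A s" and \<phi>: "satisfies_relations A s \<phi>"
  defines "f \<equiv> \<lambda>X. the_elem (free_alg_ext A s \<phi> ` X)"
  shows "f \<in> Ring.ring_hom H A"
    and "t \<in> carrier free_alg \<Longrightarrow> f (cls t) = free_alg_ext A s \<phi> t"
    and "a \<in> gens \<Longrightarrow> f (cls (word [a])) = \<phi> a"
    and "f (scalar c) = s c"
proof -
  interpret central_scalars A s by (rule A)
  have gen: "\<phi> a \<in> carrier A" if "a \<in> gens" for a using \<phi> that unfolding satisfies_relations_def by blast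
  then have cl: "\<forall>a\<in>gens. \<phi> a \<in> carrier A" by blast
  note hom = free_alg_ext_hom[OF A cl]
  have G: "\<phi> (Grp h) \<in> carrier A" if "h \<in> carrier G" for h using gen that by blast
  have Y: "\<phi> Y \<in> carrier A" using gen by blast
  interpret h: ring_hom_ring free_alg A "free_alg_ext A s \<phi>"
    by (rule ring_hom_ringI2[OF free_alg_ring ring_axioms hom(1)])
  have sub: "free_alg_ext A s \<phi> (p - q) = free_alg_ext A s \<phi> p \<ominus>\<^bsub>A\<^esub> free_alg_ext A s \<phi> q"
    if "p \<in> carrier free_alg" "q \<in> carrier free_alg" for p q
    using diff_free_alg[OF that] that h.hom_add h.hom_a_inv by (metis a_minus_def h.R.a_inv_closed)
  have rep: "foldr (\<lambda>a x. \<phi> a \<otimes>\<^bsub>A\<^esub> x) (replicate m Y) \<one>\<^bsub>A\<^esub> = \<phi> Y [^]\<^bsub>A\<^esub> m" for m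
    using Y by (induction m) (simp_all only: replicate_0 replicate_Suc foldr_Nil foldr_Cons o_apply id_apply nat_pow_0 nat_pow_Suc2)
  have z: "free_alg_ext A s \<phi> r = \<zero>\<^bsub>A\<^esub>" if "r \<in> relators" for r
    using that unfolding relators_def
  proof (elim UnE)
    assume "r \<in> {word [] - word [Grp \<one>]}"
    then show ?thesis using \<phi> G by (simp add: sub hom(2) single_free_alg satisfies_relations_def)
  next
    assume "r \<in> {word [Grp h, Grp k] - word [Grp (h \<otimes> k)] |h k. h \<in> carrier G \<and> k \<in> carrier G}"
    then obtain h k where "h \<in> carrier G" "k \<in> carrier G" "r = word [Grp h, Grp k] - word [Grp (h \<otimes> k)]" by auto
    then show ?thesis using \<phi> G by (simp add: sub hom(2) single_free_alg satisfies_relations_def)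
  next
    assume "r \<in> {word [Y, Grp h] - Poly_Mapping.single [Grp h, Y] (\<chi> h) |h. h \<in> carrier G}"
    then obtain h where "h \<in> carrier G" "r = word [Y, Grp h] - Poly_Mapping.single [Grp h, Y] (\<chi> h)" by auto
    then show ?thesis using \<phi> G Y by (simp add: sub hom(2) single_free_alg satisfies_relations_def)
  next
    assume r: "r \<in> {word (replicate n Y) - (word [Grp (g [^] n)] - word [])}"
    have l: "replicate n Y \<in> lists gens" by (auto simp: in_set_replicate)
    have e: "free_alg_ext A s \<phi> (word (replicate n Y)) = \<phi> Y [^]\<^bsub>A\<^esub> n"
      unfolding hom(2)[OF l] rep using Y by simp
    have "free_alg_ext A s \<phi> r = \<phi> Y [^]\<^bsub>A\<^esub> n \<ominus>\<^bsub>A\<^esub> (\<phi> (Grp (g [^] n)) \<ominus>\<^bsub>A\<^esub> \<one>\<^bsub>A\<^esub>)"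
      using r G g_closed diff_free_alg[of "word [Grp (g [^] n)]" "word []"] single_free_alg[OF l]
      by (simp add: sub hom(2) single_free_alg e)
    also have "\<dots> = \<zero>\<^bsub>A\<^esub>"
      using \<phi> G[of "g [^] n"] g_closed unfolding satisfies_relations_def by simp
    finally show ?thesis .
  qed
  have zz: "free_alg_ext A s \<phi> x = \<zero>\<^bsub>A\<^esub>" if "x \<in> relator_ideal" for x
    using ring_hom_kills_genideal[OF free_alg_ring ring_axioms hom(1) relators_free_alg z, folded relator_ideal_def, OF _ that] .
  show "f \<in> Ring.ring_hom H A"
    unfolding f_def H_def by (rule quotient_lift(2)[OF free_alg_ring ring_axioms hom(1) relator_ideal zz])
  show cls: "f (cls t) = free_alg_ext A s \<phi> t" if "t \<in> carrier free_alg" for t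
    unfolding f_def cls_def by (rule quotient_lift(1)[OF free_alg_ring ring_axioms hom(1) relator_ideal zz that])
  show "f (cls (word [a])) = \<phi> a" if "a \<in> gens"
    using that gen by (subst cls) (auto simp: hom(2) single_free_alg)
  show "f (scalar c) = s c"
    unfolding scalar_def by (subst cls) (auto simp: hom(2) single_free_alg)
qed

subsection \<open>Coproduct and counit\<close>

lemma pure_tensor_pm_sum: "pure_tensor p q =
    pm_sum (\<lambda>u x. pm_sum (\<lambda>v y. Poly_Mapping.single (u, v) (x * y)) q) p"
  by (simp add: pure_tensor_def pm_sum_def)

lemma pure_tensor_outer: "additive_coeff (\<lambda>u (x::complex). pm_sum (\<lambda>v y. Poly_Mapping.single (u, v) (x * y)) q)"
  by unfold_locales (simp add: distrib_right single_add pm_sum_add_fun)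

lemma pure_tensor_inner: "additive_coeff (\<lambda>v (y::complex). Poly_Mapping.single (u, v) (x * y))"
  by unfold_locales (simp add: distrib_left single_add)

lemma pure_tensor_add_left: "pure_tensor (p + p') q = pure_tensor p q + pure_tensor p' q"
  by (simp add: pure_tensor_pm_sum additive_coeff.pm_sum_add[OF pure_tensor_outer])

lemma pure_tensor_diff_left: "pure_tensor (p - p') q = pure_tensor p q - pure_tensor p' q"
  by (simp add: pure_tensor_pm_sum additive_coeff.pm_sum_diff[OF pure_tensor_outer])

lemma pure_tensor_add_right: "pure_tensor p (q + q') = pure_tensor p q + pure_tensor p q'"
  by (simp add: pure_tensor_pm_sum additive_coeff.pm_sum_add[OF pure_tensor_inner] pm_sum_add_fun)

lemma pure_tensor_zero [simp]: "pure_tensor 0 q = 0" "pure_tensor p 0 = 0"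
  using pure_tensor_add_left[of 0 0 q] pure_tensor_add_right[of p 0 0] by auto

lemma pure_tensor_diff_right: "pure_tensor p (q - q') = pure_tensor p q - pure_tensor p q'"
  using pure_tensor_add_right[of p "q - q'" q'] by (simp add: algebra_simps)

lemma pure_tensor_single [simp]: "pure_tensor (Poly_Mapping.single u x) (Poly_Mapping.single v y) = Poly_Mapping.single (u, v) (x * y)"
  by (subst pure_tensor_pm_sum, subst additive_coeff.pm_sum_single[OF pure_tensor_outer],
      subst additive_coeff.pm_sum_single[OF pure_tensor_inner], rule refl)

lemma words2_monoid: "monoid (words \<times>\<times> words)"
  by (rule DirProd_monoid[OF words_monoid words_monoid])

lemma free_alg2_ring: "ring free_alg2"
  unfolding free_alg2_def by (rule monoid_ring_ring[OF words2_monoid])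

lemma carrier_free_alg2: "t \<in> carrier free_alg2 \<longleftrightarrow> Poly_Mapping.keys t \<subseteq> lists gens \<times> lists gens"
  by (simp add: free_alg2_def monoid_ring_simps words_simps)

lemma single_free_alg2: "u \<in> lists gens \<Longrightarrow> v \<in> lists gens \<Longrightarrow> Poly_Mapping.single (u, v) c \<in> carrier free_alg2"
  by (simp add: carrier_free_alg2)

lemma diff_free_alg2: "s \<in> carrier free_alg2 \<Longrightarrow> t \<in> carrier free_alg2 \<Longrightarrow>
    s - t \<in> carrier free_alg2 \<and> s \<ominus>\<^bsub>free_alg2\<^esub> t = s - t"
  using monoid_ring_minus[OF words2_monoid, of s t] ring.ring_simprules(4)[OF free_alg2_ring, of s t]
  by (simp add: free_alg2_def)

lemma pure_tensor_closed:
  assumes "s \<in> carrier free_alg" "t \<in> carrier free_alg"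
  shows "pure_tensor s t \<in> carrier free_alg2"
proof -
  interpret ring free_alg2 by (rule free_alg2_ring)
  have add: "p + q \<in> carrier free_alg2" if "p \<in> carrier free_alg2" "q \<in> carrier free_alg2" for p q
    using a_closed[OF that] by (simp add: free_alg2_def monoid_ring_simps(2))
  have zero: "0 \<in> carrier free_alg2" by (simp add: carrier_free_alg2)
  have "Poly_Mapping.keys s \<subseteq> lists gens" "Poly_Mapping.keys t \<subseteq> lists gens"
    using assms by (auto simp: carrier_free_alg)
  then show ?thesis
  proof (induction s rule: poly_mapping_span_induct)
    case (single a x)
    from single(2) show ?case
      by (induction t rule: poly_mapping_span_induct)
        (use single(1) in \<open>auto simp: pure_tensor_add_right zero intro!: add single_free_alg2\<close>)
  qed (auto simp: pure_tensor_add_left zero intro: add)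
qed

lemma relator_ideal2_gens: "(\<lambda>t. pure_tensor t (word [])) ` relator_ideal \<union> (\<lambda>t. pure_tensor (word []) t) ` relator_ideal
    \<subseteq> carrier free_alg2"
  using ideal.Icarr[OF relator_ideal] by (auto intro!: pure_tensor_closed single_free_alg)

lemma relator_ideal2: "ideal relator_ideal2 free_alg2"
  unfolding relator_ideal2_def by (rule ring.genideal_ideal[OF free_alg2_ring relator_ideal2_gens])

lemma HH_ring: "ring HH"
  unfolding HH_def by (rule ideal.quotient_is_ring[OF relator_ideal2])

lemma cls2_hom: "cls2 \<in> Ring.ring_hom free_alg2 HH"
  using ideal.rcos_ring_hom[OF relator_ideal2] unfolding HH_def cls2_def[abs_def] .

lemma scalar2_central: "central_scalars HH scalar2"
  using quotient_central_scalars[OF monoid_ring_central_scalars[OF words2_monoid, where 'k = complex], folded free_alg2_def, OF relator_ideal2]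
  by (simp add: scalar2_def[abs_def] cls2_def[abs_def] HH_def words_simps)

lemma free_alg2_mult: "Poly_Mapping.single (u, v) x \<otimes>\<^bsub>free_alg2\<^esub> Poly_Mapping.single (u', v') y
    = Poly_Mapping.single (u @ u', v @ v') (x * y)"
  by (simp add: free_alg2_def words_simps)

end

context nonnilpotent_group_datum
begin

definition e2 :: "'g gen list \<Rightarrow> 'g gen list \<Rightarrow> 'g hopf2_elt" where
  "e2 u v = cls2 (Poly_Mapping.single (u, v) 1)"

lemma e2_closed: "u \<in> lists gens \<Longrightarrow> v \<in> lists gens \<Longrightarrow> e2 u v \<in> carrier HH"
  unfolding e2_def by (rule ring_hom_closed[OF cls2_hom single_free_alg2])

lemma e2_mult: "u \<in> lists gens \<Longrightarrow> v \<in> lists gens \<Longrightarrow> u' \<in> lists gens \<Longrightarrow> v' \<in> lists gens \<Longrightarrow>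
    e2 u v \<otimes>\<^bsub>HH\<^esub> e2 u' v' = e2 (u @ u') (v @ v')"
  unfolding e2_def
  by (subst ring_hom_mult[OF cls2_hom, symmetric]) (simp_all add: single_free_alg2 free_alg2_mult)

lemma e2_one: "e2 [] [] = \<one>\<^bsub>HH\<^esub>"
  using ring_hom_one[OF cls2_hom] by (simp add: e2_def free_alg2_def monoid_ring_simps(4) words_simps)

lemma cls2_single: "u \<in> lists gens \<Longrightarrow> v \<in> lists gens \<Longrightarrow>
    cls2 (Poly_Mapping.single (u, v) c) = scalar2 c \<otimes>\<^bsub>HH\<^esub> e2 u v"
  unfolding e2_def scalar2_def
  by (subst ring_hom_mult[OF cls2_hom, symmetric]) (simp_all add: single_free_alg2 free_alg2_mult)

lemma cls2_eq_zero: "t \<in> relator_ideal2 \<Longrightarrow> cls2 t = \<zero>\<^bsub>HH\<^esub>"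
proof -
  assume t: "t \<in> relator_ideal2"
  interpret ideal relator_ideal2 free_alg2 by (rule relator_ideal2)
  show ?thesis using a_rcos_const[OF t] by (simp add: cls2_def HH_def FactRing_def)
qed

lemma cls2_diff: "p \<in> carrier free_alg2 \<Longrightarrow> q \<in> carrier free_alg2 \<Longrightarrow>
    cls2 (p - q) = cls2 p \<ominus>\<^bsub>HH\<^esub> cls2 q"
proof -
  assume p: "p \<in> carrier free_alg2" "q \<in> carrier free_alg2"
  interpret ring_hom_ring free_alg2 HH cls2
    by (rule ring_hom_ringI2[OF free_alg2_ring HH_ring cls2_hom])
  show ?thesis using p diff_free_alg2[OF p] by (metis R.a_inv_closed a_minus_def hom_a_inv hom_add)
qed

text \<open>\<open>relator_ideal2\<close> contains the relators in each tensor factor separately, so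
  a relation of \<open>H\<close> may be applied on one side while the other holds the empty
  word.\<close>

lemma cls2_relation:
  assumes "p - q \<in> relators" and p: "p \<in> carrier free_alg" and q: "q \<in> carrier free_alg"
  shows "cls2 (pure_tensor p (word [])) = cls2 (pure_tensor q (word []))"
    and "cls2 (pure_tensor (word []) p) = cls2 (pure_tensor (word []) q)"
proof -
  interpret HH: ring HH by (rule HH_ring)
  have w: "word [] \<in> carrier free_alg" by (simp add: single_free_alg)
  have i: "p - q \<in> relator_ideal" using assms(1) relators_in_ideal by auto
  have "pure_tensor (p - q) (word []) \<in> relator_ideal2" "pure_tensor (word []) (p - q) \<in> relator_ideal2"
    unfolding relator_ideal2_def
    using ring.genideal_self[OF free_alg2_ring relator_ideal2_gens] i by blast+
  then have z: "cls2 (pure_tensor (p - q) (word [])) = \<zero>\<^bsub>HH\<^esub>" "cls2 (pure_tensor (word []) (p - q)) = \<zero>\<^bsub>HH\<^esub>"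
    by (simp_all only: cls2_eq_zero)
  note c = pure_tensor_closed[OF p w] pure_tensor_closed[OF q w] pure_tensor_closed[OF w p] pure_tensor_closed[OF w q]
  note cc = c[THEN ring_hom_closed[OF cls2_hom]]
  show "cls2 (pure_tensor p (word [])) = cls2 (pure_tensor q (word []))"
    using z(1) cc c by (simp add: pure_tensor_diff_left cls2_diff)
  show "cls2 (pure_tensor (word []) p) = cls2 (pure_tensor (word []) q)"
    using z(2) cc c by (simp add: pure_tensor_diff_right cls2_diff)
qed

lemma gens_lists: "[] \<in> lists gens" "[Y] \<in> lists gens" "h \<in> carrier G \<Longrightarrow> [Grp h] \<in> lists gens"
  "k \<in> carrier G \<Longrightarrow> h \<in> carrier G \<Longrightarrow> [Grp h, Grp k] \<in> lists gens"
  "h \<in> carrier G \<Longrightarrow> [Grp h, Y] \<in> lists gens" "h \<in> carrier G \<Longrightarrow> [Y, Grp h] \<in> lists gens"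
  "replicate m Y \<in> lists gens"
  by (auto simp: in_set_replicate)

lemma e2_relations:
  shows "e2 [Grp \<one>] [] = \<one>\<^bsub>HH\<^esub>" "e2 [] [Grp \<one>] = \<one>\<^bsub>HH\<^esub>"
    and "h \<in> carrier G \<Longrightarrow> k \<in> carrier G \<Longrightarrow> e2 [Grp h, Grp k] [] = e2 [Grp (h \<otimes> k)] []"
    and "h \<in> carrier G \<Longrightarrow> k \<in> carrier G \<Longrightarrow> e2 [] [Grp h, Grp k] = e2 [] [Grp (h \<otimes> k)]"
    and "h \<in> carrier G \<Longrightarrow> e2 [Y, Grp h] [] = scalar2 (\<chi> h) \<otimes>\<^bsub>HH\<^esub> e2 [Grp h, Y] []"
    and "h \<in> carrier G \<Longrightarrow> e2 [] [Y, Grp h] = scalar2 (\<chi> h) \<otimes>\<^bsub>HH\<^esub> e2 [] [Grp h, Y]"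
    and "e2 (replicate n Y) [] = e2 [Grp (g [^] n)] [] \<ominus>\<^bsub>HH\<^esub> \<one>\<^bsub>HH\<^esub>"
    and "e2 [] (replicate n Y) = e2 [] [Grp (g [^] n)] \<ominus>\<^bsub>HH\<^esub> \<one>\<^bsub>HH\<^esub>"
proof -
  note gl = gens_lists single_free_alg
  have r: "word [] - word [Grp \<one>] \<in> relators" by (simp add: relators_def)
  show "e2 [Grp \<one>] [] = \<one>\<^bsub>HH\<^esub>" "e2 [] [Grp \<one>] = \<one>\<^bsub>HH\<^esub>"
    using cls2_relation[OF r] by (simp_all add: gl e2_def flip: e2_one)
  show "e2 [Grp h, Grp k] [] = e2 [Grp (h \<otimes> k)] []" "e2 [] [Grp h, Grp k] = e2 [] [Grp (h \<otimes> k)]"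
    if "h \<in> carrier G" "k \<in> carrier G" for h k
  proof -
    have r: "word [Grp h, Grp k] - word [Grp (h \<otimes> k)] \<in> relators" using that unfolding relators_def by blast
    show "e2 [Grp h, Grp k] [] = e2 [Grp (h \<otimes> k)] []" "e2 [] [Grp h, Grp k] = e2 [] [Grp (h \<otimes> k)]"
      using cls2_relation[OF r] that by (simp_all add: gl e2_def)
  qed
  show "e2 [Y, Grp h] [] = scalar2 (\<chi> h) \<otimes>\<^bsub>HH\<^esub> e2 [Grp h, Y] []"
    "e2 [] [Y, Grp h] = scalar2 (\<chi> h) \<otimes>\<^bsub>HH\<^esub> e2 [] [Grp h, Y]" if "h \<in> carrier G" for h
  proof -
    have r: "word [Y, Grp h] - Poly_Mapping.single [Grp h, Y] (\<chi> h) \<in> relators" using that unfolding relators_def by blast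
    show "e2 [Y, Grp h] [] = scalar2 (\<chi> h) \<otimes>\<^bsub>HH\<^esub> e2 [Grp h, Y] []"
      "e2 [] [Y, Grp h] = scalar2 (\<chi> h) \<otimes>\<^bsub>HH\<^esub> e2 [] [Grp h, Y]"
      using cls2_relation[OF r] that
      by (simp_all only: gl cls2_single[unfolded e2_def, symmetric] pure_tensor_single mult_1_left mult_1_right e2_def)
  qed
  have r: "word (replicate n Y) - (word [Grp (g [^] n)] - word []) \<in> relators" unfolding relators_def by blast
  have G: "g [^] n \<in> carrier G" using g_closed by simp
  have d: "word [Grp (g [^] n)] - word [] \<in> carrier free_alg"
    by (rule diff_free_alg[THEN conjunct1]) (use G in \<open>auto simp: gl\<close>)
  show "e2 (replicate n Y) [] = e2 [Grp (g [^] n)] [] \<ominus>\<^bsub>HH\<^esub> \<one>\<^bsub>HH\<^esub>"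
    "e2 [] (replicate n Y) = e2 [] [Grp (g [^] n)] \<ominus>\<^bsub>HH\<^esub> \<one>\<^bsub>HH\<^esub>"
    using cls2_relation[OF r _ d] G
    by (simp_all add: gl pure_tensor_diff_left pure_tensor_diff_right cls2_diff single_free_alg2 e2_def flip: e2_one)
qed

text \<open>The relation for y^n is the one with content. The summands y \<otimes> g and 1 \<otimes>
  y of the coproduct q-commute because y g = q g y, so by \<open>q_frobenius\<close> the n-th power
  of their sum is y^n \<otimes> g^n + 1 \<otimes> y^n. Substituting g^n - 1 for y^n, the mixed terms
  cancel and g^n \<otimes> g^n - 1 \<otimes> 1 remains.\<close>

lemma comult_relations: "satisfies_relations HH scalar2 comult_gen"
proof -
  interpret HH: central_scalars HH scalar2 by (rule scalar2_central)
  note gl = gens_lists e2_closed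
  define a where "a = e2 [Y] [Grp g]"
  define b where "b = e2 [] [Y]"
  have ab: "a \<in> carrier HH" "b \<in> carrier HH" using g_closed by (auto simp: a_def b_def gl)
  have Y: "comult_gen Y = a \<oplus>\<^bsub>HH\<^esub> b"
  proof -
    have "comult_gen Y = cls2 (Poly_Mapping.single ([Y], [Grp g]) 1 \<oplus>\<^bsub>free_alg2\<^esub> Poly_Mapping.single ([], [Y]) 1)"
      by (simp add: free_alg2_def monoid_ring_simps(2))
    also have "\<dots> = a \<oplus>\<^bsub>HH\<^esub> b"
      unfolding a_def b_def e2_def
      by (rule ring_hom_add[OF cls2_hom]) (use g_closed in \<open>auto simp: single_free_alg2\<close>)
    finally show ?thesis .
  qed
  have G: "comult_gen (Grp h) = e2 [Grp h] [Grp h]" for h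
    by (simp add: e2_def)
  have pow: "e2 u v [^]\<^bsub>HH\<^esub> m = e2 (concat (replicate m u)) (concat (replicate m v))"
    if "u \<in> lists gens" "v \<in> lists gens" for u v and m :: nat
  proof (induction m)
    case 0
    then show ?case by (simp add: e2_one)
  next
    case (Suc m)
    have "concat (replicate m u) \<in> lists gens" "concat (replicate m v) \<in> lists gens"
      using that by (auto simp: in_set_replicate)
    then show ?case using that Suc
      by (simp only: HH.nat_pow_Suc2 gl e2_mult replicate_Suc concat.simps)
  qed
  have split: "e2 u v = e2 u [] \<otimes>\<^bsub>HH\<^esub> e2 [] v" "e2 u v = e2 [] v \<otimes>\<^bsub>HH\<^esub> e2 u []"
    if "u \<in> lists gens" "v \<in> lists gens" for u v
    using that by (simp_all add: e2_mult gl)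
  have Gpow: "e2 [] [Grp g] [^]\<^bsub>HH\<^esub> m = e2 [] [Grp (g [^] m)]" for m :: nat
  proof (induction m)
    case 0
    then show ?case by (simp add: e2_relations)
  next
    case (Suc m)
    then show ?case using g_closed
      by (simp add: e2_mult gl e2_relations)
  qed
  have gn: "g [^] n \<in> carrier G" using g_closed by simp
  have "b \<otimes>\<^bsub>HH\<^esub> a = e2 [Y] [Y, Grp g]" using g_closed by (simp add: a_def b_def e2_mult gl)
  also have "\<dots> = e2 [Y] [] \<otimes>\<^bsub>HH\<^esub> (scalar2 (\<chi> g) \<otimes>\<^bsub>HH\<^esub> e2 [] [Grp g, Y])"
    using g_closed by (simp add: split(1)[of "[Y]" "[Y, Grp g]"] gl e2_relations)
  also have "\<dots> = scalar2 (\<chi> g) \<otimes>\<^bsub>HH\<^esub> (e2 [Y] [] \<otimes>\<^bsub>HH\<^esub> e2 [] [Grp g, Y])"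
    using g_closed by (intro HH.s_comm_left) (auto simp: gl)
  also have "e2 [Y] [] \<otimes>\<^bsub>HH\<^esub> e2 [] [Grp g, Y] = a \<otimes>\<^bsub>HH\<^esub> b"
    using g_closed by (simp add: a_def b_def e2_mult gl)
  finally have ba: "b \<otimes>\<^bsub>HH\<^esub> a = scalar2 (\<chi> g) \<otimes>\<^bsub>HH\<^esub> (a \<otimes>\<^bsub>HH\<^esub> b)" .
  have "(a \<oplus>\<^bsub>HH\<^esub> b) [^]\<^bsub>HH\<^esub> n = a [^]\<^bsub>HH\<^esub> n \<oplus>\<^bsub>HH\<^esub> b [^]\<^bsub>HH\<^esub> n"
    using qbinom_root_of_unity[OF q_pow_n q_pow_less] n_ge_2 by (intro HH.q_frobenius[OF ab ba]) auto
  also have "a [^]\<^bsub>HH\<^esub> n = e2 (replicate n Y) [] \<otimes>\<^bsub>HH\<^esub> e2 [] [Grp (g [^] n)]"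
  proof -
    have c: "concat (replicate m [x]) = replicate m x" for m and x :: "'g gen" by (induction m) auto
    have rl: "replicate n (Grp g) \<in> lists gens" using g_closed by (auto simp: in_set_replicate)
    have "a [^]\<^bsub>HH\<^esub> n = e2 (replicate n Y) (replicate n (Grp g))"
      unfolding a_def using g_closed by (simp add: pow gl c)
    also have "\<dots> = e2 (replicate n Y) [] \<otimes>\<^bsub>HH\<^esub> e2 [] (replicate n (Grp g))"
      by (rule split(1)[OF gl(7) rl])
    also have "e2 [] (replicate n (Grp g)) = e2 [] [Grp g] [^]\<^bsub>HH\<^esub> n"
      using g_closed by (simp add: pow gl c)
    finally show ?thesis by (simp add: Gpow)
  qed
  also have "b [^]\<^bsub>HH\<^esub> n = e2 [] (replicate n Y)"
  proof -
    have c: "concat (replicate m [x]) = replicate m x" for m and x :: "'g gen" by (induction m) auto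
    show ?thesis unfolding b_def by (simp add: pow gl c)
  qed
  also have "e2 (replicate n Y) [] \<otimes>\<^bsub>HH\<^esub> e2 [] [Grp (g [^] n)] \<oplus>\<^bsub>HH\<^esub> e2 [] (replicate n Y) =
      e2 [Grp (g [^] n)] [Grp (g [^] n)] \<ominus>\<^bsub>HH\<^esub> \<one>\<^bsub>HH\<^esub>"
  proof -
    define p r where "p = e2 [Grp (g [^] n)] []" "r = e2 [] [Grp (g [^] n)]"
    have pr: "p \<in> carrier HH" "r \<in> carrier HH" using gn by (auto simp: p_r_def gl)
    have "(p \<ominus>\<^bsub>HH\<^esub> \<one>\<^bsub>HH\<^esub>) \<otimes>\<^bsub>HH\<^esub> r \<oplus>\<^bsub>HH\<^esub> (r \<ominus>\<^bsub>HH\<^esub> \<one>\<^bsub>HH\<^esub>) = p \<otimes>\<^bsub>HH\<^esub> r \<ominus>\<^bsub>HH\<^esub> \<one>\<^bsub>HH\<^esub>"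
      using pr by (simp add: a_minus_def HH.l_distr HH.l_minus) (simp add: HH.a_ac HH.r_neg1 HH.r_neg2)
    then show ?thesis
      unfolding e2_relations(7,8) p_r_def[symmetric] split(1)[OF gl(3)[OF gn] gl(3)[OF gn]] .
  qed
  finally have Yn: "comult_gen Y [^]\<^bsub>HH\<^esub> n = comult_gen (Grp (g [^] n)) \<ominus>\<^bsub>HH\<^esub> \<one>\<^bsub>HH\<^esub>"
    by (simp only: Y G)
  have G1: "comult_gen (Grp \<one>) = \<one>\<^bsub>HH\<^esub>"
    unfolding G split(1)[OF gl(3)[OF one_closed] gl(3)[OF one_closed]] by (simp add: e2_relations)
  have GG: "comult_gen (Grp h) \<otimes>\<^bsub>HH\<^esub> comult_gen (Grp k) = comult_gen (Grp (h \<otimes> k))"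
    if "h \<in> carrier G" "k \<in> carrier G" for h k
  proof -
    have "comult_gen (Grp h) \<otimes>\<^bsub>HH\<^esub> comult_gen (Grp k) = e2 [Grp h, Grp k] [Grp h, Grp k]"
      using that unfolding G by (simp add: e2_mult gl)
    also have "\<dots> = e2 [Grp h, Grp k] [] \<otimes>\<^bsub>HH\<^esub> e2 [] [Grp h, Grp k]" using that by (intro split) (auto simp: gl)
    also have "\<dots> = e2 [Grp (h \<otimes> k)] [Grp (h \<otimes> k)]" using that by (simp add: e2_relations e2_mult gl)
    finally show ?thesis by (simp only: G)
  qed
  have YG: "comult_gen Y \<otimes>\<^bsub>HH\<^esub> comult_gen (Grp h) =
      scalar2 (\<chi> h) \<otimes>\<^bsub>HH\<^esub> (comult_gen (Grp h) \<otimes>\<^bsub>HH\<^esub> comult_gen Y)" if h: "h \<in> carrier G" for h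
  proof -
    note gl' = gl(1-6)[OF] g_closed h
    have "a \<otimes>\<^bsub>HH\<^esub> e2 [Grp h] [Grp h] = e2 [Y, Grp h] [] \<otimes>\<^bsub>HH\<^esub> e2 [] [Grp g, Grp h]"
      using g_closed h by (simp add: a_def e2_mult gl)
    also have "\<dots> = scalar2 (\<chi> h) \<otimes>\<^bsub>HH\<^esub> (e2 [Grp h, Y] [] \<otimes>\<^bsub>HH\<^esub> e2 [] [Grp g, Grp h])"
      using g_closed h by (simp add: e2_relations gl HH.m_assoc)
    \<comment> \<open>Centrality of \<open>g\<close> enters here: without it y \<otimes> g would not
      commute with h \<otimes> h up to \<chi> h.\<close>
    also have "e2 [] [Grp g, Grp h] = e2 [] [Grp h, Grp g]"
      using g_closed h by (simp add: e2_relations g_central)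
    also have "e2 [Grp h, Y] [] \<otimes>\<^bsub>HH\<^esub> e2 [] [Grp h, Grp g] = e2 [Grp h] [Grp h] \<otimes>\<^bsub>HH\<^esub> a"
      using g_closed h by (simp add: a_def e2_mult gl)
    finally have 1: "a \<otimes>\<^bsub>HH\<^esub> e2 [Grp h] [Grp h] = scalar2 (\<chi> h) \<otimes>\<^bsub>HH\<^esub> (e2 [Grp h] [Grp h] \<otimes>\<^bsub>HH\<^esub> a)" .
    have "b \<otimes>\<^bsub>HH\<^esub> e2 [Grp h] [Grp h] = e2 [] [Y, Grp h] \<otimes>\<^bsub>HH\<^esub> e2 [Grp h] []"
      using h by (simp add: b_def e2_mult gl)
    also have "\<dots> = scalar2 (\<chi> h) \<otimes>\<^bsub>HH\<^esub> (e2 [] [Grp h, Y] \<otimes>\<^bsub>HH\<^esub> e2 [Grp h] [])"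
      using h by (simp add: e2_relations gl HH.m_assoc)
    also have "e2 [] [Grp h, Y] \<otimes>\<^bsub>HH\<^esub> e2 [Grp h] [] = e2 [Grp h] [Grp h] \<otimes>\<^bsub>HH\<^esub> b"
      using h by (simp add: b_def e2_mult gl)
    finally have 2: "b \<otimes>\<^bsub>HH\<^esub> e2 [Grp h] [Grp h] = scalar2 (\<chi> h) \<otimes>\<^bsub>HH\<^esub> (e2 [Grp h] [Grp h] \<otimes>\<^bsub>HH\<^esub> b)" .
    show ?thesis unfolding Y G using ab h by (simp add: HH.l_distr HH.r_distr gl 1 2)
  qed
  have "comult_gen x \<in> carrier HH" if "x \<in> gens" for x
    using that ab by (auto simp: Y G gl simp del: comult_gen.simps)
  then show ?thesis
    unfolding satisfies_relations_def using G1 GG YG Yn by blast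
qed

lemmas comult_hom = H_lift[OF scalar2_central comult_relations, folded comult_def]

lemma counit_relations: "satisfies_relations complex_ring (\<lambda>c. c) counit_gen"
proof -
  interpret ring complex_ring by (rule central_scalars.axioms(1)[OF complex_ring_central_scalars])
  have c [simp]: "x \<otimes>\<^bsub>complex_ring\<^esub> y = x * y" "\<one>\<^bsub>complex_ring\<^esub> = 1" "\<zero>\<^bsub>complex_ring\<^esub> = 0"
    "x \<in> carrier complex_ring" for x y
    by (simp_all add: complex_ring_def)
  have pow: "x [^]\<^bsub>complex_ring\<^esub> m = x ^ m" for x :: complex and m :: nat
    by (induction m) (simp_all only: nat_pow_0 nat_pow_Suc c power_0 power_Suc2)
  have m: "1 \<ominus>\<^bsub>complex_ring\<^esub> 1 = (0 :: complex)"
    using r_neg[of 1] by (simp add: a_minus_def)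
  show ?thesis
    using n_ge_2 unfolding satisfies_relations_def pow by (simp only: m c counit_gen.simps zero_power if_True) simp
qed

lemmas counit_hom = H_lift[OF complex_ring_central_scalars counit_relations, folded counit_def]

end

lemma ring_hom_congruent:
  assumes R: "ring R" and f: "f \<in> Ring.ring_hom R S" and eq: "\<And>x. x \<in> carrier R \<Longrightarrow> f' x = f x"
  shows "f' \<in> Ring.ring_hom R S"
proof -
  interpret ring R by (rule R)
  show ?thesis
  proof (rule ring_hom_memI)
    show "f' x \<in> carrier S" if "x \<in> carrier R" for x
      using ring_hom_closed[OF f that] by (simp add: eq that)
    show "f' (x \<otimes>\<^bsub>R\<^esub> y) = f' x \<otimes>\<^bsub>S\<^esub> f' y" if "x \<in> carrier R" "y \<in> carrier R" for x y
      using ring_hom_mult[OF f that] by (simp add: eq that)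
    show "f' (x \<oplus>\<^bsub>R\<^esub> y) = f' x \<oplus>\<^bsub>S\<^esub> f' y" if "x \<in> carrier R" "y \<in> carrier R" for x y
      using ring_hom_add[OF f that] by (simp add: eq that)
    show "f' \<one>\<^bsub>R\<^esub> = \<one>\<^bsub>S\<^esub>"
      using ring_hom_one[OF f] by (simp add: eq)
  qed
qed

lemma intertwine_mult:
  fixes F :: "'a::semiring_0 mat"
  assumes "F \<in> carrier_mat k m" "A \<in> carrier_mat m m" "B \<in> carrier_mat m m"
    "A' \<in> carrier_mat k k" "B' \<in> carrier_mat k k" "F * A = A' * F" "F * B = B' * F"
  shows "F * (A * B) = A' * B' * F"
proof -
  have "F * (A * B) = (F * A) * B" using assms(1-5) by (simp add: mat_assoc)
  also have "\<dots> = A' * (F * B)" unfolding assms(6) using assms(1-5) by (simp add: mat_assoc)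
  also have "\<dots> = A' * B' * F" unfolding assms(7) using assms(1-5) by (simp add: mat_assoc)
  finally show ?thesis .
qed

context nonnilpotent_group_datum
begin

subsection \<open>Modules as matrices satisfying the relations\<close>

abbreviation gr :: "'g hopf_mod \<Rightarrow> 'g \<Rightarrow> complex mat" where "gr M h \<equiv> act M (cls (word [Grp h]))"
abbreviation yy :: "'g hopf_mod \<Rightarrow> complex mat" where "yy M \<equiv> act M (cls (word [Y]))"

lemma cls_closed: "t \<in> carrier free_alg \<Longrightarrow> cls t \<in> carrier H"
  by (rule ring_hom_closed[OF cls_hom])

lemma cls_diff: "p \<in> carrier free_alg \<Longrightarrow> q \<in> carrier free_alg \<Longrightarrow> cls (p - q) = cls p \<ominus>\<^bsub>H\<^esub> cls q"
proof -
  assume p: "p \<in> carrier free_alg" "q \<in> carrier free_alg"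
  interpret ring_hom_ring free_alg H cls
    by (rule ring_hom_ringI2[OF free_alg_ring H_ring cls_hom])
  show ?thesis using p diff_free_alg[OF p] by (metis R.a_inv_closed a_minus_def hom_a_inv hom_add)
qed

lemma cls_add: "p \<in> carrier free_alg \<Longrightarrow> q \<in> carrier free_alg \<Longrightarrow> cls (p + q) = cls p \<oplus>\<^bsub>H\<^esub> cls q"
  using ring_hom_add[OF cls_hom, of p q] by (simp add: free_alg_def monoid_ring_simps(2))

lemma cls_relation:
  assumes "p - q \<in> relators" and p: "p \<in> carrier free_alg" and q: "q \<in> carrier free_alg"
  shows "cls p = cls q"
proof -
  interpret ring H by (rule H_ring)
  interpret I: ideal relator_ideal free_alg by (rule relator_ideal)
  have "cls (p - q) = \<zero>\<^bsub>H\<^esub>"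
    using I.a_rcos_const[of "p - q"] assms(1) relators_in_ideal by (auto simp: cls_def H_def FactRing_def)
  then show ?thesis using cls_closed[OF p] cls_closed[OF q] by (simp add: cls_diff p q)
qed

lemma word_append: "u \<in> lists gens \<Longrightarrow> v \<in> lists gens \<Longrightarrow> cls (word (u @ v)) = cls (word u) \<otimes>\<^bsub>H\<^esub> cls (word v)"
  by (subst ring_hom_mult[OF cls_hom, symmetric]) (simp_all add: single_free_alg free_alg_mult)

lemma cls_single: "u \<in> lists gens \<Longrightarrow> cls (Poly_Mapping.single u c) = scalar c \<otimes>\<^bsub>H\<^esub> cls (word u)"
  unfolding scalar_def
  by (subst ring_hom_mult[OF cls_hom, symmetric]) (simp_all add: single_free_alg free_alg_mult)

lemma cls_one: "cls (word []) = \<one>\<^bsub>H\<^esub>"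
  using ring_hom_one[OF cls_hom] by (simp add: free_alg_def monoid_ring_simps(4) words_simps)

lemma cmats_minus: "A \<in> carrier_mat d d \<Longrightarrow> B \<in> carrier_mat d d \<Longrightarrow> A \<ominus>\<^bsub>cmats d\<^esub> B = A - B"
proof -
  assume AB: "A \<in> carrier_mat d d" "B \<in> carrier_mat d d"
  interpret ring "cmats d" by (rule ring_mat)
  have "\<ominus>\<^bsub>cmats d\<^esub> B = - B"
    by (rule minus_equality) (use AB in \<open>auto simp: ring_mat_simps\<close>)
  then show ?thesis using AB by (simp add: a_minus_def ring_mat_simps add_uminus_minus_mat)
qed

lemma module_hom: "is_module M \<Longrightarrow> act M \<in> Ring.ring_hom H (cmats (mdim M))"
  and act_scalar: "is_module M \<Longrightarrow> act M (scalar c) = c \<cdot>\<^sub>m 1\<^sub>m (mdim M)"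
  by (auto simp: is_module_def)

lemma act_carrier: "is_module M \<Longrightarrow> x \<in> carrier H \<Longrightarrow> act M x \<in> carrier_mat (mdim M) (mdim M)"
  using ring_hom_closed[OF module_hom] by (fastforce simp: ring_mat_simps)

lemma act_mult: "is_module M \<Longrightarrow> x \<in> carrier H \<Longrightarrow> y \<in> carrier H \<Longrightarrow> act M (x \<otimes>\<^bsub>H\<^esub> y) = act M x * act M y"
  using ring_hom_mult[OF module_hom] by (simp add: ring_mat_simps)

lemma act_add: "is_module M \<Longrightarrow> x \<in> carrier H \<Longrightarrow> y \<in> carrier H \<Longrightarrow> act M (x \<oplus>\<^bsub>H\<^esub> y) = act M x + act M y"
  using ring_hom_add[OF module_hom] by (simp add: ring_mat_simps)

lemma act_one: "is_module M \<Longrightarrow> act M \<one>\<^bsub>H\<^esub> = 1\<^sub>m (mdim M)"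
  using ring_hom_one[OF module_hom] by (simp add: ring_mat_simps)

lemma act_minus: "is_module M \<Longrightarrow> x \<in> carrier H \<Longrightarrow> y \<in> carrier H \<Longrightarrow> act M (x \<ominus>\<^bsub>H\<^esub> y) = act M x - act M y"
proof -
  assume a: "is_module M" "x \<in> carrier H" "y \<in> carrier H"
  interpret ring_hom_ring H "cmats (mdim M)" "act M"
    by (rule ring_hom_ringI2[OF H_ring ring_mat module_hom[OF a(1)]])
  have "act M (x \<ominus>\<^bsub>H\<^esub> y) = act M x \<ominus>\<^bsub>cmats (mdim M)\<^esub> act M y"
    using a by (metis R.a_inv_closed a_minus_def hom_a_inv hom_add)
  then show ?thesis using a by (simp add: cmats_minus act_carrier)
qed

lemma act_zero: "is_module M \<Longrightarrow> act M (cls 0) = 0\<^sub>m (mdim M) (mdim M)"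
proof -
  assume M: "is_module M"
  have w: "word [] \<in> carrier free_alg" by (simp add: single_free_alg)
  have "act M (cls (word [] - word [])) = act M (cls (word [])) - act M (cls (word []))"
    by (simp only: cls_diff[OF w w] act_minus[OF M cls_closed[OF w] cls_closed[OF w]])
  then show ?thesis using act_carrier[OF M cls_closed[OF w]] by (simp add: minus_self_mat)
qed

lemma act_word: "is_module M \<Longrightarrow> u \<in> lists gens \<Longrightarrow> act M (cls (word u)) \<in> carrier_mat (mdim M) (mdim M)"
  by (intro act_carrier cls_closed single_free_alg)

lemma act_word_append: "is_module M \<Longrightarrow> u \<in> lists gens \<Longrightarrow> v \<in> lists gens \<Longrightarrow>
    act M (cls (word (u @ v))) = act M (cls (word u)) * act M (cls (word v))"
  by (simp only: word_append act_mult cls_closed single_free_alg)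

lemma act_single: "is_module M \<Longrightarrow> u \<in> lists gens \<Longrightarrow>
    act M (cls (Poly_Mapping.single u c)) = c \<cdot>\<^sub>m act M (cls (word u))"
proof -
  assume a: "is_module M" "u \<in> lists gens"
  have "scalar c \<in> carrier H" unfolding scalar_def by (simp add: cls_closed single_free_alg)
  then have "act M (cls (Poly_Mapping.single u c)) = act M (scalar c) * act M (cls (word u))"
    using a by (subst cls_single) (simp_all only: act_mult cls_closed single_free_alg)
  then show ?thesis using a act_word[OF a] by (simp add: act_scalar)
qed

lemma gr_carrier [simp]: "is_module M \<Longrightarrow> h \<in> carrier G \<Longrightarrow> gr M h \<in> carrier_mat (mdim M) (mdim M)"
  by (rule act_word) (auto simp: gens_lists)

lemma yy_carrier [simp]: "is_module M \<Longrightarrow> yy M \<in> carrier_mat (mdim M) (mdim M)"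
  by (rule act_word) (auto simp: gens_lists)

lemma gr_yy_dim [simp]:
  "is_module M \<Longrightarrow> dim_row (yy M) = mdim M" "is_module M \<Longrightarrow> dim_col (yy M) = mdim M"
  "is_module M \<Longrightarrow> h \<in> carrier G \<Longrightarrow> dim_row (gr M h) = mdim M"
  "is_module M \<Longrightarrow> h \<in> carrier G \<Longrightarrow> dim_col (gr M h) = mdim M"
  using yy_carrier gr_carrier by blast+

lemma gr_one: "is_module M \<Longrightarrow> gr M \<one> = 1\<^sub>m (mdim M)"
proof -
  assume M: "is_module M"
  have "cls (word []) = cls (word [Grp \<one>])"
    by (rule cls_relation) (auto simp: relators_def single_free_alg gens_lists)
  then show ?thesis using M by (metis act_one cls_one)
qed

lemma gr_mult: "is_module M \<Longrightarrow> h \<in> carrier G \<Longrightarrow> k \<in> carrier G \<Longrightarrow> gr M h * gr M k = gr M (h \<otimes> k)"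
proof -
  assume a: "is_module M" "h \<in> carrier G" "k \<in> carrier G"
  have "cls (word [Grp h, Grp k]) = cls (word [Grp (h \<otimes> k)])"
    by (rule cls_relation) (use a in \<open>auto simp: relators_def single_free_alg gens_lists\<close>)
  then show ?thesis using act_word_append[of M "[Grp h]" "[Grp k]"] a by (simp add: gens_lists)
qed

lemma yy_gr: "is_module M \<Longrightarrow> h \<in> carrier G \<Longrightarrow> yy M * gr M h = \<chi> h \<cdot>\<^sub>m (gr M h * yy M)"
proof -
  assume a: "is_module M" "h \<in> carrier G"
  have "cls (word [Y, Grp h]) = cls (Poly_Mapping.single [Grp h, Y] (\<chi> h))"
    by (rule cls_relation) (use a in \<open>auto simp: relators_def single_free_alg gens_lists\<close>)
  then show ?thesis
    using act_word_append[of M "[Y]" "[Grp h]"] act_word_append[of M "[Grp h]" "[Y]"]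
      act_single[of M "[Grp h, Y]" "\<chi> h"] a by (simp add: gens_lists)
qed

lemma yy_pow: "is_module M \<Longrightarrow> yy M ^\<^sub>m n = gr M (g [^] n) - 1\<^sub>m (mdim M)"
proof -
  assume M: "is_module M"
  have "yy M ^\<^sub>m m = act M (cls (word (replicate m Y)))" for m
  proof (induction m)
    case 0
    then show ?case using M by (simp add: act_one cls_one)
  next
    case (Suc m)
    then show ?case using act_word_append[of M "replicate m Y" "[Y]"] M
      by (simp add: gens_lists replicate_append_same)
  qed
  moreover have "cls (word (replicate n Y)) = cls (word [Grp (g [^] n)] - word [])"
    by (rule cls_relation) (use g_closed in \<open>auto simp: relators_def intro!: diff_free_alg[THEN conjunct1] single_free_alg gens_lists\<close>)
  moreover have "act M (cls (word [Grp (g [^] n)] - word [])) = gr M (g [^] n) - 1\<^sub>m (mdim M)"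
    using M g_closed by (simp add: cls_diff single_free_alg gens_lists act_minus cls_closed) (simp add: cls_one act_one)
  ultimately show ?thesis by simp
qed

definition is_rep :: "nat \<Rightarrow> ('g \<Rightarrow> complex mat) \<Rightarrow> complex mat \<Rightarrow> bool" where
  "is_rep d \<rho> y \<longleftrightarrow> y \<in> carrier_mat d d \<and> (\<forall>h\<in>carrier G. \<rho> h \<in> carrier_mat d d) \<and> \<rho> \<one> = 1\<^sub>m d \<and>
    (\<forall>h\<in>carrier G. \<forall>k\<in>carrier G. \<rho> h * \<rho> k = \<rho> (h \<otimes> k)) \<and>
    (\<forall>h\<in>carrier G. y * \<rho> h = \<chi> h \<cdot>\<^sub>m (\<rho> h * y)) \<and> y ^\<^sub>m n = \<rho> (g [^] n) - 1\<^sub>m d"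

definition mk_mod :: "nat \<Rightarrow> ('g \<Rightarrow> complex mat) \<Rightarrow> complex mat \<Rightarrow> 'g hopf_mod" where
  "mk_mod d \<rho> y = (d, \<lambda>X. the_elem (free_alg_ext (cmats d) (mat_scalar d) (case_gen y \<rho>) ` X))"

lemma mk_mod:
  assumes "is_rep d \<rho> y"
  shows "is_module (mk_mod d \<rho> y)" "mdim (mk_mod d \<rho> y) = d"
    "h \<in> carrier G \<Longrightarrow> gr (mk_mod d \<rho> y) h = \<rho> h" "yy (mk_mod d \<rho> y) = y"
proof -
  have y: "y \<in> carrier_mat d d" and \<rho>: "\<And>h. h \<in> carrier G \<Longrightarrow> \<rho> h \<in> carrier_mat d d"
    using assms by (auto simp: is_rep_def)
  have p: "y [^]\<^bsub>cmats d\<^esub> n = \<rho> (g [^] n) - 1\<^sub>m d"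
    using pow_mat_ring_pow[OF y, of n "()"] assms by (simp add: is_rep_def)
  have "satisfies_relations (cmats d) (mat_scalar d) (case_gen y \<rho>)"
    unfolding satisfies_relations_def
    using assms y \<rho> g_closed carrier_matD[OF y] carrier_matD[OF \<rho>]
    by (auto simp: ring_mat_simps p cmats_minus is_rep_def)
  note l = H_lift[OF cmats_central_scalars this]
  show "mdim (mk_mod d \<rho> y) = d" by (simp add: mk_mod_def)
  show "is_module (mk_mod d \<rho> y)" unfolding is_module_def mk_mod_def using l(1,4) by simp
  show "gr (mk_mod d \<rho> y) h = \<rho> h" if "h \<in> carrier G"
    using l(3)[of "Grp h"] that unfolding mk_mod_def by simp
  show "yy (mk_mod d \<rho> y) = y" using l(3)[of Y] unfolding mk_mod_def by simp
qed

text \<open>Commuting with the action passes from generators to words by products and from words to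
  all of \<open>H\<close> by linear combinations.\<close>

lemma homs_iff:
  assumes M: "is_module M" and N: "is_module N"
  shows "F \<in> homs M N \<longleftrightarrow> F \<in> carrier_mat (mdim N) (mdim M) \<and>
    (\<forall>h\<in>carrier G. F * gr M h = gr N h * F) \<and> F * yy M = yy N * F"
proof (intro iffI conjI ballI)
  assume F: "F \<in> homs M N"
  then show "F \<in> carrier_mat (mdim N) (mdim M)" by (simp add: homs_def)
  show "F * gr M h = gr N h * F" if "h \<in> carrier G" for h
    using F that cls_closed[OF single_free_alg[OF gens_lists(3)]] unfolding homs_def by blast
  show "F * yy M = yy N * F"
    using F cls_closed[OF single_free_alg[OF gens_lists(2)]] unfolding homs_def by blast
next
  assume a: "F \<in> carrier_mat (mdim N) (mdim M) \<and>
    (\<forall>h\<in>carrier G. F * gr M h = gr N h * F) \<and> F * yy M = yy N * F"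
  then have F: "F \<in> carrier_mat (mdim N) (mdim M)" by blast
  have gen: "F * act M (cls (word [x])) = act N (cls (word [x])) * F" if "x \<in> gens" for x
    using a that by auto
  have w: "F * act M (cls (word u)) = act N (cls (word u)) * F" if "u \<in> lists gens" for u
    using that
  proof (induction u)
    case Nil
    then show ?case using F M N by (simp add: cls_one act_one)
  next
    case (Cons x u)
    then have x: "[x] \<in> lists gens" "u \<in> lists gens" by auto
    note c = act_word[OF M x(1)] act_word[OF M x(2)] act_word[OF N x(1)] act_word[OF N x(2)]
    show ?case
      using intertwine_mult[OF F c(1,2,3,4) gen[of x]] act_word_append[OF M x] act_word_append[OF N x] Cons by simp
  qed
  have "F * act M (cls t) = act N (cls t) * F" if "t \<in> carrier free_alg" for t
  proof -
    have "Poly_Mapping.keys t \<subseteq> lists gens" using that by (simp add: carrier_free_alg)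
    then show ?thesis
    proof (induction t rule: poly_mapping_span_induct)
      case zero
      show ?case using F by (simp add: act_zero M N)
    next
      case (single u c)
      then show ?case using w[of u] act_word[OF M, of u] act_word[OF N, of u] F
        by (simp add: act_single[OF M, of u c] act_single[OF N, of u c] mat_smult_left mat_smult_right)
    next
      case (add p q)
      then have pq: "p \<in> carrier free_alg" "q \<in> carrier free_alg" by (auto simp: carrier_free_alg)
      note c = act_carrier[OF M cls_closed[OF pq(1)]] act_carrier[OF M cls_closed[OF pq(2)]]
        act_carrier[OF N cls_closed[OF pq(1)]] act_carrier[OF N cls_closed[OF pq(2)]]
      show ?case using add pq c F
        by (simp add: cls_add act_add M N cls_closed mat_distrib_left mat_distrib_right)
    qed
  qed
  then show "F \<in> homs M N" using F unfolding homs_def carrier_H by blast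
qed

lemma direct_sum_module:
  assumes M: "is_module M" and N: "is_module N"
  shows "is_module (direct_sum M N)"
    and "mdim (direct_sum M N) = mdim M + mdim N"
    and "act (direct_sum M N) x = four_block_mat (act M x) (0\<^sub>m (mdim M) (mdim N)) (0\<^sub>m (mdim N) (mdim M)) (act N x)"
proof -
  interpret H: ring H by (rule H_ring)
  have "act (direct_sum M N) \<in> Ring.ring_hom H (cmats (mdim M + mdim N))"
  proof (rule ring_hom_memI)
    fix x assume x: "x \<in> carrier H"
    note c = act_carrier[OF M x] act_carrier[OF N x]
    show "act (direct_sum M N) x \<in> carrier (cmats (mdim M + mdim N))"
      using c by (simp add: direct_sum_def ring_mat_simps)
    fix y assume y: "y \<in> carrier H"
    note c = c act_carrier[OF M y] act_carrier[OF N y]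
    show "act (direct_sum M N) (x \<otimes>\<^bsub>H\<^esub> y) = act (direct_sum M N) x \<otimes>\<^bsub>cmats (mdim M + mdim N)\<^esub> act (direct_sum M N) y"
      using c x y by (simp add: direct_sum_def ring_mat_simps act_mult M N
          mult_four_block_mat[of _ "mdim M" "mdim M" _ "mdim N" _ "mdim N" _ _ "mdim M" _ "mdim N"])
    show "act (direct_sum M N) (x \<oplus>\<^bsub>H\<^esub> y) = act (direct_sum M N) x \<oplus>\<^bsub>cmats (mdim M + mdim N)\<^esub> act (direct_sum M N) y"
      using c x y by (simp add: direct_sum_def ring_mat_simps act_add M N
          add_four_block_mat[of _ "mdim M" "mdim M" _ "mdim N" _ "mdim N"])
  next
    show "act (direct_sum M N) \<one>\<^bsub>H\<^esub> = \<one>\<^bsub>cmats (mdim M + mdim N)\<^esub>"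
      by (simp add: direct_sum_def ring_mat_simps act_one M N)
  qed
  moreover have "act (direct_sum M N) (scalar c) = c \<cdot>\<^sub>m 1\<^sub>m (mdim M + mdim N)" for c
    by (rule eq_matI) (auto simp: direct_sum_def act_scalar M N)
  ultimately show "is_module (direct_sum M N)" by (simp add: is_module_def direct_sum_def)
  show "mdim (direct_sum M N) = mdim M + mdim N" by (simp add: direct_sum_def)
  show "act (direct_sum M N) x = four_block_mat (act M x) (0\<^sub>m (mdim M) (mdim N)) (0\<^sub>m (mdim N) (mdim M)) (act N x)"
    by (simp add: direct_sum_def)
qed

lemma trivial_module:
  shows "is_module trivial_mod" "mdim trivial_mod = 1"
    "h \<in> carrier G \<Longrightarrow> gr trivial_mod h = 1\<^sub>m 1" "yy trivial_mod = 0\<^sub>m 1 1"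
proof -
  have h: "counit \<in> Ring.ring_hom H complex_ring" by (rule counit_hom(1))
  have "act trivial_mod \<in> Ring.ring_hom H (cmats 1)"
    by (rule ring_hom_memI)
      (use ring_hom_mult[OF h] ring_hom_add[OF h] ring_hom_one[OF h] in
        \<open>auto simp: trivial_mod_def ring_mat_simps complex_ring_def\<close>)
  moreover have "act trivial_mod (scalar c) = c \<cdot>\<^sub>m 1\<^sub>m 1" for c
    by (simp add: trivial_mod_def counit_hom(4))
  ultimately show "is_module trivial_mod" by (simp add: is_module_def trivial_mod_def)
  show "mdim trivial_mod = 1" by (simp add: trivial_mod_def)
  show "gr trivial_mod h = 1\<^sub>m 1" if "h \<in> carrier G"
    using that counit_hom(3)[of "Grp h"] by (simp add: trivial_mod_def)
  show "yy trivial_mod = 0\<^sub>m 1 1"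
    using counit_hom(3)[of Y] by (auto simp: trivial_mod_def)
qed

text \<open>The action is defined through representatives of cosets in \<open>HH\<close>. Here it is
  identified with the linear extension of the Kronecker products \<open>K u v\<close>, which is
  multiplicative and kills the relators in either factor, hence is well defined. From this point
  tensor products are handled by the matrices of the generators alone.\<close>

lemma tensor_module:
  assumes M: "is_module M" and N: "is_module N"
  shows "is_module (tensor M N)" "mdim (tensor M N) = mdim M * mdim N"
    and "h \<in> carrier G \<Longrightarrow> gr (tensor M N) h = kronecker (gr M h) (gr N h)"
    and "yy (tensor M N) = kronecker (yy M) (gr N g) + kronecker (1\<^sub>m (mdim M)) (yy N)"
proof -
  define d where "d = mdim M * mdim N"
  define K where "K u v = kronecker (act M (cls (word u))) (act N (cls (word v)))" for u v
  let ?\<mu> = "\<lambda>p. K (fst p) (snd p)"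
  let ?f = "mr_ext (cmats d) (mat_scalar d) ?\<mu>"
  have K: "K u v \<in> carrier_mat d d" if "u \<in> lists gens" "v \<in> lists gens" for u v
    using act_word[OF M that(1)] act_word[OF N that(2)] by (simp add: K_def d_def)
  have f: "?f \<in> Ring.ring_hom free_alg2 (cmats d)"
    unfolding free_alg2_def
  proof (rule central_scalars.mr_ext_hom[OF cmats_central_scalars words2_monoid])
    show "?\<mu> \<in> carrier (words \<times>\<times> words) \<rightarrow> carrier (cmats d)"
      by (auto simp: words_simps ring_mat_simps simp del: in_lists_conv_set intro!: K)
    show "?\<mu> \<one>\<^bsub>words \<times>\<times> words\<^esub> = \<one>\<^bsub>cmats d\<^esub>"
      by (simp add: words_simps ring_mat_simps K_def cls_one act_one M N d_def)
    fix p q assume "p \<in> carrier (words \<times>\<times> words)" "q \<in> carrier (words \<times>\<times> words)"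
    then obtain u v u' v' where p: "p = (u, v)" "q = (u', v')"
      "u \<in> lists gens" "v \<in> lists gens" "u' \<in> lists gens" "v' \<in> lists gens"
      by (auto simp: words_simps)
    then show "?\<mu> (p \<otimes>\<^bsub>words \<times>\<times> words\<^esub> q) = ?\<mu> p \<otimes>\<^bsub>cmats d\<^esub> ?\<mu> q"
      using act_word[OF M p(3)] act_word[OF M p(5)] act_word[OF N p(4)] act_word[OF N p(6)]
      by (simp add: words_simps ring_mat_simps K_def act_word_append M N kronecker_mult)
  qed
  have fadd: "?f (p + q) = ?f p + ?f q" if "p \<in> carrier free_alg2" "q \<in> carrier free_alg2" for p q
    using ring_hom_add[OF f that] by (simp add: free_alg2_def monoid_ring_simps(2) ring_mat_simps)
  have fsingle: "?f (Poly_Mapping.single (u, v) c) = c \<cdot>\<^sub>m K u v" if "u \<in> lists gens" "v \<in> lists gens" for u v c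
    using central_scalars.mr_ext_single[OF cmats_central_scalars, of ?\<mu> "(u, v)" d c] K[OF that]
    by (simp add: ring_mat_simps)
  have f0: "?f 0 = 0\<^sub>m d d"
    using central_scalars.mr_ext_zero[OF cmats_central_scalars, of d ?\<mu>] by (simp add: ring_mat_simps)
  have w: "word [] \<in> carrier free_alg" by (simp add: single_free_alg)
  have K1: "K u [] = kronecker (act M (cls (word u))) (1\<^sub>m (mdim N))"
    and K2: "K [] u = kronecker (1\<^sub>m (mdim M)) (act N (cls (word u)))" for u
    by (simp_all add: K_def cls_one act_one M N)
  have f1: "?f (pure_tensor t (word [])) = kronecker (act M (cls t)) (1\<^sub>m (mdim N)) \<and>
      ?f (pure_tensor (word []) t) = kronecker (1\<^sub>m (mdim M)) (act N (cls t))"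
    if "t \<in> carrier free_alg" for t
  proof -
    have "Poly_Mapping.keys t \<subseteq> lists gens" using that by (simp add: carrier_free_alg)
    then show ?thesis
    proof (induction t rule: poly_mapping_span_induct)
      case zero
      show ?case using f0 by (simp add: d_def act_zero M N)
    next
      case (single u c)
      then show ?case
        by (simp add: fsingle K1 K2 act_single[OF M, of u c] act_single[OF N, of u c] kronecker_smult_left kronecker_smult_right)
    next
      case (add p q)
      then have pq: "p \<in> carrier free_alg" "q \<in> carrier free_alg" by (auto simp: carrier_free_alg)
      note c = act_carrier[OF M cls_closed[OF pq(1)]] act_carrier[OF M cls_closed[OF pq(2)]]
        act_carrier[OF N cls_closed[OF pq(1)]] act_carrier[OF N cls_closed[OF pq(2)]]
      show ?case using add pq c
        by (simp add: pure_tensor_add_left pure_tensor_add_right fadd pure_tensor_closed w cls_add act_add M N cls_closed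
            kronecker_add_left kronecker_add_right)
    qed
  qed
  have act0: "act L (cls t) = 0\<^sub>m (mdim L) (mdim L)" if "is_module L" "t \<in> relator_ideal" for L t
  proof -
    interpret I: ideal relator_ideal free_alg by (rule relator_ideal)
    interpret h: ring_hom_ring H "cmats (mdim L)" "act L"
      by (rule ring_hom_ringI2[OF H_ring ring_mat module_hom[OF that(1)]])
    have "cls t = \<zero>\<^bsub>H\<^esub>" using I.a_rcos_const[OF that(2)] by (simp add: cls_def H_def FactRing_def)
    then show ?thesis using h.hom_zero by (simp add: ring_mat_simps)
  qed
  have z: "?f t = \<zero>\<^bsub>cmats d\<^esub>" if "t \<in> relator_ideal2" for t
  proof (rule ring_hom_kills_genideal[OF free_alg2_ring ring_mat f relator_ideal2_gens _ that[unfolded relator_ideal2_def]])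
    fix x assume "x \<in> (\<lambda>t. pure_tensor t (word [])) ` relator_ideal \<union> (\<lambda>t. pure_tensor (word []) t) ` relator_ideal"
    then show "?f x = \<zero>\<^bsub>cmats d\<^esub>"
      using f1 ideal.Icarr[OF relator_ideal] by (auto simp: act0[OF M] act0[OF N] ring_mat_simps d_def)
  qed
  note q = quotient_lift[OF free_alg2_ring ring_mat f relator_ideal2 z]
  have out: "outer_act M N X = the_elem (?f ` X)" if X: "X \<in> carrier HH" for X
  proof -
    obtain t where t: "t \<in> carrier free_alg2" "X = relator_ideal2 +>\<^bsub>free_alg2\<^esub> t"
      using X unfolding HH_def carrier_quotient by auto
    interpret R: ring free_alg2 by (rule free_alg2_ring)
    interpret I: ideal relator_ideal2 free_alg2 by (rule relator_ideal2)
    interpret Mt: ring "cmats d" by (rule ring_mat)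
    have sub: "X \<subseteq> carrier free_alg2" unfolding t(2) by (rule R.a_r_coset_subset_G[OF I.a_subset t(1)])
    show ?thesis unfolding outer_act_def
    proof (intro arg_cong[of _ _ the_elem] image_cong refl)
      fix t assume tX: "t \<in> X"
      have k: "Poly_Mapping.keys t \<subseteq> lists gens \<times> lists gens" using tX sub carrier_free_alg2 by blast
      have kK: "K (fst p) (snd p) \<in> carrier_mat d d" if "p \<in> Poly_Mapping.keys t" for p
      proof -
        have "p \<in> lists gens \<times> lists gens" using k that by blast
        then show ?thesis by (cases p) (simp only: fst_conv snd_conv mem_Sigma_iff K)
      qed
      show "(\<Oplus>\<^bsub>cmats (mdim M * mdim N)\<^esub>p\<in>Poly_Mapping.keys t. Poly_Mapping.lookup t p \<cdot>\<^sub>m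
          kronecker (act M (cls (word (fst p)))) (act N (cls (word (snd p))))) = ?f t"
        unfolding mr_ext_def d_def[symmetric]
      proof (rule Mt.finsum_cong')
        fix p assume "p \<in> Poly_Mapping.keys t"
        then have c: "K (fst p) (snd p) \<in> carrier_mat d d" by (rule kK)
        then show "Poly_Mapping.lookup t p \<cdot>\<^sub>m kronecker (act M (cls (word (fst p)))) (act N (cls (word (snd p)))) =
          mat_scalar d (Poly_Mapping.lookup t p) \<otimes>\<^bsub>cmats d\<^esub> K (fst p) (snd p)"
          by (simp add: K_def[symmetric] ring_mat_simps)
      next
        show "(\<lambda>p. mat_scalar d (Poly_Mapping.lookup t p) \<otimes>\<^bsub>cmats d\<^esub> K (fst p) (snd p)) \<in> Poly_Mapping.keys t \<rightarrow> carrier (cmats d)"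
        proof (rule Pi_I)
          fix p assume "p \<in> Poly_Mapping.keys t"
          then have "K (fst p) (snd p) \<in> carrier_mat d d" by (rule kK)
          then show "mat_scalar d (Poly_Mapping.lookup t p) \<otimes>\<^bsub>cmats d\<^esub> K (fst p) (snd p) \<in> carrier (cmats d)"
            by (simp add: ring_mat_simps)
        qed
      qed simp
    qed
  qed
  have oh: "outer_act M N \<in> Ring.ring_hom HH (cmats d)"
    by (rule ring_hom_congruent[OF HH_ring q(2)[folded HH_def] out])
  have o2: "outer_act M N (cls2 t) = ?f t" if "t \<in> carrier free_alg2" for t
    using q(1)[OF _ that] ring_hom_closed[OF cls2_hom that] by (simp add: out cls2_def)
  have oe: "outer_act M N (e2 u v) = K u v" if "u \<in> lists gens" "v \<in> lists gens" for u v
    unfolding e2_def using that by (simp add: o2 single_free_alg2 fsingle)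
  show dim: "mdim (tensor M N) = mdim M * mdim N" by (simp add: tensor_def)
  have t: "act (tensor M N) = (\<lambda>x. outer_act M N (comult x))" by (simp add: tensor_def)
  have th: "act (tensor M N) \<in> Ring.ring_hom H (cmats d)"
    unfolding t using ring_hom_trans[OF comult_hom(1) oh] by (simp add: o_def)
  have K0: "K [] [] = 1\<^sub>m d" by (simp add: K_def cls_one act_one M N d_def)
  have "act (tensor M N) (scalar c) = c \<cdot>\<^sub>m 1\<^sub>m d" for c
    unfolding t comult_hom(4) scalar2_def
    by (simp add: o2 single_free_alg2 fsingle K0)
  then show "is_module (tensor M N)" using th by (simp add: is_module_def dim d_def)
  show "gr (tensor M N) h = kronecker (gr M h) (gr N h)" if "h \<in> carrier G"
  proof -
    have "gr (tensor M N) h = outer_act M N (comult_gen (Grp h))"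
      unfolding t using that by (subst comult_hom(3)) auto
    also have "comult_gen (Grp h) = e2 [Grp h] [Grp h]" by (simp add: e2_def)
    finally show ?thesis using that by (simp add: oe gens_lists K_def)
  qed
  have "yy (tensor M N) = outer_act M N (comult_gen Y)"
    unfolding t by (subst comult_hom(3)) auto
  also have "comult_gen Y = cls2 (Poly_Mapping.single ([Y], [Grp g]) 1 + Poly_Mapping.single ([], [Y]) 1)"
    by simp
  also have "\<dots> = e2 [Y] [Grp g] \<oplus>\<^bsub>HH\<^esub> e2 [] [Y]"
    using ring_hom_add[OF cls2_hom single_free_alg2[of "[Y]" "[Grp g]" 1] single_free_alg2[of "[]" "[Y]" 1]] g_closed
    by (simp add: e2_def free_alg2_def monoid_ring_simps(2) gens_lists)
  also have "outer_act M N \<dots> = K [Y] [Grp g] + K [] [Y]"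
    using ring_hom_add[OF oh e2_closed[of "[Y]" "[Grp g]"] e2_closed[of "[]" "[Y]"]] g_closed
    by (simp add: oe gens_lists ring_mat_simps)
  finally show "yy (tensor M N) = kronecker (yy M) (gr N g) + kronecker (1\<^sub>m (mdim M)) (yy N)"
    by (simp add: K_def cls_one act_one M)
qed

end

section \<open>Matrices as vectors in tensor products\<close>

text \<open>Row-major flattening of a matrix. A matrix of size dim M x dim N thereby becomes a
  linear form on M \<otimes> N, and by \<open>ket\<close> a vector in it; so maps between M
  \<otimes> N and the trivial module are encoded by matrices.\<close>

definition bra :: "complex mat \<Rightarrow> complex mat" where
  "bra X = mat 1 (dim_row X * dim_col X) (\<lambda>(_, j). X $$ (j div dim_col X, j mod dim_col X))"

definition ket :: "complex mat \<Rightarrow> complex mat" where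
  "ket X = mat (dim_row X * dim_col X) 1 (\<lambda>(i, _). X $$ (i div dim_col X, i mod dim_col X))"

lemma bra_ket_dim [simp]:
  "dim_row (bra X) = 1" "dim_col (bra X) = dim_row X * dim_col X"
  "dim_row (ket X) = dim_row X * dim_col X" "dim_col (ket X) = 1"
  by (auto simp: bra_def ket_def)

lemma bra_ket_index:
  "j < dim_row X * dim_col X \<Longrightarrow> bra X $$ (0, j) = X $$ (j div dim_col X, j mod dim_col X)"
  "j < dim_row X * dim_col X \<Longrightarrow> ket X $$ (j, 0) = X $$ (j div dim_col X, j mod dim_col X)"
  by (auto simp: bra_def ket_def)

text \<open>The identity (A \<otimes> B) vec X = vec (A X B^T). It turns invariance of a vector in a
  tensor product into an equation between small matrices.\<close>

lemma ket_kronecker: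
  assumes "dim_col A = dim_row X" "dim_col B = dim_col X"
  shows "kronecker A B * ket X = ket (A * X * transpose_mat B)"
proof (rule eq_matI)
  fix i j assume "i < dim_row (ket (A * X * transpose_mat B))" "j < dim_col (ket (A * X * transpose_mat B))"
  then have i: "i < dim_row A * dim_row B" and j: "j = 0" by auto
  note b = div_mod_bounds[OF i]
  define i1 i2 where "i1 = i div dim_row B" "i2 = i mod dim_row B"
  note d = this
  have "(kronecker A B * ket X) $$ (i, 0) =
      (\<Sum>k<dim_row X * dim_col X. kronecker A B $$ (i, k) * ket X $$ (k, 0))"
    using i assms by (simp add: index_mult_sum del: index_mult_mat(1))
  also have "\<dots> = (\<Sum>k<dim_row X * dim_col X.
      (A $$ (i1, k div dim_col X) * B $$ (i2, k mod dim_col X)) * X $$ (k div dim_col X, k mod dim_col X))"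
    using i assms by (intro sum.cong) (auto simp: kronecker_index bra_ket_index d)
  also have "\<dots> = (\<Sum>k<dim_row X. \<Sum>l<dim_col X. (A $$ (i1, k) * B $$ (i2, l)) * X $$ (k, l))"
    by (rule sum_div_mod)
  also have "\<dots> = (\<Sum>l<dim_col X. \<Sum>k<dim_row X. A $$ (i1, k) * X $$ (k, l) * B $$ (i2, l))"
    by (subst sum.swap) (simp add: ac_simps)
  also have "\<dots> = (\<Sum>l<dim_col X. (A * X) $$ (i1, l) * transpose_mat B $$ (l, i2))"
    using b assms by (intro sum.cong) (auto simp: index_mult_sum d sum_distrib_right simp del: index_mult_mat(1))
  also have "\<dots> = (A * X * transpose_mat B) $$ (i1, i2)"
    using b assms by (subst index_mult_sum) (auto simp: d simp del: index_mult_mat(1))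
  also have "\<dots> = ket (A * X * transpose_mat B) $$ (i, 0)"
    using i by (simp add: bra_ket_index d)
  finally show "(kronecker A B * ket X) $$ (i, j) = ket (A * X * transpose_mat B) $$ (i, j)" using j by simp
qed (use assms in auto)

lemma transpose_ket: "transpose_mat (ket X) = bra X"
  by (rule eq_matI) (auto simp: bra_ket_index ket_def bra_def)

lemma bra_kronecker:
  assumes "dim_row A = dim_row X" "dim_row B = dim_col X"
  shows "bra X * kronecker A B = bra (transpose_mat A * X * B)"
proof -
  have "bra X * kronecker A B = transpose_mat (kronecker (transpose_mat A) (transpose_mat B) * ket X)"
    using assms by (subst transpose_mult[of _ "dim_col A * dim_col B" "dim_row A * dim_row B" _ 1])
      (auto simp: transpose_ket kronecker_transpose)
  also have "\<dots> = bra (transpose_mat A * X * B)"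
    using assms by (simp add: ket_kronecker transpose_ket)
  finally show ?thesis .
qed

lemma bra_ket_linear:
  "dim_row X = dim_row Z \<Longrightarrow> dim_col X = dim_col Z \<Longrightarrow> bra (X + Z) = bra X + bra Z"
  "dim_row X = dim_row Z \<Longrightarrow> dim_col X = dim_col Z \<Longrightarrow> ket (X + Z) = ket X + ket Z"
  "bra (0\<^sub>m a b) = 0\<^sub>m 1 (a * b)" "ket (0\<^sub>m a b) = 0\<^sub>m (a * b) 1"
  by (rule eq_matI; auto simp: bra_def ket_def div_mod_bounds)+

lemma bra_mult_ket:
  assumes "dim_row X = dim_row Z" "dim_col X = dim_col Z"
  shows "(bra X * ket Z) $$ (0, 0) = tr (transpose_mat X * Z)"
proof -
  have "(bra X * ket Z) $$ (0, 0) = (\<Sum>k<dim_row Z * dim_col Z. bra X $$ (0, k) * ket Z $$ (k, 0))"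
    using assms by (simp add: index_mult_sum del: index_mult_mat(1))
  also have "\<dots> = (\<Sum>k<dim_row Z * dim_col Z. X $$ (k div dim_col Z, k mod dim_col Z) * Z $$ (k div dim_col Z, k mod dim_col Z))"
    using assms by (intro sum.cong) (auto simp: bra_ket_index)
  also have "\<dots> = (\<Sum>i<dim_row Z. \<Sum>j<dim_col Z. X $$ (i, j) * Z $$ (i, j))"
    by (rule sum_div_mod)
  also have "\<dots> = (\<Sum>j<dim_col Z. \<Sum>i<dim_row Z. X $$ (i, j) * Z $$ (i, j))" by (rule sum.swap)
  also have "\<dots> = tr (transpose_mat X * Z)"
    using assms by (simp add: tr_def index_mult_sum del: index_mult_mat(1))
  finally show ?thesis .
qed

lemma triple_index:
  fixes k b c :: nat
  shows "k div c mod b = k mod (b * c) div c" "k mod c = k mod (b * c) mod c" "k div c div b = k div (b * c)"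
proof -
  have e: "k mod (b * c) = c * (k div c mod b) + k mod c"
    using mod_mult2_eq[of k c b] by (simp only: mult.commute[of b c])
  show "k div c mod b = k mod (b * c) div c" "k mod c = k mod (b * c) mod c"
    unfolding e by (cases "c = 0"; simp)+
  show "k div c div b = k div (b * c)"
    by (simp only: mult.commute[of b c] div_mult2_eq)
qed

text \<open>The snake composite of rigid duality, with arbitrary matrices in place of the identity
  pairing. With \<open>Z\<close> and \<open>X\<close> inverse to each other it is a triangle
  identity; with one of them general it computes the adjoint of a map.\<close>

lemma zigzag:
  assumes "dim_col Z = dim_row X" and [simp]: "a = dim_row Z" "c = dim_col X"
  shows "kronecker (1\<^sub>m a) (bra X) * kronecker (ket Z) (1\<^sub>m c) = Z * X"
proof (rule eq_matI)
  define b where "b = dim_row X"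
  fix i j assume "i < dim_row (Z * X)" "j < dim_col (Z * X)"
  then have ij: "i < a" "j < c" by auto
  define L where "L k = (if i = k div (b * c) then 1 else 0) * X $$ (k mod (b * c) div c, k mod (b * c) mod c)" for k
  have "(kronecker (1\<^sub>m a) (bra X) * kronecker (ket Z) (1\<^sub>m c)) $$ (i, j) =
     (\<Sum>k<a * (b * c). kronecker (1\<^sub>m a) (bra X) $$ (i, k) * kronecker (ket Z) (1\<^sub>m c) $$ (k, j))"
    using ij assms by (simp add: index_mult_sum b_def mult.assoc del: index_mult_mat(1))
  also have "\<dots> = (\<Sum>k<a * (b * c). (if i = k div (b * c) then 1 else 0) * X $$ (k mod (b * c) div c, k mod (b * c) mod c) *
      (Z $$ (k div (b * c), k mod (b * c) div c) * (if k mod (b * c) mod c = j then 1 else 0)))"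
  proof (rule sum.cong)
    fix k assume "k \<in> {..<a * (b * c)}"
    then have k: "k < a * (b * c)" and k': "k < a * b * c" by (auto simp: mult.assoc)
    note bd = div_mod_bounds[OF k] div_mod_bounds[OF k']
    have 1: "kronecker (1\<^sub>m a) (bra X) $$ (i, k) = (if i = k div (b * c) then 1 else 0) * X $$ (k mod (b * c) div c, k mod (b * c) mod c)"
      using k ij bd by (subst kronecker_index) (auto simp: b_def bra_ket_index)
    have 2: "kronecker (ket Z) (1\<^sub>m c) $$ (k, j) = Z $$ (k div c div b, k div c mod b) * (if k mod c = j then 1 else 0)"
      using k' ij bd assms by (subst kronecker_index) (auto simp: b_def bra_ket_index)
    show "kronecker (1\<^sub>m a) (bra X) $$ (i, k) * kronecker (ket Z) (1\<^sub>m c) $$ (k, j) = (if i = k div (b * c) then 1 else 0) * X $$ (k mod (b * c) div c, k mod (b * c) mod c) *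
      (Z $$ (k div (b * c), k mod (b * c) div c) * (if k mod (b * c) mod c = j then 1 else 0))"
      unfolding 1 2 unfolding triple_index(1)[of k c b] triple_index(2)[of k c b] triple_index(3)[of k c b] ..
  qed simp
  also have "\<dots> = (\<Sum>p<a. \<Sum>r<b * c. (if i = p then 1 else 0) * X $$ (r div c, r mod c) *
      (Z $$ (p, r div c) * (if r mod c = j then 1 else 0)))"
    by (rule sum_div_mod)
  also have "\<dots> = (\<Sum>p<a. if p = i then (\<Sum>r<b * c. X $$ (r div c, r mod c) *
      (Z $$ (p, r div c) * (if r mod c = j then 1 else 0))) else 0)"
    by (intro sum.cong) auto
  also have "\<dots> = (\<Sum>r<b * c. X $$ (r div c, r mod c) * (Z $$ (i, r div c) * (if r mod c = j then 1 else 0)))"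
    using ij by simp
  also have "\<dots> = (\<Sum>s<b. \<Sum>t<c. X $$ (s, t) * (Z $$ (i, s) * (if t = j then 1 else 0)))"
    by (rule sum_div_mod)
  also have "\<dots> = (\<Sum>s<b. \<Sum>t<c. if t = j then Z $$ (i, s) * X $$ (s, j) else 0)"
    by (intro sum.cong) auto
  also have "\<dots> = (\<Sum>s<b. Z $$ (i, s) * X $$ (s, j))"
    using ij by simp
  also have "\<dots> = (Z * X) $$ (i, j)" using ij assms by (subst index_mult_sum) (auto simp: b_def)
  finally show "(kronecker (1\<^sub>m a) (bra X) * kronecker (ket Z) (1\<^sub>m c)) $$ (i, j) = (Z * X) $$ (i, j)" .
qed auto

text \<open>The mirror image of \<open>zigzag\<close>. Here the free index enters through the rows
  of \<open>X\<close> and leaves through the columns of \<open>Z\<close>, so the product appears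
  transposed.\<close>

lemma zigzag':
  assumes "dim_col X = dim_row Z" and [simp]: "a = dim_row X" "c = dim_col Z"
  shows "kronecker (bra X) (1\<^sub>m c) * kronecker (1\<^sub>m a) (ket Z) = transpose_mat (X * Z)"
proof (rule eq_matI)
  define b where "b = dim_row Z"
  fix i j assume "i < dim_row (transpose_mat (X * Z))" "j < dim_col (transpose_mat (X * Z))"
  then have ij: "i < c" "j < a" by auto
  have "(kronecker (bra X) (1\<^sub>m c) * kronecker (1\<^sub>m a) (ket Z)) $$ (i, j) =
     (\<Sum>k<a * (b * c). kronecker (bra X) (1\<^sub>m c) $$ (i, k) * kronecker (1\<^sub>m a) (ket Z) $$ (k, j))"
    using ij assms by (simp add: index_mult_sum b_def mult.assoc del: index_mult_mat(1))
  also have "\<dots> = (\<Sum>k<a * (b * c). X $$ (k div (b * c), k mod (b * c) div c) * (if i = k mod (b * c) mod c then 1 else 0) *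
      ((if k div (b * c) = j then 1 else 0) * Z $$ (k mod (b * c) div c, k mod (b * c) mod c)))"
  proof (rule sum.cong)
    fix k assume "k \<in> {..<a * (b * c)}"
    then have k: "k < a * (b * c)" and k': "k < a * b * c" by (auto simp: mult.assoc)
    note bd = div_mod_bounds[OF k] div_mod_bounds[OF k']
    have 1: "kronecker (bra X) (1\<^sub>m c) $$ (i, k) = X $$ (k div c div b, k div c mod b) * (if i = k mod c then 1 else 0)"
      using k' ij bd assms by (subst kronecker_index) (auto simp: b_def bra_ket_index)
    have 2: "kronecker (1\<^sub>m a) (ket Z) $$ (k, j) = (if k div (b * c) = j then 1 else 0) * Z $$ (k mod (b * c) div c, k mod (b * c) mod c)"
      using k ij bd assms by (subst kronecker_index) (auto simp: b_def bra_ket_index)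
    show "kronecker (bra X) (1\<^sub>m c) $$ (i, k) * kronecker (1\<^sub>m a) (ket Z) $$ (k, j) = X $$ (k div (b * c), k mod (b * c) div c) * (if i = k mod (b * c) mod c then 1 else 0) *
      ((if k div (b * c) = j then 1 else 0) * Z $$ (k mod (b * c) div c, k mod (b * c) mod c))"
      unfolding 1 2 unfolding triple_index(1)[of k c b] triple_index(2)[of k c b] triple_index(3)[of k c b] ..
  qed simp
  also have "\<dots> = (\<Sum>p<a. \<Sum>r<b * c. X $$ (p, r div c) * (if i = r mod c then 1 else 0) *
      ((if p = j then 1 else 0) * Z $$ (r div c, r mod c)))"
    by (rule sum_div_mod)
  also have "\<dots> = (\<Sum>p<a. if p = j then (\<Sum>r<b * c. X $$ (p, r div c) * (if i = r mod c then 1 else 0) *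
       Z $$ (r div c, r mod c)) else 0)"
    by (intro sum.cong) auto
  also have "\<dots> = (\<Sum>r<b * c. X $$ (j, r div c) * (if i = r mod c then 1 else 0) * Z $$ (r div c, r mod c))"
    using ij by simp
  also have "\<dots> = (\<Sum>s<b. \<Sum>t<c. X $$ (j, s) * (if i = t then 1 else 0) * Z $$ (s, t))"
    by (rule sum_div_mod)
  also have "\<dots> = (\<Sum>s<b. \<Sum>t<c. if t = i then X $$ (j, s) * Z $$ (s, i) else 0)"
    by (intro sum.cong) auto
  also have "\<dots> = (\<Sum>s<b. X $$ (j, s) * Z $$ (s, i))"
    using ij by simp
  also have "\<dots> = transpose_mat (X * Z) $$ (i, j)" using ij assms
    by (simp add: index_mult_sum b_def del: index_mult_mat(1))
  finally show "(kronecker (bra X) (1\<^sub>m c) * kronecker (1\<^sub>m a) (ket Z)) $$ (i, j) = transpose_mat (X * Z) $$ (i, j)" .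
qed auto

section \<open>The category of modules\<close>

context nonnilpotent_group_datum
begin

text \<open>Preimages of the unit vectors form the columns of a linear section. Such a section is
  the raw material that is later averaged into a module map.\<close>

lemma surjective_iff:
  assumes E: "E \<in> carrier_mat b a"
  shows "surjective E \<longleftrightarrow> (\<exists>R\<in>carrier_mat a b. E * R = 1\<^sub>m b)"
proof
  assume s: "surjective E"
  then have "\<forall>i. \<exists>u. i < b \<longrightarrow> u \<in> carrier_vec a \<and> E *\<^sub>v u = unit_vec b i"
    using E unfolding surjective_def by (metis carrier_matD unit_vec_carrier)
  then obtain u where u: "\<And>i. i < b \<Longrightarrow> u i \<in> carrier_vec a \<and> E *\<^sub>v u i = unit_vec b i" by metis
  define R where "R = mat a b (\<lambda>(i, j). u j $ i)"
  have "E * R = 1\<^sub>m b"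
  proof (rule eq_matI)
    fix i j assume ij: "i < dim_row (1\<^sub>m b :: complex mat)" "j < dim_col (1\<^sub>m b :: complex mat)"
    have c: "col R j = u j" using ij u[of j] by (auto simp: R_def intro!: eq_vecI)
    have "(E * R) $$ (i, j) = (E *\<^sub>v u j) $ i" using ij E c by (simp add: R_def)
    then show "(E * R) $$ (i, j) = 1\<^sub>m b $$ (i, j)" using ij u[of j] by simp
  qed (use E in \<open>auto simp: R_def\<close>)
  then show "\<exists>R\<in>carrier_mat a b. E * R = 1\<^sub>m b" by (intro bexI[of _ R]) (auto simp: R_def)
next
  assume "\<exists>R\<in>carrier_mat a b. E * R = 1\<^sub>m b"
  then obtain R where R: "R \<in> carrier_mat a b" "E * R = 1\<^sub>m b" by blast
  show "surjective E" unfolding surjective_def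
  proof
    fix v :: "complex vec" assume "v \<in> carrier_vec (dim_row E)"
    then have v: "v \<in> carrier_vec b" using E by simp
    have "E *\<^sub>v (R *\<^sub>v v) = v" using assoc_mult_mat_vec[OF E R(1) v] R(2) v by simp
    then show "\<exists>u\<in>carrier_vec (dim_col E). E *\<^sub>v u = v"
      using R(1) E v by (intro bexI[of _ "R *\<^sub>v v"]) auto
  qed
qed

lemma homs_carrier: "F \<in> homs M N \<Longrightarrow> F \<in> carrier_mat (mdim N) (mdim M)"
  by (simp add: homs_def)

lemma homs_dim: "F \<in> homs M N \<Longrightarrow> dim_row F = mdim N" "F \<in> homs M N \<Longrightarrow> dim_col F = mdim M"
  by (rule carrier_matD[OF homs_carrier], assumption)+

lemma homs_comp:
  assumes "is_module M" "is_module N" "is_module L" "F \<in> homs M N" "F' \<in> homs N L"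
  shows "F' * F \<in> homs M L"
proof -
  have "F' * F * act M x = act L x * (F' * F)" if "x \<in> carrier H" for x
  proof -
    note c = homs_carrier[OF assms(4)] homs_carrier[OF assms(5)] act_carrier[OF assms(1) that]
      act_carrier[OF assms(2) that] act_carrier[OF assms(3) that]
    have e: "F * act M x = act N x * F" "F' * act N x = act L x * F'" using assms(4,5) that by (auto simp: homs_def)
    have "F' * F * act M x = F' * (F * act M x)" using c by (simp add: mat_assoc)
    also have "\<dots> = F' * act N x * F" unfolding e(1) using c by (simp add: mat_assoc)
    also have "\<dots> = act L x * (F' * F)" unfolding e(2) using c by (simp add: mat_assoc)
    finally show ?thesis .
  qed
  then show ?thesis using homs_carrier[OF assms(4)] homs_carrier[OF assms(5)] by (simp add: homs_def)
qed

lemma homs_one: "is_module M \<Longrightarrow> 1\<^sub>m (mdim M) \<in> homs M M"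
proof -
  assume M: "is_module M"
  have "1\<^sub>m (mdim M) * act M x = act M x * 1\<^sub>m (mdim M)" if "x \<in> carrier H" for x
    using act_carrier[OF M that] by simp
  then show ?thesis by (simp add: homs_def)
qed

lemma homs_zero: "is_module M \<Longrightarrow> is_module N \<Longrightarrow> 0\<^sub>m (mdim N) (mdim M) \<in> homs M N"
proof -
  assume M: "is_module M" and N: "is_module N"
  have "0\<^sub>m (mdim N) (mdim M) * act M x = act N x * 0\<^sub>m (mdim N) (mdim M)" if "x \<in> carrier H" for x
    using act_carrier[OF M that] act_carrier[OF N that] by simp
  then show ?thesis by (simp add: homs_def)
qed

lemma homs_add: "is_module M \<Longrightarrow> is_module N \<Longrightarrow> F \<in> homs M N \<Longrightarrow> F' \<in> homs M N \<Longrightarrow> F + F' \<in> homs M N"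
proof -
  assume M: "is_module M" and N: "is_module N" and F: "F \<in> homs M N" "F' \<in> homs M N"
  have "(F + F') * act M x = act N x * (F + F')" if "x \<in> carrier H" for x
    using act_carrier[OF M that] act_carrier[OF N that] F that by (auto simp: homs_def mat_dist)
  then show ?thesis using F by (simp add: homs_def)
qed

lemma homs_smult: "is_module M \<Longrightarrow> is_module N \<Longrightarrow> F \<in> homs M N \<Longrightarrow> c \<cdot>\<^sub>m F \<in> homs M N"
proof -
  assume M: "is_module M" and N: "is_module N" and F: "F \<in> homs M N"
  have "(c \<cdot>\<^sub>m F) * act M x = act N x * (c \<cdot>\<^sub>m F)" if "x \<in> carrier H" for x
    using act_carrier[OF M that] act_carrier[OF N that] F that by (auto simp: homs_def mat_dist)
  then show ?thesis using F by (simp add: homs_def)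
qed

lemma homs_diff: "is_module M \<Longrightarrow> is_module N \<Longrightarrow> F \<in> homs M N \<Longrightarrow> F' \<in> homs M N \<Longrightarrow> F - F' \<in> homs M N"
proof -
  assume M: "is_module M" and N: "is_module N" and F: "F \<in> homs M N" "F' \<in> homs M N"
  have "(F - F') * act M x = act N x * (F - F')" if "x \<in> carrier H" for x
    using act_carrier[OF M that] act_carrier[OF N that] F that by (auto simp: homs_def mat_dist)
  then show ?thesis using F minus_carrier_mat by (auto simp: homs_def)
qed

text \<open>\<open>act\<close> is unconstrained outside \<open>carrier H\<close>, so modules such as
  the two bracketings of a triple tensor product need not be equal as pairs. They are therefore
  compared on generators, which already determine the maps.\<close>

lemma homs_congruent:
  assumes "is_module M" "is_module M'" "is_module N" "is_module N'" "mdim M' = mdim M" "mdim N' = mdim N"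
    "yy M' = yy M" "yy N' = yy N" "\<And>h. h \<in> carrier G \<Longrightarrow> gr M' h = gr M h" "\<And>h. h \<in> carrier G \<Longrightarrow> gr N' h = gr N h"
  shows "homs M' N' = homs M N"
  using assms by (auto simp: homs_iff)

lemma mod_isoI: "F \<in> homs M N \<Longrightarrow> F' \<in> homs N M \<Longrightarrow> F' * F = 1\<^sub>m (mdim M) \<Longrightarrow> F * F' = 1\<^sub>m (mdim N) \<Longrightarrow> mod_iso M N"
  unfolding mod_iso_def by blast

lemma mod_iso_same_gens:
  assumes "is_module M" "is_module N" "mdim M = mdim N" "yy M = yy N" "\<And>h. h \<in> carrier G \<Longrightarrow> gr M h = gr N h"
  shows "mod_iso M N"
  by (rule mod_isoI[of "1\<^sub>m (mdim N)" _ _ "1\<^sub>m (mdim N)"])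
    (use assms homs_one[OF assms(2)] homs_congruent[of N M N N] homs_congruent[of N N N M] in auto)

lemma mod_iso_refl: "is_module M \<Longrightarrow> mod_iso M M"
  by (rule mod_iso_same_gens) auto

lemma mod_iso_sym: "mod_iso M N \<Longrightarrow> mod_iso N M"
  unfolding mod_iso_def by blast

lemma mat_sandwich_cancel:
  fixes A B C D :: "complex mat"
  assumes "A \<in> carrier_mat a b" "B \<in> carrier_mat b c" "C \<in> carrier_mat c b" "D \<in> carrier_mat b a"
    "B * C = 1\<^sub>m b" "A * D = 1\<^sub>m a"
  shows "A * B * (C * D) = 1\<^sub>m a"
proof -
  have "A * B * (C * D) = A * (B * C) * D" using assms(1-4) by (simp add: mat_assoc)
  then show ?thesis using assms by simp
qed

lemma mod_iso_trans:
  assumes "is_module M" "is_module N" "is_module L" "mod_iso M N" "mod_iso N L"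
  shows "mod_iso M L"
proof -
  obtain F F' where F: "F \<in> homs M N" "F' \<in> homs N M" "F' * F = 1\<^sub>m (mdim M)" "F * F' = 1\<^sub>m (mdim N)"
    using assms(4) unfolding mod_iso_def by blast
  obtain K K' where K: "K \<in> homs N L" "K' \<in> homs L N" "K' * K = 1\<^sub>m (mdim N)" "K * K' = 1\<^sub>m (mdim L)"
    using assms(5) unfolding mod_iso_def by blast
  show ?thesis
    by (rule mod_isoI[OF homs_comp[OF assms(1,2,3) F(1) K(1)] homs_comp[OF assms(3,2,1) K(2) F(2)]])
      (rule mat_sandwich_cancel[OF homs_carrier homs_carrier homs_carrier homs_carrier]; (rule F K)+)+
qed

subsection \<open>Direct sums\<close>

text \<open>A decomposition given by injections and projections rather than block matrices.
  Identities between maps survive tensoring and, with arrows reversed, dualising, where the shape of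
  block matrices would not.\<close>

definition biproduct :: "'g hopf_mod \<Rightarrow> 'g hopf_mod \<Rightarrow> 'g hopf_mod \<Rightarrow> complex mat \<Rightarrow> complex mat \<Rightarrow> complex mat \<Rightarrow> complex mat \<Rightarrow> bool" where
  "biproduct X A B iA pA iB pB \<longleftrightarrow> iA \<in> homs A X \<and> pA \<in> homs X A \<and> iB \<in> homs B X \<and> pB \<in> homs X B \<and>
     pA * iA = 1\<^sub>m (mdim A) \<and> pB * iB = 1\<^sub>m (mdim B) \<and> iA * pA + iB * pB = 1\<^sub>m (mdim X)"

lemma biproduct_carrier:
  assumes "biproduct X A B iA pA iB pB"
  shows "iA \<in> carrier_mat (mdim X) (mdim A)" "pA \<in> carrier_mat (mdim A) (mdim X)"
    "iB \<in> carrier_mat (mdim X) (mdim B)" "pB \<in> carrier_mat (mdim B) (mdim X)"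
  using assms homs_carrier unfolding biproduct_def by blast+

text \<open>Multiplying the decomposition of the identity by \<open>pA\<close> on the left and
  cancelling \<open>pA\<close> gives \<open>(pA * iB) * pB = 0\<close>; then
  \<open>pB * iB = 1\<close> removes \<open>pB\<close>. The second equation is symmetric.\<close>

lemma biproduct_orthogonal:
  assumes b: "biproduct X A B iA pA iB pB"
  shows "pA * iB = 0\<^sub>m (mdim A) (mdim B)" "pB * iA = 0\<^sub>m (mdim B) (mdim A)"
proof -
  note c = biproduct_carrier[OF b]
  note e = b[unfolded biproduct_def]
  have cancel: "P + Q = P \<Longrightarrow> P \<in> carrier_mat r s \<Longrightarrow> Q \<in> carrier_mat r s \<Longrightarrow> Q = 0\<^sub>m r s" for P Q :: "complex mat" and r s
    by (auto simp: mat_eq_iff)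
  have "pA = pA * (iA * pA + iB * pB)" using e c by simp
  also have "\<dots> = (pA * iA) * pA + (pA * iB) * pB" using c by (simp add: mat_dist mat_assoc)
  finally have "pA + (pA * iB) * pB = pA" using e c by simp
  then have z: "(pA * iB) * pB = 0\<^sub>m (mdim A) (mdim X)" by (rule cancel) (use c in auto)
  have "pA * iB = (pA * iB) * (pB * iB)" using e c by simp
  also have "\<dots> = ((pA * iB) * pB) * iB" using c by (simp add: mat_assoc)
  finally show "pA * iB = 0\<^sub>m (mdim A) (mdim B)" unfolding z using c by simp
  have "pB = pB * (iA * pA + iB * pB)" using e c by simp
  also have "\<dots> = (pB * iB) * pB + (pB * iA) * pA"
    using c comm_add_mat[of "pB * iA * pA" "mdim B" "mdim X" "pB * iB * pB"] by (simp add: mat_dist mat_assoc)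
  finally have "pB + (pB * iA) * pA = pB" using e c by simp
  then have z: "(pB * iA) * pA = 0\<^sub>m (mdim B) (mdim X)" by (rule cancel) (use c in auto)
  have "pB * iA = (pB * iA) * (pA * iA)" using e c by simp
  also have "\<dots> = ((pB * iA) * pA) * iA" using c by (simp add: mat_assoc)
  finally show "pB * iA = 0\<^sub>m (mdim B) (mdim A)" unfolding z using c by simp
qed

lemma biproduct_cross:
  assumes M: "is_module X" "is_module X'" "is_module A" "is_module B"
    and b: "biproduct X A B iA pA iB pB" and b': "biproduct X' A B jA qA jB qB"
  shows "(iA * qA + iB * qB) * (jA * pA + jB * pB) = 1\<^sub>m (mdim X)" "jA * pA + jB * pB \<in> homs X X'"
proof -
  note c = biproduct_carrier[OF b] biproduct_carrier[OF b']
  note e = b[unfolded biproduct_def] b'[unfolded biproduct_def]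
  note z = biproduct_orthogonal[OF b']
  have "(iA * qA + iB * qB) * (jA * pA + jB * pB) =
     iA * (qA * jA) * pA + iB * (qB * jA) * pA + (iA * (qA * jB) * pB + iB * (qB * jB) * pB)"
    using c by (simp add: mat_dist mat_assoc)
  also have "\<dots> = iA * pA + iB * pB" using c e z by simp
  finally show "(iA * qA + iB * qB) * (jA * pA + jB * pB) = 1\<^sub>m (mdim X)" using e by simp
  show "jA * pA + jB * pB \<in> homs X X'" using e M by (intro homs_add homs_comp[of X A X'] homs_comp[of X B X']) auto
qed

lemma biproduct_unique:
  assumes M: "is_module X" "is_module X'" "is_module A" "is_module B"
    and b: "biproduct X A B iA pA iB pB" and b': "biproduct X' A B jA qA jB qB"
  shows "mod_iso X X'"
  by (rule mod_isoI[of "jA * pA + jB * pB" _ _ "iA * qA + iB * qB"])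
    (use biproduct_cross[OF assms] biproduct_cross[OF M(2,1,3,4) b' b] in auto)

lemma direct_sum_biproduct:
  assumes A: "is_module A" and B: "is_module B"
  obtains iA pA iB pB where "biproduct (direct_sum A B) A B iA pA iB pB"
proof -
  define a b where "a = mdim A" "b = mdim B"
  define I :: "complex mat" where "I = mat (a + b) a (\<lambda>(i, j). if i = j then 1 else 0)"
  define J :: "complex mat" where "J = mat (a + b) b (\<lambda>(i, j). if i = a + j then 1 else 0)"
  note ds = direct_sum_module[OF A B]
  have IJ: "I \<in> carrier_mat (a + b) a" "J \<in> carrier_mat (a + b) b" by (auto simp: I_def J_def)
  have colI: "D * I = mat r a (\<lambda>(i, j). D $$ (i, j))" if "D \<in> carrier_mat r (a + b)" for D :: "complex mat" and r
  proof (rule eq_matI)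
    fix i j assume "i < dim_row (mat r a (\<lambda>(i, j). D $$ (i, j)))" "j < dim_col (mat r a (\<lambda>(i, j). D $$ (i, j)))"
    then have ij: "i < r" "j < a" by auto
    have "(D * I) $$ (i, j) = (\<Sum>k<a + b. if k = j then D $$ (i, k) else 0)"
      using ij that by (subst index_mult_sum) (auto simp: I_def if_distrib[of "\<lambda>x. _ * x"] cong: if_cong)
    then show "(D * I) $$ (i, j) = mat r a (\<lambda>(i, j). D $$ (i, j)) $$ (i, j)" using ij by simp
  qed (use that in \<open>auto simp: I_def\<close>)
  have colJ: "D * J = mat r b (\<lambda>(i, j). D $$ (i, a + j))" if "D \<in> carrier_mat r (a + b)" for D :: "complex mat" and r
  proof (rule eq_matI)
    fix i j assume "i < dim_row (mat r b (\<lambda>(i, j). D $$ (i, a + j)))" "j < dim_col (mat r b (\<lambda>(i, j). D $$ (i, a + j)))"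
    then have ij: "i < r" "j < b" by auto
    have "(D * J) $$ (i, j) = (\<Sum>k<a + b. if k = a + j then D $$ (i, k) else 0)"
      using ij that by (subst index_mult_sum) (auto simp: J_def if_distrib[of "\<lambda>x. _ * x"] cong: if_cong)
    then show "(D * J) $$ (i, j) = mat r b (\<lambda>(i, j). D $$ (i, a + j)) $$ (i, j)" using ij by simp
  qed (use that in \<open>auto simp: J_def\<close>)
  have rowI: "I * X = mat (a + b) r (\<lambda>(i, j). if i < a then X $$ (i, j) else 0)" if "X \<in> carrier_mat a r" for X :: "complex mat" and r
  proof (rule eq_matI)
    fix i j assume "i < dim_row (mat (a + b) r (\<lambda>(i, j). if i < a then X $$ (i, j) else 0))"
      "j < dim_col (mat (a + b) r (\<lambda>(i, j). if i < a then X $$ (i, j) else 0))"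
    then have ij: "i < a + b" "j < r" by auto
    have "(I * X) $$ (i, j) = (\<Sum>k<a. if i = k then X $$ (k, j) else 0)"
      using ij that by (subst index_mult_sum) (auto simp: I_def if_distrib[of "\<lambda>x. x * _"] cong: if_cong)
    then show "(I * X) $$ (i, j) = mat (a + b) r (\<lambda>(i, j). if i < a then X $$ (i, j) else 0) $$ (i, j)" using ij by simp
  qed (use that in \<open>auto simp: I_def\<close>)
  have rowJ: "J * X = mat (a + b) r (\<lambda>(i, j). if i < a then 0 else X $$ (i - a, j))" if "X \<in> carrier_mat b r" for X :: "complex mat" and r
  proof (rule eq_matI)
    fix i j assume "i < dim_row (mat (a + b) r (\<lambda>(i, j). if i < a then 0 else X $$ (i - a, j)))"
      "j < dim_col (mat (a + b) r (\<lambda>(i, j). if i < a then 0 else X $$ (i - a, j)))"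
    then have ij: "i < a + b" "j < r" by auto
    have "(J * X) $$ (i, j) = (\<Sum>k<b. if i = a + k then X $$ (k, j) else 0)"
      using ij that by (subst index_mult_sum) (auto simp: J_def if_distrib[of "\<lambda>x. x * _"] cong: if_cong)
    also have "\<dots> = (\<Sum>k<b. if k = i - a then (if i < a then 0 else X $$ (i - a, j)) else 0)"
      using ij by (intro sum.cong) auto
    finally show "(J * X) $$ (i, j) = mat (a + b) r (\<lambda>(i, j). if i < a then 0 else X $$ (i - a, j)) $$ (i, j)" using ij by auto
  qed (use that in \<open>auto simp: J_def\<close>)
  have h: "I \<in> homs A (direct_sum A B)" "J \<in> homs B (direct_sum A B)"
    "transpose_mat I \<in> homs (direct_sum A B) A" "transpose_mat J \<in> homs (direct_sum A B) B"
  proof -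
    have "I * act A x = act (direct_sum A B) x * I \<and> J * act B x = act (direct_sum A B) x * J \<and>
        transpose_mat I * act (direct_sum A B) x = act A x * transpose_mat I \<and>
        transpose_mat J * act (direct_sum A B) x = act B x * transpose_mat J" if x: "x \<in> carrier H" for x
    proof -
      have c: "act A x \<in> carrier_mat a a" "act B x \<in> carrier_mat b b"
        using act_carrier[OF A x] act_carrier[OF B x] by (auto simp: a_b_def)
      define D where "D = act (direct_sum A B) x"
      have Dc: "D \<in> carrier_mat (a + b) (a + b)" using act_carrier[OF ds(1) x] ds(2) by (simp add: D_def a_b_def)
      have D: "D = four_block_mat (act A x) (0\<^sub>m a b) (0\<^sub>m b a) (act B x)"
        unfolding D_def by (simp add: ds(3) a_b_def)
      have 1: "I * act A x = D * I" "J * act B x = D * J"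
        unfolding colI[OF Dc] colJ[OF Dc] rowI[OF c(1)] rowJ[OF c(2)]
        using c by (auto simp: D)
      \<comment> \<open>The projections are the transposes of the inclusions \<open>I\<close> and
        \<open>J\<close>. Their equivariance is obtained from the same column and row computations
        for the transposed blocks.\<close>
      have tc: "transpose_mat (act A x) \<in> carrier_mat a a" "transpose_mat (act B x) \<in> carrier_mat b b" "transpose_mat D \<in> carrier_mat (a + b) (a + b)"
        using c Dc by auto
      have "I * transpose_mat (act A x) = transpose_mat D * I" "J * transpose_mat (act B x) = transpose_mat D * J"
        unfolding colI[OF tc(3)] colJ[OF tc(3)] rowI[OF tc(1)] rowJ[OF tc(2)]
        using c by (auto simp: D)
      then have 2: "transpose_mat (I * transpose_mat (act A x)) = transpose_mat (transpose_mat D * I)"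
          "transpose_mat (J * transpose_mat (act B x)) = transpose_mat (transpose_mat D * J)" by simp_all
      have 3: "transpose_mat I * D = act A x * transpose_mat I" "transpose_mat J * D = act B x * transpose_mat J"
        using 2[unfolded transpose_mult[OF IJ(1) tc(1)] transpose_mult[OF IJ(2) tc(2)]
          transpose_mult[OF tc(3) IJ(1)] transpose_mult[OF tc(3) IJ(2)]] by simp_all
      show ?thesis using 1 3 unfolding D_def by blast
    qed
    then show "I \<in> homs A (direct_sum A B)" "J \<in> homs B (direct_sum A B)"
      "transpose_mat I \<in> homs (direct_sum A B) A" "transpose_mat J \<in> homs (direct_sum A B) B"
      using IJ by (auto simp: homs_def ds(2) a_b_def)
  qed
  have tI: "transpose_mat I * I = 1\<^sub>m a"
    by (subst colI) (auto simp: I_def)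
  have tJ: "transpose_mat J * J = 1\<^sub>m b"
    by (subst colJ) (auto simp: J_def)
  have "I * transpose_mat I + J * transpose_mat J = 1\<^sub>m (a + b)"
    by (subst rowI[of _ "a + b"], use IJ in simp, subst rowJ[of _ "a + b"], use IJ in simp)
      (auto simp: I_def J_def)
  then show ?thesis using that[of I "transpose_mat I" J "transpose_mat J"] h tI tJ
    by (simp add: biproduct_def ds(2) a_b_def)
qed

lemma biproduct_iso:
  assumes "is_module X" "is_module A" "is_module B" "biproduct X A B iA pA iB pB"
  shows "mod_iso X (direct_sum A B)"
proof -
  obtain jA qA jB qB where "biproduct (direct_sum A B) A B jA qA jB qB"
    using direct_sum_biproduct[OF assms(2,3)] .
  then show ?thesis using biproduct_unique assms direct_sum_module(1) by blast
qed

end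

section \<open>Transposes, roots of unity and the flip of tensor factors\<close>

lemma smult_pow_mat: "A \<in> carrier_mat d d \<Longrightarrow> (c \<cdot>\<^sub>m A) ^\<^sub>m k = c ^ k \<cdot>\<^sub>m (A ^\<^sub>m k)" for A :: "'a::comm_ring_1 mat"
proof (induction k)
  case (Suc k)
  then show ?case by (simp add: mat_smult_left mat_smult_right smult_smult_mat mult.commute)
qed auto

lemma transpose_pow_mat: "A \<in> carrier_mat d d \<Longrightarrow> transpose_mat A ^\<^sub>m k = transpose_mat (A ^\<^sub>m k)" for A :: "'a::comm_ring_1 mat"
proof (induction k)
  case (Suc k)
  have "transpose_mat A ^\<^sub>m Suc k = transpose_mat (A ^\<^sub>m k) * transpose_mat A" using Suc by simp
  also have "\<dots> = transpose_mat (A * A ^\<^sub>m k)"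
    using Suc.prems by (intro transpose_mult[symmetric, of _ d d _ d]) auto
  also have "\<dots> = transpose_mat (A ^\<^sub>m Suc k)" using pow_mat_Suc_left[OF Suc.prems, of k] by simp
  finally show ?case .
qed auto

lemma transpose_mat_mult: "dim_col A = dim_row B \<Longrightarrow> transpose_mat (A * B) = transpose_mat B * transpose_mat A" for A :: "'a::comm_semiring_0 mat"
  by (rule transpose_mult[of _ "dim_row A" "dim_col A" _ "dim_col B"]) auto

lemma transpose_mat_add: "dim_row A = dim_row B \<Longrightarrow> dim_col A = dim_col B \<Longrightarrow>
    transpose_mat (A + B) = transpose_mat A + transpose_mat B"
  by (rule eq_matI) auto

lemma transpose_smult: "transpose_mat (c \<cdot>\<^sub>m A) = c \<cdot>\<^sub>m transpose_mat A"
  by (rule eq_matI) auto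

text \<open>This is the constant in S(y)^n = - y^n g^(-n). The exponent of q is n(n-1)/2: for odd n
  it is a multiple of n, and for even n one uses q^(n/2) = -1, which follows from
  primitivity.\<close>

lemma root_of_unity_product:
  fixes q :: complex
  assumes q: "q ^ n = 1" "\<And>m. 0 < m \<Longrightarrow> m < n \<Longrightarrow> q ^ m \<noteq> 1" and n: "2 \<le> n"
  shows "(- 1) ^ n * (\<Prod>i<n. q ^ i) = - 1"
proof -
  have p: "(\<Prod>i<m. q ^ i) = q ^ (m * (m - 1) div 2)" for m
  proof (induction m)
    case (Suc m)
    have "m * (m - 1) div 2 + m = Suc m * (Suc m - 1) div 2" by (cases m) auto
    then show ?case using Suc by (simp add: power_add[symmetric])
  qed simp
  show ?thesis
  proof (cases "even n")
    case False
    then obtain k where k: "n = Suc (2 * k)" by (elim oddE) simp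
    have "n * (n - 1) div 2 = n * k" using k by simp
    then show ?thesis using p[of n] q(1) False by (simp add: power_mult)
  next
    case True
    then obtain k where k: "n = 2 * k" by (elim evenE)
    have "q ^ k \<noteq> 1" using q(2)[of k] k n by simp
    moreover have "q ^ k * q ^ k = 1" using q(1) k by (simp add: power_add[symmetric] mult_2)
    ultimately have m: "q ^ k = - 1" by (metis square_eq_1_iff)
    have "n * (n - 1) div 2 = k * (n - 1)" using k by simp
    then have "(\<Prod>i<n. q ^ i) = (- 1) ^ (n - 1)" using p[of n] m by (simp add: power_mult)
    moreover have "odd (n - 1)" using True n by simp
    ultimately show ?thesis using True by simp
  qed
qed

text \<open>The permutation matrix of the flip; needed because duality reverses the order of tensor
  factors.\<close>

definition swap_mat :: "nat \<Rightarrow> nat \<Rightarrow> complex mat" where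
  "swap_mat a b = mat (b * a) (a * b) (\<lambda>(i, j). if i div a = j mod b \<and> i mod a = j div b then 1 else 0)"

lemma swap_index_bound: "i < b * a \<Longrightarrow> (i mod a) * b + i div a < a * b" for i :: nat
proof -
  assume i: "i < b * a"
  have "(i mod a) * b + i div a < (i mod a) * b + b" using div_mod_bounds[OF i] by simp
  also have "\<dots> = Suc (i mod a) * b" by simp
  also have "\<dots> \<le> a * b" using div_mod_bounds[OF i] by (intro mult_le_mono1) simp
  finally show ?thesis .
qed

lemma swap_index_iff:
  fixes i k :: nat
  assumes "i < b * a"
  shows "i div a = k mod b \<and> i mod a = k div b \<longleftrightarrow> k = (i mod a) * b + i div a"
proof
  assume a: "i div a = k mod b \<and> i mod a = k div b"
  show "k = (i mod a) * b + i div a" using a div_mult_mod_eq[of k b] by simp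
next
  assume k: "k = (i mod a) * b + i div a"
  show "i div a = k mod b \<and> i mod a = k div b"
    using div_mod_bounds[OF assms] unfolding k by simp
qed

lemma swap_mat_mult:
  assumes X: "X \<in> carrier_mat (a * b) c" and i: "i < b * a" "j < c"
  shows "(swap_mat a b * X) $$ (i, j) = X $$ ((i mod a) * b + i div a, j)"
proof -
  have "(swap_mat a b * X) $$ (i, j) = (\<Sum>k<a * b. if k = (i mod a) * b + i div a then X $$ (k, j) else 0)"
    using X i by (subst index_mult_sum) (auto simp: swap_mat_def swap_index_iff[OF i(1)] if_distrib[of "\<lambda>x. x * _"] cong: if_cong)
  then show ?thesis using swap_index_bound[OF i(1)] by simp
qed

lemma transpose_swap_mat: "transpose_mat (swap_mat a b) = swap_mat b a"
  by (rule eq_matI) (auto simp: swap_mat_def)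

lemma mult_swap_mat:
  assumes X: "X \<in> carrier_mat c (b * a)" and j: "i < c" "j < a * b"
  shows "(X * swap_mat a b) $$ (i, j) = X $$ (i, (j mod b) * a + j div b)"
proof -
  have "X * swap_mat a b = transpose_mat (swap_mat b a * transpose_mat X)"
    using X by (subst transpose_mat_mult) (auto simp: transpose_swap_mat, simp add: swap_mat_def)
  then show ?thesis using swap_mat_mult[of "transpose_mat X" b a c j i] X j swap_index_bound[OF j(2)]
    by (simp add: swap_mat_def)
qed

lemma swap_mat_dim [simp]: "dim_row (swap_mat a b) = b * a" "dim_col (swap_mat a b) = a * b"
  by (auto simp: swap_mat_def)

lemma swap_kronecker:
  assumes A: "A \<in> carrier_mat a a" and B: "B \<in> carrier_mat b b"
  shows "swap_mat a b * kronecker A B = kronecker B A * swap_mat a b"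
proof (rule eq_matI)
  fix i j assume "i < dim_row (kronecker B A * swap_mat a b)" "j < dim_col (kronecker B A * swap_mat a b)"
  then have ij: "i < b * a" "j < a * b" using A B by auto
  have K: "kronecker A B \<in> carrier_mat (a * b) (a * b)" "kronecker B A \<in> carrier_mat (b * a) (b * a)" using A B by auto
  note b1 = div_mod_bounds[OF ij(1)] and b2 = div_mod_bounds[OF ij(2)]
  have e: "((i mod a) * b + i div a) div b = i mod a" "((i mod a) * b + i div a) mod b = i div a"
    "((j mod b) * a + j div b) div a = j mod b" "((j mod b) * a + j div b) mod a = j div b"
    using b1 b2 by simp_all
  show "(swap_mat a b * kronecker A B) $$ (i, j) = (kronecker B A * swap_mat a b) $$ (i, j)"
    unfolding swap_mat_mult[OF K(1) ij] mult_swap_mat[OF K(2) ij]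
    using A B ij swap_index_bound[OF ij(1)] swap_index_bound[OF ij(2)]
    by (simp add: kronecker_index e mod_less[OF b1(1)] mod_less[OF b2(1)])
qed (use A B in auto)

lemma swap_swap: "swap_mat b a * swap_mat a b = 1\<^sub>m (a * b)"
proof (rule eq_matI)
  fix i j assume "i < dim_row (1\<^sub>m (a * b) :: complex mat)" "j < dim_col (1\<^sub>m (a * b) :: complex mat)"
  then have ij: "i < a * b" "j < a * b" by auto
  have c: "swap_mat a b \<in> carrier_mat (b * a) (a * b)" by (simp add: swap_mat_def)
  note b1 = div_mod_bounds[OF ij(1)]
  have e: "((i mod b) * a + i div b) div a = i mod b" "((i mod b) * a + i div b) mod a = i div b"
    using b1 by simp_all
  have "i mod b = j mod b \<and> i div b = j div b \<longleftrightarrow> i = j" by (metis div_mult_mod_eq)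
  then show "(swap_mat b a * swap_mat a b) $$ (i, j) = 1\<^sub>m (a * b) $$ (i, j)"
    unfolding swap_mat_mult[OF c ij] using swap_index_bound[OF ij(1)] ij
    by (auto simp add: swap_mat_def e mod_less[OF b1(1)] mod_less[OF div_mod_bounds(1)[OF ij(2)]])
qed auto

context nonnilpotent_group_datum
begin

subsection \<open>Tensor products\<close>

lemma tensor_dim [simp]: "mdim (tensor M N) = mdim M * mdim N"
  by (simp add: tensor_def)

lemma tensor_hom:
  assumes M: "is_module M" "is_module M'" "is_module N" "is_module N'"
    and F: "F \<in> homs M M'" and K: "K \<in> homs N N'"
  shows "kronecker F K \<in> homs (tensor M N) (tensor M' N')"
proof -
  note F' = F[unfolded homs_iff[OF M(1,2)]] and K' = K[unfolded homs_iff[OF M(3,4)]]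
  have d: "dim_row F = mdim M'" "dim_col F = mdim M" "dim_row K = mdim N'" "dim_col K = mdim N"
    using F' K' by auto
  have e: "F * yy M = yy M' * F" "K * yy N = yy N' * K" "K * gr N g = gr N' g * K" using F' K' g_closed by auto
  have "kronecker F K * yy (tensor M N) = yy (tensor M' N') * kronecker F K"
    using M d g_closed by (simp add: tensor_module mat_distrib_left mat_distrib_right kronecker_mult e)
  moreover have "kronecker F K * gr (tensor M N) h = gr (tensor M' N') h * kronecker F K" if "h \<in> carrier G" for h
    using M d that F' K' by (simp add: tensor_module kronecker_mult)
  ultimately show ?thesis using F' K' M by (simp add: homs_iff tensor_module(1))
qed

text \<open>Lexicographically ordered bases make Kronecker products strictly associative, so no
  associator occurs. For y both sides expand into the same three summands, the iterated
  coproduct.\<close>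

lemma tensor_assoc:
  assumes M: "is_module L" "is_module M" "is_module N"
  shows "yy (tensor (tensor L M) N) = yy (tensor L (tensor M N))"
    and "h \<in> carrier G \<Longrightarrow> gr (tensor (tensor L M) N) h = gr (tensor L (tensor M N)) h"
proof -
  show "gr (tensor (tensor L M) N) h = gr (tensor L (tensor M N)) h" if "h \<in> carrier G"
    using that M by (simp add: tensor_module kronecker_assoc)
  let ?a = "kronecker (yy L) (kronecker (gr M g) (gr N g))"
    and ?b = "kronecker (1\<^sub>m (mdim L)) (kronecker (yy M) (gr N g))"
    and ?c = "kronecker (1\<^sub>m (mdim L)) (kronecker (1\<^sub>m (mdim M)) (yy N))"
  have "yy (tensor (tensor L M) N) = ?a + ?b + ?c"
    using M g_closed by (simp add: tensor_module kronecker_add_left kronecker_assoc flip: kronecker_one)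
  also have "\<dots> = ?a + (?b + ?c)"
    by (rule assoc_add_mat[of _ "mdim L * (mdim M * mdim N)" "mdim L * (mdim M * mdim N)"])
      (use M g_closed in \<open>auto intro!: kronecker_carrier\<close>)
  also have "\<dots> = yy (tensor L (tensor M N))"
    using M g_closed by (simp add: tensor_module kronecker_add_right)
  finally show "yy (tensor (tensor L M) N) = yy (tensor L (tensor M N))" .
qed

lemma tensor_unit:
  assumes M: "is_module M"
  shows "yy (tensor trivial_mod M) = yy M" "yy (tensor M trivial_mod) = yy M"
    and "h \<in> carrier G \<Longrightarrow> gr (tensor trivial_mod M) h = gr M h"
    and "h \<in> carrier G \<Longrightarrow> gr (tensor M trivial_mod) h = gr M h"
proof -
  note t = trivial_module
  show "gr (tensor trivial_mod M) h = gr M h" "gr (tensor M trivial_mod) h = gr M h" if "h \<in> carrier G"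
    using that M t by (simp_all add: tensor_module)
  show "yy (tensor trivial_mod M) = yy M" "yy (tensor M trivial_mod) = yy M"
    using M t g_closed yy_carrier[OF M] gr_carrier[OF M g_closed] by (simp_all add: tensor_module)
qed

subsection \<open>Duals\<close>

lemma chi_inv: "h \<in> carrier G \<Longrightarrow> \<chi> h * \<chi> (inv h) = 1"
  using \<chi>_mult[of h "inv h"] \<chi>_one by simp

text \<open>The transposes of the antipodes of the generators: h acts through its inverse, and y
  through - y g^(-1).\<close>

definition dual :: "'g hopf_mod \<Rightarrow> 'g hopf_mod" where
  "dual M = mk_mod (mdim M) (\<lambda>h. transpose_mat (gr M (inv h))) (transpose_mat ((- 1) \<cdot>\<^sub>m (yy M * gr M (inv g))))"

lemma gr_yy: "is_module M \<Longrightarrow> h \<in> carrier G \<Longrightarrow> gr M (inv h) * yy M = \<chi> h \<cdot>\<^sub>m (yy M * gr M (inv h))"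
  using yy_gr[of M "inv h"] chi_inv[of h] by (simp add: smult_smult_mat)

text \<open>Moving y to the left past g^(-i) costs q^i; collecting these costs for i < m gives the
  product.\<close>

lemma antipode_pow:
  assumes M: "is_module M"
  shows "(yy M * gr M (inv g)) ^\<^sub>m m = (\<Prod>i<m. \<chi> g ^ i) \<cdot>\<^sub>m (yy M ^\<^sub>m m * gr M (inv (g [^] m)))"
proof (induction m)
  case 0
  then show ?case using M yy_carrier[OF M] by (simp add: gr_one)
next
  case (Suc m)
  let ?y = "yy M" and ?b = "gr M (inv g)" and ?k = "gr M (inv (g [^] m))" and ?c = "\<Prod>i<m. \<chi> g ^ i"
  have gm: "g [^] m \<in> carrier G" using g_closed by simp
  have chi: "\<chi> (g [^] m) = \<chi> g ^ m"
    using g_closed by (induction m) (auto simp: \<chi>_one \<chi>_mult mult.commute)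
  have ky: "?k * ?y = \<chi> g ^ m \<cdot>\<^sub>m (?y * ?k)" using gr_yy[OF M gm] by (simp add: chi)
  have kb: "?k * ?b = gr M (inv (g [^] Suc m))"
    using gr_mult[OF M, of "inv (g [^] m)" "inv g"] g_closed gm nat_pow_comm[OF g_closed, of m 1]
    by (simp add: inv_mult_group[symmetric])
  have c: "?y \<in> carrier_mat (mdim M) (mdim M)" "?b \<in> carrier_mat (mdim M) (mdim M)" "?k \<in> carrier_mat (mdim M) (mdim M)"
    using M g_closed gm by auto
  have "(?y * ?b) ^\<^sub>m Suc m = ?c \<cdot>\<^sub>m (?y ^\<^sub>m m * (?k * ?y) * ?b)"
    using Suc c by (simp add: mat_assoc mat_smult_left)
  also have "\<dots> = (?c * \<chi> g ^ m) \<cdot>\<^sub>m (?y ^\<^sub>m Suc m * (?k * ?b))"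
    unfolding ky using c by (simp add: mat_assoc mat_smult_left mat_smult_right smult_smult_mat)
  finally show ?case unfolding kb by (simp add: mult.commute)
qed

lemma dual_rep:
  assumes M: "is_module M"
  shows "is_rep (mdim M) (\<lambda>h. transpose_mat (gr M (inv h))) (transpose_mat ((- 1) \<cdot>\<^sub>m (yy M * gr M (inv g))))"
  unfolding is_rep_def
proof (intro conjI ballI)
  show "transpose_mat ((- 1) \<cdot>\<^sub>m (yy M * gr M (inv g))) \<in> carrier_mat (mdim M) (mdim M)"
    using M g_closed by auto
  show "transpose_mat (gr M (inv \<one>)) = 1\<^sub>m (mdim M)" using M by (simp add: gr_one)
  fix h assume h: "h \<in> carrier G"
  show "transpose_mat (gr M (inv h)) \<in> carrier_mat (mdim M) (mdim M)" using M h by auto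
  show "transpose_mat (gr M (inv h)) * transpose_mat (gr M (inv k)) = transpose_mat (gr M (inv (h \<otimes> k)))" if "k \<in> carrier G" for k
    using M h that by (simp add: transpose_mat_mult[symmetric] gr_mult inv_mult_group)
  have comm: "gr M (inv g) * gr M (inv h) = gr M (inv h) * gr M (inv g)"
    using M h g_closed g_central[OF h] by (simp add: gr_mult inv_mult_group[symmetric])
  have c: "yy M \<in> carrier_mat (mdim M) (mdim M)" "gr M (inv g) \<in> carrier_mat (mdim M) (mdim M)" "gr M (inv h) \<in> carrier_mat (mdim M) (mdim M)"
    using M g_closed h by auto
  have "gr M (inv h) * (yy M * gr M (inv g)) = (gr M (inv h) * yy M) * gr M (inv g)" using c by (simp add: mat_assoc)
  also have "\<dots> = \<chi> h \<cdot>\<^sub>m (yy M * (gr M (inv h) * gr M (inv g)))"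
    unfolding gr_yy[OF M h] using c by (simp add: mat_assoc mat_smult_left)
  also have "\<dots> = \<chi> h \<cdot>\<^sub>m (yy M * gr M (inv g) * gr M (inv h))"
    unfolding comm[symmetric] using c by (simp add: mat_assoc)
  finally have e: "gr M (inv h) * (yy M * gr M (inv g)) = \<chi> h \<cdot>\<^sub>m (yy M * gr M (inv g) * gr M (inv h))" .
  show "transpose_mat ((- 1) \<cdot>\<^sub>m (yy M * gr M (inv g))) * transpose_mat (gr M (inv h)) =
      \<chi> h \<cdot>\<^sub>m (transpose_mat (gr M (inv h)) * transpose_mat ((- 1) \<cdot>\<^sub>m (yy M * gr M (inv g))))"
    using arg_cong[OF e, of "\<lambda>X. transpose_mat ((- 1) \<cdot>\<^sub>m X)"] c M g_closed h
    by (simp add: transpose_mat_mult transpose_smult mat_smult_left mat_smult_right smult_smult_mat mult.commute mat_assoc)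
next
  have c: "yy M * gr M (inv g) \<in> carrier_mat (mdim M) (mdim M)" using M g_closed by auto
  have gn: "g [^] n \<in> carrier G" using g_closed by simp
  have "((- 1) \<cdot>\<^sub>m (yy M * gr M (inv g))) ^\<^sub>m n = ((- 1) ^ n * (\<Prod>i<n. \<chi> g ^ i)) \<cdot>\<^sub>m (yy M ^\<^sub>m n * gr M (inv (g [^] n)))"
    using smult_pow_mat[OF c, of "- 1" n] antipode_pow[OF M, of n] by (simp add: smult_smult_mat)
  \<comment> \<open>The constant is -1 by \<open>root_of_unity_product\<close>. What remains is
    -(g^n - 1) g^(-n) = g^(-n) - 1, which is the relation required of the dual.\<close>
  also have "\<dots> = (- 1) \<cdot>\<^sub>m ((gr M (g [^] n) - 1\<^sub>m (mdim M)) * gr M (inv (g [^] n)))"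
    using root_of_unity_product[OF q_pow_n q_pow_less n_ge_2] yy_pow[OF M] by simp
  also have "\<dots> = gr M (inv (g [^] n)) - 1\<^sub>m (mdim M)"
    using M gn gr_mult[OF M gn inv_closed[OF gn]] gr_one[OF M] gr_carrier[OF M inv_closed[OF gn]]
    by (simp add: mat_diff_right) (rule eq_matI; simp)
  finally show "transpose_mat ((- 1) \<cdot>\<^sub>m (yy M * gr M (inv g))) ^\<^sub>m n = transpose_mat (gr M (inv (g [^] n))) - 1\<^sub>m (mdim M)"
    using c M gn transpose_minus[of "gr M (inv (g [^] n))" "mdim M" "mdim M" "1\<^sub>m (mdim M)"]
      transpose_pow_mat[of "(- 1) \<cdot>\<^sub>m (yy M * gr M (inv g))" "mdim M" n] by simp
qed

lemma dual_module:
  assumes M: "is_module M"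
  shows "is_module (dual M)" "mdim (dual M) = mdim M"
    "h \<in> carrier G \<Longrightarrow> gr (dual M) h = transpose_mat (gr M (inv h))"
    "yy (dual M) = transpose_mat ((- 1) \<cdot>\<^sub>m (yy M * gr M (inv g)))"
  unfolding dual_def
  by (rule mk_mod(1)[OF dual_rep[OF M]], rule mk_mod(2)[OF dual_rep[OF M]],
      erule mk_mod(3)[OF dual_rep[OF M]], rule mk_mod(4)[OF dual_rep[OF M]])

lemma gr_inv: "is_module M \<Longrightarrow> h \<in> carrier G \<Longrightarrow> gr M h * gr M (inv h) = 1\<^sub>m (mdim M)"
  "is_module M \<Longrightarrow> h \<in> carrier G \<Longrightarrow> gr M (inv h) * gr M h = 1\<^sub>m (mdim M)"
  by (simp_all add: gr_mult gr_one)

lemma gr_g_central: "is_module M \<Longrightarrow> h \<in> carrier G \<Longrightarrow> gr M g * gr M h = gr M h * gr M g"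
  by (simp add: gr_mult g_closed g_central)

lemma inv_g_central: "h \<in> carrier G \<Longrightarrow> inv g \<otimes> h = h \<otimes> inv g"
  using g_central[of h] g_closed by (metis inv_closed inv_solve_left inv_solve_right m_assoc m_closed)

lemma dual_hom:
  assumes M: "is_module M" "is_module N" and F: "F \<in> homs M N"
  shows "transpose_mat F \<in> homs (dual N) (dual M)"
proof -
  note F' = F[unfolded homs_iff[OF M]]
  have d: "dim_row F = mdim N" "dim_col F = mdim M" using F' by auto
  have "transpose_mat F * gr (dual N) h = gr (dual M) h * transpose_mat F" if "h \<in> carrier G" for h
    using F' that M d by (simp add: dual_module transpose_mat_mult[symmetric])
  moreover have "F * (yy M * gr M (inv g)) = yy N * gr N (inv g) * F"
    by (rule intertwine_mult) (use F' M g_closed in auto)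
  then have "transpose_mat F * yy (dual N) = yy (dual M) * transpose_mat F"
    using M d g_closed by (simp add: dual_module transpose_mat_mult[symmetric] mat_smult_left mat_smult_right)
  ultimately show ?thesis using M F' by (simp add: homs_iff dual_module)
qed

lemma dual_biproduct:
  assumes M: "is_module X" "is_module A" "is_module B" and b: "biproduct X A B iA pA iB pB"
  shows "biproduct (dual X) (dual A) (dual B) (transpose_mat pA) (transpose_mat iA) (transpose_mat pB) (transpose_mat iB)"
proof -
  note c = biproduct_carrier[OF b]
  note e = b[unfolded biproduct_def]
  have "transpose_mat pA * transpose_mat iA + transpose_mat pB * transpose_mat iB = transpose_mat (iA * pA + iB * pB)"
    using c by (subst transpose_add[of _ "mdim X" "mdim X"]) (auto simp: transpose_mat_mult)
  then show ?thesis using e c M by (simp add: biproduct_def dual_hom dual_module transpose_mat_mult[symmetric])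
qed

lemma dual_iso:
  assumes "is_module M" "is_module N" "mod_iso M N"
  shows "mod_iso (dual M) (dual N)"
proof -
  obtain F F' where F: "F \<in> homs M N" "F' \<in> homs N M" "F' * F = 1\<^sub>m (mdim M)" "F * F' = 1\<^sub>m (mdim N)"
    using assms(3) unfolding mod_iso_def by blast
  show ?thesis
    by (rule mod_isoI[OF dual_hom[OF assms(2,1) F(2)] dual_hom[OF assms(1,2) F(1)]])
      (use F homs_dim[OF F(1)] homs_dim[OF F(2)] assms in \<open>simp_all add: dual_module transpose_mat_mult[symmetric]\<close>)
qed

text \<open>On the double dual h acts as before and y acts as g y g^(-1), the square of the
  antipode. So the action of g itself is the isomorphism, and it commutes with G because g is
  central.\<close>

lemma dual_dual:
  assumes M: "is_module M"
  shows "mod_iso M (dual (dual M))"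
proof -
  note D = dual_module(1)[OF M]
  have c: "yy M \<in> carrier_mat (mdim M) (mdim M)" "gr M g \<in> carrier_mat (mdim M) (mdim M)" "gr M (inv g) \<in> carrier_mat (mdim M) (mdim M)"
    using M g_closed by auto
  have y: "yy (dual (dual M)) = gr M g * yy M * gr M (inv g)"
    using c M D g_closed
    by (simp add: dual_module transpose_smult transpose_mat_mult mat_smult_left mat_smult_right smult_smult_mat mat_assoc)
  have gm: "gr (dual (dual M)) h = gr M h" if "h \<in> carrier G" for h
    using that M D by (simp add: dual_module)
  have i: "gr M (inv g) * gr M g = 1\<^sub>m (mdim M)" "gr M g * gr M (inv g) = 1\<^sub>m (mdim M)"
    using gr_inv[OF M g_closed] by auto
  have yg: "yy (dual (dual M)) * gr M g = gr M g * yy M"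
    unfolding y using c i by (simp add: mat_assoc)
  have h1: "gr M g \<in> homs M (dual (dual M))"
    using M D g_closed by (simp add: homs_iff dual_module(1,2) gm gr_g_central yg)
  have gc: "gr M (inv g) * gr M h = gr M h * gr M (inv g)" if h: "h \<in> carrier G" for h
  proof -
    show ?thesis using M h g_closed by (simp add: gr_mult inv_g_central)
  qed
  have yg': "gr M (inv g) * yy (dual (dual M)) = yy M * gr M (inv g)"
  proof -
    have "gr M (inv g) * yy (dual (dual M)) = (gr M (inv g) * gr M g) * (yy M * gr M (inv g))"
      unfolding y using c by (simp add: mat_assoc)
    then show ?thesis unfolding i using c by simp
  qed
  have h2: "gr M (inv g) \<in> homs (dual (dual M)) M"
    using M D g_closed by (simp add: homs_iff dual_module(1,2) gm gc yg')
  show ?thesis by (rule mod_isoI[OF h1 h2]) (use i M D in \<open>auto simp: dual_module\<close>)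
qed

lemma dual_trivial: "mod_iso (dual trivial_mod) trivial_mod"
  by (rule mod_iso_same_gens)
    (use trivial_module g_closed in \<open>auto simp: dual_module\<close>)

text \<open>The antipode reverses the coproduct, so the flip of the tensor factors is an
  isomorphism.\<close>

lemma dual_tensor:
  assumes M: "is_module M" and N: "is_module N"
  shows "mod_iso (dual (tensor M N)) (tensor (dual N) (dual M))"
proof -
  let ?m = "mdim M" and ?n = "mdim N"
  note MN = tensor_module[OF M N]
  note DM = dual_module[OF M] and DN = dual_module[OF N]
  note T = tensor_module[OF DN(1) DM(1)] and D = dual_module[OF MN(1)]
  have cM: "yy M \<in> carrier_mat ?m ?m" "gr M g \<in> carrier_mat ?m ?m" "gr M (inv g) \<in> carrier_mat ?m ?m"
    and cN: "yy N \<in> carrier_mat ?n ?n" "gr N g \<in> carrier_mat ?n ?n" "gr N (inv g) \<in> carrier_mat ?n ?n"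
    using M N g_closed by auto
  have c: "yy (dual M) \<in> carrier_mat ?m ?m" "yy (dual N) \<in> carrier_mat ?n ?n"
     "gr (dual M) g \<in> carrier_mat ?m ?m" using yy_carrier[OF DM(1)] yy_carrier[OF DN(1)] gr_carrier[OF DM(1) g_closed] DM(2) DN(2) by auto
  have gD: "gr (dual (tensor M N)) h = kronecker (gr (dual M) h) (gr (dual N) h)" if "h \<in> carrier G" for h
    using that M N by (simp add: D DM DN MN kronecker_transpose)
  \<comment> \<open>On the dual of a tensor product y acts by y \<otimes> 1 + g \<otimes> y, which
    is the opposite of the coproduct; flipping the factors restores the usual form.\<close>
  have yD: "yy (dual (tensor M N)) = kronecker (yy (dual M)) (1\<^sub>m ?n) + kronecker (gr (dual M) g) (yy (dual N))"
  proof -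
    have "yy (tensor M N) * gr (tensor M N) (inv g) =
        kronecker (yy M * gr M (inv g)) (1\<^sub>m ?n) + kronecker (gr M (inv g)) (yy N * gr N (inv g))"
      using cM cN M N g_closed gr_inv[OF N g_closed]
      by (simp add: MN mat_distrib_right kronecker_mult)
    then show ?thesis
      using cM cN g_closed M N
      by (simp add: D DM DN mat_smult_add transpose_smult kronecker_smult_left kronecker_smult_right kronecker_transpose
          transpose_mat_add)
  qed
  have S: "swap_mat a b \<in> carrier_mat (b * a) (a * b)" for a b by (simp add: swap_mat_def)
  have 1: "swap_mat ?m ?n * gr (dual (tensor M N)) h = gr (tensor (dual N) (dual M)) h * swap_mat ?m ?n"
    if "h \<in> carrier G" for h
    using that gr_carrier[OF DM(1) that] gr_carrier[OF DN(1) that] DM(2) DN(2) by (simp add: gD T swap_kronecker)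
  have 2: "swap_mat ?m ?n * yy (dual (tensor M N)) = yy (tensor (dual N) (dual M)) * swap_mat ?m ?n"
  proof -
    have "swap_mat ?m ?n * yy (dual (tensor M N)) =
      kronecker (1\<^sub>m ?n) (yy (dual M)) * swap_mat ?m ?n + kronecker (yy (dual N)) (gr (dual M) g) * swap_mat ?m ?n"
      unfolding yD using c by (simp add: mat_distrib_left swap_kronecker)
    also have "\<dots> = (kronecker (1\<^sub>m ?n) (yy (dual M)) + kronecker (yy (dual N)) (gr (dual M) g)) * swap_mat ?m ?n"
      using c by (simp add: mat_distrib_right)
    also have "kronecker (1\<^sub>m ?n) (yy (dual M)) + kronecker (yy (dual N)) (gr (dual M) g) = yy (tensor (dual N) (dual M))"
      unfolding T DN(2) by (rule comm_add_mat[of _ "?n * ?m" "?n * ?m"]) (use c in auto)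
    finally show ?thesis .
  qed
  have h1: "swap_mat ?m ?n \<in> homs (dual (tensor M N)) (tensor (dual N) (dual M))"
    using 1 2 S by (simp add: homs_iff D(1) T(1) D(2) DM(2) DN(2))
  have inv: "swap_mat ?n ?m * swap_mat ?m ?n = 1\<^sub>m (?m * ?n)" "swap_mat ?m ?n * swap_mat ?n ?m = 1\<^sub>m (?n * ?m)"
    by (rule swap_swap)+
  have transport: "swap_mat ?n ?m * B = A * swap_mat ?n ?m"
    if "swap_mat ?m ?n * A = B * swap_mat ?m ?n" "A \<in> carrier_mat (?m * ?n) (?m * ?n)" "B \<in> carrier_mat (?n * ?m) (?n * ?m)" for A B
  proof -
    have "swap_mat ?n ?m * B = swap_mat ?n ?m * (B * (swap_mat ?m ?n * swap_mat ?n ?m))" using that inv by simp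
    also have "\<dots> = swap_mat ?n ?m * (swap_mat ?m ?n * A) * swap_mat ?n ?m"
      unfolding that(1) using that by (simp add: mat_assoc)
    also have "\<dots> = (swap_mat ?n ?m * swap_mat ?m ?n) * A * swap_mat ?n ?m" using that(2) by (simp add: mat_assoc)
    finally show ?thesis using that inv by simp
  qed
  have h2: "swap_mat ?n ?m \<in> homs (tensor (dual N) (dual M)) (dual (tensor M N))"
    using transport[OF 1] transport[OF 2] S gr_carrier[OF D(1)] gr_carrier[OF T(1)] yy_carrier[OF D(1)] yy_carrier[OF T(1)]
    by (simp add: homs_iff D(1) T(1) D(2) DM(2) DN(2))
  show ?thesis by (rule mod_isoI[OF h1 h2]) (use inv in \<open>simp_all add: D(2) DM(2) DN(2)\<close>)
qed

end

section \<open>Evaluation and coevaluation\<close>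

context nonnilpotent_group_datum
begin

text \<open>The first two maps are the standard duality pairing and copairing. The other two make
  the dual serve on the opposite side as well; since the double dual agrees with \<open>M\<close>
  only through the action of g, they are twisted by g and its inverse. The composite of the third
  after the second is the quantum dimension tr g.\<close>

lemma ev_coev:
  assumes M: "is_module M"
  shows "bra (1\<^sub>m (mdim M)) \<in> homs (tensor (dual M) M) trivial_mod"
    and "ket (1\<^sub>m (mdim M)) \<in> homs trivial_mod (tensor M (dual M))"
    and "bra (transpose_mat (gr M g)) \<in> homs (tensor M (dual M)) trivial_mod"
    and "ket (transpose_mat (gr M (inv g))) \<in> homs trivial_mod (tensor (dual M) M)"
proof -
  let ?m = "mdim M"
  note D = dual_module[OF M] and t = trivial_module
  note T = tensor_module[OF D(1) M] and T' = tensor_module[OF M D(1)]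
  have c: "yy M \<in> carrier_mat ?m ?m" "gr M g \<in> carrier_mat ?m ?m" "gr M (inv g) \<in> carrier_mat ?m ?m"
    using M g_closed by auto
  have i: "gr M (inv g) * gr M g = 1\<^sub>m ?m" "gr M g * gr M (inv g) = 1\<^sub>m ?m"
    using gr_inv[OF M g_closed] by auto
  have z: "(- 1) \<cdot>\<^sub>m A + A = 0\<^sub>m ?m ?m" "A + (- 1) \<cdot>\<^sub>m A = 0\<^sub>m ?m ?m" if "A \<in> carrier_mat ?m ?m" for A :: "complex mat"
    using that by (auto simp: mat_eq_iff)
  have gih: "gr M (inv h) * gr M g * gr M h = gr M g" "gr M h * gr M (inv g) * gr M (inv h) = gr M (inv g)" if h: "h \<in> carrier G" for h
  proof -
    have "inv h \<otimes> g \<otimes> h = inv h \<otimes> h \<otimes> g"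
      using h g_closed by (simp only: m_assoc g_central inv_closed)
    moreover have "h \<otimes> inv g \<otimes> inv h = inv g \<otimes> (h \<otimes> inv h)"
      using h g_closed by (simp only: inv_g_central[symmetric] m_assoc inv_closed)
    ultimately have "inv h \<otimes> g \<otimes> h = g" "h \<otimes> inv g \<otimes> inv h = inv g"
      using h g_closed by simp_all
    then show "gr M (inv h) * gr M g * gr M h = gr M g" "gr M h * gr M (inv g) * gr M (inv h) = gr M (inv g)"
      using M h g_closed by (simp_all add: gr_mult)
  qed
  show "bra (1\<^sub>m ?m) \<in> homs (tensor (dual M) M) trivial_mod"
  proof -
    have "bra (1\<^sub>m ?m) * gr (tensor (dual M) M) h = bra (1\<^sub>m ?m)" if "h \<in> carrier G" for h
      using that M gr_inv[OF M that] by (simp add: T D bra_kronecker)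
    moreover have "bra (1\<^sub>m ?m) * yy (tensor (dual M) M) = 0\<^sub>m 1 (?m * ?m)"
    proof -
      have "bra (1\<^sub>m ?m) * yy (tensor (dual M) M) = bra ((- 1) \<cdot>\<^sub>m (yy M * gr M (inv g)) * gr M g) + bra (yy M)"
        using M c g_closed by (simp add: T D mat_distrib_left bra_kronecker)
      also have "\<dots> = bra ((- 1) \<cdot>\<^sub>m yy M + yy M)"
        using c i by (simp add: mat_smult_left mat_assoc bra_ket_linear)
      finally show ?thesis using c by (simp add: z bra_ket_linear)
    qed
    ultimately show ?thesis using t M by (simp add: homs_iff T(1,2) D(2) carrier_matI)
  qed
  show "ket (1\<^sub>m ?m) \<in> homs trivial_mod (tensor M (dual M))"
  proof -
    have "gr (tensor M (dual M)) h * ket (1\<^sub>m ?m) = ket (1\<^sub>m ?m)" if "h \<in> carrier G" for h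
      using that M gr_inv[OF M that] by (simp add: T' D ket_kronecker)
    moreover have "yy (tensor M (dual M)) * ket (1\<^sub>m ?m) = 0\<^sub>m (?m * ?m) 1"
    proof -
      have "yy (tensor M (dual M)) * ket (1\<^sub>m ?m) = ket (yy M * gr M (inv g)) + ket ((- 1) \<cdot>\<^sub>m (yy M * gr M (inv g)))"
        using M c g_closed by (simp add: T' D mat_distrib_right ket_kronecker)
      also have "\<dots> = ket (yy M * gr M (inv g) + (- 1) \<cdot>\<^sub>m (yy M * gr M (inv g)))"
        using c by (simp add: bra_ket_linear)
      finally show ?thesis using c by (simp add: z bra_ket_linear)
    qed
    ultimately show ?thesis using t M by (simp add: homs_iff T'(1,2) D(2) carrier_matI)
  qed
  show "bra (transpose_mat (gr M g)) \<in> homs (tensor M (dual M)) trivial_mod"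
  proof -
    have "bra (transpose_mat (gr M g)) * gr (tensor M (dual M)) h = bra (transpose_mat (gr M g))" if h: "h \<in> carrier G" for h
    proof -
      have "bra (transpose_mat (gr M g)) * gr (tensor M (dual M)) h =
        bra (transpose_mat (gr M h) * transpose_mat (gr M g) * transpose_mat (gr M (inv h)))"
        using h M c by (simp add: T' D bra_kronecker)
      also have "transpose_mat (gr M h) * transpose_mat (gr M g) * transpose_mat (gr M (inv h)) =
          transpose_mat (gr M (inv h) * gr M g * gr M h)"
        using h M c by (simp add: transpose_mat_mult mat_assoc)
      finally show ?thesis unfolding gih[OF h] .
    qed
    moreover have "bra (transpose_mat (gr M g)) * yy (tensor M (dual M)) = 0\<^sub>m 1 (?m * ?m)"
    proof -
      have "bra (transpose_mat (gr M g)) * yy (tensor M (dual M)) =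
          bra (transpose_mat (yy M) * transpose_mat (gr M g) * transpose_mat (gr M (inv g))) +
          bra (transpose_mat (gr M g) * transpose_mat ((- 1) \<cdot>\<^sub>m (yy M * gr M (inv g))))"
        using M c g_closed by (simp add: T' D mat_distrib_left bra_kronecker)
      also have "transpose_mat (yy M) * transpose_mat (gr M g) * transpose_mat (gr M (inv g)) =
          transpose_mat ((gr M (inv g) * gr M g) * yy M)"
        using c by (simp add: transpose_mat_mult mat_assoc)
      also have "\<dots> = transpose_mat (yy M)" unfolding i using c by simp
      also have "transpose_mat (gr M g) * transpose_mat ((- 1) \<cdot>\<^sub>m (yy M * gr M (inv g))) =
          transpose_mat (((- 1) \<cdot>\<^sub>m (yy M * gr M (inv g))) * gr M g)"
        using c by (simp add: transpose_mat_mult)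
      also have "((- 1) \<cdot>\<^sub>m (yy M * gr M (inv g))) * gr M g = (- 1) \<cdot>\<^sub>m (yy M * (gr M (inv g) * gr M g))"
        using c by (simp add: mat_assoc mat_smult_left)
      also have "\<dots> = (- 1) \<cdot>\<^sub>m yy M" unfolding i using c by simp
      also have "bra (transpose_mat (yy M)) + bra (transpose_mat ((- 1) \<cdot>\<^sub>m yy M)) = bra (transpose_mat (yy M) + (- 1) \<cdot>\<^sub>m transpose_mat (yy M))"
        using c by (simp add: bra_ket_linear transpose_smult)
      finally show ?thesis using c z(2)[of "transpose_mat (yy M)"] by (simp add: bra_ket_linear)
    qed
    moreover have "bra (transpose_mat (gr M g)) \<in> carrier_mat 1 (?m * ?m)"
      using c by (intro carrier_matI) auto
    ultimately show ?thesis unfolding homs_iff[OF T'(1) t(1)] T'(2) D(2) t(2)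
      by (intro conjI ballI) (simp_all only: t(3,4) left_mult_one_mat left_mult_zero_mat)
  qed
  show "ket (transpose_mat (gr M (inv g))) \<in> homs trivial_mod (tensor (dual M) M)"
  proof -
    have "gr (tensor (dual M) M) h * ket (transpose_mat (gr M (inv g))) = ket (transpose_mat (gr M (inv g)))" if h: "h \<in> carrier G" for h
    proof -
      have "gr (tensor (dual M) M) h * ket (transpose_mat (gr M (inv g))) =
        ket (transpose_mat (gr M (inv h)) * transpose_mat (gr M (inv g)) * transpose_mat (gr M h))"
        using h M c by (simp add: T D ket_kronecker)
      also have "transpose_mat (gr M (inv h)) * transpose_mat (gr M (inv g)) * transpose_mat (gr M h) =
          transpose_mat (gr M h * gr M (inv g) * gr M (inv h))"
        using h M c by (simp add: transpose_mat_mult mat_assoc)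
      finally show ?thesis unfolding gih[OF h] .
    qed
    moreover have "yy (tensor (dual M) M) * ket (transpose_mat (gr M (inv g))) = 0\<^sub>m (?m * ?m) 1"
    proof -
      have "yy (tensor (dual M) M) * ket (transpose_mat (gr M (inv g))) =
          ket (transpose_mat ((- 1) \<cdot>\<^sub>m (yy M * gr M (inv g))) * transpose_mat (gr M (inv g)) * transpose_mat (gr M g)) +
          ket (transpose_mat (gr M (inv g)) * transpose_mat (yy M))"
        using M c g_closed by (simp add: T D mat_distrib_right ket_kronecker)
      also have "transpose_mat ((- 1) \<cdot>\<^sub>m (yy M * gr M (inv g))) * transpose_mat (gr M (inv g)) * transpose_mat (gr M g) =
          transpose_mat ((gr M g * gr M (inv g)) * ((- 1) \<cdot>\<^sub>m (yy M * gr M (inv g))))"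
        using c by (simp add: transpose_mat_mult mat_assoc)
      also have "\<dots> = (- 1) \<cdot>\<^sub>m transpose_mat (yy M * gr M (inv g))" unfolding i using c by (simp add: transpose_smult)
      also have "transpose_mat (gr M (inv g)) * transpose_mat (yy M) = transpose_mat (yy M * gr M (inv g))"
        using c by (simp add: transpose_mat_mult)
      also have "ket ((- 1) \<cdot>\<^sub>m transpose_mat (yy M * gr M (inv g))) + ket (transpose_mat (yy M * gr M (inv g))) =
          ket ((- 1) \<cdot>\<^sub>m transpose_mat (yy M * gr M (inv g)) + transpose_mat (yy M * gr M (inv g)))"
        using c by (simp add: bra_ket_linear)
      finally show ?thesis using c z(1)[of "transpose_mat (yy M * gr M (inv g))"] by (simp add: bra_ket_linear)
    qed
    moreover have "ket (transpose_mat (gr M (inv g))) \<in> carrier_mat (?m * ?m) 1"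
      using c by (intro carrier_matI) auto
    ultimately show ?thesis unfolding homs_iff[OF t(1) T(1)] T(2) D(2) t(2)
      by (intro conjI ballI) (simp_all only: t(3,4) right_mult_one_mat right_mult_zero_mat)
  qed
qed

subsection \<open>Projective modules\<close>

lemma projective_module: "projective P \<Longrightarrow> is_module P"
  by (simp add: projective_def)

lemma projective_lift:
  assumes "projective P" "is_module A" "is_module B" "E \<in> homs A B" "F \<in> homs P B" "surjective E"
  obtains L where "L \<in> homs P A" "E * L = F"
  using assms unfolding projective_def by blast

lemma projectiveI:
  assumes "is_module P" "\<And>A B E F. is_module A \<Longrightarrow> is_module B \<Longrightarrow> E \<in> homs A B \<Longrightarrow> F \<in> homs P B \<Longrightarrow> surjective E \<Longrightarrow>
    \<exists>L\<in>homs P A. E * L = F"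
  shows "projective P"
  using assms unfolding projective_def by blast

lemma projective_summand:
  assumes P: "projective P" and M: "is_module M" and A: "A \<in> homs M P" and B: "B \<in> homs P M" and BA: "B * A = 1\<^sub>m (mdim M)"
  shows "projective M"
proof (rule projectiveI[OF M])
  note Pm = projective_module[OF P]
  fix X Z E F assume h: "is_module X" "is_module Z" "E \<in> homs X Z" "F \<in> homs M Z" "surjective E"
  obtain L where L: "L \<in> homs P X" "E * L = F * B"
    using projective_lift[OF P h(1-3) homs_comp[OF Pm M h(2) B h(4)] h(5)] .
  have "E * (L * A) = E * L * A"
    using homs_carrier[OF h(3)] homs_carrier[OF L(1)] homs_carrier[OF A] by (simp add: mat_assoc)
  also have "\<dots> = F * (B * A)" unfolding L(2)
    using homs_carrier[OF h(4)] homs_carrier[OF B] homs_carrier[OF A] by (simp add: mat_assoc)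
  also have "\<dots> = F" unfolding BA using homs_carrier[OF h(4)] by simp
  finally show "\<exists>L\<in>homs M X. E * L = F" using homs_comp[OF M Pm h(1) A L(1)] by blast
qed

lemma projective_iso: "projective P \<Longrightarrow> is_module M \<Longrightarrow> mod_iso P M \<Longrightarrow> projective M"
  unfolding mod_iso_def using projective_summand by blast

lemma projective_biproduct:
  assumes X: "is_module X" and A: "projective A" and B: "projective B" and b: "biproduct X A B iA pA iB pB"
  shows "projective X"
proof (rule projectiveI[OF X])
  note Am = projective_module[OF A] and Bm = projective_module[OF B]
  note e = b[unfolded biproduct_def] and c = biproduct_carrier[OF b]
  fix Z W E F assume h: "is_module Z" "is_module W" "E \<in> homs Z W" "F \<in> homs X W" "surjective E"
  have iA: "iA \<in> homs A X" and iB: "iB \<in> homs B X" and pA: "pA \<in> homs X A" and pB: "pB \<in> homs X B" using e by auto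
  obtain L where L: "L \<in> homs A Z" "E * L = F * iA"
    using projective_lift[OF A h(1-3) homs_comp[OF Am X h(2) iA h(4)] h(5)] .
  obtain K where K: "K \<in> homs B Z" "E * K = F * iB"
    using projective_lift[OF B h(1-3) homs_comp[OF Bm X h(2) iB h(4)] h(5)] .
  note cc = c homs_carrier[OF h(3)] homs_carrier[OF h(4)] homs_carrier[OF L(1)] homs_carrier[OF K(1)]
  have "E * (L * pA + K * pB) = (E * L) * pA + (E * K) * pB"
    using cc by (simp add: mat_distrib_left mat_assoc)
  also have "\<dots> = F * (iA * pA + iB * pB)" unfolding L(2) K(2)
    using cc by (simp add: mat_distrib_left mat_assoc)
  also have "\<dots> = F" using e cc by simp
  finally show "\<exists>L\<in>homs X Z. E * L = F"
    using homs_add[OF X h(1) homs_comp[OF X Am h(1) pA L(1)] homs_comp[OF X Bm h(1) pB K(1)]] by blast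
qed

lemma projective_direct_sum: "projective A \<Longrightarrow> projective B \<Longrightarrow> projective (direct_sum A B)"
  by (metis direct_sum_biproduct projective_biproduct projective_module direct_sum_module(1))

definition zero_mod :: "'g hopf_mod" where
  "zero_mod = mk_mod 0 (\<lambda>_. 1\<^sub>m 0) (0\<^sub>m 0 0)"

lemma zero_mod: "is_module zero_mod" "mdim zero_mod = 0"
proof -
  have "is_rep 0 (\<lambda>_. 1\<^sub>m 0) (0\<^sub>m 0 0)" unfolding is_rep_def by (auto intro!: eq_matI)
  then show "is_module zero_mod" "mdim zero_mod = 0" unfolding zero_mod_def by (rule mk_mod)+
qed

lemma dim_0_projective: "is_module M \<Longrightarrow> mdim M = 0 \<Longrightarrow> projective M"
proof (rule projectiveI)
  fix A B E F assume M: "is_module M" "mdim M = 0" and h: "is_module A" "is_module B" "E \<in> homs A B" "F \<in> homs M B"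
  have "E * 0\<^sub>m (mdim A) (mdim M) = F"
    using homs_carrier[OF h(3)] homs_carrier[OF h(4)] M by (auto intro!: eq_matI)
  then show "\<exists>L\<in>homs M A. E * L = F" using homs_zero[OF M(1) h(1)] by blast
qed

lemma surjective_kronecker:
  assumes "E \<in> carrier_mat b a" "surjective E"
  shows "surjective (kronecker E (1\<^sub>m d))" "surjective (kronecker (1\<^sub>m d) E)"
proof -
  obtain R where R: "R \<in> carrier_mat a b" "E * R = 1\<^sub>m b" using assms surjective_iff by blast
  have "kronecker E (1\<^sub>m d) * kronecker R (1\<^sub>m d) = 1\<^sub>m (b * d)" "kronecker (1\<^sub>m d) E * kronecker (1\<^sub>m d) R = 1\<^sub>m (d * b)"
    using assms(1) R by (simp_all add: kronecker_mult)
  then show "surjective (kronecker E (1\<^sub>m d))" "surjective (kronecker (1\<^sub>m d) E)"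
    using surjective_iff[of "kronecker E (1\<^sub>m d)" "b * d" "a * d"] surjective_iff[of "kronecker (1\<^sub>m d) E" "d * b" "d * a"]
      assms(1) R(1) kronecker_carrier[of R a b "1\<^sub>m d" d d] kronecker_carrier[of "1\<^sub>m d" d d R a b]
      kronecker_carrier[of E b a "1\<^sub>m d" d d] kronecker_carrier[of "1\<^sub>m d" d d E b a] by auto
qed

text \<open>Lifting problems for \<open>P \<otimes> N\<close> are turned into lifting problems for \<open>P\<close> by the
  duality between \<open>N\<close> and its dual.\<close>

lemma projective_tensor_right:
  assumes P: "projective P" and N: "is_module N"
  shows "projective (tensor P N)"
proof (rule projectiveI)
  note Pm = projective_module[OF P]
  show PN: "is_module (tensor P N)" by (rule tensor_module[OF Pm N])
  note D = dual_module[OF N] and t = trivial_module(1)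
  define n p where "n = mdim N" "p = mdim P"
  fix A B E F assume h: "is_module A" "is_module B" "E \<in> homs A B" "F \<in> homs (tensor P N) B" "surjective E"
  define a b where "a = mdim A" "b = mdim B"
  let ?ev = "bra (1\<^sub>m n)" and ?co = "ket (1\<^sub>m n)"
  have F: "F \<in> carrier_mat b (p * n)" and E: "E \<in> carrier_mat b a"
    using homs_carrier[OF h(4)] homs_carrier[OF h(3)] by (auto simp: n_p_def a_b_def)
  note m = tensor_module(1)[OF Pm N] tensor_module(1)[OF N D(1)] tensor_module(1)[OF D(1) N]
    tensor_module(1)[OF h(1) D(1)] tensor_module(1)[OF h(2) D(1)] tensor_module(1)[OF Pm t] tensor_module(1)[OF h(1) t]
  have F1: "kronecker F (1\<^sub>m n) \<in> homs (tensor (tensor P N) (dual N)) (tensor B (dual N))"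
    using tensor_hom[OF m(1) h(2) D(1) D(1) h(4) homs_one[OF D(1)]] by (simp add: n_p_def D)
  have c1: "kronecker (1\<^sub>m p) ?co \<in> homs (tensor P trivial_mod) (tensor P (tensor N (dual N)))"
    using tensor_hom[OF Pm Pm t m(2) homs_one[OF Pm] ev_coev(2)[OF N]] by (simp add: n_p_def)
  have eq1: "homs (tensor P trivial_mod) (tensor P (tensor N (dual N))) = homs P (tensor (tensor P N) (dual N))"
    by (rule homs_congruent)
      (use Pm N D t m in \<open>auto simp: tensor_module(1) tensor_unit tensor_assoc trivial_module(2) mult.assoc\<close>)
  have FF: "kronecker F (1\<^sub>m n) * kronecker (1\<^sub>m p) ?co \<in> homs P (tensor B (dual N))"
    by (rule homs_comp[OF Pm _ m(5) c1[unfolded eq1] F1]) (rule tensor_module(1)[OF m(1) D(1)])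
  have E1: "kronecker E (1\<^sub>m n) \<in> homs (tensor A (dual N)) (tensor B (dual N))"
    using tensor_hom[OF h(1,2) D(1) D(1) h(3) homs_one[OF D(1)]] by (simp add: n_p_def D)
  obtain L where L: "L \<in> homs P (tensor A (dual N))" "kronecker E (1\<^sub>m n) * L = kronecker F (1\<^sub>m n) * kronecker (1\<^sub>m p) ?co"
    using projective_lift[OF P m(4) m(5) E1 FF surjective_kronecker(1)[OF E h(5)]] .
  have Lc: "L \<in> carrier_mat (a * n) p" using homs_carrier[OF L(1)] by (simp add: a_b_def n_p_def D)
  have L1: "kronecker L (1\<^sub>m n) \<in> homs (tensor P N) (tensor (tensor A (dual N)) N)"
    using tensor_hom[OF Pm m(4) N N L(1) homs_one[OF N]] by (simp add: n_p_def)
  have e1: "kronecker (1\<^sub>m a) ?ev \<in> homs (tensor A (tensor (dual N) N)) (tensor A trivial_mod)"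
    using tensor_hom[OF h(1) h(1) m(3) t homs_one[OF h(1)] ev_coev(1)[OF N]] by (simp add: n_p_def a_b_def)
  have eq2: "homs (tensor A (tensor (dual N) N)) (tensor A trivial_mod) = homs (tensor (tensor A (dual N)) N) A"
    by (rule homs_congruent)
      (use h N D t m in \<open>auto simp: tensor_module(1) tensor_unit tensor_assoc trivial_module(2) mult.assoc\<close>)
  have res: "kronecker (1\<^sub>m a) ?ev * kronecker L (1\<^sub>m n) \<in> homs (tensor P N) A"
    by (rule homs_comp[OF m(1) _ h(1) L1 e1[unfolded eq2]]) (rule tensor_module(1)[OF m(4) N])
  \<comment> \<open>The interchange law moves \<open>E\<close> to \<open>L\<close> and then
    \<open>F\<close> to the left end. What remains to its right is evaluation after coevaluation on
    the factor \<open>N\<close>, which \<open>zigzag\<close> contracts to the identity.\<close>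
  have "E * (kronecker (1\<^sub>m a) ?ev * kronecker L (1\<^sub>m n)) = kronecker E ?ev * kronecker L (1\<^sub>m n)"
  proof -
    have "E * kronecker (1\<^sub>m a) ?ev = kronecker E (1\<^sub>m 1) * kronecker (1\<^sub>m a) ?ev" by simp
    also have "\<dots> = kronecker E ?ev" using E by (subst kronecker_mult) auto
    finally have e: "E * kronecker (1\<^sub>m a) ?ev = kronecker E ?ev" .
    have "E * (kronecker (1\<^sub>m a) ?ev * kronecker L (1\<^sub>m n)) = E * kronecker (1\<^sub>m a) ?ev * kronecker L (1\<^sub>m n)"
      using E Lc by (intro mat_assoc[symmetric]) auto
    then show ?thesis unfolding e .
  qed
  also have "kronecker E ?ev = kronecker (1\<^sub>m b) ?ev * kronecker (kronecker E (1\<^sub>m n)) (1\<^sub>m n)"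
    unfolding kronecker_assoc kronecker_one using E by (subst kronecker_mult) auto
  also have "\<dots> * kronecker L (1\<^sub>m n) = kronecker (1\<^sub>m b) ?ev * (kronecker (kronecker E (1\<^sub>m n)) (1\<^sub>m n) * kronecker L (1\<^sub>m n))"
    using E Lc by (intro mat_assoc) auto
  also have "kronecker (kronecker E (1\<^sub>m n)) (1\<^sub>m n) * kronecker L (1\<^sub>m n) = kronecker (kronecker E (1\<^sub>m n) * L) (1\<^sub>m n)"
    using E Lc by (subst kronecker_mult) auto
  also have "\<dots> = kronecker (kronecker F (1\<^sub>m n)) (1\<^sub>m n) * kronecker (kronecker (1\<^sub>m p) ?co) (1\<^sub>m n)"
    unfolding L(2) using F by (subst kronecker_mult) auto
  also have "\<dots> = kronecker F (1\<^sub>m (n * n)) * kronecker (1\<^sub>m p) (kronecker ?co (1\<^sub>m n))"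
    unfolding kronecker_assoc kronecker_one ..
  also have "kronecker (1\<^sub>m b) ?ev * (kronecker F (1\<^sub>m (n * n)) * kronecker (1\<^sub>m p) (kronecker ?co (1\<^sub>m n))) =
      (kronecker (1\<^sub>m b) ?ev * kronecker F (1\<^sub>m (n * n))) * kronecker (1\<^sub>m p) (kronecker ?co (1\<^sub>m n))"
    using F by (intro mat_assoc[symmetric]) auto
  also have "kronecker (1\<^sub>m b) ?ev * kronecker F (1\<^sub>m (n * n)) = kronecker F (1\<^sub>m 1) * kronecker (1\<^sub>m (p * n)) ?ev"
    using F by (subst (1 2) kronecker_mult) auto
  also have "\<dots> * kronecker (1\<^sub>m p) (kronecker ?co (1\<^sub>m n)) =
      F * (kronecker (1\<^sub>m p) (kronecker (1\<^sub>m n) ?ev) * kronecker (1\<^sub>m p) (kronecker ?co (1\<^sub>m n)))"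
    using F by (subst mat_assoc) (auto simp: kronecker_assoc simp flip: kronecker_one)
  also have "kronecker (1\<^sub>m p) (kronecker (1\<^sub>m n) ?ev) * kronecker (1\<^sub>m p) (kronecker ?co (1\<^sub>m n)) =
      kronecker (1\<^sub>m p) (kronecker (1\<^sub>m n) ?ev * kronecker ?co (1\<^sub>m n))"
    by (subst kronecker_mult) auto
  also have "kronecker (1\<^sub>m n) ?ev * kronecker ?co (1\<^sub>m n) = 1\<^sub>m n"
    by (subst zigzag) auto
  finally have "E * (kronecker (1\<^sub>m a) ?ev * kronecker L (1\<^sub>m n)) = F" using F by simp
  then show "\<exists>L\<in>homs (tensor P N) A. E * L = F" using res by blast
qed

text \<open>The mirror image of \<open>projective_tensor_right\<close>. The dual now stands to the
  left of \<open>N\<close> in the coevaluation and to the right in the evaluation, so the maps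
  twisted by g have to be used; the two twists cancel in \<open>zigzag'\<close>.\<close>

lemma projective_tensor_left:
  assumes P: "projective P" and N: "is_module N"
  shows "projective (tensor N P)"
proof (rule projectiveI)
  note Pm = projective_module[OF P]
  show NP: "is_module (tensor N P)" by (rule tensor_module[OF N Pm])
  note D = dual_module[OF N] and t = trivial_module(1)
  define n p where "n = mdim N" "p = mdim P"
  fix A B E F assume h: "is_module A" "is_module B" "E \<in> homs A B" "F \<in> homs (tensor N P) B" "surjective E"
  define a b where "a = mdim A" "b = mdim B"
  let ?ev = "bra (transpose_mat (gr N g))" and ?co = "ket (transpose_mat (gr N (inv g)))"
  have gc: "gr N g \<in> carrier_mat n n" "gr N (inv g) \<in> carrier_mat n n" using N g_closed by (auto simp: n_p_def)
  have d [simp]: "dim_row (gr N g) = n" "dim_col (gr N g) = n" "dim_row (gr N (inv g)) = n" "dim_col (gr N (inv g)) = n"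
    using gc by auto
  have F: "F \<in> carrier_mat b (n * p)" and E: "E \<in> carrier_mat b a"
    using homs_carrier[OF h(4)] homs_carrier[OF h(3)] by (auto simp: n_p_def a_b_def)
  note m = tensor_module(1)[OF N Pm] tensor_module(1)[OF N D(1)] tensor_module(1)[OF D(1) N]
    tensor_module(1)[OF D(1) h(1)] tensor_module(1)[OF D(1) h(2)] tensor_module(1)[OF t Pm] tensor_module(1)[OF t h(1)]
  have F1: "kronecker (1\<^sub>m n) F \<in> homs (tensor (dual N) (tensor N P)) (tensor (dual N) B)"
    using tensor_hom[OF D(1) D(1) m(1) h(2) homs_one[OF D(1)] h(4)] by (simp add: n_p_def D)
  have c1: "kronecker ?co (1\<^sub>m p) \<in> homs (tensor trivial_mod P) (tensor (tensor (dual N) N) P)"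
    using tensor_hom[OF t m(3) Pm Pm ev_coev(4)[OF N] homs_one[OF Pm]] by (simp add: n_p_def)
  have eq1: "homs (tensor trivial_mod P) (tensor (tensor (dual N) N) P) = homs P (tensor (dual N) (tensor N P))"
    by (rule homs_congruent)
      (use Pm N D t m in \<open>auto simp: tensor_module(1) tensor_unit tensor_assoc trivial_module(2) mult.assoc\<close>)
  have FF: "kronecker (1\<^sub>m n) F * kronecker ?co (1\<^sub>m p) \<in> homs P (tensor (dual N) B)"
    by (rule homs_comp[OF Pm _ m(5) c1[unfolded eq1] F1]) (rule tensor_module(1)[OF D(1) m(1)])
  have E1: "kronecker (1\<^sub>m n) E \<in> homs (tensor (dual N) A) (tensor (dual N) B)"
    using tensor_hom[OF D(1) D(1) h(1,2) homs_one[OF D(1)] h(3)] by (simp add: n_p_def D)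
  obtain L where L: "L \<in> homs P (tensor (dual N) A)" "kronecker (1\<^sub>m n) E * L = kronecker (1\<^sub>m n) F * kronecker ?co (1\<^sub>m p)"
    using projective_lift[OF P m(4) m(5) E1 FF surjective_kronecker(2)[OF E h(5)]] .
  have Lc: "L \<in> carrier_mat (n * a) p" using homs_carrier[OF L(1)] by (simp add: a_b_def n_p_def D)
  have L1: "kronecker (1\<^sub>m n) L \<in> homs (tensor N P) (tensor N (tensor (dual N) A))"
    using tensor_hom[OF N N Pm m(4) homs_one[OF N] L(1)] by (simp add: n_p_def)
  have e1: "kronecker ?ev (1\<^sub>m a) \<in> homs (tensor (tensor N (dual N)) A) (tensor trivial_mod A)"
    using tensor_hom[OF m(2) t h(1) h(1) ev_coev(3)[OF N] homs_one[OF h(1)]] by (simp add: n_p_def a_b_def)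
  have eq2: "homs (tensor (tensor N (dual N)) A) (tensor trivial_mod A) = homs (tensor N (tensor (dual N) A)) A"
    by (rule homs_congruent)
      (use h N D t m in \<open>auto simp: tensor_module(1) tensor_unit tensor_assoc trivial_module(2) mult.assoc\<close>)
  have res: "kronecker ?ev (1\<^sub>m a) * kronecker (1\<^sub>m n) L \<in> homs (tensor N P) A"
    by (rule homs_comp[OF m(1) _ h(1) L1 e1[unfolded eq2]]) (rule tensor_module(1)[OF N m(4)])
  have "E * (kronecker ?ev (1\<^sub>m a) * kronecker (1\<^sub>m n) L) = kronecker ?ev E * kronecker (1\<^sub>m n) L"
  proof -
    have "E * kronecker ?ev (1\<^sub>m a) = kronecker (1\<^sub>m 1) E * kronecker ?ev (1\<^sub>m a)" by simp
    also have "\<dots> = kronecker ?ev E" using E by (subst kronecker_mult) auto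
    finally have e: "E * kronecker ?ev (1\<^sub>m a) = kronecker ?ev E" .
    have "E * (kronecker ?ev (1\<^sub>m a) * kronecker (1\<^sub>m n) L) = E * kronecker ?ev (1\<^sub>m a) * kronecker (1\<^sub>m n) L"
      using E Lc by (intro mat_assoc[symmetric]) auto
    then show ?thesis unfolding e .
  qed
  also have "kronecker ?ev E = kronecker ?ev (1\<^sub>m b) * kronecker (1\<^sub>m n) (kronecker (1\<^sub>m n) E)"
    unfolding kronecker_assoc[symmetric] kronecker_one using E by (subst kronecker_mult) auto
  also have "\<dots> * kronecker (1\<^sub>m n) L = kronecker ?ev (1\<^sub>m b) * (kronecker (1\<^sub>m n) (kronecker (1\<^sub>m n) E) * kronecker (1\<^sub>m n) L)"
    using E Lc by (intro mat_assoc) auto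
  also have "kronecker (1\<^sub>m n) (kronecker (1\<^sub>m n) E) * kronecker (1\<^sub>m n) L = kronecker (1\<^sub>m n) (kronecker (1\<^sub>m n) E * L)"
    using E Lc by (subst kronecker_mult) auto
  also have "\<dots> = kronecker (1\<^sub>m n) (kronecker (1\<^sub>m n) F) * kronecker (1\<^sub>m n) (kronecker ?co (1\<^sub>m p))"
    unfolding L(2) using F by (subst kronecker_mult) auto
  also have "\<dots> = kronecker (1\<^sub>m (n * n)) F * kronecker (kronecker (1\<^sub>m n) ?co) (1\<^sub>m p)"
    unfolding kronecker_assoc[symmetric] kronecker_one ..
  also have "kronecker ?ev (1\<^sub>m b) * (kronecker (1\<^sub>m (n * n)) F * kronecker (kronecker (1\<^sub>m n) ?co) (1\<^sub>m p)) =
      (kronecker ?ev (1\<^sub>m b) * kronecker (1\<^sub>m (n * n)) F) * kronecker (kronecker (1\<^sub>m n) ?co) (1\<^sub>m p)"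
    using F by (intro mat_assoc[symmetric]) auto
  also have "kronecker ?ev (1\<^sub>m b) * kronecker (1\<^sub>m (n * n)) F = kronecker (1\<^sub>m 1) F * kronecker ?ev (1\<^sub>m (n * p))"
    using F by (subst (1 2) kronecker_mult) auto
  also have "\<dots> * kronecker (kronecker (1\<^sub>m n) ?co) (1\<^sub>m p) =
      F * (kronecker (kronecker ?ev (1\<^sub>m n)) (1\<^sub>m p) * kronecker (kronecker (1\<^sub>m n) ?co) (1\<^sub>m p))"
    using F by (subst mat_assoc) (auto simp: kronecker_assoc simp flip: kronecker_one)
  also have "kronecker (kronecker ?ev (1\<^sub>m n)) (1\<^sub>m p) * kronecker (kronecker (1\<^sub>m n) ?co) (1\<^sub>m p) =
      kronecker (kronecker ?ev (1\<^sub>m n) * kronecker (1\<^sub>m n) ?co) (1\<^sub>m p)"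
    by (subst kronecker_mult) auto
  also have "kronecker ?ev (1\<^sub>m n) * kronecker (1\<^sub>m n) ?co = 1\<^sub>m n"
  proof -
    have "kronecker ?ev (1\<^sub>m n) * kronecker (1\<^sub>m n) ?co = transpose_mat (transpose_mat (gr N g) * transpose_mat (gr N (inv g)))"
      by (rule zigzag') auto
    also have "\<dots> = gr N (inv g) * gr N g" using gc by (simp add: transpose_mat_mult)
    finally show ?thesis using gr_inv[OF N g_closed] by (simp add: n_p_def)
  qed
  finally have "E * (kronecker ?ev (1\<^sub>m a) * kronecker (1\<^sub>m n) L) = F" using F by simp
  then show "\<exists>L\<in>homs (tensor N P) A. E * L = F" using res by blast
qed

subsection \<open>Stable isomorphism\<close>

lemma proj_homs_iff: "\<pi> \<in> proj_homs M N \<longleftrightarrow> (\<exists>A B P. projective P \<and> A \<in> homs M P \<and> B \<in> homs P N \<and> \<pi> = B * A)"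
  unfolding proj_homs_def by blast

lemma proj_homs_homs: "is_module M \<Longrightarrow> is_module N \<Longrightarrow> \<pi> \<in> proj_homs M N \<Longrightarrow> \<pi> \<in> homs M N"
  unfolding proj_homs_iff using homs_comp projective_module by blast

lemma proj_homs_comp:
  assumes "is_module L" "is_module M" "is_module N" "is_module K" and \<pi>: "\<pi> \<in> proj_homs M N" and F: "F \<in> homs N K" "F' \<in> homs L M"
  shows "F * \<pi> * F' \<in> proj_homs L K"
proof -
  obtain A B P where P: "projective P" "A \<in> homs M P" "B \<in> homs P N" "\<pi> = B * A" using \<pi> unfolding proj_homs_iff by blast
  note Pm = projective_module[OF P(1)]
  have "F * \<pi> * F' = (F * B) * (A * F')"
    unfolding P(4) using F[THEN homs_carrier] P(2,3)[THEN homs_carrier] by (simp add: mat_assoc)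
  then show ?thesis unfolding proj_homs_iff
    using homs_comp[OF Pm assms(3,4) P(3) F(1)] homs_comp[OF assms(1,2) Pm F(2) P(2)] P(1) by blast
qed

text \<open>Two maps may factor through different projectives; their sum factors through the direct
  sum of these.\<close>

lemma proj_homs_add:
  assumes M: "is_module M" and N: "is_module N" and \<pi>: "\<pi> \<in> proj_homs M N" "\<pi>' \<in> proj_homs M N"
  shows "\<pi> + \<pi>' \<in> proj_homs M N"
proof -
  obtain A B P where P: "projective P" "A \<in> homs M P" "B \<in> homs P N" "\<pi> = B * A" using \<pi>(1) unfolding proj_homs_iff by blast
  obtain A' B' P' where P': "projective P'" "A' \<in> homs M P'" "B' \<in> homs P' N" "\<pi>' = B' * A'" using \<pi>(2) unfolding proj_homs_iff by blast
  note Pm = projective_module[OF P(1)] and Pm' = projective_module[OF P'(1)]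
  let ?Q = "direct_sum P P'"
  have Q: "is_module ?Q" by (rule direct_sum_module(1)[OF Pm Pm'])
  obtain i p i' p' where b: "biproduct ?Q P P' i p i' p'" using direct_sum_biproduct[OF Pm Pm'] .
  note e = b[unfolded biproduct_def] and c = biproduct_carrier[OF b] and o = biproduct_orthogonal[OF b]
  note cc = c P(2,3)[THEN homs_carrier] P'(2,3)[THEN homs_carrier]
  have "(B * p + B' * p') * (i * A + i' * A') = B * (p * i) * A + B' * (p' * i) * A + (B * (p * i') * A' + B' * (p' * i') * A')"
    using cc by (simp add: mat_distrib_left mat_distrib_right mat_assoc)
  also have "\<dots> = B * A + B' * A'" using e o cc by simp
  finally have eq: "\<pi> + \<pi>' = (B * p + B' * p') * (i * A + i' * A')" using P(4) P'(4) by simp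
  have "B * p + B' * p' \<in> homs ?Q N" "i * A + i' * A' \<in> homs M ?Q"
    using homs_add[OF Q N homs_comp[OF Q Pm N _ P(3)] homs_comp[OF Q Pm' N _ P'(3)]]
      homs_add[OF M Q homs_comp[OF M Pm Q P(2)] homs_comp[OF M Pm' Q P'(2)]] e by blast+
  then show ?thesis unfolding eq proj_homs_iff using projective_direct_sum[OF P(1) P'(1)] by blast
qed

lemma proj_homs_zero: "is_module M \<Longrightarrow> is_module N \<Longrightarrow> 0\<^sub>m (mdim N) (mdim M) \<in> proj_homs M N"
proof -
  assume M: "is_module M" and N: "is_module N"
  note z = zero_mod(1)
  have "0\<^sub>m (mdim N) (mdim M) = 0\<^sub>m (mdim N) (mdim zero_mod) * 0\<^sub>m (mdim zero_mod) (mdim M)" by simp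
  then show ?thesis unfolding proj_homs_iff
    using homs_zero[OF M z] homs_zero[OF z N] dim_0_projective[OF zero_mod] by blast
qed

lemma stable_iso_mod_iso: "is_module M \<Longrightarrow> is_module N \<Longrightarrow> mod_iso M N \<Longrightarrow> stable_iso M N"
  unfolding mod_iso_def stable_iso_def
  using proj_homs_zero[of M M] proj_homs_zero[of N N] by (force simp: minus_self_mat)

lemma stable_iso_refl: "is_module M \<Longrightarrow> stable_iso M M"
  by (intro stable_iso_mod_iso mod_iso_refl)

lemma stable_iso_sym: "stable_iso M N \<Longrightarrow> stable_iso N M"
  unfolding stable_iso_def by blast

lemma stable_iso_trans_aux:
  assumes M: "is_module M" "is_module N" "is_module L"
    and F: "F \<in> homs M N" "F' \<in> homs N M" "F' * F - 1\<^sub>m (mdim M) \<in> proj_homs M M"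
    and K: "K \<in> homs N L" "K' \<in> homs L N" "K' * K - 1\<^sub>m (mdim N) \<in> proj_homs N N"
  shows "F' * K' * (K * F) - 1\<^sub>m (mdim M) \<in> proj_homs M M"
proof -
  note c = F(1,2)[THEN homs_carrier] K(1,2)[THEN homs_carrier]
  have "F' * (K' * K - 1\<^sub>m (mdim N)) * F = F' * K' * (K * F) - F' * F"
    using c by (simp add: mat_diff_left mat_diff_right mat_assoc)
  then have "F' * K' * (K * F) - 1\<^sub>m (mdim M) = F' * (K' * K - 1\<^sub>m (mdim N)) * F + (F' * F - 1\<^sub>m (mdim M))"
    using c by (auto simp: mat_eq_iff)
  then show ?thesis using proj_homs_add[OF M(1,1) proj_homs_comp[OF M(1,2,2,1) K(3) F(2,1)] F(3)] by simp
qed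

lemma stable_iso_trans:
  assumes M: "is_module M" "is_module N" "is_module L" and "stable_iso M N" "stable_iso N L"
  shows "stable_iso M L"
proof -
  obtain F F' where F: "F \<in> homs M N" "F' \<in> homs N M" "F' * F - 1\<^sub>m (mdim M) \<in> proj_homs M M"
      "F * F' - 1\<^sub>m (mdim N) \<in> proj_homs N N"
    using assms(4) unfolding stable_iso_def by blast
  obtain K K' where K: "K \<in> homs N L" "K' \<in> homs L N" "K' * K - 1\<^sub>m (mdim N) \<in> proj_homs N N"
      "K * K' - 1\<^sub>m (mdim L) \<in> proj_homs L L"
    using assms(5) unfolding stable_iso_def by blast
  show ?thesis unfolding stable_iso_def
    using homs_comp[OF M F(1) K(1)] homs_comp[OF M(3,2,1) K(2) F(2)]
      stable_iso_trans_aux[OF M F(1-3) K(1-3)] stable_iso_trans_aux[OF M(3,2,1) K(2,1,4) F(2,1,4)] by blast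
qed

lemma stable_class_eq_iff:
  assumes "is_module M" "is_module N"
  shows "stable_class M = stable_class N \<longleftrightarrow> stable_iso M N"
proof
  assume "stable_class M = stable_class N"
  moreover have "N \<in> stable_class N" using assms stable_iso_refl by (simp add: stable_class_def)
  ultimately have "N \<in> stable_class M" by blast
  then show "stable_iso M N" by (simp add: stable_class_def)
next
  assume "stable_iso M N"
  then show "stable_class M = stable_class N"
    unfolding stable_class_def using assms stable_iso_trans stable_iso_sym by blast
qed

text \<open>The identity of a projective module factors through that module itself, so it is stably
  zero.\<close>

lemma projective_stable_zero:
  assumes P: "projective P" shows "stable_iso P zero_mod"
proof -
  note Pm = projective_module[OF P] and z = zero_mod
  let ?F = "0\<^sub>m (mdim zero_mod) (mdim P) :: complex mat" and ?F' = "0\<^sub>m (mdim P) (mdim zero_mod) :: complex mat"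
  have "?F' * ?F - 1\<^sub>m (mdim P) = ((- 1) \<cdot>\<^sub>m 1\<^sub>m (mdim P)) * 1\<^sub>m (mdim P)"
    by (auto simp: mat_eq_iff)
  then have 1: "?F' * ?F - 1\<^sub>m (mdim P) \<in> proj_homs P P"
    unfolding proj_homs_iff using P homs_one[OF Pm] homs_smult[OF Pm Pm homs_one[OF Pm]] by blast
  have "?F * ?F' - 1\<^sub>m (mdim zero_mod) = 0\<^sub>m (mdim zero_mod) (mdim zero_mod)" using z by (auto simp: mat_eq_iff)
  then have 2: "?F * ?F' - 1\<^sub>m (mdim zero_mod) \<in> proj_homs zero_mod zero_mod"
    using proj_homs_zero[OF z(1) z(1)] by simp
  show ?thesis unfolding stable_iso_def using 1 2 homs_zero[OF Pm z(1)] homs_zero[OF z(1) Pm] by blast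
qed

lemma proj_homs_tensor:
  assumes M: "is_module M" "is_module M'" and N: "is_module N" and \<pi>: "\<pi> \<in> proj_homs M M'"
  shows "kronecker \<pi> (1\<^sub>m (mdim N)) \<in> proj_homs (tensor M N) (tensor M' N)"
    and "kronecker (1\<^sub>m (mdim N)) \<pi> \<in> proj_homs (tensor N M) (tensor N M')"
proof -
  obtain A B P where P: "projective P" "A \<in> homs M P" "B \<in> homs P M'" "\<pi> = B * A" using \<pi> unfolding proj_homs_iff by blast
  note Pm = projective_module[OF P(1)]
  have d: "dim_col B = dim_row A" using homs_dim[OF P(2)] homs_dim[OF P(3)] by simp
  have "kronecker \<pi> (1\<^sub>m (mdim N)) = kronecker B (1\<^sub>m (mdim N)) * kronecker A (1\<^sub>m (mdim N))"
    "kronecker (1\<^sub>m (mdim N)) \<pi> = kronecker (1\<^sub>m (mdim N)) B * kronecker (1\<^sub>m (mdim N)) A"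
    unfolding P(4) using d by (simp_all add: kronecker_mult)
  then show "kronecker \<pi> (1\<^sub>m (mdim N)) \<in> proj_homs (tensor M N) (tensor M' N)"
    "kronecker (1\<^sub>m (mdim N)) \<pi> \<in> proj_homs (tensor N M) (tensor N M')"
    unfolding proj_homs_iff
    using projective_tensor_right[OF P(1) N] projective_tensor_left[OF P(1) N]
      tensor_hom[OF M(1) Pm N N P(2) homs_one[OF N]] tensor_hom[OF Pm M(2) N N P(3) homs_one[OF N]]
      tensor_hom[OF N N M(1) Pm homs_one[OF N] P(2)] tensor_hom[OF N N Pm M(2) homs_one[OF N] P(3)] by blast+
qed

lemma stable_iso_tensor_aux:
  assumes M: "is_module M" "is_module M'" and N: "is_module N"
    and F: "F \<in> homs M M'" "F' \<in> homs M' M" "F' * F - 1\<^sub>m (mdim M) \<in> proj_homs M M"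
  shows "kronecker F' (1\<^sub>m (mdim N)) * kronecker F (1\<^sub>m (mdim N)) - 1\<^sub>m (mdim (tensor M N)) \<in> proj_homs (tensor M N) (tensor M N)"
    and "kronecker (1\<^sub>m (mdim N)) F' * kronecker (1\<^sub>m (mdim N)) F - 1\<^sub>m (mdim (tensor N M)) \<in> proj_homs (tensor N M) (tensor N M)"
proof -
  note d = homs_dim[OF F(1)] homs_dim[OF F(2)]
  show "kronecker F' (1\<^sub>m (mdim N)) * kronecker F (1\<^sub>m (mdim N)) - 1\<^sub>m (mdim (tensor M N)) \<in> proj_homs (tensor M N) (tensor M N)"
    using proj_homs_tensor(1)[OF M(1,1) N F(3)] d by (simp add: kronecker_mult kronecker_diff_left)
  show "kronecker (1\<^sub>m (mdim N)) F' * kronecker (1\<^sub>m (mdim N)) F - 1\<^sub>m (mdim (tensor N M)) \<in> proj_homs (tensor N M) (tensor N M)"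
    using proj_homs_tensor(2)[OF M(1,1) N F(3)] d by (simp add: kronecker_mult kronecker_diff_right)
qed

lemma stable_iso_tensor:
  assumes M: "is_module M" "is_module M'" and N: "is_module N" and s: "stable_iso M M'"
  shows "stable_iso (tensor M N) (tensor M' N)" "stable_iso (tensor N M) (tensor N M')"
proof -
  obtain F F' where F: "F \<in> homs M M'" "F' \<in> homs M' M" "F' * F - 1\<^sub>m (mdim M) \<in> proj_homs M M"
      "F * F' - 1\<^sub>m (mdim M') \<in> proj_homs M' M'"
    using s unfolding stable_iso_def by blast
  show "stable_iso (tensor M N) (tensor M' N)" "stable_iso (tensor N M) (tensor N M')"
    unfolding stable_iso_def
    using tensor_hom[OF M N N F(1) homs_one[OF N]] tensor_hom[OF M(2,1) N N F(2) homs_one[OF N]]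
      tensor_hom[OF N N M homs_one[OF N] F(1)] tensor_hom[OF N N M(2,1) homs_one[OF N] F(2)]
      stable_iso_tensor_aux[OF M N F(1-3)] stable_iso_tensor_aux[OF M(2,1) N F(2,1,4)] by blast+
qed

lemma tensor_direct_sum:
  assumes A: "is_module A" and B: "is_module B" and N: "is_module N"
  shows "mod_iso (tensor (direct_sum A B) N) (direct_sum (tensor A N) (tensor B N))"
    and "mod_iso (tensor N (direct_sum A B)) (direct_sum (tensor N A) (tensor N B))"
proof -
  let ?X = "direct_sum A B"
  have X: "is_module ?X" by (rule direct_sum_module(1)[OF A B])
  obtain i p i' p' where b: "biproduct ?X A B i p i' p'" using direct_sum_biproduct[OF A B] .
  note e = b[unfolded biproduct_def] and c = biproduct_carrier[OF b]
  have "biproduct (tensor ?X N) (tensor A N) (tensor B N) (kronecker i (1\<^sub>m (mdim N))) (kronecker p (1\<^sub>m (mdim N)))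
      (kronecker i' (1\<^sub>m (mdim N))) (kronecker p' (1\<^sub>m (mdim N)))"
    unfolding biproduct_def
    using e c tensor_hom[OF _ _ N N _ homs_one[OF N]] A B X
    by (simp add: kronecker_mult kronecker_add_left[symmetric])
  then show "mod_iso (tensor ?X N) (direct_sum (tensor A N) (tensor B N))"
    by (rule biproduct_iso[rotated 3]) (auto intro: tensor_module A B N X)
  have "biproduct (tensor N ?X) (tensor N A) (tensor N B) (kronecker (1\<^sub>m (mdim N)) i) (kronecker (1\<^sub>m (mdim N)) p)
      (kronecker (1\<^sub>m (mdim N)) i') (kronecker (1\<^sub>m (mdim N)) p')"
    unfolding biproduct_def
    using e c tensor_hom[OF N N _ _ homs_one[OF N]] A B X
    by (simp add: kronecker_mult kronecker_add_right[symmetric])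
  then show "mod_iso (tensor N ?X) (direct_sum (tensor N A) (tensor N B))"
    by (rule biproduct_iso[rotated 3]) (auto intro: tensor_module A B N X)
qed

end

context nonnilpotent_group_datum
begin

section \<open>Indecomposable modules\<close>

lemma homs_pow: "is_module M \<Longrightarrow> X \<in> homs M M \<Longrightarrow> X ^\<^sub>m k \<in> homs M M"
  by (induction k) (auto simp: homs_one homs_comp homs_dim)

lemma homs_msum:
  assumes M: "is_module M" "is_module N" and I: "finite I" "\<And>a. a \<in> I \<Longrightarrow> f a \<in> homs M N"
  shows "msum (mdim N) (mdim M) f I \<in> homs M N"
  using I by (induction I rule: finite_induct) (auto simp: homs_zero homs_add M msum_insert homs_carrier)

text \<open>Fitting's lemma, with the projection obtained from an annihilating polynomial instead of
  kernels and images. If \<open>a\<close> is the lowest degree with nonzero coefficient, dividing by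
  that coefficient gives \<open>X ^\<^sub>m a = X ^\<^sub>m Suc a * Q\<close> with \<open>Q\<close>
  a polynomial in \<open>X\<close>. Hence \<open>U = X * Q\<close> fixes
  \<open>X ^\<^sub>m a\<close> from the right, and \<open>e = U ^\<^sub>m Suc a\<close> is
  idempotent, being equal to \<open>Q ^\<^sub>m Suc a * X ^\<^sub>m Suc a\<close>. The factor
  \<open>Z\<close> records that \<open>e\<close> is a right multiple of \<open>X\<close>, so
  \<open>X\<close> is invertible if \<open>e\<close> is the identity.\<close>

lemma fitting:
  assumes M: "is_module M" and X: "X \<in> homs M M"
  obtains e a Z where "e \<in> homs M M" "e * e = e" "X ^\<^sub>m a * e = X ^\<^sub>m a" "Z \<in> homs M M" "X * Z = e"
proof -
  define d where "d = mdim M"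
  have Xc: "X \<in> carrier_mat d d" using homs_carrier[OF X] by (simp add: d_def)
  obtain N f k where N: "k < N" "f k \<noteq> 0" "msum d d (\<lambda>i. f i \<cdot>\<^sub>m X ^\<^sub>m i) {..<N} = 0\<^sub>m d d"
    using powers_linearly_dependent[OF Xc] by metis
  define a where "a = (LEAST k. f k \<noteq> 0)"
  have a: "f a \<noteq> 0" "a < N" and below: "\<And>i. i < a \<Longrightarrow> f i = 0"
    unfolding a_def using N LeastI[of "\<lambda>k. f k \<noteq> 0"] Least_le[of "\<lambda>k. f k \<noteq> 0" k] not_less_Least by fastforce+
  define Q where "Q = msum d d (\<lambda>i. (- f i / f a) \<cdot>\<^sub>m X ^\<^sub>m (i - Suc a)) {a<..<N}"
  have Q: "Q \<in> homs M M" unfolding Q_def d_def by (rule homs_msum) (auto intro: homs_smult homs_pow M X)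
  have Qc: "Q \<in> carrier_mat d d" using homs_carrier[OF Q] by (simp add: d_def)
  have QX: "Q * X = X * Q"
    unfolding Q_def using Xc
    by (subst msum_mult_left, simp, simp, subst msum_mult_right, simp, simp)
      (intro msum_cong; simp add: mat_smult_left mat_smult_right pow_mat_Suc_left[OF Xc, symmetric])
  have red: "X ^\<^sub>m Suc a * Q = X ^\<^sub>m a"
  proof (rule eq_matI)
    fix i j assume "i < dim_row (X ^\<^sub>m a)" "j < dim_col (X ^\<^sub>m a)"
    then have ij: "i < d" "j < d" using carrier_matD[OF pow_carrier_mat[OF Xc, of a]] by simp_all
    have e: "X ^\<^sub>m Suc a * Q = msum d d (\<lambda>i. (- f i / f a) \<cdot>\<^sub>m X ^\<^sub>m i) {a<..<N}"
      unfolding Q_def using Xc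
      by (subst msum_mult_left, simp, simp)
        (intro msum_cong; simp add: mat_smult_right pow_mat_add[OF Xc, symmetric] del: pow_mat.simps)
    have split: "{..<N} = {..<a} \<union> {a} \<union> {a<..<N}" using a by auto
    have "0 = (\<Sum>l<N. f l * (X ^\<^sub>m l) $$ (i, j))"
      using arg_cong[OF N(3), of "\<lambda>A. A $$ (i, j)"] ij Xc by (simp add: msum_index)
    also have "\<dots> = f a * (X ^\<^sub>m a) $$ (i, j) + (\<Sum>l\<in>{a<..<N}. f l * (X ^\<^sub>m l) $$ (i, j))"
      unfolding split using below by (subst sum.union_disjoint, auto)+
    finally have "(X ^\<^sub>m a) $$ (i, j) = - (\<Sum>l\<in>{a<..<N}. f l * (X ^\<^sub>m l) $$ (i, j)) / f a"
      using a(1) by (simp add: field_simps eq_neg_iff_add_eq_0)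
    also have "\<dots> = (\<Sum>l\<in>{a<..<N}. (- f l / f a) * (X ^\<^sub>m l) $$ (i, j))"
      by (simp add: sum_negf sum_divide_distrib)
    finally show "(X ^\<^sub>m Suc a * Q) $$ (i, j) = (X ^\<^sub>m a) $$ (i, j)"
      unfolding e using ij Xc by (simp add: msum_index)
  qed (use Xc Qc in auto)
  define U where "U = X * Q"
  have Uc: "U \<in> carrier_mat d d" using Xc Qc by (simp add: U_def)
  have U: "U \<in> homs M M" unfolding U_def by (rule homs_comp[OF M M M Q X])
  have red': "X ^\<^sub>m a * U = X ^\<^sub>m a" using red Xc Qc by (simp add: U_def mat_assoc)
  have redm: "X ^\<^sub>m a * U ^\<^sub>m m = X ^\<^sub>m a" for m
  proof (induction m)
    case (Suc m)
    have "X ^\<^sub>m a * U ^\<^sub>m Suc m = X ^\<^sub>m a * U ^\<^sub>m m * U" using Xc Uc by (simp add: mat_assoc)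
    then show ?case by (simp only: Suc red')
  qed (use Xc Uc in auto)
  have Um: "U ^\<^sub>m m = Q ^\<^sub>m m * X ^\<^sub>m m" for m
  proof (induction m)
    case (Suc m)
    have XQ: "X ^\<^sub>m m * Q = Q * X ^\<^sub>m m"
      using pow_mat_intertwine[OF Xc Xc Qc QX, of m] by simp
    have UQ: "U = Q * X" by (simp only: U_def QX)
    have "U ^\<^sub>m Suc m = Q ^\<^sub>m m * X ^\<^sub>m m * U" by (simp only: pow_mat.simps(2) Suc.IH)
    also have "\<dots> = Q ^\<^sub>m m * (X ^\<^sub>m m * Q) * X" unfolding UQ using Xc Qc by (simp add: mat_assoc)
    also have "\<dots> = Q ^\<^sub>m Suc m * X ^\<^sub>m Suc m" unfolding XQ using Xc Qc by (simp add: mat_assoc)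
    finally show ?case .
  qed (use Xc Qc Uc in auto)
  define e where "e = U ^\<^sub>m Suc a"
  have Xe: "X ^\<^sub>m a * e = X ^\<^sub>m a" unfolding e_def by (rule redm)
  have ec: "e \<in> carrier_mat d d" unfolding e_def by (rule pow_carrier_mat[OF Uc])
  have "e * e = Q ^\<^sub>m Suc a * (X * (X ^\<^sub>m a * e))"
  proof -
    have "e * e = (Q ^\<^sub>m Suc a * X ^\<^sub>m Suc a) * e" by (simp only: e_def Um)
    also have "X ^\<^sub>m Suc a = X * X ^\<^sub>m a" by (rule pow_mat_Suc_left[OF Xc])
    finally show ?thesis using Xc Qc ec by (simp add: mat_assoc)
  qed
  also have "\<dots> = Q ^\<^sub>m Suc a * X ^\<^sub>m Suc a" unfolding Xe pow_mat_Suc_left[OF Xc, of a] ..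
  also have "\<dots> = e" by (simp only: e_def Um)
  finally have ee: "e * e = e" .
  have "X * (Q * U ^\<^sub>m a) = X * Q * U ^\<^sub>m a"
    by (rule assoc_mult_mat[symmetric, OF Xc Qc pow_carrier_mat[OF Uc]])
  then have "X * (Q * U ^\<^sub>m a) = e"
    by (simp only: U_def[symmetric] e_def pow_mat_Suc_left[OF Uc])
  then show ?thesis
    using that[OF _ ee Xe homs_comp[OF M M M homs_pow[OF M U, of a] Q]] homs_pow[OF M U, of "Suc a"] by (simp add: e_def)
qed

text \<open>The image of the idempotent \<open>B * A\<close> as a module of its own. Compressing the
  action to it stays multiplicative because the idempotent commutes with the action and
  \<open>A * B\<close> is the identity.\<close>

lemma corner_module:
  assumes M: "is_module M" and A: "A \<in> carrier_mat r (mdim M)" and B: "B \<in> carrier_mat (mdim M) r"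
    and AB: "A * B = 1\<^sub>m r" and e: "B * A \<in> homs M M"
  defines "N \<equiv> (r, \<lambda>x. A * act M x * B)"
  shows "is_module N" "A \<in> homs M N" "B \<in> homs N M"
proof -
  let ?d = "mdim M"
  interpret H: ring H by (rule H_ring)
  have ex: "B * A * act M x = act M x * (B * A)" if "x \<in> carrier H" for x using e that by (simp add: homs_def)
  have Bx: "B * (A * act M x * B) = act M x * B" and xA: "A * act M x * B * A = A * act M x" if x: "x \<in> carrier H" for x
  proof -
    note c = act_carrier[OF M x]
    have "B * (A * act M x * B) = (B * A * act M x) * B" using A B c by (simp add: mat_assoc)
    also have "\<dots> = act M x * (B * (A * B))" unfolding ex[OF x] using A B c by (simp add: mat_assoc)
    finally show "B * (A * act M x * B) = act M x * B" unfolding AB using A B c by simp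
    have "A * act M x * B * A = A * (act M x * (B * A))" using A B c by (simp add: mat_assoc)
    also have "\<dots> = (A * B) * (A * act M x)" unfolding ex[OF x, symmetric] using A B c by (simp add: mat_assoc)
    finally show "A * act M x * B * A = A * act M x" unfolding AB using A B c by simp
  qed
  have "snd N \<in> Ring.ring_hom H (cmats r)"
  proof (rule ring_hom_memI)
    fix x assume x: "x \<in> carrier H"
    note c = act_carrier[OF M x]
    show "snd N x \<in> carrier (cmats r)" using A B c by (simp add: N_def ring_mat_simps)
    fix y assume y: "y \<in> carrier H"
    note c = c act_carrier[OF M y]
    have "A * (act M x * act M y) * B = A * act M x * (act M y * B)" using A B c by (simp add: mat_assoc)
    also have "\<dots> = A * act M x * B * (A * act M y * B)"
      unfolding Bx[OF y, symmetric] using A B c by (simp add: mat_assoc)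
    finally show "snd N (x \<otimes>\<^bsub>H\<^esub> y) = snd N x \<otimes>\<^bsub>cmats r\<^esub> snd N y"
      using x y M by (simp add: N_def ring_mat_simps act_mult)
    show "snd N (x \<oplus>\<^bsub>H\<^esub> y) = snd N x \<oplus>\<^bsub>cmats r\<^esub> snd N y"
      using x y M A B c by (simp add: N_def ring_mat_simps act_add mat_dist)
  next
    show "snd N \<one>\<^bsub>H\<^esub> = \<one>\<^bsub>cmats r\<^esub>" using A B AB M by (simp add: N_def ring_mat_simps act_one)
  qed
  moreover have "snd N (scalar c) = c \<cdot>\<^sub>m 1\<^sub>m r" for c
    using A B AB M by (simp add: N_def act_scalar mat_smult_left mat_smult_right)
  ultimately show "is_module N" by (simp add: is_module_def N_def)
  show "A \<in> homs M N" "B \<in> homs N M" using A B Bx xA by (auto simp: homs_def N_def)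
qed

lemma idempotent_biproduct:
  assumes M: "is_module M" and e: "e \<in> homs M M" "e * e = e"
  obtains A B iA pA iB pB where "is_module A" "is_module B" "biproduct M A B iA pA iB pB" "iA * pA = e"
proof -
  let ?d = "mdim M"
  have ec: "e \<in> carrier_mat ?d ?d" by (rule homs_carrier[OF e(1)])
  obtain r A B where 1: "A \<in> carrier_mat r ?d" "B \<in> carrier_mat ?d r" "B * A = e" "A * B = 1\<^sub>m r"
    using idempotent_mat_splits[OF ec e(2)] .
  define e' where "e' = 1\<^sub>m ?d - e"
  have e'h: "e' \<in> homs M M" unfolding e'_def by (rule homs_diff[OF M M homs_one[OF M] e(1)])
  have e'c: "e' \<in> carrier_mat ?d ?d" by (rule homs_carrier[OF e'h])
  have "e' * e' = e'" unfolding e'_def using ec e(2) by (simp add: mat_diff_left mat_diff_right) (auto simp: mat_eq_iff)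
  then obtain r' A' B' where 2: "A' \<in> carrier_mat r' ?d" "B' \<in> carrier_mat ?d r'" "B' * A' = e'" "A' * B' = 1\<^sub>m r'"
    using idempotent_mat_splits[OF e'c] by metis
  note c1 = corner_module[OF M 1(1,2,4) e(1)[folded 1(3)]] and c2 = corner_module[OF M 2(1,2,4) e'h[folded 2(3)]]
  have "B * A + B' * A' = 1\<^sub>m ?d" unfolding 1(3) 2(3) e'_def using ec by (auto simp: mat_eq_iff)
  then have "biproduct M (r, \<lambda>x. A * act M x * B) (r', \<lambda>x. A' * act M x * B') B A B' A'"
    unfolding biproduct_def using c1 c2 1 2 by simp
  then show ?thesis using that c1(1) c2(1) 1(3) by blast
qed

lemma mod_iso_dim: "mod_iso M N \<Longrightarrow> mdim M = mdim N"
proof -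
  assume "mod_iso M N"
  then obtain F F' where F: "F \<in> homs M N" "F' \<in> homs N M" "F' * F = 1\<^sub>m (mdim M)" "F * F' = 1\<^sub>m (mdim N)"
    unfolding mod_iso_def by blast
  have "tr (F' * F) = tr (F * F')" by (rule tr_mult_comm) (use homs_dim[OF F(1)] homs_dim[OF F(2)] in auto)
  then show ?thesis unfolding F by simp
qed

lemma indec_module: "indecomposable M \<Longrightarrow> is_module M" "indecomposable M \<Longrightarrow> mdim M \<noteq> 0"
  by (auto simp: indecomposable_def)

lemma indec_split:
  assumes "indecomposable M" "is_module A" "is_module B" "mod_iso M (direct_sum A B)"
  shows "mdim A = 0 \<or> mdim B = 0"
  by (rule assms(1)[unfolded indecomposable_def, THEN conjunct2, THEN conjunct2, rule_format,
        OF conjI[OF assms(2) conjI[OF assms(3,4)]]])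

lemma indec_idempotent:
  assumes M: "indecomposable M" and e: "e \<in> homs M M" "e * e = e"
  shows "e = 0\<^sub>m (mdim M) (mdim M) \<or> e = 1\<^sub>m (mdim M)"
proof -
  note Mm = indec_module[OF M]
  obtain A B iA pA iB pB where b: "is_module A" "is_module B" "biproduct M A B iA pA iB pB" "iA * pA = e"
    using idempotent_biproduct[OF Mm(1) e] .
  note c = biproduct_carrier[OF b(3)]
  have "mod_iso M (direct_sum A B)" by (rule biproduct_iso[OF Mm(1) b(1-3)])
  then have "mdim A = 0 \<or> mdim B = 0" by (rule indec_split[OF M b(1,2)])
  then show ?thesis
  proof
    assume "mdim A = 0"
    then have "iA * pA = 0\<^sub>m (mdim M) (mdim M)" using c by (intro eq_matI) (auto simp: scalar_prod_def)
    then show ?thesis using b(4) by simp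
  next
    assume "mdim B = 0"
    then have "iB * pB = 0\<^sub>m (mdim M) (mdim M)" using c by (intro eq_matI) (auto simp: scalar_prod_def)
    then show ?thesis using b(3,4) homs_carrier[OF e(1)] unfolding biproduct_def by simp
  qed
qed

definition nilpotent_mat :: "complex mat \<Rightarrow> bool" where
  "nilpotent_mat X \<longleftrightarrow> (\<exists>k. X ^\<^sub>m k = 0\<^sub>m (dim_row X) (dim_row X))"

lemma nilpotent_trace: "X \<in> carrier_mat d d \<Longrightarrow> nilpotent_mat X \<Longrightarrow> tr X = 0"
  unfolding nilpotent_mat_def using trace_nilpotent by auto

text \<open>The idempotent of \<open>fitting\<close> is 0 or 1. In the first case
  \<open>X ^\<^sub>m a = X ^\<^sub>m a * e\<close> is zero, in the second \<open>Z\<close> is a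
  right inverse and, by finite dimension, an inverse. This dichotomy is the locality of the
  endomorphism ring.\<close>

lemma indec_endo:
  assumes M: "indecomposable M" and X: "X \<in> homs M M"
  shows "nilpotent_mat X \<or> (\<exists>Z\<in>homs M M. X * Z = 1\<^sub>m (mdim M) \<and> Z * X = 1\<^sub>m (mdim M))"
proof -
  note Mm = indec_module(1)[OF M]
  have Xc: "X \<in> carrier_mat (mdim M) (mdim M)" by (rule homs_carrier[OF X])
  obtain e a Z where e: "e \<in> homs M M" "e * e = e" "X ^\<^sub>m a * e = X ^\<^sub>m a" "Z \<in> homs M M" "X * Z = e"
    using fitting[OF Mm X] .
  from indec_idempotent[OF M e(1,2)] show ?thesis
  proof
    assume "e = 0\<^sub>m (mdim M) (mdim M)"
    then have "X ^\<^sub>m a = 0\<^sub>m (mdim M) (mdim M)" using e(3) Xc by simp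
    then show ?thesis unfolding nilpotent_mat_def using Xc by auto
  next
    assume "e = 1\<^sub>m (mdim M)"
    then show ?thesis using e(4,5) mat_mult_left_right_inverse[OF Xc homs_carrier[OF e(4)]] by blast
  qed
qed

lemma nilpotent_not_invertible:
  assumes X: "X \<in> carrier_mat d d" and Z: "Z \<in> carrier_mat d d" and "X * Z = 1\<^sub>m d" and n: "nilpotent_mat X"
  shows "d = 0"
proof -
  have p: "X ^\<^sub>m k * Z ^\<^sub>m k = 1\<^sub>m d" for k
  proof (induction k)
    case (Suc k)
    have "X ^\<^sub>m Suc k * Z ^\<^sub>m Suc k = X ^\<^sub>m k * (X * Z) * Z ^\<^sub>m k"
      unfolding pow_mat_Suc_left[OF Z] using X Z by (simp add: mat_assoc)
    then show ?case using assms(3) Suc X Z by simp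
  qed (use X Z in auto)
  obtain k where "X ^\<^sub>m k = 0\<^sub>m d d" using n X unfolding nilpotent_mat_def by auto
  then have "1\<^sub>m d = (0\<^sub>m d d :: complex mat)"
    using p[of k] left_mult_zero_mat[OF pow_carrier_mat[OF Z, of k], of d] by simp
  then have "tr (1\<^sub>m d :: complex mat) = 0" by simp
  then show "d = 0" by simp
qed

text \<open>Otherwise \<open>X * Z\<close> is invertible, and then \<open>X\<close> has a right
  inverse, which a nilpotent endomorphism of a nonzero module cannot have.\<close>

lemma indec_endo_nilpotent_mult:
  assumes M: "indecomposable M" and X: "X \<in> homs M M" "nilpotent_mat X" and Z: "Z \<in> homs M M"
  shows "nilpotent_mat (X * Z)"
proof (rule ccontr)
  note Mm = indec_module[OF M]
  assume "\<not> nilpotent_mat (X * Z)"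
  then obtain W where W: "W \<in> homs M M" "X * Z * W = 1\<^sub>m (mdim M)"
    using indec_endo[OF M homs_comp[OF Mm(1) Mm(1) Mm(1) Z X(1)]] by blast
  note c = homs_carrier[OF X(1)] homs_carrier[OF Z] homs_carrier[OF W(1)]
  have "X * (Z * W) = 1\<^sub>m (mdim M)" using W(2) c by (simp add: mat_assoc)
  then have "mdim M = 0" by (intro nilpotent_not_invertible[OF c(1) _ _ X(2), of "Z * W"]) (use c in auto)
  then show False using Mm by simp
qed

text \<open>The residue field of the endomorphism ring is \<complex>: subtracting an eigenvalue
  leaves an endomorphism with nonzero kernel, which is therefore nilpotent, and vanishing of its
  trace identifies the eigenvalue as the normalised trace.\<close>

lemma indec_endo_scalar:
  assumes M: "indecomposable M" and X: "X \<in> homs M M"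
  shows "nilpotent_mat (X - (tr X / mdim M) \<cdot>\<^sub>m 1\<^sub>m (mdim M))"
    and "X - (tr X / mdim M) \<cdot>\<^sub>m 1\<^sub>m (mdim M) \<in> homs M M"
proof -
  note Mm = indec_module[OF M]
  let ?d = "mdim M"
  have Xc: "X \<in> carrier_mat ?d ?d" by (rule homs_carrier[OF X])
  obtain c where "eigenvalue X c" using spectrum_non_empty[OF Xc] Mm(2) by (auto simp: spectrum_def)
  then obtain v where v: "v \<in> carrier_vec ?d" "v \<noteq> 0\<^sub>v ?d" "X *\<^sub>v v = c \<cdot>\<^sub>v v"
    unfolding eigenvalue_def eigenvector_def using Xc by auto
  define Y where "Y = X - c \<cdot>\<^sub>m 1\<^sub>m ?d"
  have Y: "Y \<in> homs M M" unfolding Y_def by (rule homs_diff[OF Mm(1) Mm(1) X homs_smult[OF Mm(1) Mm(1) homs_one[OF Mm(1)]]])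
  have Yc: "Y \<in> carrier_mat ?d ?d" by (rule homs_carrier[OF Y])
  have "Y *\<^sub>v v = X *\<^sub>v v - c \<cdot>\<^sub>v v"
  proof -
    have "(c \<cdot>\<^sub>m 1\<^sub>m ?d) *\<^sub>v v = c \<cdot>\<^sub>v v" by (rule eq_vecI) (use v(1) in auto)
    then show ?thesis unfolding Y_def using Xc v(1)
      by (subst minus_mult_distrib_mat_vec[of _ ?d ?d]) auto
  qed
  then have Yv: "Y *\<^sub>v v = 0\<^sub>v ?d" using v by simp
  have nY: "nilpotent_mat Y"
  proof (rule ccontr)
    assume "\<not> nilpotent_mat Y"
    then obtain Z where Z: "Z \<in> homs M M" "Z * Y = 1\<^sub>m ?d" using indec_endo[OF M Y] by blast
    note Zc = homs_carrier[OF Z(1)]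
    have "v = Z *\<^sub>v (Y *\<^sub>v v)" using assoc_mult_mat_vec[OF Zc Yc v(1)] Z(2) v(1) by simp
    also have "\<dots> = 0\<^sub>v ?d" unfolding Yv using Zc by (intro eq_vecI) (auto simp: scalar_prod_def)
    finally show False using v(2) by simp
  qed
  have "0 = tr Y" using nilpotent_trace[OF Yc nY] by simp
  also have "\<dots> = tr X - c * ?d" unfolding Y_def using Xc by (simp add: tr_diff tr_smult)
  finally have "c = tr X / ?d" using Mm(2) by (simp add: field_simps)
  then show "nilpotent_mat (X - (tr X / ?d) \<cdot>\<^sub>m 1\<^sub>m ?d)" "X - (tr X / ?d) \<cdot>\<^sub>m 1\<^sub>m ?d \<in> homs M M" using nY Y by (simp_all add: Y_def)
qed

text \<open>The normalised trace is reduction modulo the radical, hence a ring homomorphism to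
  \<complex>.\<close>

lemma indec_trace_mult:
  assumes M: "indecomposable M" and X: "X \<in> homs M M" and Z: "Z \<in> homs M M"
  shows "tr (X * Z) = tr X * tr Z / mdim M"
proof -
  note Mm = indec_module[OF M]
  let ?d = "mdim M" and ?c = "tr X / mdim M"
  note c = homs_carrier[OF X] homs_carrier[OF Z]
  note s = indec_endo_scalar[OF M X]
  have n: "nilpotent_mat ((X - ?c \<cdot>\<^sub>m 1\<^sub>m ?d) * Z)" by (rule indec_endo_nilpotent_mult[OF M s(2,1) Z])
  have "0 = tr ((X - ?c \<cdot>\<^sub>m 1\<^sub>m ?d) * Z)" using nilpotent_trace[OF homs_carrier[OF homs_comp[OF Mm(1) Mm(1) Mm(1) Z s(2)]] n] by simp
  also have "(X - ?c \<cdot>\<^sub>m 1\<^sub>m ?d) * Z = X * Z - ?c \<cdot>\<^sub>m Z" using c by (simp add: mat_diff_right)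
  also have "tr (X * Z - ?c \<cdot>\<^sub>m Z) = tr (X * Z) - ?c * tr Z" using c by (simp add: tr_diff tr_smult)
  finally show ?thesis by simp
qed

text \<open>\<open>X\<close> minus its residue is nilpotent and commutes with \<open>K\<close>, so
  its product with \<open>K\<close> is nilpotent too. \<open>K\<close> need not be a module map: it
  will be the action of g, which commutes with y only up to q.\<close>

lemma indec_trace_central:
  assumes M: "indecomposable M" and X: "X \<in> homs M M" and K: "K \<in> carrier_mat (mdim M) (mdim M)" "K * X = X * K"
  shows "tr (K * X) = tr K * tr X / mdim M"
proof -
  let ?d = "mdim M" and ?c = "tr X / mdim M"
  note c = homs_carrier[OF X]
  define Y where "Y = X - ?c \<cdot>\<^sub>m 1\<^sub>m ?d"
  have Yc: "Y \<in> carrier_mat ?d ?d" using c by (auto simp: Y_def)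
  have KY: "K * Y = Y * K" unfolding Y_def using c K by (simp add: mat_diff_left mat_diff_right)
  have pow: "(K * Y) ^\<^sub>m k = K ^\<^sub>m k * Y ^\<^sub>m k" for k
  proof (induction k)
    case (Suc k)
    have yk: "Y ^\<^sub>m k * K = K * Y ^\<^sub>m k" using pow_mat_intertwine[OF Yc Yc K(1) KY, of k] by simp
    have "(K * Y) ^\<^sub>m Suc k = K ^\<^sub>m k * (Y ^\<^sub>m k * K) * Y" using Suc K(1) Yc by (simp add: mat_assoc)
    then show ?case unfolding yk using K(1) Yc by (simp add: mat_assoc)
  qed (use K Yc in auto)
  obtain k where "Y ^\<^sub>m k = 0\<^sub>m ?d ?d" using indec_endo_scalar(1)[OF M X] Yc unfolding nilpotent_mat_def Y_def[symmetric] by auto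
  then have "(K * Y) ^\<^sub>m k = 0\<^sub>m ?d ?d" unfolding pow using K by simp
  then have "0 = tr (K * Y)" using trace_nilpotent[of "K * Y" ?d k] K Yc by simp
  also have "K * Y = K * X - ?c \<cdot>\<^sub>m K" unfolding Y_def using c K by (simp add: mat_diff_left)
  also have "tr \<dots> = tr (K * X) - ?c * tr K" using c K by (simp add: tr_diff tr_smult)
  finally show ?thesis by (simp add: mult.commute)
qed

text \<open>An endomorphism of nonzero trace is invertible, say with inverse \<open>Z\<close>. Then
  \<open>f * (Z * h)\<close> is a nonzero idempotent of \<open>N\<close>, hence the
  identity.\<close>

lemma indec_iso_if_trace:
  assumes M: "indecomposable M" and N: "indecomposable N" and f: "f \<in> homs M N" and h: "h \<in> homs N M" and t: "tr (h * f) \<noteq> 0"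
  shows "mod_iso M N"
proof -
  note Mm = indec_module[OF M] and Nm = indec_module[OF N]
  have hf: "h * f \<in> homs M M" by (rule homs_comp[OF Mm(1) Nm(1) Mm(1) f h])
  then obtain Z where Z: "Z \<in> homs M M" "h * f * Z = 1\<^sub>m (mdim M)" "Z * (h * f) = 1\<^sub>m (mdim M)"
    using indec_endo[OF M hf] nilpotent_trace[OF homs_carrier[OF hf]] t by blast
  note c = homs_carrier[OF f] homs_carrier[OF h] homs_carrier[OF Z(1)]
  have Zh: "Z * h \<in> homs N M" by (rule homs_comp[OF Nm(1) Mm(1) Mm(1) h Z(1)])
  define e where "e = f * (Z * h)"
  have e: "e \<in> homs N N" unfolding e_def by (rule homs_comp[OF Nm(1) Mm(1) Nm(1) Zh f])
  have Zhf: "Z * h * f = 1\<^sub>m (mdim M)" using Z(3) c by (simp add: mat_assoc)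
  have "e * e = f * (Z * h * f) * (Z * h)" unfolding e_def using c by (simp add: mat_assoc)
  then have ee: "e * e = e" unfolding Zhf e_def using c by simp
  have "e \<noteq> 0\<^sub>m (mdim N) (mdim N)"
  proof
    assume z: "e = 0\<^sub>m (mdim N) (mdim N)"
    have "h * e * f = (h * f) * (Z * h * f)" unfolding e_def using c by (simp add: mat_assoc)
    then have "h * f = h * e * f" unfolding Zhf using c by simp
    also have "\<dots> = 0\<^sub>m (mdim M) (mdim M)" unfolding z using c by simp
    finally show False using t by simp
  qed
  then have "e = 1\<^sub>m (mdim N)" using indec_idempotent[OF N e ee] by simp
  then show ?thesis using mod_isoI[OF f Zh Zhf] by (simp add: e_def)
qed

text \<open>The existence half of the Krull-Schmidt theorem, phrased as an induction rule on the
  dimension. What replaces the uniqueness half are the multiplicity functionals.\<close>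

lemma module_induct [consumes 1, case_names zero indecomposable sum]:
  assumes "is_module X"
    and z: "\<And>X. is_module X \<Longrightarrow> mdim X = 0 \<Longrightarrow> P X"
    and i: "\<And>X. indecomposable X \<Longrightarrow> P X"
    and s: "\<And>X A B. is_module X \<Longrightarrow> is_module A \<Longrightarrow> is_module B \<Longrightarrow> mod_iso X (direct_sum A B) \<Longrightarrow> P A \<Longrightarrow> P B \<Longrightarrow> P X"
  shows "P X"
  using assms(1)
proof (induction "mdim X" arbitrary: X rule: less_induct)
  case less
  show ?case
  proof (cases "mdim X = 0 \<or> indecomposable X")
    case False
    then obtain A B where AB: "is_module A" "is_module B" "mod_iso X (direct_sum A B)" "mdim A \<noteq> 0" "mdim B \<noteq> 0"
      using less.prems unfolding indecomposable_def by blast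
    have "mdim X = mdim A + mdim B" using mod_iso_dim[OF AB(3)] direct_sum_module(2)[OF AB(1,2)] by simp
    then show ?thesis using less.hyps[OF _ AB(1)] less.hyps[OF _ AB(2)] AB s[OF less.prems AB(1-3)] by simp
  next
    case True
    then show ?thesis using less.prems z i by blast
  qed
qed

end

section \<open>Biorthogonal functions and matrix units\<close>

lemma sum_lessThan_append:
  fixes f :: "nat \<Rightarrow> 'a::comm_monoid_add"
  shows "(\<Sum>t<r + s. f t) = (\<Sum>t<r. f t) + (\<Sum>t<s. f (r + t))"
  by (induction s) (auto simp: add.assoc)

text \<open>Biorthogonal functions on \<open>S\<close> are linearly independent, so there are at
  most card S of them. Otherwise take one more, \<open>r = card S + 1\<close>, and write their
  normalised pairing as a product of two r x r matrices, the inner index beyond card S being filled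
  with zeros: \<open>A * B = 1\<close>, but the last diagonal entry of \<open>B * A\<close> is
  0.\<close>

lemma biorthogonal_finite:
  fixes \<alpha> \<beta> :: "'i \<Rightarrow> 'h \<Rightarrow> 'a::field"
  assumes S: "finite S" and z: "\<And>i j. i \<in> I \<Longrightarrow> j \<in> I \<Longrightarrow> (\<Sum>h\<in>S. \<alpha> i h * \<beta> j h) = 0 \<longleftrightarrow> i \<noteq> j"
  shows "finite I"
proof (rule ccontr)
  assume "infinite I"
  define m r where "m = card S" "r = Suc (card S)"
  obtain J where J: "J \<subseteq> I" "card J = r" "finite J" using infinite_arbitrarily_large[OF \<open>infinite I\<close>] by blast
  obtain e where e: "bij_betw e {..<r} J"
    using ex_bij_betw_nat_finite[OF J(3)] J(2) by (auto simp: atLeast0LessThan)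
  obtain u where u: "bij_betw u {..<m} S"
    using ex_bij_betw_nat_finite[OF S] by (auto simp: atLeast0LessThan m_r_def(1))
  have eI: "e i \<in> I" if "i < r" for i using e J(1) that bij_betwE by blast
  define c where "c j = (\<Sum>h\<in>S. \<alpha> (e j) h * \<beta> (e j) h)" for j
  have c: "c j \<noteq> 0" if "j < r" for j unfolding c_def using z[OF eI[OF that] eI[OF that]] by blast
  define A where "A = mat r r (\<lambda>(i, k). if k < m then \<alpha> (e i) (u k) else 0)"
  define B where "B = mat r r (\<lambda>(k, j). if k < m then \<beta> (e j) (u k) / c j else 0)"
  have AB: "A * B = 1\<^sub>m r"
  proof (rule eq_matI)
    fix i j assume "i < dim_row (1\<^sub>m r :: 'a mat)" "j < dim_col (1\<^sub>m r :: 'a mat)"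
    then have ij: "i < r" "j < r" by auto
    have "(A * B) $$ (i, j) = (\<Sum>k<r. A $$ (i, k) * B $$ (k, j))"
      using ij by (subst index_mult_sum) (auto simp: A_def B_def)
    also have "\<dots> = (\<Sum>k<m. A $$ (i, k) * B $$ (k, j)) + A $$ (i, m) * B $$ (m, j)"
      by (simp add: m_r_def)
    also have "\<dots> = (\<Sum>k<m. \<alpha> (e i) (u k) * \<beta> (e j) (u k)) / c j"
      using ij by (simp add: A_def B_def sum_divide_distrib m_r_def)
    also have "(\<Sum>k<m. \<alpha> (e i) (u k) * \<beta> (e j) (u k)) = (\<Sum>h\<in>S. \<alpha> (e i) h * \<beta> (e j) h)"
      by (rule sum.reindex_bij_betw[OF u])
    also have "\<dots> / c j = (if i = j then 1 else 0)"
    proof (cases "i = j")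
      case True
      then show ?thesis using c[OF ij(2)] by (simp add: c_def)
    next
      case False
      then have "e i \<noteq> e j" using e ij by (auto simp: bij_betw_def inj_on_def)
      then show ?thesis using False z[OF eI[OF ij(1)] eI[OF ij(2)]] by simp
    qed
    finally show "(A * B) $$ (i, j) = 1\<^sub>m r $$ (i, j)" using ij by simp
  qed (auto simp: A_def B_def)
  have "B * A = 1\<^sub>m r" by (rule mat_mult_left_right_inverse[OF _ _ AB]) (auto simp: A_def B_def)
  moreover have "(B * A) $$ (m, m) = 0"
    by (subst index_mult_sum) (auto simp: A_def B_def m_r_def)
  ultimately show False by (simp add: m_r_def)
qed

lemma trace_form_unit:
  fixes X :: "'a::comm_semiring_1 mat"
  assumes X: "X \<in> carrier_mat a b" and ij: "i < a" "j < b"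
  shows "tr (X * mat b a (\<lambda>(k, l). if k = j \<and> l = i then 1 else 0)) = X $$ (i, j)"
proof -
  let ?T = "mat b a (\<lambda>(k, l). if k = j \<and> l = i then 1 else 0) :: 'a mat"
  have "tr (X * ?T) = (\<Sum>p<a. \<Sum>k<b. X $$ (p, k) * ?T $$ (k, p))"
    using X by (simp add: tr_def index_mult_sum del: index_mult_mat(1) index_mat)
  also have "\<dots> = (\<Sum>p<a. if p = i then X $$ (i, j) else 0)"
    using ij by (intro sum.cong) (auto simp: if_distrib[of "\<lambda>x. _ * x"] cong: if_cong)
  finally show ?thesis using ij by simp
qed

context nonnilpotent_group_datum
begin

subsection \<open>Multiplicities\<close>

abbreviation nonproj_indec :: "'g hopf_mod \<Rightarrow> bool" where
  "nonproj_indec M \<equiv> indecomposable M \<and> \<not> projective M"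

text \<open>If the map were invertible, \<open>M\<close> would be a summand of the projective
  through which it factors. So it is nilpotent and its trace vanishes; this is why trace forms
  ignore maps through projectives.\<close>

lemma nonproj_trace:
  assumes M: "nonproj_indec M" and \<pi>: "\<pi> \<in> proj_homs M M"
  shows "tr \<pi> = 0"
proof -
  note Mi = conjunct1[OF M] and Mm = indec_module(1)[OF conjunct1[OF M]]
  obtain A B P where P: "projective P" "A \<in> homs M P" "B \<in> homs P M" "\<pi> = B * A" using \<pi> unfolding proj_homs_iff by blast
  note Pm = projective_module[OF P(1)]
  have h: "\<pi> \<in> homs M M" by (rule proj_homs_homs[OF Mm Mm \<pi>])
  have "nilpotent_mat \<pi>"
  proof (rule ccontr)
    assume "\<not> nilpotent_mat \<pi>"
    then obtain Z where Z: "Z \<in> homs M M" "Z * \<pi> = 1\<^sub>m (mdim M)" using indec_endo[OF Mi h] by blast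
    have "Z * B * A = 1\<^sub>m (mdim M)" using Z(2) homs_carrier[OF Z(1)] homs_carrier[OF P(2)] homs_carrier[OF P(3)]
      unfolding P(4) by (simp add: mat_assoc)
    then have "projective M" by (rule projective_summand[OF P(1) Mm P(2) homs_comp[OF Pm Mm Mm P(3) Z(1)]])
    then show False using M by simp
  qed
  then show ?thesis by (rule nilpotent_trace[OF homs_carrier[OF h]])
qed

text \<open>For indecomposable \<open>M\<close> this is the residue of the endomorphism
  \<open>h * f\<close> in \<complex>; dividing by the dimension makes the identity pair to
  1.\<close>

definition pairing :: "'g hopf_mod \<Rightarrow> complex mat \<Rightarrow> complex mat \<Rightarrow> complex" where
  "pairing M h f = tr (h * f) / of_nat (mdim M)"

text \<open>For \<open>M\<close> indecomposable the pairing of \<open>Hom(X, M)\<close> with \<open>Hom(M, X)\<close> has rank the multiplicity of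
  \<open>M\<close> in \<open>X\<close>. The rank is read off as the trace of a factorisation of the form, which does not
  depend on the factorisation.\<close>

definition has_mult :: "'g hopf_mod \<Rightarrow> 'g hopf_mod \<Rightarrow> complex \<Rightarrow> bool" where
  "has_mult M X c \<longleftrightarrow> (\<exists>(r::nat) i p. (\<forall>t<r. i t \<in> homs M X \<and> p t \<in> homs X M) \<and>
     (\<forall>f\<in>homs M X. \<forall>h\<in>homs X M. pairing M h f = (\<Sum>t<r. pairing M h (i t) * pairing M (p t) f)) \<and>
     c = (\<Sum>t<r. pairing M (p t) (i t)))"

lemma has_multI:
  fixes r :: nat
  assumes "\<And>t. t < r \<Longrightarrow> i t \<in> homs M X" "\<And>t. t < r \<Longrightarrow> p t \<in> homs X M"
    "\<And>f h. f \<in> homs M X \<Longrightarrow> h \<in> homs X M \<Longrightarrow> pairing M h f = (\<Sum>t<r. pairing M h (i t) * pairing M (p t) f)"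
    "c = (\<Sum>t<r. pairing M (p t) (i t))"
  shows "has_mult M X c"
  unfolding has_mult_def using assms by blast

lemma has_multE:
  assumes "has_mult M X c"
  obtains r :: nat and i p where "\<And>t. t < r \<Longrightarrow> i t \<in> homs M X" "\<And>t. t < r \<Longrightarrow> p t \<in> homs X M"
    "\<And>f h. f \<in> homs M X \<Longrightarrow> h \<in> homs X M \<Longrightarrow> pairing M h f = (\<Sum>t<r. pairing M h (i t) * pairing M (p t) f)"
    "c = (\<Sum>t<r. pairing M (p t) (i t))"
  using assms unfolding has_mult_def by blast

text \<open>Expanding the diagonal terms of one factorisation by means of the other gives a double
  sum that is symmetric in the two: the identity tr (U V) = tr (V U).\<close>

lemma has_mult_unique:
  assumes "has_mult M X c" "has_mult M X c'"
  shows "c = c'"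
proof -
  obtain r i p where 1: "\<And>t. t < (r::nat) \<Longrightarrow> i t \<in> homs M X" "\<And>t. t < r \<Longrightarrow> p t \<in> homs X M"
    "\<And>f h. f \<in> homs M X \<Longrightarrow> h \<in> homs X M \<Longrightarrow> pairing M h f = (\<Sum>t<r. pairing M h (i t) * pairing M (p t) f)"
    "c = (\<Sum>t<r. pairing M (p t) (i t))" using assms(1) by (rule has_multE) blast
  obtain r' i' p' where 2: "\<And>t. t < (r'::nat) \<Longrightarrow> i' t \<in> homs M X" "\<And>t. t < r' \<Longrightarrow> p' t \<in> homs X M"
    "\<And>f h. f \<in> homs M X \<Longrightarrow> h \<in> homs X M \<Longrightarrow> pairing M h f = (\<Sum>t<r'. pairing M h (i' t) * pairing M (p' t) f)"
    "c' = (\<Sum>t<r'. pairing M (p' t) (i' t))" using assms(2) by (rule has_multE) blast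
  have "c = (\<Sum>t<r. \<Sum>s<r'. pairing M (p t) (i' s) * pairing M (p' s) (i t))"
    unfolding 1(4) using 1(1,2) by (intro sum.cong refl 2(3)) auto
  also have "\<dots> = (\<Sum>s<r'. \<Sum>t<r. pairing M (p' s) (i t) * pairing M (p t) (i' s))"
    by (subst sum.swap) (simp add: mult.commute)
  also have "\<dots> = c'"
    unfolding 2(4) using 2(1,2) by (intro sum.cong refl 1(3)[symmetric]) auto
  finally show ?thesis .
qed

lemma has_mult_biproduct:
  assumes M: "is_module M" "is_module X" "is_module A" "is_module B"
    and b: "biproduct X A B iA pA iB pB" and A: "has_mult M A c" and B: "has_mult M B c'"
  shows "has_mult M X (c + c')"
proof -
  obtain r i p where 1: "\<And>t. t < (r::nat) \<Longrightarrow> i t \<in> homs M A" "\<And>t. t < r \<Longrightarrow> p t \<in> homs A M"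
    "\<And>f h. f \<in> homs M A \<Longrightarrow> h \<in> homs A M \<Longrightarrow> pairing M h f = (\<Sum>t<r. pairing M h (i t) * pairing M (p t) f)"
    "c = (\<Sum>t<r. pairing M (p t) (i t))" using A by (rule has_multE) blast
  obtain s j k where 2: "\<And>t. t < (s::nat) \<Longrightarrow> j t \<in> homs M B" "\<And>t. t < s \<Longrightarrow> k t \<in> homs B M"
    "\<And>f h. f \<in> homs M B \<Longrightarrow> h \<in> homs B M \<Longrightarrow> pairing M h f = (\<Sum>t<s. pairing M h (j t) * pairing M (k t) f)"
    "c' = (\<Sum>t<s. pairing M (k t) (j t))" using B by (rule has_multE) blast
  note e = b[unfolded biproduct_def] and cb = biproduct_carrier[OF b]
  have iA: "iA \<in> homs A X" and iB: "iB \<in> homs B X" and pA: "pA \<in> homs X A" and pB: "pB \<in> homs X B" using e by auto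
  define I where "I t = (if t < r then iA * i t else iB * j (t - r))" for t
  define P where "P t = (if t < r then p t * pA else k (t - r) * pB)" for t
  have split: "pairing M h f = pairing M (h * iA) (pA * f) + pairing M (h * iB) (pB * f)"
    if f: "f \<in> homs M X" and h: "h \<in> homs X M" for f h
  proof -
    note cf = homs_carrier[OF f] homs_carrier[OF h]
    have "h * f = h * ((iA * pA + iB * pB) * f)" using e cf by simp
    also have "\<dots> = h * iA * (pA * f) + h * iB * (pB * f)" using cb cf by (simp add: mat_dist mat_assoc)
    finally show ?thesis unfolding pairing_def using cb cf by (simp add: tr_add add_divide_distrib)
  qed
  have asc: "pairing M (h * u) v = pairing M h (u * v)"
    if "h \<in> homs Z M" "u \<in> homs W Z" "v \<in> homs M W" for h u v Z W
    unfolding pairing_def using that[THEN homs_carrier] by (simp add: mat_assoc)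
  show ?thesis
  proof (rule has_multI[of "r + s" I M X P])
    fix t assume t: "t < r + s"
    show "I t \<in> homs M X" "P t \<in> homs X M"
      using t 1(1,2)[of t] 2(1,2)[of "t - r"] homs_comp[OF M(1,3,2) _ iA] homs_comp[OF M(1,4,2) _ iB]
        homs_comp[OF M(2,3,1) pA] homs_comp[OF M(2,4,1) pB] by (auto simp: I_def P_def)
  next
    fix f h assume f: "f \<in> homs M X" and h: "h \<in> homs X M"
    have hA: "h * iA \<in> homs A M" "h * iB \<in> homs B M" "pA * f \<in> homs M A" "pB * f \<in> homs M B"
      using homs_comp[OF M(3,2,1) iA h] homs_comp[OF M(4,2,1) iB h] homs_comp[OF M(1,2,3) f pA] homs_comp[OF M(1,2,4) f pB] by auto
    have "pairing M (h * iA) (pA * f) = (\<Sum>t<r. pairing M h (I t) * pairing M (P t) f)"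
      unfolding 1(3)[OF hA(3,1)]
      by (intro sum.cong refl) (simp add: I_def P_def asc[OF h iA 1(1)] asc[OF 1(2) pA f])
    moreover have "pairing M (h * iB) (pB * f) = (\<Sum>t<s. pairing M h (I (r + t)) * pairing M (P (r + t)) f)"
      unfolding 2(3)[OF hA(4,2)]
      by (intro sum.cong refl) (simp add: I_def P_def asc[OF h iB 2(1)] asc[OF 2(2) pB f])
    ultimately show "pairing M h f = (\<Sum>t<r + s. pairing M h (I t) * pairing M (P t) f)"
      unfolding split[OF f h] sum_lessThan_append by simp
  next
    have "pairing M (p t * pA) (iA * i t) = pairing M (p t) (i t)" if "t < r" for t
    proof -
      note cc = homs_carrier[OF 1(1)[OF that]] homs_carrier[OF 1(2)[OF that]]
      have "p t * pA * (iA * i t) = p t * (pA * iA) * i t" using cb cc by (simp add: mat_assoc)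
      then show ?thesis using e cc by (simp add: pairing_def)
    qed
    moreover have "pairing M (k t * pB) (iB * j t) = pairing M (k t) (j t)" if "t < s" for t
    proof -
      note cc = homs_carrier[OF 2(1)[OF that]] homs_carrier[OF 2(2)[OF that]]
      have "k t * pB * (iB * j t) = k t * (pB * iB) * j t" using cb cc by (simp add: mat_assoc)
      then show ?thesis using e cc by (simp add: pairing_def)
    qed
    ultimately show "c + c' = (\<Sum>t<r + s. pairing M (P t) (I t))"
      unfolding sum_lessThan_append 1(4) 2(4) by (simp add: I_def P_def)
  qed
qed

text \<open>A stable isomorphism carries one factorisation to the other. The round trip differs from
  the identity by a map through a projective, which the pairing does not see by
  \<open>nonproj_trace\<close>.\<close>

lemma has_mult_stable:
  assumes M: "nonproj_indec M" and X: "is_module X" "is_module X'" and s: "stable_iso X X'" and c: "has_mult M X' c"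
  shows "has_mult M X c"
proof -
  note Mm = indec_module(1)[OF conjunct1[OF M]]
  obtain F F' where F: "F \<in> homs X X'" "F' \<in> homs X' X" "F' * F - 1\<^sub>m (mdim X) \<in> proj_homs X X"
      "F * F' - 1\<^sub>m (mdim X') \<in> proj_homs X' X'"
    using s unfolding stable_iso_def by blast
  obtain r i p where 1: "\<And>t. t < (r::nat) \<Longrightarrow> i t \<in> homs M X'" "\<And>t. t < r \<Longrightarrow> p t \<in> homs X' M"
    "\<And>f h. f \<in> homs M X' \<Longrightarrow> h \<in> homs X' M \<Longrightarrow> pairing M h f = (\<Sum>t<r. pairing M h (i t) * pairing M (p t) f)"
    "c = (\<Sum>t<r. pairing M (p t) (i t))" using c by (rule has_multE) blast
  have inv: "pairing M (h * U') (U * f) = pairing M h f"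
    if f: "f \<in> homs M Z" and h: "h \<in> homs Z M" and Z: "is_module Z" "is_module W" and U: "U \<in> homs Z W" "U' \<in> homs W Z"
      "U' * U - 1\<^sub>m (mdim Z) \<in> proj_homs Z Z" for f h U U' Z W
  proof -
    note cc = homs_carrier[OF f] homs_carrier[OF h] homs_carrier[OF U(1)] homs_carrier[OF U(2)]
    have t: "tr (h * (U' * U - 1\<^sub>m (mdim Z)) * f) = 0"
      by (rule nonproj_trace[OF M proj_homs_comp[OF Mm Z(1) Z(1) Mm U(3) h f]])
    have "h * (U' * U - 1\<^sub>m (mdim Z)) * f = h * U' * (U * f) - h * f"
      using cc by (simp add: mat_diff_left mat_diff_right mat_assoc)
    then have "tr (h * U' * (U * f)) = tr (h * f)" using t cc by (simp add: tr_diff)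
    then show ?thesis by (simp add: pairing_def)
  qed
  have asc: "pairing M (h * u) v = pairing M h (u * v)"
    if "h \<in> homs Z M" "u \<in> homs W Z" "v \<in> homs M W" for h u v Z W
    unfolding pairing_def using that[THEN homs_carrier] by (simp add: mat_assoc)
  show ?thesis
  proof (rule has_multI[of r "\<lambda>t. F' * i t" M X "\<lambda>t. p t * F"])
    show "F' * i t \<in> homs M X" "p t * F \<in> homs X M" if "t < r" for t
      using homs_comp[OF Mm X(2,1) 1(1)[OF that] F(2)] homs_comp[OF X Mm F(1) 1(2)[OF that]] by auto
    fix f h assume f: "f \<in> homs M X" and h: "h \<in> homs X M"
    have "pairing M h f = pairing M (h * F') (F * f)" using inv[OF f h X F(1-3)] by simp
    also have "\<dots> = (\<Sum>t<r. pairing M (h * F') (i t) * pairing M (p t) (F * f))"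
      by (rule 1(3)[OF homs_comp[OF Mm X f F(1)] homs_comp[OF X(2,1) Mm F(2) h]])
    also have "\<dots> = (\<Sum>t<r. pairing M h (F' * i t) * pairing M (p t * F) f)"
      by (intro sum.cong refl) (simp add: asc[OF h F(2) 1(1)] asc[OF 1(2) F(1) f])
    finally show "pairing M h f = (\<Sum>t<r. pairing M h (F' * i t) * pairing M (p t * F) f)" .
  next
    show "c = (\<Sum>t<r. pairing M (p t * F) (F' * i t))"
      unfolding 1(4) using inv[OF 1(1) 1(2) X(2,1) F(2,1,4)] by (intro sum.cong refl) simp
  qed
qed

lemma has_mult_dim_0:
  assumes X: "is_module X" "mdim X = 0"
  shows "has_mult M X 0"
proof (rule has_multI[of 0 "\<lambda>_. 1\<^sub>m 0" M X "\<lambda>_. 1\<^sub>m 0"])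
  fix f h assume f: "f \<in> homs M X" "h \<in> homs X M"
  have "h * f = 0\<^sub>m (mdim M) (mdim M)"
    using homs_carrier[OF f(1)] homs_carrier[OF f(2)] X(2) by (intro eq_matI) (auto simp: scalar_prod_def)
  then show "pairing M h f = (\<Sum>t<0::nat. pairing M h (1\<^sub>m 0) * pairing M (1\<^sub>m 0) f)" by (simp add: pairing_def)
qed auto

text \<open>On the endomorphisms of \<open>M\<close> the form is the product of the residues, hence
  of rank one with the identity as factor on both sides. If \<open>N\<close> is not isomorphic to
  \<open>M\<close>, all composites have trace zero by \<open>indec_iso_if_trace\<close>.\<close>

lemma has_mult_indec:
  assumes M: "nonproj_indec M" and N: "indecomposable N"
  shows "has_mult M N (if mod_iso M N then 1 else 0)"
proof -
  note Mi = conjunct1[OF M] and Mm = indec_module[OF conjunct1[OF M]] and Nm = indec_module[OF N]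
  have MM: "has_mult M M 1"
  proof (rule has_multI[of 1 "\<lambda>_. 1\<^sub>m (mdim M)" M M "\<lambda>_. 1\<^sub>m (mdim M)"])
    fix f h assume f: "f \<in> homs M M" and h: "h \<in> homs M M"
    show "pairing M h f = (\<Sum>t<1::nat. pairing M h (1\<^sub>m (mdim M)) * pairing M (1\<^sub>m (mdim M)) f)"
      using indec_trace_mult[OF Mi h f] homs_carrier[OF f] homs_carrier[OF h] by (simp add: pairing_def)
  qed (use Mm homs_one in \<open>auto simp: pairing_def\<close>)
  show ?thesis
  proof (cases "mod_iso M N")
    case True
    then have "stable_iso N M" using stable_iso_mod_iso[OF Nm(1) Mm(1) mod_iso_sym] by simp
    then show ?thesis using True has_mult_stable[OF M Nm(1) Mm(1) _ MM] by simp
  next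
    case False
    then show ?thesis
      using indec_iso_if_trace[OF Mi N] by (intro has_multI[of 0]) (auto simp: pairing_def)
  qed
qed

definition mult :: "'g hopf_mod \<Rightarrow> 'g hopf_mod \<Rightarrow> nat" where
  "mult M X = (THE k. has_mult M X (of_nat k))"

lemma mult_eqI: "has_mult M X (of_nat k) \<Longrightarrow> mult M X = k"
  unfolding mult_def by (rule the_equality) (auto dest: has_mult_unique)

text \<open>The number in \<open>has_mult\<close> is a priori complex. Along
  \<open>module_induct\<close> it is built up from zeros and ones, so it is a natural
  number.\<close>

lemma has_mult_mult:
  assumes M: "nonproj_indec M" and X: "is_module X"
  shows "has_mult M X (of_nat (mult M X))"
proof -
  note Mm = indec_module(1)[OF conjunct1[OF M]]
  from X have "\<exists>k. has_mult M X (of_nat k)"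
  proof (induction rule: module_induct)
    case (zero X)
    then show ?case using has_mult_dim_0[of X M] by (intro exI[of _ 0]) simp
  next
    case (indecomposable X)
    then show ?case using has_mult_indec[OF M, of X]
      by (intro exI[of _ "if mod_iso M X then 1 else 0"]) (auto split: if_splits)
  next
    case (sum X A B)
    then obtain k l where "has_mult M A (of_nat k)" "has_mult M B (of_nat l)" by blast
    moreover obtain i p i' p' where "biproduct (direct_sum A B) A B i p i' p'" using direct_sum_biproduct sum.hyps by blast
    ultimately have "has_mult M (direct_sum A B) (of_nat k + of_nat l)"
      using has_mult_biproduct Mm sum.hyps direct_sum_module(1) by blast
    then have "has_mult M X (of_nat (k + l))"
      using has_mult_stable[OF M sum.hyps(1) direct_sum_module(1)[OF sum.hyps(2,3)]]
        stable_iso_mod_iso[OF sum.hyps(1) direct_sum_module(1)[OF sum.hyps(2,3)] sum.hyps(4)] by simp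
    then show ?case by blast
  qed
  then show ?thesis using mult_eqI by blast
qed

lemma mult_direct_sum:
  assumes M: "nonproj_indec M" and A: "is_module A" and B: "is_module B"
  shows "mult M (direct_sum A B) = mult M A + mult M B"
proof -
  note Mm = indec_module(1)[OF conjunct1[OF M]]
  obtain i p i' p' where "biproduct (direct_sum A B) A B i p i' p'" using direct_sum_biproduct[OF A B] .
  then show ?thesis
    using has_mult_biproduct[OF Mm direct_sum_module(1)[OF A B] A B _ has_mult_mult[OF M A] has_mult_mult[OF M B]]
    by (intro mult_eqI) simp
qed

lemma mult_stable: "nonproj_indec M \<Longrightarrow> is_module X \<Longrightarrow> is_module X' \<Longrightarrow> stable_iso X X' \<Longrightarrow> mult M X = mult M X'"
  by (rule mult_eqI) (rule has_mult_stable[OF _ _ _ _ has_mult_mult])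

lemma mult_indec: "nonproj_indec M \<Longrightarrow> indecomposable N \<Longrightarrow> mult M N = (if mod_iso M N then 1 else 0)"
  using has_mult_indec[of M N] by (intro mult_eqI) (auto split: if_splits)

subsection \<open>Relative traces\<close>

lemma yy_pow_gr:
  assumes M: "is_module M" and h: "h \<in> carrier G"
  shows "yy M ^\<^sub>m j * gr M h = \<chi> h ^ j \<cdot>\<^sub>m (gr M h * yy M ^\<^sub>m j)"
proof (induction j)
  case (Suc j)
  note c = yy_carrier[OF M] gr_carrier[OF M h] pow_carrier_mat[OF yy_carrier[OF M], of j]
  have "yy M ^\<^sub>m Suc j * gr M h = yy M ^\<^sub>m j * (yy M * gr M h)" using c by (simp add: mat_assoc)
  also have "\<dots> = \<chi> h \<cdot>\<^sub>m ((yy M ^\<^sub>m j * gr M h) * yy M)" unfolding yy_gr[OF M h] using c by (simp add: mat_assoc mat_smult_right)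
  also have "\<dots> = \<chi> h ^ Suc j \<cdot>\<^sub>m (gr M h * yy M ^\<^sub>m Suc j)" unfolding Suc using c by (simp add: mat_assoc mat_smult_left smult_smult_mat)
  finally show ?case .
qed (use M h in auto)

text \<open>The weight opposite to that of y^j: a product of \<open>T\<close> with j factors y,
  distributed on both sides, commutes with G.\<close>

definition skew :: "nat \<Rightarrow> 'g hopf_mod \<Rightarrow> 'g hopf_mod \<Rightarrow> complex mat \<Rightarrow> bool" where
  "skew j M N T \<longleftrightarrow> T \<in> carrier_mat (mdim N) (mdim M) \<and>
     (\<forall>h\<in>carrier G. T * gr M h = \<chi> (inv h) ^ j \<cdot>\<^sub>m (gr N h * T))"

text \<open>The projection of linear maps onto those of the weight required by \<open>skew\<close>,
  scaled by card G.\<close>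

definition average :: "nat \<Rightarrow> 'g hopf_mod \<Rightarrow> 'g hopf_mod \<Rightarrow> complex mat \<Rightarrow> complex mat" where
  "average j M N S = msum (mdim N) (mdim M) (\<lambda>h. \<chi> h ^ j \<cdot>\<^sub>m (gr N (inv h) * S * gr M h)) (carrier G)"

lemma average_skew:
  assumes M: "is_module M" and N: "is_module N" and S: "S \<in> carrier_mat (mdim N) (mdim M)"
  shows "skew j M N (average j M N S)"
  unfolding skew_def
proof (intro conjI ballI)
  show "average j M N S \<in> carrier_mat (mdim N) (mdim M)" by (simp add: average_def)
  fix k assume k: "k \<in> carrier G"
  have c: "gr M h \<in> carrier_mat (mdim M) (mdim M)" "gr N h \<in> carrier_mat (mdim N) (mdim N)" if "h \<in> carrier G" for h
    using that M N by auto
  have cc: "\<chi> h ^ j \<cdot>\<^sub>m (gr N (inv h) * S * gr M h) \<in> carrier_mat (mdim N) (mdim M)" if "h \<in> carrier G" for h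
    using that S c[OF that] c[OF inv_closed[OF that]] by auto
  have bij: "bij_betw (\<lambda>h. h \<otimes> inv k) (carrier G) (carrier G)"
    using k by (intro bij_betwI[of _ _ _ "\<lambda>h. h \<otimes> k"]) (auto simp: m_assoc)
  have "average j M N S * gr M k = msum (mdim N) (mdim M) (\<lambda>h. \<chi> h ^ j \<cdot>\<^sub>m (gr N (inv h) * S * gr M h) * gr M k) (carrier G)"
    unfolding average_def using c[OF k] cc by (subst msum_mult_right) auto
  also have "\<dots> = msum (mdim N) (mdim M) (\<lambda>h. \<chi> (h \<otimes> inv k) ^ j \<cdot>\<^sub>m (gr N (inv (h \<otimes> inv k)) * S * gr M (h \<otimes> inv k)) * gr M k) (carrier G)"
    by (rule msum_reindex[OF bij])
  also have "\<dots> = msum (mdim N) (mdim M) (\<lambda>h. \<chi> (inv k) ^ j \<cdot>\<^sub>m (gr N k * (\<chi> h ^ j \<cdot>\<^sub>m (gr N (inv h) * S * gr M h)))) (carrier G)"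
  proof (rule msum_cong)
    fix h assume h: "h \<in> carrier G"
    have hk: "h \<otimes> inv k \<in> carrier G" "inv (h \<otimes> inv k) = k \<otimes> inv h" using h k by (auto simp: inv_mult_group)
    have "gr M (h \<otimes> inv k) * gr M k = gr M h" using M h k by (simp add: gr_mult m_assoc)
    moreover have "gr N (k \<otimes> inv h) = gr N k * gr N (inv h)" using N h k by (simp add: gr_mult)
    moreover have "\<chi> (h \<otimes> inv k) ^ j \<cdot>\<^sub>m (gr N (inv (h \<otimes> inv k)) * S * gr M (h \<otimes> inv k)) * gr M k =
      \<chi> (h \<otimes> inv k) ^ j \<cdot>\<^sub>m (gr N (k \<otimes> inv h) * S * (gr M (h \<otimes> inv k) * gr M k))"
      using c[OF k] c[OF hk(1)] c[OF inv_closed[OF hk(1)]] S unfolding hk(2) by (simp add: mat_assoc mat_smult_left)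
    ultimately show "\<chi> (h \<otimes> inv k) ^ j \<cdot>\<^sub>m (gr N (inv (h \<otimes> inv k)) * S * gr M (h \<otimes> inv k)) * gr M k =
      \<chi> (inv k) ^ j \<cdot>\<^sub>m (gr N k * (\<chi> h ^ j \<cdot>\<^sub>m (gr N (inv h) * S * gr M h)))"
      using c[OF k] c[OF h] c[OF inv_closed[OF h]] S h k
      by (simp add: \<chi>_mult mat_assoc mat_smult_right smult_smult_mat power_mult_distrib mult.commute)
  qed auto
  also have "\<dots> = \<chi> (inv k) ^ j \<cdot>\<^sub>m (gr N k * average j M N S)"
    unfolding average_def using c[OF k] cc by (subst msum_mult_left, simp, simp, subst msum_smult) auto
  finally show "average j M N S * gr M k = \<chi> (inv k) ^ j \<cdot>\<^sub>m (gr N k * average j M N S)" .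
qed

lemma chi_inv_pow: "h \<in> carrier G \<Longrightarrow> \<chi> h ^ j * \<chi> (inv h) ^ j = 1"
  using chi_inv[of h] by (simp add: power_mult_distrib[symmetric])

text \<open>Formally the derivative of y^l in the direction \<open>T\<close>. It is a relative trace
  from maps of weight l - 1 over G to maps over the whole algebra.\<close>

definition rel_trace :: "nat \<Rightarrow> 'g hopf_mod \<Rightarrow> 'g hopf_mod \<Rightarrow> complex mat \<Rightarrow> complex mat" where
  "rel_trace l M N T = msum (mdim N) (mdim M) (\<lambda>i. yy N ^\<^sub>m i * T * yy M ^\<^sub>m (l - Suc i)) {..<l}"

lemma rel_trace_hom:
  assumes M: "is_module M" and N: "is_module N" and T: "skew (l - 1) M N T"
    and y: "yy N ^\<^sub>m l * T = T * yy M ^\<^sub>m l" and l: "0 < l"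
  shows "rel_trace l M N T \<in> homs M N"
proof -
  have Tc: "T \<in> carrier_mat (mdim N) (mdim M)" using T by (simp add: skew_def)
  have pM: "yy M ^\<^sub>m i \<in> carrier_mat (mdim M) (mdim M)" and pN: "yy N ^\<^sub>m i \<in> carrier_mat (mdim N) (mdim N)" for i
    by (rule pow_carrier_mat[OF yy_carrier[OF M]], rule pow_carrier_mat[OF yy_carrier[OF N]])
  note c = Tc pM pN yy_carrier[OF M] yy_carrier[OF N]
  have dp [simp]: "dim_row (yy M ^\<^sub>m i) = mdim M" "dim_col (yy M ^\<^sub>m i) = mdim M"
    "dim_row (yy N ^\<^sub>m i) = mdim N" "dim_col (yy N ^\<^sub>m i) = mdim N" for i
    using pM[of i] pN[of i] by auto
  have tc: "yy N ^\<^sub>m i * T * yy M ^\<^sub>m j \<in> carrier_mat (mdim N) (mdim M)" for i j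
    using c by (intro carrier_matI) (auto simp del: pow_mat_dim)
  define a where "a i = yy N ^\<^sub>m i * T * yy M ^\<^sub>m (l - i)" for i
  have ac: "a i \<in> carrier_mat (mdim N) (mdim M)" for i unfolding a_def by (rule tc)
  have gr: "rel_trace l M N T * gr M h = gr N h * rel_trace l M N T" if h: "h \<in> carrier G" for h
  proof -
    note ch = gr_carrier[OF M h] gr_carrier[OF N h]
    have "yy N ^\<^sub>m i * T * yy M ^\<^sub>m (l - Suc i) * gr M h = gr N h * (yy N ^\<^sub>m i * T * yy M ^\<^sub>m (l - Suc i))" if i: "i < l" for i
    proof -
      have "yy N ^\<^sub>m i * T * yy M ^\<^sub>m (l - Suc i) * gr M h = yy N ^\<^sub>m i * T * (yy M ^\<^sub>m (l - Suc i) * gr M h)"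
        using c ch by (simp add: mat_assoc del: pow_mat_dim)
      also have "\<dots> = \<chi> h ^ (l - Suc i) \<cdot>\<^sub>m (yy N ^\<^sub>m i * (T * gr M h) * yy M ^\<^sub>m (l - Suc i))"
        unfolding yy_pow_gr[OF M h] using c ch by (simp add: mat_assoc mat_smult_right del: pow_mat_dim)
      also have "T * gr M h = \<chi> (inv h) ^ (l - 1) \<cdot>\<^sub>m (gr N h * T)" using T h by (simp add: skew_def)
      also have "yy N ^\<^sub>m i * (\<chi> (inv h) ^ (l - 1) \<cdot>\<^sub>m (gr N h * T)) * yy M ^\<^sub>m (l - Suc i) =
          \<chi> (inv h) ^ (l - 1) \<cdot>\<^sub>m ((yy N ^\<^sub>m i * gr N h) * T * yy M ^\<^sub>m (l - Suc i))"
        using c ch by (simp add: mat_assoc mat_smult_right mat_smult_left del: pow_mat_dim)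
      also have "\<dots> = (\<chi> (inv h) ^ (l - 1) * \<chi> h ^ i) \<cdot>\<^sub>m (gr N h * (yy N ^\<^sub>m i * T * yy M ^\<^sub>m (l - Suc i)))"
        unfolding yy_pow_gr[OF N h] using c ch by (simp add: mat_assoc mat_smult_right mat_smult_left smult_smult_mat del: pow_mat_dim)
      also have "\<chi> h ^ (l - Suc i) \<cdot>\<^sub>m \<dots> = (\<chi> h ^ (l - Suc i + i) * \<chi> (inv h) ^ (l - 1)) \<cdot>\<^sub>m (gr N h * (yy N ^\<^sub>m i * T * yy M ^\<^sub>m (l - Suc i)))"
        by (simp add: smult_smult_mat power_add mult_ac)
      \<comment> \<open>Each summand contains l - 1 factors y; the character they produce is
        cancelled by the weight of \<open>T\<close>.\<close>
      also have "l - Suc i + i = l - 1" using i by simp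
      finally show ?thesis by (simp add: chi_inv_pow[OF h])
    qed
    define A where "A i = yy N ^\<^sub>m i * T * yy M ^\<^sub>m (l - Suc i)" for i
    have Ac: "A i \<in> carrier_mat (mdim N) (mdim M)" for i unfolding A_def by (rule tc)
    have "msum (mdim N) (mdim M) A {..<l} * gr M h = msum (mdim N) (mdim M) (\<lambda>i. A i * gr M h) {..<l}"
      using ch Ac by (subst msum_mult_right) auto
    also have "\<dots> = msum (mdim N) (mdim M) (\<lambda>i. gr N h * A i) {..<l}"
      using \<open>\<And>i. i < l \<Longrightarrow> _\<close> by (intro msum_cong) (auto simp: A_def)
    also have "\<dots> = gr N h * msum (mdim N) (mdim M) A {..<l}"
      using ch Ac by (subst msum_mult_left) auto
    finally show ?thesis unfolding rel_trace_def A_def .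
  qed
  have "rel_trace l M N T * yy M = msum (mdim N) (mdim M) a {..<l}"
    unfolding rel_trace_def
  proof (subst msum_mult_right)
    show "msum (mdim N) (dim_col (yy M)) (\<lambda>i. yy N ^\<^sub>m i * T * yy M ^\<^sub>m (l - Suc i) * yy M) {..<l} = msum (mdim N) (mdim M) a {..<l}"
    proof (rule msum_cong)
      fix i assume "i \<in> {..<l}"
      then have "l - i = Suc (l - Suc i)" by simp
      then show "yy N ^\<^sub>m i * T * yy M ^\<^sub>m (l - Suc i) * yy M = a i"
        unfolding a_def using c by (simp add: mat_assoc del: pow_mat_dim)
    qed (use M in auto)
  qed (use M tc in auto)
  moreover have "yy N * rel_trace l M N T = msum (mdim N) (mdim M) (\<lambda>i. a (Suc i)) {..<l}"
    unfolding rel_trace_def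
  proof (subst msum_mult_left)
    show "msum (dim_row (yy N)) (mdim M) (\<lambda>i. yy N * (yy N ^\<^sub>m i * T * yy M ^\<^sub>m (l - Suc i))) {..<l} = msum (mdim N) (mdim M) (\<lambda>i. a (Suc i)) {..<l}"
    proof (rule msum_cong)
      fix i assume "i \<in> {..<l}"
      have "yy N * (yy N ^\<^sub>m i * T * yy M ^\<^sub>m (l - Suc i)) = (yy N * yy N ^\<^sub>m i) * T * yy M ^\<^sub>m (l - Suc i)"
        using c by (simp add: mat_assoc del: pow_mat_dim)
      then show "yy N * (yy N ^\<^sub>m i * T * yy M ^\<^sub>m (l - Suc i)) = a (Suc i)"
        unfolding a_def pow_mat_Suc_left[OF yy_carrier[OF N]] .
    qed (use N in auto)
  qed (use N tc in auto)
  moreover have "msum (mdim N) (mdim M) (\<lambda>i. a (Suc i)) {..<l} = msum (mdim N) (mdim M) a {..<l}"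
  proof (rule eq_matI)
    fix r s assume "r < dim_row (msum (mdim N) (mdim M) a {..<l})" "s < dim_col (msum (mdim N) (mdim M) a {..<l})"
    then have rs: "r < mdim N" "s < mdim M" by auto
    \<comment> \<open>The hypothesis on y^l says that the telescoping sum closes up: its last and
      first terms agree.\<close>
    have al: "a l = a 0" unfolding a_def using c y by simp
    have "(\<Sum>i<l. a (Suc i) $$ (r, s) - a i $$ (r, s)) = a l $$ (r, s) - a 0 $$ (r, s)"
      by (rule sum_lessThan_telescope)
    then show "msum (mdim N) (mdim M) (\<lambda>i. a (Suc i)) {..<l} $$ (r, s) = msum (mdim N) (mdim M) a {..<l} $$ (r, s)"
      using rs by (simp add: msum_index sum_subtractf al)
  qed auto
  ultimately show ?thesis using gr M N by (simp add: homs_iff rel_trace_def)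
qed

text \<open>By cyclicity the right factor y^(l-1-i) of each summand can be brought around and past
  \<open>K\<close> at the cost of c^(l-1-i). All summands then have the same trace, and the costs
  add up to a geometric sum.\<close>

lemma rel_trace_trace:
  assumes M: "is_module M" and N: "is_module N" and T: "T \<in> carrier_mat (mdim N) (mdim M)"
    and K: "K \<in> carrier_mat (mdim M) (mdim N)" "yy M * K = c \<cdot>\<^sub>m (K * yy N)"
  shows "tr (K * rel_trace l M N T) = (\<Sum>i<l. c ^ i) * tr (K * yy N ^\<^sub>m (l - 1) * T)"
proof -
  have pM: "yy M ^\<^sub>m i \<in> carrier_mat (mdim M) (mdim M)" and pN: "yy N ^\<^sub>m i \<in> carrier_mat (mdim N) (mdim N)" for i
    by (rule pow_carrier_mat[OF yy_carrier[OF M]], rule pow_carrier_mat[OF yy_carrier[OF N]])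
  have dp [simp]: "dim_row (yy M ^\<^sub>m i) = mdim M" "dim_col (yy M ^\<^sub>m i) = mdim M"
    "dim_row (yy N ^\<^sub>m i) = mdim N" "dim_col (yy N ^\<^sub>m i) = mdim N" for i
    using pM[of i] pN[of i] by auto
  note cc = T K(1) yy_carrier[OF M] yy_carrier[OF N]
  have yK: "yy M ^\<^sub>m j * K = c ^ j \<cdot>\<^sub>m (K * yy N ^\<^sub>m j)" for j
  proof (induction j)
    case (Suc j)
    have "yy M ^\<^sub>m Suc j * K = yy M ^\<^sub>m j * (yy M * K)" using cc by (simp add: mat_assoc del: pow_mat_dim)
    also have "\<dots> = c \<cdot>\<^sub>m ((yy M ^\<^sub>m j * K) * yy N)" unfolding K(2) using cc by (simp add: mat_assoc mat_smult_right del: pow_mat_dim)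
    also have "\<dots> = c ^ Suc j \<cdot>\<^sub>m (K * yy N ^\<^sub>m Suc j)" unfolding Suc using cc by (simp add: mat_assoc mat_smult_left smult_smult_mat del: pow_mat_dim)
    finally show ?case .
  qed (use cc M N in auto)
  have tc: "yy N ^\<^sub>m i * T * yy M ^\<^sub>m j \<in> carrier_mat (mdim N) (mdim M)" for i j
    using cc by (intro carrier_matI) (auto simp del: pow_mat_dim)
  have one: "tr (K * (yy N ^\<^sub>m i * T * yy M ^\<^sub>m (l - Suc i))) = c ^ (l - Suc i) * tr (K * yy N ^\<^sub>m (l - 1) * T)" if i: "i < l" for i
  proof -
    have "tr (K * (yy N ^\<^sub>m i * T * yy M ^\<^sub>m (l - Suc i))) = tr ((K * yy N ^\<^sub>m i * T) * yy M ^\<^sub>m (l - Suc i))"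
      using cc by (simp add: mat_assoc del: pow_mat_dim)
    also have "\<dots> = tr (yy M ^\<^sub>m (l - Suc i) * (K * yy N ^\<^sub>m i * T))"
      using cc by (intro tr_mult_comm) (auto simp del: pow_mat_dim)
    also have "yy M ^\<^sub>m (l - Suc i) * (K * yy N ^\<^sub>m i * T) = (yy M ^\<^sub>m (l - Suc i) * K) * (yy N ^\<^sub>m i * T)"
      using cc by (simp add: mat_assoc del: pow_mat_dim)
    also have "\<dots> = c ^ (l - Suc i) \<cdot>\<^sub>m (K * (yy N ^\<^sub>m (l - Suc i) * yy N ^\<^sub>m i) * T)"
      unfolding yK using cc by (simp add: mat_assoc mat_smult_left del: pow_mat_dim)
    also have "yy N ^\<^sub>m (l - Suc i) * yy N ^\<^sub>m i = yy N ^\<^sub>m (l - 1)"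
      using pow_mat_add[OF yy_carrier[OF N], of "l - Suc i" i] i by simp
    finally show ?thesis using cc by (simp add: tr_smult del: pow_mat_dim)
  qed
  have Kc: "K * (yy N ^\<^sub>m i * T * yy M ^\<^sub>m (l - Suc i)) \<in> carrier_mat (mdim M) (mdim M)" for i
    by (rule mult_carrier_mat[OF K(1) tc])
  have "K * rel_trace l M N T = msum (mdim M) (mdim M) (\<lambda>i. K * (yy N ^\<^sub>m i * T * yy M ^\<^sub>m (l - Suc i))) {..<l}"
    unfolding rel_trace_def using msum_mult_left[of K "mdim N" "{..<l}" "\<lambda>i. yy N ^\<^sub>m i * T * yy M ^\<^sub>m (l - Suc i)" "mdim M"] K(1) tc
    by simp
  then have "tr (K * rel_trace l M N T) = (\<Sum>i<l. tr (K * (yy N ^\<^sub>m i * T * yy M ^\<^sub>m (l - Suc i))))"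
    using tr_msum[of "{..<l}" _ "mdim M", OF Kc] by simp
  also have "\<dots> = (\<Sum>i<l. c ^ (l - Suc i) * tr (K * yy N ^\<^sub>m (l - 1) * T))" by (simp add: one)
  also have "\<dots> = (\<Sum>i<l. c ^ (l - Suc i)) * tr (K * yy N ^\<^sub>m (l - 1) * T)" by (simp add: sum_distrib_right)
  also have "(\<Sum>i<l. c ^ (l - Suc i)) = (\<Sum>i<l. c ^ i)" by (rule sum.nat_diff_reindex)
  finally show ?thesis .
qed

text \<open>Conjugating \<open>K * yy N ^\<^sub>m j\<close> by a group element produces a character
  that cancels the one in \<open>average\<close>; so every term contributes the same trace as
  \<open>S\<close> itself.\<close>

lemma average_trace:
  assumes M: "is_module M" and N: "is_module N" and S: "S \<in> carrier_mat (mdim N) (mdim M)"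
    and K: "K \<in> carrier_mat (mdim M) (mdim N)" "\<And>h. h \<in> carrier G \<Longrightarrow> gr M h * K = K * gr N h"
  shows "tr (K * yy N ^\<^sub>m j * average j M N S) = of_nat (card (carrier G)) * tr (K * yy N ^\<^sub>m j * S)"
proof -
  define W where "W = yy N ^\<^sub>m j"
  define X where "X = K * W"
  have pN: "W \<in> carrier_mat (mdim N) (mdim N)" unfolding W_def by (rule pow_carrier_mat[OF yy_carrier[OF N]])
  have yW: "W * gr N h = \<chi> h ^ j \<cdot>\<^sub>m (gr N h * W)" if "h \<in> carrier G" for h
    unfolding W_def by (rule yy_pow_gr[OF N that])
  have X: "X \<in> carrier_mat (mdim M) (mdim N)" unfolding X_def by (rule mult_carrier_mat[OF K(1) pN])
  have one: "tr (X * (\<chi> h ^ j \<cdot>\<^sub>m (gr N (inv h) * S * gr M h))) = tr (X * S)" if h: "h \<in> carrier G" for h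
  proof -
    note c = gr_carrier[OF M h] gr_carrier[OF N h] gr_carrier[OF M inv_closed[OF h]] gr_carrier[OF N inv_closed[OF h]]
    have gX: "gr M h * X = K * gr N h * W" unfolding X_def K(2)[OF h, symmetric] using c K(1) pN by (simp add: mat_assoc)
    have "gr M h * X * gr N (inv h) = K * (gr N h * (W * gr N (inv h)))" unfolding gX using c K(1) pN by (simp add: mat_assoc)
    also have "\<dots> = \<chi> (inv h) ^ j \<cdot>\<^sub>m (K * ((gr N h * gr N (inv h)) * W))"
      unfolding yW[OF inv_closed[OF h]] using c K(1) pN by (simp add: mat_assoc mat_smult_right)
    finally have e: "gr M h * X * gr N (inv h) = \<chi> (inv h) ^ j \<cdot>\<^sub>m X"
      unfolding gr_inv(1)[OF N h] X_def using pN by simp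
    have "tr (X * (\<chi> h ^ j \<cdot>\<^sub>m (gr N (inv h) * S * gr M h))) = \<chi> h ^ j * tr ((X * gr N (inv h) * S) * gr M h)"
      using c S X by (simp add: mat_assoc mat_smult_right tr_smult)
    also have "tr ((X * gr N (inv h) * S) * gr M h) = tr (gr M h * (X * gr N (inv h) * S))"
      using c S X by (intro tr_mult_comm) auto
    also have "gr M h * (X * gr N (inv h) * S) = gr M h * X * gr N (inv h) * S" using c S X by (simp add: mat_assoc)
    also have "\<dots> = \<chi> (inv h) ^ j \<cdot>\<^sub>m (X * S)" unfolding e using S X by (simp add: mat_smult_left)
    also have "tr \<dots> = \<chi> (inv h) ^ j * tr (X * S)" using S X by (simp add: tr_smult)
    finally show ?thesis using chi_inv_pow[OF h, of j] by (simp add: mult.assoc[symmetric])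
  qed
  have c: "gr M h \<in> carrier_mat (mdim M) (mdim M)" "gr N h \<in> carrier_mat (mdim N) (mdim N)" if "h \<in> carrier G" for h
    using that M N by auto
  have cc: "\<chi> h ^ j \<cdot>\<^sub>m (gr N (inv h) * S * gr M h) \<in> carrier_mat (mdim N) (mdim M)" if "h \<in> carrier G" for h
    using that S c[OF that] c[OF inv_closed[OF that]] by auto
  have Xc: "X * (\<chi> h ^ j \<cdot>\<^sub>m (gr N (inv h) * S * gr M h)) \<in> carrier_mat (mdim M) (mdim M)" if "h \<in> carrier G" for h
    by (rule mult_carrier_mat[OF X cc[OF that]])
  have "X * average j M N S = msum (mdim M) (mdim M) (\<lambda>h. X * (\<chi> h ^ j \<cdot>\<^sub>m (gr N (inv h) * S * gr M h))) (carrier G)"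
    unfolding average_def
    using msum_mult_left[of X "mdim N" "carrier G" "\<lambda>h. \<chi> h ^ j \<cdot>\<^sub>m (gr N (inv h) * S * gr M h)" "mdim M"] X cc by simp
  then have "tr (X * average j M N S) = (\<Sum>h\<in>carrier G. tr (X * (\<chi> h ^ j \<cdot>\<^sub>m (gr N (inv h) * S * gr M h))))"
    using tr_msum[of "carrier G" _ "mdim M", OF Xc] by simp
  also have "\<dots> = of_nat (card (carrier G)) * tr (X * S)" by (simp add: one)
  finally show ?thesis by (simp add: X_def W_def)
qed

lemma card_G_pos: "(of_nat (card (carrier G)) :: complex) \<noteq> 0"
  using finite_G one_closed by (auto simp: card_eq_0_iff)

text \<open>The power y^n acts as g^n - 1, and a skew map commutes with g^n because \<chi>(g^n) =
  q^n = 1.\<close>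

lemma skew_pow_n:
  assumes M: "is_module M" and N: "is_module N" and T: "skew (n - 1) M N T"
  shows "yy N ^\<^sub>m n * T = T * yy M ^\<^sub>m n"
proof -
  have gn: "g [^] n \<in> carrier G" using g_closed by simp
  have Tc: "T \<in> carrier_mat (mdim N) (mdim M)" using T by (simp add: skew_def)
  have "\<chi> (g [^] m) = \<chi> g ^ m" for m :: nat
    using g_closed by (induction m) (auto simp: \<chi>_one \<chi>_mult mult.commute)
  then have "\<chi> (g [^] n) = 1" using q_pow_n by simp
  then have "\<chi> (inv (g [^] n)) = 1" using chi_inv[OF gn] by simp
  then have "T * gr M (g [^] n) = gr N (g [^] n) * T" using T gn by (simp add: skew_def)
  then show ?thesis unfolding yy_pow[OF M] yy_pow[OF N] using Tc gr_carrier[OF M gn] gr_carrier[OF N gn]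
    by (simp add: mat_diff_left mat_diff_right)
qed

text \<open>Produces module maps that the trace can see. By \<open>rel_trace_trace\<close> and
  \<open>average_trace\<close>, the trace of \<open>K\<close> against the averaged map is a nonzero
  multiple of the trace of \<open>K * yy N ^\<^sub>m (l - 1)\<close> against the linear map one
  starts from, and a matrix unit picks out a nonzero entry there. It is applied with
  \<open>K\<close> the identity or a module map, where c = 1, and with \<open>K\<close> the action
  of g, where c = q. The matrix unit stays explicit in the conclusion because its position becomes
  an index of the biorthogonal functions.\<close>

lemma detecting_hom:
  assumes M: "is_module M" and N: "is_module N" and l: "0 < l"
    and y: "l = n \<or> yy M ^\<^sub>m l = 0\<^sub>m (mdim M) (mdim M) \<and> yy N ^\<^sub>m l = 0\<^sub>m (mdim N) (mdim N)"
    and K: "K \<in> carrier_mat (mdim M) (mdim N)" "\<And>h. h \<in> carrier G \<Longrightarrow> gr M h * K = K * gr N h"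
      "yy M * K = c \<cdot>\<^sub>m (K * yy N)" "(\<Sum>i<l. c ^ i) \<noteq> 0" "K * yy N ^\<^sub>m (l - 1) \<noteq> 0\<^sub>m (mdim M) (mdim N)"
  obtains a b where "a < mdim M" "b < mdim N"
    "let T = average (l - 1) M N (mat (mdim N) (mdim M) (\<lambda>(k, i). if k = b \<and> i = a then 1 else 0))
     in rel_trace l M N T \<in> homs M N \<and> tr (K * rel_trace l M N T) \<noteq> 0"
proof -
  let ?X = "K * yy N ^\<^sub>m (l - 1)"
  have X: "?X \<in> carrier_mat (mdim M) (mdim N)" by (rule mult_carrier_mat[OF K(1) pow_carrier_mat[OF yy_carrier[OF N]]])
  obtain a b where ab: "a < mdim M" "b < mdim N" "?X $$ (a, b) \<noteq> 0"
    using K(5) carrier_matD[OF X] by (auto simp: mat_eq_iff simp del: index_mult_mat(1))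
  define S where "S = mat (mdim N) (mdim M) (\<lambda>(k, i). if k = b \<and> i = a then 1 else 0 :: complex)"
  have S: "S \<in> carrier_mat (mdim N) (mdim M)" by (simp add: S_def)
  define T where "T = average (l - 1) M N S"
  have T: "skew (l - 1) M N T" unfolding T_def by (rule average_skew[OF M N S])
  have Tc: "T \<in> carrier_mat (mdim N) (mdim M)" using T by (simp add: skew_def)
  have "yy N ^\<^sub>m l * T = T * yy M ^\<^sub>m l"
    using y skew_pow_n[OF M N] T Tc by auto
  then have h: "rel_trace l M N T \<in> homs M N" by (rule rel_trace_hom[OF M N T _ l])
  have "tr (?X * T) = of_nat (card (carrier G)) * tr (?X * S)"
    unfolding T_def by (rule average_trace[OF M N S K(1,2)])
  moreover have "tr (?X * S) = ?X $$ (a, b)"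
    unfolding S_def by (rule trace_form_unit[OF X ab(1,2)])
  ultimately have "tr (K * rel_trace l M N T) = (\<Sum>i<l. c ^ i) * (of_nat (card (carrier G)) * ?X $$ (a, b))"
    using rel_trace_trace[OF M N Tc K(1,3), of l] by presburger
  then have "tr (K * rel_trace l M N T) \<noteq> 0" using K(4) ab(3) card_G_pos by simp
  then show ?thesis using that[OF ab(1,2)] h unfolding T_def S_def Let_def by blast
qed

end

context nonnilpotent_group_datum
begin

subsection \<open>Non-projective indecomposable modules\<close>

text \<open>A criterion in the style of Higman: averaging is natural in module maps on both sides,
  so the averaged linear lift composes with \<open>E\<close> to \<open>F\<close> times the average
  of \<open>T\<close>, which is the identity up to card G.\<close>

lemma projective_criterion:
  assumes M: "is_module M" and T: "skew (n - 1) M M T" and one: "rel_trace n M M T = 1\<^sub>m (mdim M)"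
  shows "projective M"
proof (rule projectiveI[OF M])
  fix A B E F assume h: "is_module A" "is_module B" "E \<in> homs A B" "F \<in> homs M B" "surjective E"
  note c = homs_carrier[OF h(3)] homs_carrier[OF h(4)]
  obtain R where R: "R \<in> carrier_mat (mdim A) (mdim B)" "E * R = 1\<^sub>m (mdim B)"
    using surjective_iff[OF c(1)] h(5) by blast
  have Tc: "T \<in> carrier_mat (mdim M) (mdim M)" using T by (simp add: skew_def)
  have N: "0 < n" using n_ge_2 by simp
  text \<open>The linear lift \<open>R F T\<close> is averaged over \<open>G\<close> and then over the powers of \<open>y\<close>.\<close>
  define S where "S = R * F * T"
  have Sc: "S \<in> carrier_mat (mdim A) (mdim M)" using R(1) c(2) Tc by (simp add: S_def)
  define k where "k = (of_nat (card (carrier G)) :: complex)"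
  define L where "L = average (n - 1) M A S"
  have Lsk: "skew (n - 1) M A L" unfolding L_def by (rule average_skew[OF M h(1) Sc])
  have Lc: "L \<in> carrier_mat (mdim A) (mdim M)" using Lsk by (simp add: skew_def)
  have gAc: "gr A h \<in> carrier_mat (mdim A) (mdim A)" "gr M h \<in> carrier_mat (mdim M) (mdim M)" "gr B h \<in> carrier_mat (mdim B) (mdim B)"
    if "h \<in> carrier G" for h using that h M by auto
  \<comment> \<open>\<open>F * T\<close> is already skew, so the average over G just multiplies it
    by \<open>k\<close>; equivariance of \<open>E\<close> and \<open>F\<close> lets the group
    elements pass.\<close>
  have EL: "E * L = k \<cdot>\<^sub>m (F * T)"
  proof -
    have cc: "\<chi> h ^ (n - 1) \<cdot>\<^sub>m (gr A (inv h) * S * gr M h) \<in> carrier_mat (mdim A) (mdim M)" if "h \<in> carrier G" for h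
      using gAc[OF that] gAc[OF inv_closed[OF that]] Sc by auto
    have "E * L = msum (mdim B) (mdim M) (\<lambda>h. E * (\<chi> h ^ (n - 1) \<cdot>\<^sub>m (gr A (inv h) * S * gr M h))) (carrier G)"
      unfolding L_def average_def
      using msum_mult_left[of E "mdim A" "carrier G" "\<lambda>h. \<chi> h ^ (n - 1) \<cdot>\<^sub>m (gr A (inv h) * S * gr M h)" "mdim M"] c(1) cc by simp
    also have "\<dots> = msum (mdim B) (mdim M) (\<lambda>h. F * T) (carrier G)"
    proof (rule msum_cong)
      fix x assume x: "x \<in> carrier G"
      note g = gAc[OF x] gAc[OF inv_closed[OF x]]
      have E1: "E * gr A (inv x) = gr B (inv x) * E" using h(3) homs_iff[OF h(1,2)] x by blast
      have F1: "gr B (inv x) * F = F * gr M (inv x)" using h(4) homs_iff[OF M h(2)] x by auto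
      have ES: "E * S = F * T"
      proof -
        have "E * S = (E * R) * (F * T)" unfolding S_def using c R(1) Tc by (simp add: mat_assoc)
        then show ?thesis unfolding R(2) using c Tc by simp
      qed
      have "E * (\<chi> x ^ (n - 1) \<cdot>\<^sub>m (gr A (inv x) * S * gr M x)) = \<chi> x ^ (n - 1) \<cdot>\<^sub>m ((E * gr A (inv x)) * S * gr M x)"
        using c g Sc by (simp add: mat_assoc mat_smult_right)
      also have "(E * gr A (inv x)) * S * gr M x = gr B (inv x) * (E * S) * gr M x"
        unfolding E1 using c g Sc by (simp add: mat_assoc)
      also have "\<dots> = (gr B (inv x) * F) * (T * gr M x)" unfolding ES using c g Tc by (simp add: mat_assoc)
      also have "\<dots> = F * gr M (inv x) * (\<chi> (inv x) ^ (n - 1) \<cdot>\<^sub>m (gr M x * T))"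
        unfolding F1 using T x by (simp add: skew_def)
      also have "\<dots> = \<chi> (inv x) ^ (n - 1) \<cdot>\<^sub>m (F * (gr M (inv x) * gr M x) * T)"
        using c g Tc by (simp add: mat_assoc mat_smult_right)
      also have "\<dots> = \<chi> (inv x) ^ (n - 1) \<cdot>\<^sub>m (F * T)" unfolding gr_inv(2)[OF M x] using c Tc by simp
      finally show "E * (\<chi> x ^ (n - 1) \<cdot>\<^sub>m (gr A (inv x) * S * gr M x)) = F * T"
        using chi_inv_pow[OF x, of "n - 1"] by (simp add: smult_smult_mat)
    qed auto
    also have "\<dots> = k \<cdot>\<^sub>m (F * T)" unfolding k_def by (rule msum_const[OF finite_G]) (use c Tc in auto)
    finally show ?thesis .
  qed
  have lift: "rel_trace n M A L \<in> homs M A"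
    by (rule rel_trace_hom[OF M h(1) Lsk skew_pow_n[OF M h(1) Lsk] N])
  have "E * rel_trace n M A L = k \<cdot>\<^sub>m F"
  proof -
    have pA: "yy A ^\<^sub>m i \<in> carrier_mat (mdim A) (mdim A)" and pM: "yy M ^\<^sub>m i \<in> carrier_mat (mdim M) (mdim M)" for i
      by (rule pow_carrier_mat[OF yy_carrier[OF h(1)]], rule pow_carrier_mat[OF yy_carrier[OF M]])
    have pB: "yy B ^\<^sub>m i \<in> carrier_mat (mdim B) (mdim B)" for i by (rule pow_carrier_mat[OF yy_carrier[OF h(2)]])
    have tA: "yy A ^\<^sub>m i * L * yy M ^\<^sub>m j \<in> carrier_mat (mdim A) (mdim M)" for i j
      by (rule mult_carrier_mat[OF mult_carrier_mat[OF pA Lc] pM])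
    have tM: "yy M ^\<^sub>m i * T * yy M ^\<^sub>m j \<in> carrier_mat (mdim M) (mdim M)" for i j
      by (rule mult_carrier_mat[OF mult_carrier_mat[OF pM Tc] pM])
    have one_term: "E * (yy A ^\<^sub>m i * L * yy M ^\<^sub>m j) = k \<cdot>\<^sub>m (F * (yy M ^\<^sub>m i * T * yy M ^\<^sub>m j))" for i j
    proof -
      define P Q Z W where "P = yy A ^\<^sub>m i" "Q = yy B ^\<^sub>m i" "Z = yy M ^\<^sub>m i" "W = yy M ^\<^sub>m j"
      have PQ: "P \<in> carrier_mat (mdim A) (mdim A)" "Q \<in> carrier_mat (mdim B) (mdim B)"
        "Z \<in> carrier_mat (mdim M) (mdim M)" "W \<in> carrier_mat (mdim M) (mdim M)" unfolding P_Q_Z_W_def by (rule pA pB pM)+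
      have EP: "E * P = Q * E" unfolding P_Q_Z_W_def
        by (rule pow_mat_intertwine[OF yy_carrier[OF h(1)] yy_carrier[OF h(2)] c(1)]) (use h(3) homs_iff[OF h(1,2)] in blast)
      have FZ: "F * Z = Q * F" unfolding P_Q_Z_W_def
        by (rule pow_mat_intertwine[OF yy_carrier[OF M] yy_carrier[OF h(2)] c(2)]) (use h(4) homs_iff[OF M h(2)] in blast)
      have "E * (P * L * W) = (E * P) * L * W" using c Lc PQ by (simp add: mat_assoc)
      also have "\<dots> = Q * (E * L) * W" unfolding EP using c Lc PQ by (simp add: mat_assoc)
      also have "\<dots> = k \<cdot>\<^sub>m ((Q * F) * T * W)" unfolding EL using c Tc PQ by (simp add: mat_assoc mat_smult_left mat_smult_right)
      also have "\<dots> = k \<cdot>\<^sub>m (F * (Z * T * W))" unfolding FZ[symmetric] using c Tc PQ by (simp add: mat_assoc)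
      finally show ?thesis unfolding P_Q_Z_W_def .
    qed
    have "E * rel_trace n M A L = msum (mdim B) (mdim M) (\<lambda>i. E * (yy A ^\<^sub>m i * L * yy M ^\<^sub>m (n - Suc i))) {..<n}"
      unfolding rel_trace_def
      using msum_mult_left[of E "mdim A" "{..<n}" "\<lambda>i. yy A ^\<^sub>m i * L * yy M ^\<^sub>m (n - Suc i)" "mdim M"] c(1) tA by simp
    also have "\<dots> = msum (mdim B) (mdim M) (\<lambda>i. k \<cdot>\<^sub>m (F * (yy M ^\<^sub>m i * T * yy M ^\<^sub>m (n - Suc i)))) {..<n}"
      by (simp only: one_term)
    also have "\<dots> = k \<cdot>\<^sub>m msum (mdim B) (mdim M) (\<lambda>i. F * (yy M ^\<^sub>m i * T * yy M ^\<^sub>m (n - Suc i))) {..<n}"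
      by (rule msum_smult[symmetric]) (rule mult_carrier_mat[OF c(2) tM])
    also have "msum (mdim B) (mdim M) (\<lambda>i. F * (yy M ^\<^sub>m i * T * yy M ^\<^sub>m (n - Suc i))) {..<n} = F * rel_trace n M M T"
      unfolding rel_trace_def
      using msum_mult_left[of F "mdim M" "{..<n}" "\<lambda>i. yy M ^\<^sub>m i * T * yy M ^\<^sub>m (n - Suc i)" "mdim M"] c(2) tM by simp
    finally show ?thesis unfolding one using c by simp
  qed
  then have "E * ((1 / k) \<cdot>\<^sub>m rel_trace n M A L) = F"
    using c homs_carrier[OF lift] card_G_pos by (simp add: mat_smult_right smult_smult_mat k_def)
  then show "\<exists>L\<in>homs M A. E * L = F" using homs_smult[OF M h(1) lift] by blast
qed

text \<open>If y^(n-1) does not vanish on \<open>M\<close>, then \<open>detecting_hom\<close> with l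
  = n yields an endomorphism of nonzero trace that is a relative trace. It is invertible, and
  normalising it to the identity makes \<open>M\<close> projective by the criterion.\<close>

lemma nonproj_yy:
  assumes M: "nonproj_indec M"
  shows "yy M ^\<^sub>m (n - 1) = 0\<^sub>m (mdim M) (mdim M)"
proof (rule ccontr)
  note Mi = conjunct1[OF M] and Mm = indec_module(1)[OF conjunct1[OF M]]
  assume nz: "yy M ^\<^sub>m (n - 1) \<noteq> 0\<^sub>m (mdim M) (mdim M)"
  have N: "0 < n" using n_ge_2 by simp
  have yc: "yy M ^\<^sub>m (n - 1) \<in> carrier_mat (mdim M) (mdim M)" by (rule pow_carrier_mat[OF yy_carrier[OF Mm]])
  have K: "1\<^sub>m (mdim M) \<in> carrier_mat (mdim M) (mdim M)" "\<And>h. h \<in> carrier G \<Longrightarrow> gr M h * 1\<^sub>m (mdim M) = 1\<^sub>m (mdim M) * gr M h"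
    "yy M * 1\<^sub>m (mdim M) = 1 \<cdot>\<^sub>m (1\<^sub>m (mdim M) * yy M)" "(\<Sum>i<n. (1::complex) ^ i) \<noteq> 0"
    "1\<^sub>m (mdim M) * yy M ^\<^sub>m (n - 1) \<noteq> 0\<^sub>m (mdim M) (mdim M)"
    using Mm N nz left_mult_one_mat[OF yc] by auto
  obtain a b where ab: "let T = average (n - 1) M M (mat (mdim M) (mdim M) (\<lambda>(k, i). if k = b \<and> i = a then 1 else 0))
     in rel_trace n M M T \<in> homs M M \<and> tr (1\<^sub>m (mdim M) * rel_trace n M M T) \<noteq> 0"
    using detecting_hom[OF Mm Mm N disjI1[OF refl] K] by metis
  define T where "T = average (n - 1) M M (mat (mdim M) (mdim M) (\<lambda>(k, i). if k = b \<and> i = a then 1 else 0))"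
  have T: "skew (n - 1) M M T" unfolding T_def by (rule average_skew[OF Mm Mm]) simp
  have Tc: "T \<in> carrier_mat (mdim M) (mdim M)" using T by (simp add: skew_def)
  define \<phi> where "\<phi> = rel_trace n M M T"
  have \<phi>: "\<phi> \<in> homs M M" "tr \<phi> \<noteq> 0" using ab homs_carrier[of \<phi> M M] unfolding Let_def T_def[symmetric] \<phi>_def[symmetric] by auto
  obtain Z where Z: "Z \<in> homs M M" "\<phi> * Z = 1\<^sub>m (mdim M)"
    using indec_endo[OF Mi \<phi>(1)] nilpotent_trace[OF homs_carrier[OF \<phi>(1)]] \<phi>(2) by blast
  have Zc: "Z \<in> carrier_mat (mdim M) (mdim M)" by (rule homs_carrier[OF Z(1)])
  have pM: "yy M ^\<^sub>m i \<in> carrier_mat (mdim M) (mdim M)" for i by (rule pow_carrier_mat[OF yy_carrier[OF Mm]])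
  \<comment> \<open>The module map \<open>Z\<close> commutes with y and can be pulled out of every
    summand on the right, so the relative trace of \<open>T * Z\<close> is
    \<open>\<phi> * Z\<close>.\<close>
  have "rel_trace n M M (T * Z) = 1\<^sub>m (mdim M)"
  proof -
    have tM: "yy M ^\<^sub>m i * T * yy M ^\<^sub>m j \<in> carrier_mat (mdim M) (mdim M)" for i j
      by (rule mult_carrier_mat[OF mult_carrier_mat[OF pM Tc] pM])
    have "yy M ^\<^sub>m i * (T * Z) * yy M ^\<^sub>m j = yy M ^\<^sub>m i * T * yy M ^\<^sub>m j * Z" for i j
    proof -
      have "Z * yy M ^\<^sub>m j = yy M ^\<^sub>m j * Z"
        by (rule pow_mat_intertwine[OF yy_carrier[OF Mm] yy_carrier[OF Mm] Zc]) (use Z(1) homs_iff[OF Mm Mm] in blast)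
      moreover have "yy M ^\<^sub>m i * (T * Z) * yy M ^\<^sub>m j = yy M ^\<^sub>m i * T * (Z * yy M ^\<^sub>m j)"
        using assoc_mult_mat[OF pM[of i] mult_carrier_mat[OF Tc Zc] pM[of j]] assoc_mult_mat[OF Tc Zc pM[of j]]
          assoc_mult_mat[OF pM[of i] Tc mult_carrier_mat[OF Zc pM[of j]]] by simp
      ultimately show ?thesis
        using assoc_mult_mat[OF mult_carrier_mat[OF pM[of i] Tc] pM[of j] Zc] by simp
    qed
    then have "rel_trace n M M (T * Z) = msum (mdim M) (mdim M) (\<lambda>i. yy M ^\<^sub>m i * T * yy M ^\<^sub>m (n - Suc i) * Z) {..<n}"
      unfolding rel_trace_def by simp
    also have "\<dots> = \<phi> * Z" unfolding \<phi>_def rel_trace_def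
      using msum_mult_right[of Z "mdim M" "{..<n}" "\<lambda>i. yy M ^\<^sub>m i * T * yy M ^\<^sub>m (n - Suc i)" "mdim M"] Zc tM by simp
    finally show ?thesis unfolding Z(2) .
  qed
  moreover have "skew (n - 1) M M (T * Z)"
    unfolding skew_def
  proof (intro conjI ballI)
    fix h assume h: "h \<in> carrier G"
    note c = gr_carrier[OF Mm h]
    have "Z * gr M h = gr M h * Z" using Z(1) homs_iff[OF Mm Mm] h by blast
    then have "T * Z * gr M h = (T * gr M h) * Z" using Tc Zc c by (simp add: mat_assoc)
    also have "T * gr M h = \<chi> (inv h) ^ (n - 1) \<cdot>\<^sub>m (gr M h * T)" using T h by (simp add: skew_def)
    finally show "T * Z * gr M h = \<chi> (inv h) ^ (n - 1) \<cdot>\<^sub>m (gr M h * (T * Z))"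
      using Tc Zc c by (simp add: mat_assoc mat_smult_left)
  qed (use Tc Zc in auto)
  ultimately have "projective M" using projective_criterion[OF Mm] by blast
  then show False using M by simp
qed

definition yy_index :: "'g hopf_mod \<Rightarrow> nat" where
  "yy_index M = (LEAST l. yy M ^\<^sub>m l = 0\<^sub>m (mdim M) (mdim M))"

lemma yy_index:
  assumes M: "nonproj_indec M"
  shows "0 < yy_index M" "yy_index M < n" "yy M ^\<^sub>m yy_index M = 0\<^sub>m (mdim M) (mdim M)"
    "yy M ^\<^sub>m (yy_index M - 1) \<noteq> 0\<^sub>m (mdim M) (mdim M)"
proof -
  note Mm = indec_module[OF conjunct1[OF M]]
  note y = nonproj_yy[OF M]
  have "yy_index M \<le> n - 1" unfolding yy_index_def by (rule Least_le) (rule y)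
  then show "yy_index M < n" using n_ge_2 by simp
  show z: "yy M ^\<^sub>m yy_index M = 0\<^sub>m (mdim M) (mdim M)" unfolding yy_index_def by (rule LeastI[of _ "n - 1"]) (rule y)
  show p: "0 < yy_index M"
  proof (rule ccontr)
    assume "\<not> 0 < yy_index M"
    then have "1\<^sub>m (mdim M) = (0\<^sub>m (mdim M) (mdim M) :: complex mat)" using z Mm(1) by simp
    then have "tr (1\<^sub>m (mdim M) :: complex mat) = tr (0\<^sub>m (mdim M) (mdim M) :: complex mat)" by (rule arg_cong)
    then show False using Mm(2) by simp
  qed
  show "yy M ^\<^sub>m (yy_index M - 1) \<noteq> 0\<^sub>m (mdim M) (mdim M)"
    using not_less_Least[of "yy_index M - 1" "\<lambda>l. yy M ^\<^sub>m l = 0\<^sub>m (mdim M) (mdim M)"] p unfolding yy_index_def by simp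
qed

text \<open>Some endomorphism has nonzero trace against g, by \<open>detecting_hom\<close> with c =
  q; the geometric sum is nonzero because q^l differs from 1 for the nilpotency index l. By
  \<open>indec_trace_central\<close> this trace is a multiple of tr g.\<close>

lemma trace_g_nonzero:
  assumes M: "nonproj_indec M"
  shows "tr (gr M g) \<noteq> 0"
proof
  assume z: "tr (gr M g) = 0"
  note Mi = conjunct1[OF M] and Mm = indec_module(1)[OF conjunct1[OF M]]
  note y = yy_index[OF M]
  let ?l = "yy_index M"
  have pc: "yy M ^\<^sub>m (?l - 1) \<in> carrier_mat (mdim M) (mdim M)" by (rule pow_carrier_mat[OF yy_carrier[OF Mm]])
  have gc: "gr M g \<in> carrier_mat (mdim M) (mdim M)" "gr M (inv g) \<in> carrier_mat (mdim M) (mdim M)" using Mm g_closed by auto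
  have "(\<chi> g - 1) * (\<Sum>i<?l. \<chi> g ^ i) = \<chi> g ^ ?l - 1" by (rule power_diff_1_eq[symmetric])
  then have s: "(\<Sum>i<?l. \<chi> g ^ i) \<noteq> 0" using q_pow_less[OF y(1,2)] by auto
  have nz: "gr M g * yy M ^\<^sub>m (?l - 1) \<noteq> 0\<^sub>m (mdim M) (mdim M)"
  proof
    assume "gr M g * yy M ^\<^sub>m (?l - 1) = 0\<^sub>m (mdim M) (mdim M)"
    then have "gr M (inv g) * (gr M g * yy M ^\<^sub>m (?l - 1)) = 0\<^sub>m (mdim M) (mdim M)" using gc by simp
    then have "gr M (inv g) * gr M g * yy M ^\<^sub>m (?l - 1) = 0\<^sub>m (mdim M) (mdim M)"
      using assoc_mult_mat[OF gc(2,1) pc] by simp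
    then show False using y(4) gr_inv(2)[OF Mm g_closed] left_mult_one_mat[OF pc] by simp
  qed
  obtain a b where ab: "let T = average (?l - 1) M M (mat (mdim M) (mdim M) (\<lambda>(k, i). if k = b \<and> i = a then 1 else 0))
     in rel_trace ?l M M T \<in> homs M M \<and> tr (gr M g * rel_trace ?l M M T) \<noteq> 0"
    using detecting_hom[OF Mm Mm y(1) disjI2[OF conjI[OF y(3) y(3)]] gc(1) _ yy_gr[OF Mm g_closed] s nz] gr_g_central[OF Mm] by metis
  then obtain \<phi> where \<phi>: "\<phi> \<in> homs M M" "tr (gr M g * \<phi>) \<noteq> 0" unfolding Let_def by blast
  have "gr M g * \<phi> = \<phi> * gr M g" using \<phi>(1) homs_iff[OF Mm Mm] g_closed by simp
  then show False using indec_trace_central[OF Mi \<phi>(1) gc(1)] \<phi>(2) z by simp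
qed

text \<open>The given map itself serves as \<open>K\<close> in \<open>detecting_hom\<close>; the map
  obtained in the opposite direction has a composite of nonzero trace with it.\<close>

lemma iso_if_socle_hom:
  assumes M: "nonproj_indec M" and N: "nonproj_indec N" and l: "yy_index M = yy_index N" and \<phi>: "\<phi> \<in> homs M N"
    and nz: "yy N ^\<^sub>m (yy_index N - 1) * \<phi> \<noteq> 0\<^sub>m (mdim N) (mdim M)"
  shows "mod_iso M N"
proof -
  note Mm = indec_module(1)[OF conjunct1[OF M]] and Nm = indec_module(1)[OF conjunct1[OF N]]
  let ?l = "yy_index M"
  note y = yy_index[OF M] and y' = yy_index[OF N, folded l]
  have \<phi>': "\<phi> \<in> carrier_mat (mdim N) (mdim M)" "\<And>h. h \<in> carrier G \<Longrightarrow> gr N h * \<phi> = \<phi> * gr M h" "\<phi> * yy M = yy N * \<phi>"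
    using \<phi> homs_iff[OF Mm Nm] by auto
  have yphi: "yy N * \<phi> = 1 \<cdot>\<^sub>m (\<phi> * yy M)" using \<phi>'(3) by simp
  have nz': "\<phi> * yy M ^\<^sub>m (?l - 1) \<noteq> 0\<^sub>m (mdim N) (mdim M)"
    using nz pow_mat_intertwine[OF yy_carrier[OF Mm] yy_carrier[OF Nm] \<phi>'(1,3), of "?l - 1"] l by simp
  have s: "(\<Sum>i<?l. (1::complex) ^ i) \<noteq> 0" using y(1) by simp
  obtain a b where ab: "let T = average (?l - 1) N M (mat (mdim M) (mdim N) (\<lambda>(k, i). if k = b \<and> i = a then 1 else 0))
     in rel_trace ?l N M T \<in> homs N M \<and> tr (\<phi> * rel_trace ?l N M T) \<noteq> 0"
    using detecting_hom[OF Nm Mm y(1) disjI2[OF conjI[OF y'(3) y(3)]] \<phi>'(1,2) yphi s nz'] by metis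
  then obtain \<psi> where "\<psi> \<in> homs N M" "tr (\<phi> * \<psi>) \<noteq> 0" unfolding Let_def by blast
  then have "mod_iso N M" using indec_iso_if_trace[OF conjunct1[OF N] conjunct1[OF M] _ \<phi>] by blast
  then show ?thesis by (rule mod_iso_sym)
qed

text \<open>After multiplication by y^(l-1), every summand with a further factor y on the left
  contains y^l; the summand i = 0 is the one that survives.\<close>

lemma rel_trace_socle:
  assumes N: "is_module N" and M: "is_module M" and l: "0 < l" and y: "yy N ^\<^sub>m l = 0\<^sub>m (mdim N) (mdim N)"
    and T: "T \<in> carrier_mat (mdim N) (mdim M)"
  shows "yy N ^\<^sub>m (l - 1) * rel_trace l M N T = yy N ^\<^sub>m (l - 1) * T * yy M ^\<^sub>m (l - 1)"
proof -
  have pM: "yy M ^\<^sub>m i \<in> carrier_mat (mdim M) (mdim M)" and pN: "yy N ^\<^sub>m i \<in> carrier_mat (mdim N) (mdim N)" for i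
    by (rule pow_carrier_mat[OF yy_carrier[OF M]], rule pow_carrier_mat[OF yy_carrier[OF N]])
  have tc: "yy N ^\<^sub>m i * T * yy M ^\<^sub>m j \<in> carrier_mat (mdim N) (mdim M)" for i j
    by (rule mult_carrier_mat[OF mult_carrier_mat[OF pN T] pM])
  have e: "yy N ^\<^sub>m (l - 1) * (yy N ^\<^sub>m i * T * yy M ^\<^sub>m j) = yy N ^\<^sub>m (l - 1 + i) * T * yy M ^\<^sub>m j" for i j
    using pow_mat_add[OF yy_carrier[OF N], of "l - 1" i] assoc_mult_mat[OF pN[of "l - 1"] mult_carrier_mat[OF pN[of i] T] pM[of j]]
      assoc_mult_mat[OF pN[of "l - 1"] pN[of i] T] by simp
  have z: "yy N ^\<^sub>m (l - 1 + Suc i) = 0\<^sub>m (mdim N) (mdim N)" for i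
    using pow_mat_add[OF yy_carrier[OF N], of l i] y l left_mult_zero_mat[OF pN[of i], of "mdim N"] by (simp del: pow_mat.simps)
  have "yy N ^\<^sub>m (l - 1) * rel_trace l M N T = msum (mdim N) (mdim M) (\<lambda>i. yy N ^\<^sub>m (l - 1) * (yy N ^\<^sub>m i * T * yy M ^\<^sub>m (l - Suc i))) {..<l}"
    unfolding rel_trace_def
    using msum_mult_left[of "yy N ^\<^sub>m (l - 1)" "mdim N" "{..<l}" "\<lambda>i. yy N ^\<^sub>m i * T * yy M ^\<^sub>m (l - Suc i)" "mdim M"]
      carrier_matD[OF pN[of "l - 1"]] tc by simp
  also have "\<dots> = msum (mdim N) (mdim M) (\<lambda>i. if i = 0 then yy N ^\<^sub>m (l - 1) * T * yy M ^\<^sub>m (l - 1) else 0\<^sub>m (mdim N) (mdim M)) {..<l}"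
  proof (rule msum_cong)
    fix i assume "i \<in> {..<l}"
    show "yy N ^\<^sub>m (l - 1) * (yy N ^\<^sub>m i * T * yy M ^\<^sub>m (l - Suc i)) =
        (if i = 0 then yy N ^\<^sub>m (l - 1) * T * yy M ^\<^sub>m (l - 1) else 0\<^sub>m (mdim N) (mdim M))"
    proof (cases i)
      case (Suc j)
      show ?thesis unfolding e unfolding Suc z using T left_mult_zero_mat[OF pM[of "l - Suc (Suc j)"], of "mdim N"] by simp
    qed (use e[of 0 "l - 1"] in simp)
  qed auto
  also have "\<dots> = yy N ^\<^sub>m (l - 1) * T * yy M ^\<^sub>m (l - 1)"
  proof (rule eq_matI)
    fix r s assume "r < dim_row (yy N ^\<^sub>m (l - 1) * T * yy M ^\<^sub>m (l - 1))" "s < dim_col (yy N ^\<^sub>m (l - 1) * T * yy M ^\<^sub>m (l - 1))"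
    then have rs: "r < mdim N" "s < mdim M" unfolding carrier_matD[OF tc] by simp_all
    have "(\<Sum>i<l. (if i = 0 then yy N ^\<^sub>m (l - 1) * T * yy M ^\<^sub>m (l - 1) else 0\<^sub>m (mdim N) (mdim M)) $$ (r, s)) =
      (\<Sum>i<l. if i = 0 then (yy N ^\<^sub>m (l - 1) * T * yy M ^\<^sub>m (l - 1)) $$ (r, s) else 0)"
      using rs by (intro sum.cong) auto
    then show "msum (mdim N) (mdim M) (\<lambda>i. if i = 0 then yy N ^\<^sub>m (l - 1) * T * yy M ^\<^sub>m (l - 1) else 0\<^sub>m (mdim N) (mdim M)) {..<l} $$ (r, s) =
        (yy N ^\<^sub>m (l - 1) * T * yy M ^\<^sub>m (l - 1)) $$ (r, s)"
      using rs l by (simp add: msum_index del: index_mult_mat)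
  qed (unfold carrier_matD[OF tc], simp_all)
  finally show ?thesis .
qed

end

section \<open>Matrix units, and matrices as maps to and from a tensor product\<close>

lemma mult_unit_mult:
  fixes A B :: "'a::comm_semiring_1 mat"
  assumes A: "A \<in> carrier_mat r m" and B: "B \<in> carrier_mat k s" and ij: "i < r" "j < s" "b < m" "a < k"
  shows "(A * mat m k (\<lambda>(u, v). if u = b \<and> v = a then 1 else 0) * B) $$ (i, j) = A $$ (i, b) * B $$ (a, j)"
proof -
  let ?T = "mat m k (\<lambda>(u, v). if u = b \<and> v = a then 1 else 0) :: 'a mat"
  have AT: "(A * ?T) $$ (i, v) = (if v = a then A $$ (i, b) else 0)" if "v < k" for v
  proof -
    have "(A * ?T) $$ (i, v) = (\<Sum>u<m. A $$ (i, u) * ?T $$ (u, v))"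
      using A ij that by (subst index_mult_sum) auto
    also have "\<dots> = (\<Sum>u<m. if u = b then (if v = a then A $$ (i, b) else 0) else 0)"
      using that by (intro sum.cong) auto
    finally show ?thesis using ij by simp
  qed
  have "(A * ?T * B) $$ (i, j) = (\<Sum>v<k. (A * ?T) $$ (i, v) * B $$ (v, j))"
    using A B ij by (subst index_mult_sum) auto
  also have "\<dots> = (\<Sum>v<k. if v = a then A $$ (i, b) * B $$ (a, j) else 0)"
    using AT by (intro sum.cong) auto
  finally show ?thesis using ij by simp
qed

lemma ket_surj:
  assumes "F \<in> carrier_mat (a * b) 1"
  obtains X where "X \<in> carrier_mat a b" "F = ket X"
proof
  define X where "X = mat a b (\<lambda>(i, j). F $$ (i * b + j, 0))"
  show X: "X \<in> carrier_mat a b" by (simp add: X_def)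
  show "F = ket X"
  proof (rule eq_matI)
    fix i j assume "i < dim_row (ket X)" "j < dim_col (ket X)"
    then have ij: "i < a * b" "j = 0" using X by auto
    then have "i div b < a" "i mod b < b" using div_mod_bounds[of i a b] by auto
    then show "F $$ (i, j) = ket X $$ (i, j)" using ij X by (simp add: bra_ket_index X_def)
  qed (use assms X in auto)
qed

lemma bra_surj:
  assumes "F \<in> carrier_mat 1 (a * b)"
  obtains X where "X \<in> carrier_mat a b" "F = bra X"
proof -
  have "transpose_mat F \<in> carrier_mat (a * b) 1" using assms by simp
  then obtain X where "X \<in> carrier_mat a b" "transpose_mat F = ket X" by (rule ket_surj)
  then show ?thesis using that transpose_ket[of X] by (metis transpose_transpose)
qed

context nonnilpotent_group_datum
begin

subsection \<open>Finiteness\<close>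

text \<open>A matrix unit between two matrices separates the variables: an entry of the product is
  an entry of the left factor times one of the right factor. The average thus becomes a pairing of a
  function on G depending on \<open>M\<close> with one depending on \<open>N\<close>.\<close>

lemma average_entry:
  assumes M: "is_module M" and N: "is_module N" and V: "V \<in> carrier_mat (mdim N) (mdim N)" and W: "W \<in> carrier_mat (mdim M) (mdim M)"
    and i: "i < mdim N" "b < mdim N" "a < mdim M" "k < mdim M"
  shows "(V * average j M N (mat (mdim N) (mdim M) (\<lambda>(u, v). if u = b \<and> v = a then 1 else 0)) * W) $$ (i, k) =
    (\<Sum>h\<in>carrier G. (gr M h * W) $$ (a, k) * (\<chi> h ^ j * (V * gr N (inv h)) $$ (i, b)))"
proof -
  define E where "E = mat (mdim N) (mdim M) (\<lambda>(u, v). if u = b \<and> v = a then 1 else 0 :: complex)"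
  have Ec: "E \<in> carrier_mat (mdim N) (mdim M)" by (simp add: E_def)
  have c: "gr M h \<in> carrier_mat (mdim M) (mdim M)" "gr N (inv h) \<in> carrier_mat (mdim N) (mdim N)" if "h \<in> carrier G" for h
    using that M N by auto
  define f where "f h = \<chi> h ^ j \<cdot>\<^sub>m (gr N (inv h) * E * gr M h)" for h
  have f: "f h \<in> carrier_mat (mdim N) (mdim M)" if "h \<in> carrier G" for h
    using c[OF that] Ec by (simp add: f_def)
  have Vf: "V * f h \<in> carrier_mat (mdim N) (mdim M)" if "h \<in> carrier G" for h
    using f[OF that] V by simp
  have "V * msum (mdim N) (mdim M) f (carrier G) * W = msum (mdim N) (mdim M) (\<lambda>h. V * f h * W) (carrier G)"
    using msum_mult_left[of V "mdim N" "carrier G" f "mdim M"] msum_mult_right[of W "mdim M" "carrier G" "\<lambda>h. V * f h" "mdim N"]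
      V W f Vf by simp
  then have "(V * average j M N E * W) $$ (i, k) = (\<Sum>h\<in>carrier G. (V * f h * W) $$ (i, k))"
    using i by (simp add: average_def f_def[abs_def] msum_index)
  also have "\<dots> = (\<Sum>h\<in>carrier G. (gr M h * W) $$ (a, k) * (\<chi> h ^ j * (V * gr N (inv h)) $$ (i, b)))"
  proof (rule sum.cong[OF refl])
    fix h assume h: "h \<in> carrier G"
    note ch = c[OF h]
    let ?Q = "(V * gr N (inv h)) * E * (gr M h * W)"
    have 1: "V * f h * W = \<chi> h ^ j \<cdot>\<^sub>m ?Q"
      unfolding f_def using ch Ec V W by (simp add: mat_assoc mat_smult_left mat_smult_right)
    have 2: "?Q $$ (i, k) = (V * gr N (inv h)) $$ (i, b) * (gr M h * W) $$ (a, k)"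
      unfolding E_def by (rule mult_unit_mult) (use ch V W i in auto)
    have 3: "?Q \<in> carrier_mat (mdim N) (mdim M)"
      by (rule mult_carrier_mat[OF mult_carrier_mat[OF mult_carrier_mat[OF V ch(2)] Ec] mult_carrier_mat[OF ch(1) W]])
    have "(\<chi> h ^ j \<cdot>\<^sub>m ?Q) $$ (i, k) = \<chi> h ^ j * ?Q $$ (i, k)"
      by (rule index_smult_mat(1)) (unfold carrier_matD[OF 3], rule i(1), rule i(4))
    then show "(V * f h * W) $$ (i, k) = (gr M h * W) $$ (a, k) * (\<chi> h ^ j * (V * gr N (inv h)) $$ (i, b))"
      unfolding 1 2 by (simp only: mult_ac)
  qed
  finally show ?thesis unfolding E_def .
qed

text \<open>The averaged endomorphism from \<open>detecting_hom\<close> is invertible, so y^(l-1)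
  times it is not zero; by \<open>rel_trace_socle\<close> this product is the matrix in the
  statement, and it has a nonzero entry. These indices give the nonzero diagonal of the biorthogonal
  system.\<close>

lemma socle_coefficient:
  assumes M: "nonproj_indec M"
  obtains a b i k where "a < mdim M" "b < mdim M" "i < mdim M" "k < mdim M"
    "(yy M ^\<^sub>m (yy_index M - 1) * average (yy_index M - 1) M M
       (mat (mdim M) (mdim M) (\<lambda>(u, v). if u = b \<and> v = a then 1 else 0)) * yy M ^\<^sub>m (yy_index M - 1)) $$ (i, k) \<noteq> 0"
proof -
  note Mi = conjunct1[OF M] and Mm = indec_module(1)[OF conjunct1[OF M]]
  note y = yy_index[OF M]
  let ?l = "yy_index M"
  define W where "W = yy M ^\<^sub>m (?l - 1)"
  have Wc: "W \<in> carrier_mat (mdim M) (mdim M)" unfolding W_def by (rule pow_carrier_mat[OF yy_carrier[OF Mm]])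
  have K: "1\<^sub>m (mdim M) \<in> carrier_mat (mdim M) (mdim M)" "\<And>h. h \<in> carrier G \<Longrightarrow> gr M h * 1\<^sub>m (mdim M) = 1\<^sub>m (mdim M) * gr M h"
    "yy M * 1\<^sub>m (mdim M) = 1 \<cdot>\<^sub>m (1\<^sub>m (mdim M) * yy M)" "(\<Sum>i<?l. (1::complex) ^ i) \<noteq> 0"
    "1\<^sub>m (mdim M) * yy M ^\<^sub>m (?l - 1) \<noteq> 0\<^sub>m (mdim M) (mdim M)"
    using Mm y(1,4) left_mult_one_mat[OF Wc] by (auto simp: W_def)
  obtain a b where ab: "a < mdim M" "b < mdim M" "let T = average (?l - 1) M M (mat (mdim M) (mdim M) (\<lambda>(k, i). if k = b \<and> i = a then 1 else 0))
     in rel_trace ?l M M T \<in> homs M M \<and> tr (1\<^sub>m (mdim M) * rel_trace ?l M M T) \<noteq> 0"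
    using detecting_hom[OF Mm Mm y(1) disjI2[OF conjI[OF y(3) y(3)]] K] by metis
  define T where "T = average (?l - 1) M M (mat (mdim M) (mdim M) (\<lambda>(k, i). if k = b \<and> i = a then 1 else 0))"
  have Tc: "T \<in> carrier_mat (mdim M) (mdim M)" unfolding T_def average_def by simp
  define \<phi> where "\<phi> = rel_trace ?l M M T"
  have \<phi>: "\<phi> \<in> homs M M" "tr \<phi> \<noteq> 0" using ab homs_carrier[of \<phi> M M] unfolding Let_def T_def[symmetric] \<phi>_def[symmetric] by auto
  obtain Z where Z: "Z \<in> homs M M" "\<phi> * Z = 1\<^sub>m (mdim M)"
    using indec_endo[OF Mi \<phi>(1)] nilpotent_trace[OF homs_carrier[OF \<phi>(1)]] \<phi>(2) by blast
  note cc = homs_carrier[OF \<phi>(1)] homs_carrier[OF Z(1)]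
  have "W * \<phi> = W * T * W" unfolding W_def \<phi>_def by (rule rel_trace_socle[OF Mm Mm y(1,3) Tc])
  moreover have "W * \<phi> \<noteq> 0\<^sub>m (mdim M) (mdim M)"
  proof
    assume "W * \<phi> = 0\<^sub>m (mdim M) (mdim M)"
    then have "W * (\<phi> * Z) = 0\<^sub>m (mdim M) (mdim M)" using assoc_mult_mat[OF Wc cc] cc by simp
    then show False using Z(2) Wc y(4) unfolding W_def[symmetric] by simp
  qed
  moreover have "W * T * W \<in> carrier_mat (mdim M) (mdim M)" using Wc Tc by simp
  ultimately obtain i k where "i < mdim M" "k < mdim M" "(W * T * W) $$ (i, k) \<noteq> 0"
    by (metis (no_types, lifting) carrier_matD eq_matI index_zero_mat)
  then show ?thesis using that[OF ab(1,2)] unfolding W_def T_def by blast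
qed

text \<open>Matrix coefficients of \<open>y\<^sup>l\<^sup>-\<^sup>1\<close> on pairwise non-isomorphic modules of index \<open>l\<close> are biorthogonal
  functions on \<open>G\<close>, as for characters; this bounds the number of these modules.\<close>

lemma finite_index_classes:
  assumes I: "\<And>M. M \<in> I \<Longrightarrow> nonproj_indec M" "\<And>M. M \<in> I \<Longrightarrow> yy_index M = l"
    and d: "\<And>M N. M \<in> I \<Longrightarrow> N \<in> I \<Longrightarrow> mod_iso M N \<Longrightarrow> M = N"
  shows "finite I"
proof -
  define W where "W M = yy M ^\<^sub>m (l - 1)" for M :: "'g hopf_mod"
  have m: "is_module M" if "M \<in> I" for M using indec_module(1) I(1)[OF that] by blast
  have Wc: "W M \<in> carrier_mat (mdim M) (mdim M)" if "M \<in> I" for M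
    unfolding W_def by (rule pow_carrier_mat[OF yy_carrier[OF m[OF that]]])
  define E where "E M N a b = mat (mdim N) (mdim M) (\<lambda>(u, v). if u = b \<and> v = a then 1 else 0 :: complex)" for M N :: "'g hopf_mod" and a b :: nat
  have "\<forall>M. \<exists>a b i k. M \<in> I \<longrightarrow> a < mdim M \<and> b < mdim M \<and> i < mdim M \<and> k < mdim M \<and>
      (W M * average (l - 1) M M (E M M a b) * W M) $$ (i, k) \<noteq> 0"
  proof
    fix M show "\<exists>a b i k. M \<in> I \<longrightarrow> a < mdim M \<and> b < mdim M \<and> i < mdim M \<and> k < mdim M \<and>
      (W M * average (l - 1) M M (E M M a b) * W M) $$ (i, k) \<noteq> 0"
    proof (cases "M \<in> I")
      case True
      show ?thesis using socle_coefficient[OF I(1)[OF True]] unfolding I(2)[OF True] W_def E_def by metis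
    qed blast
  qed
  then obtain a b i k where w: "\<And>M. M \<in> I \<Longrightarrow> a M < mdim M \<and> b M < mdim M \<and> i M < mdim M \<and> k M < mdim M \<and>
      (W M * average (l - 1) M M (E M M (a M) (b M)) * W M) $$ (i M, k M) \<noteq> 0"
    by metis
  show ?thesis
  proof (rule biorthogonal_finite[OF finite_G, of I "\<lambda>M h. (gr M h * W M) $$ (a M, k M)"
        "\<lambda>N h. \<chi> h ^ (l - 1) * (W N * gr N (inv h)) $$ (i N, b N)"])
    fix M N assume MN: "M \<in> I" "N \<in> I"
    let ?T = "average (l - 1) M N (E M N (a M) (b N))"
    have s: "(\<Sum>h\<in>carrier G. (gr M h * W M) $$ (a M, k M) * (\<chi> h ^ (l - 1) * (W N * gr N (inv h)) $$ (i N, b N))) =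
        (W N * ?T * W M) $$ (i N, k M)"
      unfolding E_def by (rule average_entry[symmetric]) (use m Wc MN w in auto)
    note yM = yy_index[OF I(1)[OF MN(1)]] and yN = yy_index[OF I(1)[OF MN(2)]]
    \<comment> \<open>A nonzero sum yields a module map on whose image y^(l-1) does not vanish;
      \<open>iso_if_socle_hom\<close> then makes the two modules isomorphic, so they are equal by
      the choice of \<open>I\<close>.\<close>
    have "M = N" if nz: "(W N * ?T * W M) $$ (i N, k M) \<noteq> 0"
    proof -
      have sk: "skew (l - 1) M N ?T" by (rule average_skew[OF m[OF MN(1)] m[OF MN(2)]]) (simp add: E_def)
      have Tc: "?T \<in> carrier_mat (mdim N) (mdim M)" using sk by (simp add: skew_def)
      have l: "yy_index M = l" "yy_index N = l" using I(2) MN by auto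
      have z: "yy N ^\<^sub>m l = 0\<^sub>m (mdim N) (mdim N)" "yy M ^\<^sub>m l = 0\<^sub>m (mdim M) (mdim M)" using yM(3) yN(3) l by auto
      have l0: "0 < l" using yM(1) l by simp
      have h: "rel_trace l M N ?T \<in> homs M N"
        by (rule rel_trace_hom[OF m[OF MN(1)] m[OF MN(2)] sk _ l0]) (use z Tc in simp)
      have "W N * rel_trace l M N ?T = W N * ?T * W M"
        unfolding W_def by (rule rel_trace_socle[OF m[OF MN(2)] m[OF MN(1)] l0 z(1) Tc])
      then have "W N * rel_trace l M N ?T \<noteq> 0\<^sub>m (mdim N) (mdim M)"
        using nz w[OF MN(1)] w[OF MN(2)] by (metis index_zero_mat(1))
      then have "mod_iso M N"
        using iso_if_socle_hom[OF I(1)[OF MN(1)] I(1)[OF MN(2)] _ h] l by (simp add: W_def)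
      then show ?thesis using d MN by blast
    qed
    then show "(\<Sum>h\<in>carrier G. (gr M h * W M) $$ (a M, k M) * (\<chi> h ^ (l - 1) * (W N * gr N (inv h)) $$ (i N, b N))) = 0 \<longleftrightarrow> M \<noteq> N"
      unfolding s using w[OF MN(1)] by blast
  qed
qed

lemma iso_class_eq_iff:
  assumes "is_module M" "is_module N"
  shows "iso_class M = iso_class N \<longleftrightarrow> mod_iso M N"
  unfolding iso_class_def using assms mod_iso_refl mod_iso_sym mod_iso_trans by (smt (verit) Collect_cong mem_Collect_eq)

text \<open>Representatives are sorted by \<open>yy_index\<close>, which takes values below n, and
  \<open>finite_index_classes\<close> bounds each sort.\<close>

lemma finite_nonproj_indec_classes: "finite nonproj_indec_classes"
proof -
  define rep where "rep C = (SOME M. nonproj_indec M \<and> C = iso_class M)" for C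
  have rep: "nonproj_indec (rep C)" "iso_class (rep C) = C" if "C \<in> nonproj_indec_classes" for C
    using someI_ex[of "\<lambda>M. nonproj_indec M \<and> C = iso_class M"] that unfolding rep_def nonproj_indec_classes_def by auto
  have fin: "finite {M \<in> rep ` nonproj_indec_classes. yy_index M = l}" for l
  proof (rule finite_index_classes)
    fix M N assume MN: "M \<in> {M \<in> rep ` nonproj_indec_classes. yy_index M = l}" "N \<in> {M \<in> rep ` nonproj_indec_classes. yy_index M = l}"
      "mod_iso M N"
    then obtain C D where CD: "C \<in> nonproj_indec_classes" "D \<in> nonproj_indec_classes" "M = rep C" "N = rep D" by blast
    note r = rep[OF CD(1)] rep[OF CD(2)]
    have "C = D" using MN(3) r iso_class_eq_iff[of M N] CD(3,4) indec_module(1) by metis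
    then show "M = N" using CD by simp
  qed (use rep in auto)
  have "rep ` nonproj_indec_classes \<subseteq> (\<Union>l<n. {M \<in> rep ` nonproj_indec_classes. yy_index M = l})"
  proof
    fix M assume "M \<in> rep ` nonproj_indec_classes"
    then show "M \<in> (\<Union>l<n. {M \<in> rep ` nonproj_indec_classes. yy_index M = l})" using yy_index(2)[of M] rep(1) by blast
  qed
  moreover have "finite (\<Union>l<n. {M \<in> rep ` nonproj_indec_classes. yy_index M = l})"
    by (rule finite_UN_I) (use fin in auto)
  ultimately have "finite (rep ` nonproj_indec_classes)" by (rule finite_subset)
  moreover have "inj_on rep nonproj_indec_classes" using rep(2) by (metis inj_onI)
  ultimately show ?thesis by (rule finite_imageD)
qed

subsection \<open>The trivial module and duality\<close>

text \<open>If the trivial module were projective, it would split off a two-dimensional module that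
  has it as a quotient. A section would send 1 to a vector with first coordinate 1, which y does not
  kill, although y is zero on the trivial module.\<close>

lemma trivial_nonproj_indec: "nonproj_indec trivial_mod"
proof
  note t = trivial_module
  show "indecomposable trivial_mod"
    unfolding indecomposable_def
  proof (intro conjI allI impI)
    fix A B assume AB: "is_module A \<and> is_module B \<and> mod_iso trivial_mod (direct_sum A B)"
    then have "mdim A + mdim B = 1" using mod_iso_dim[of trivial_mod "direct_sum A B"] direct_sum_module(2) t(2) by simp
    then show "mdim A = 0 \<or> mdim B = 0" by linarith
  qed (use t(1,2) in auto)
  show "\<not> projective trivial_mod"
  proof
    assume p: "projective trivial_mod"
    \<comment> \<open>The module with basis e0, e1 on which y e0 = e1, y e1 = 0 and G acts by 1 on
      e0 and by the inverse of \<chi> on e1. The relation for y^n holds because y^2 = 0, n is at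
      least 2 and \<chi>(g^n) = 1.\<close>
    define \<rho> where "\<rho> h = mat 2 2 (\<lambda>(i, j). if i = j then (if i = 0 then 1 else \<chi> (inv h)) else 0 :: complex)" for h
    define y where "y = mat 2 2 (\<lambda>(i, j). if i = 1 \<and> j = 0 then 1 else 0 :: complex)"
    have two: "{..<2::nat} = {0, 1}" by auto
    have ix: "(A * B) $$ (i, j) = A $$ (i, 0) * B $$ (0, j) + A $$ (i, 1) * B $$ (1, j)"
      if "A \<in> carrier_mat r 2" "B \<in> carrier_mat 2 s" "i < r" "j < s" for A B :: "complex mat" and r s i j
      using that by (subst index_mult_sum) (auto simp: two)
    have c: "\<rho> h \<in> carrier_mat 2 2" "y \<in> carrier_mat 2 2" for h by (auto simp: \<rho>_def y_def)
    have "\<chi> (g [^] m) = \<chi> g ^ m" for m :: nat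
      using g_closed by (induction m) (auto simp: \<chi>_one \<chi>_mult mult.commute)
    then have "\<chi> (g [^] n) = 1" using q_pow_n by simp
    then have gn: "\<chi> (inv (g [^] n)) = 1" using chi_inv[of "g [^] n"] g_closed by simp
    have yy2: "y * y = 0\<^sub>m 2 2"
      by (rule eq_matI) (use c in \<open>auto simp: ix[of _ 2 _ 2] simp del: index_mult_mat(1), auto simp: y_def\<close>)
    have r: "is_rep 2 \<rho> y"
      unfolding is_rep_def
    proof (intro conjI ballI)
      show "\<rho> \<one> = 1\<^sub>m 2" by (rule eq_matI) (auto simp: \<rho>_def \<chi>_one)
      show "\<rho> h * \<rho> k = \<rho> (h \<otimes> k)" if "h \<in> carrier G" "k \<in> carrier G" for h k
      proof (rule eq_matI)
        fix i j assume "i < dim_row (\<rho> (h \<otimes> k))" "j < dim_col (\<rho> (h \<otimes> k))"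
        then have ij: "i < 2" "j < 2" by (auto simp: \<rho>_def)
        show "(\<rho> h * \<rho> k) $$ (i, j) = \<rho> (h \<otimes> k) $$ (i, j)"
          unfolding ix[OF c(1) c(1) ij] using ij that
          by (auto simp: \<rho>_def inv_mult_group \<chi>_mult less_2_cases_iff mult.commute)
      qed (auto simp: \<rho>_def)
      show "y * \<rho> h = \<chi> h \<cdot>\<^sub>m (\<rho> h * y)" if "h \<in> carrier G" for h
      proof (rule eq_matI)
        fix i j assume "i < dim_row (\<chi> h \<cdot>\<^sub>m (\<rho> h * y))" "j < dim_col (\<chi> h \<cdot>\<^sub>m (\<rho> h * y))"
        then have ij: "i < 2" "j < 2" by (auto simp: \<rho>_def y_def)
        have e: "(\<chi> h \<cdot>\<^sub>m (\<rho> h * y)) $$ (i, j) = \<chi> h * (\<rho> h * y) $$ (i, j)"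
          using ij by (intro index_smult_mat(1)) (auto simp: \<rho>_def y_def)
        show "(y * \<rho> h) $$ (i, j) = (\<chi> h \<cdot>\<^sub>m (\<rho> h * y)) $$ (i, j)"
          unfolding e ix[OF c(1) c(2) ij] ix[OF c(2) c(1) ij] using ij chi_inv[OF that]
          by (auto simp: \<rho>_def y_def less_2_cases_iff)
      qed (auto simp: \<rho>_def y_def)
      have "y ^\<^sub>m n = y ^\<^sub>m (n - 2) * (y * y)"
      proof -
        have "n = Suc (Suc (n - 2))" using n_ge_2 by simp
        then have "y ^\<^sub>m n = y ^\<^sub>m (n - 2) * y * y" by (metis pow_mat.simps(2))
        then show ?thesis using assoc_mult_mat[OF pow_carrier_mat[OF c(2)] c(2) c(2)] by simp
      qed
      also have "\<dots> = 0\<^sub>m 2 2" unfolding yy2 by (rule right_mult_zero_mat[OF pow_carrier_mat[OF c(2)]])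
      also have "0\<^sub>m 2 2 = \<rho> (g [^] n) - 1\<^sub>m 2" by (rule eq_matI) (auto simp: \<rho>_def gn)
      finally show "y ^\<^sub>m n = \<rho> (g [^] n) - 1\<^sub>m 2" .
    qed (use c in auto)
    define P where "P = mk_mod 2 \<rho> y"
    note P = mk_mod[OF r, folded P_def]
    define E where "E = mat 1 2 (\<lambda>(i, j). if j = 0 then 1 else 0 :: complex)"
    have Ec: "E \<in> carrier_mat 1 2" by (simp add: E_def)
    have E: "E \<in> homs P trivial_mod"
      unfolding homs_iff[OF P(1) t(1)]
    proof (intro conjI ballI)
      show "E \<in> carrier_mat (mdim trivial_mod) (mdim P)" using Ec t(2) P(2) by simp
      show "E * gr P h = gr trivial_mod h * E" if "h \<in> carrier G" for h
        unfolding P(3)[OF that] t(3)[OF that] left_mult_one_mat[OF Ec]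
        by (rule eq_matI) (use c Ec in \<open>auto simp: ix[of _ 1 _ 2] simp del: index_mult_mat(1), auto simp: \<rho>_def E_def\<close>)
      show "E * yy P = yy trivial_mod * E"
        unfolding P(4) t(4) left_mult_zero_mat[OF Ec]
        by (rule eq_matI) (use c Ec in \<open>auto simp: ix[of _ 1 _ 2] simp del: index_mult_mat(1), auto simp: y_def E_def\<close>)
    qed
    have "surjective E"
      unfolding surjective_iff[OF Ec]
    proof (intro bexI)
      show "E * mat 2 1 (\<lambda>(i, j). if i = 0 then 1 else 0) = 1\<^sub>m 1"
        by (rule eq_matI) (use Ec in \<open>auto simp: ix[of _ 1 _ 1] simp del: index_mult_mat(1), auto simp: E_def\<close>)
    qed simp
    then obtain L where L: "L \<in> homs trivial_mod P" "E * L = 1\<^sub>m (mdim trivial_mod)"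
      using projective_lift[OF p P(1) t(1) E homs_one[OF t(1)]] by blast
    have Lc: "L \<in> carrier_mat 2 1" using homs_carrier[OF L(1)] P(2) t(2) by simp
    have "L $$ (0, 0) = (E * L) $$ (0, 0)" using ix[OF Ec Lc, of 0 0] by (simp add: E_def)
    then have "L $$ (0, 0) = 1" using L(2) t(2) by simp
    moreover have "L * yy trivial_mod = y * L" using L(1) homs_iff[OF t(1) P(1)] P(4) by simp
    then have "(y * L) $$ (1, 0) = 0" using t(4) Lc by (metis index_zero_mat(1) less_numeral_extra(1) one_less_numeral_iff right_mult_zero_mat semiring_norm(76))
    then have "L $$ (0, 0) = 0" using ix[OF c(2) Lc, of 1 0] by (simp add: y_def)
    ultimately show False by simp
  qed
qed

lemma dual_indecomposable:
  assumes M: "indecomposable M"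
  shows "indecomposable (dual M)"
  unfolding indecomposable_def
proof (intro conjI allI impI)
  note Mm = indec_module[OF M]
  show "is_module (dual M)" by (rule dual_module(1)[OF Mm(1)])
  show "mdim (dual M) \<noteq> 0" using dual_module(2)[OF Mm(1)] Mm(2) by simp
  fix A B assume "is_module A \<and> is_module B \<and> mod_iso (dual M) (direct_sum A B)"
  then have A: "is_module A" and B: "is_module B" and AB: "mod_iso (dual M) (direct_sum A B)" by auto
  note S = direct_sum_module(1)[OF A B] and D = dual_module(1)
  obtain i p j q where b: "biproduct (direct_sum A B) A B i p j q" by (rule direct_sum_biproduct[OF A B])
  have "mod_iso (dual (dual M)) (dual (direct_sum A B))" by (rule dual_iso[OF D[OF Mm(1)] S AB])
  moreover have "mod_iso (dual (direct_sum A B)) (direct_sum (dual A) (dual B))"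
    by (rule biproduct_iso[OF D[OF S] D[OF A] D[OF B] dual_biproduct[OF S A B b]])
  ultimately have "mod_iso M (direct_sum (dual A) (dual B))"
    using dual_dual[OF Mm(1)] mod_iso_trans D direct_sum_module(1) S A B Mm(1) by metis
  then show "mdim A = 0 \<or> mdim B = 0"
    using indec_split[OF M D[OF A] D[OF B]] dual_module(2)[OF A] dual_module(2)[OF B] by simp
qed

text \<open>Coevaluation followed by the twisted evaluation is multiplication by tr g, which is not
  zero, so the trivial module is a summand of \<open>tensor M (dual M)\<close>. If the dual were
  projective, so would be this tensor product and with it the trivial module.\<close>

lemma dual_nonproj_indec:
  assumes M: "nonproj_indec M"
  shows "nonproj_indec (dual M)"
proof
  note Mi = conjunct1[OF M] and Mm = indec_module(1)[OF conjunct1[OF M]]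
  note t = trivial_module
  show "indecomposable (dual M)" by (rule dual_indecomposable[OF Mi])
  show "\<not> projective (dual M)"
  proof
    assume "projective (dual M)"
    then have p: "projective (tensor M (dual M))" by (rule projective_tensor_left[OF _ Mm])
    note ec = ev_coev[OF Mm]
    have gc: "gr M g \<in> carrier_mat (mdim M) (mdim M)" using Mm g_closed by simp
    let ?b = "bra (transpose_mat (gr M g))" and ?k = "ket (1\<^sub>m (mdim M))"
    have "(?b * ?k) $$ (0, 0) = tr (gr M g)" using gc by (subst bra_mult_ket) auto
    then have "?b * ?k = tr (gr M g) \<cdot>\<^sub>m 1\<^sub>m 1" using gc by (intro eq_matI) auto
    then have "((1 / tr (gr M g)) \<cdot>\<^sub>m ?b) * ?k = 1\<^sub>m (mdim trivial_mod)"
      using trace_g_nonzero[OF M] gc t(2) by (simp add: mat_smult_left smult_smult_mat)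
    then have "projective trivial_mod"
      by (rule projective_summand[OF p t(1) ec(2) homs_smult[OF projective_module[OF p] t(1) ec(3)]])
    then show False using trivial_nonproj_indec by simp
  qed
qed

text \<open>By contraposition from \<open>dual_nonproj_indec\<close> applied to the dual, since the
  double dual is isomorphic to \<open>M\<close>.\<close>

lemma dual_projective_indec:
  assumes M: "indecomposable M" "projective M"
  shows "projective (dual M)"
proof (rule ccontr)
  assume "\<not> projective (dual M)"
  then have "nonproj_indec (dual (dual M))" using dual_nonproj_indec dual_indecomposable[OF M(1)] by blast
  moreover have "projective (dual (dual M))"
    using projective_iso[OF M(2) _ dual_dual] dual_module(1) indec_module(1)[OF M(1)] by blast
  ultimately show False by blast
qed

text \<open>One half of the duality adjunction: bending the factor \<open>M\<close> of an invariant
  vector by the evaluation gives a map out of the dual, whose matrix is the transpose.\<close>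

lemma hom_trivial_tensor:
  assumes M: "is_module M" and N: "is_module N" and X: "X \<in> carrier_mat (mdim M) (mdim N)"
    and f: "ket X \<in> homs trivial_mod (tensor M N)"
  shows "transpose_mat X \<in> homs (dual M) N"
proof -
  note D = dual_module(1,2)[OF M] and T = tensor_module(1) and t = trivial_module(1)
  let ?D = "dual M"
  have 1: "kronecker (1\<^sub>m (mdim ?D)) (ket X) \<in> homs (tensor ?D trivial_mod) (tensor ?D (tensor M N))"
    by (rule tensor_hom[OF D(1) D(1) t T[OF M N] homs_one[OF D(1)] f])
  have e1: "homs (tensor ?D trivial_mod) (tensor ?D (tensor M N)) = homs ?D (tensor (tensor ?D M) N)"
    by (rule homs_congruent) (use D M N T t tensor_unit tensor_assoc trivial_module(2) in \<open>simp_all add: mult.assoc\<close>)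
  have 2: "kronecker (bra (1\<^sub>m (mdim M))) (1\<^sub>m (mdim N)) \<in> homs (tensor (tensor ?D M) N) (tensor trivial_mod N)"
    by (rule tensor_hom[OF T[OF D(1) M] t N N ev_coev(1)[OF M] homs_one[OF N]])
  have e2: "homs (tensor (tensor ?D M) N) (tensor trivial_mod N) = homs (tensor (tensor ?D M) N) N"
    by (rule homs_congruent) (use D M N T t tensor_unit trivial_module(2) in simp_all)
  have "kronecker (bra (1\<^sub>m (mdim M))) (1\<^sub>m (mdim N)) * kronecker (1\<^sub>m (mdim ?D)) (ket X) \<in> homs ?D N"
    by (rule homs_comp[OF D(1) T[OF T[OF D(1) M] N] N 1[unfolded e1] 2[unfolded e2]])
  moreover have "kronecker (bra (1\<^sub>m (mdim M))) (1\<^sub>m (mdim N)) * kronecker (1\<^sub>m (mdim ?D)) (ket X) = transpose_mat (1\<^sub>m (mdim M) * X)"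
    by (rule zigzag') (use X D in auto)
  ultimately show ?thesis using X by simp
qed

text \<open>The corresponding adjunction for invariant forms. The copairing with the dual on the
  left is the one twisted by the inverse of g, which explains the extra factor.\<close>

lemma hom_tensor_trivial:
  assumes M: "is_module M" and N: "is_module N" and Z: "Z \<in> carrier_mat (mdim M) (mdim N)"
    and h: "bra Z \<in> homs (tensor M N) trivial_mod"
  shows "transpose_mat (gr M (inv g)) * Z \<in> homs N (dual M)"
proof -
  note D = dual_module(1,2)[OF M] and T = tensor_module(1) and t = trivial_module(1)
  let ?D = "dual M" and ?W = "transpose_mat (gr M (inv g))"
  have Wc: "?W \<in> carrier_mat (mdim M) (mdim M)" using M g_closed by simp
  have 1: "kronecker (1\<^sub>m (mdim ?D)) (bra Z) \<in> homs (tensor ?D (tensor M N)) (tensor ?D trivial_mod)"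
    by (rule tensor_hom[OF D(1) D(1) T[OF M N] t homs_one[OF D(1)] h])
  have e1: "homs (tensor ?D (tensor M N)) (tensor ?D trivial_mod) = homs (tensor (tensor ?D M) N) ?D"
    by (rule homs_congruent) (use D M N T t tensor_unit tensor_assoc trivial_module(2) in \<open>simp_all add: mult.assoc\<close>)
  have 2: "kronecker (ket ?W) (1\<^sub>m (mdim N)) \<in> homs (tensor trivial_mod N) (tensor (tensor ?D M) N)"
    by (rule tensor_hom[OF t T[OF D(1) M] N N ev_coev(4)[OF M] homs_one[OF N]])
  have e2: "homs (tensor trivial_mod N) (tensor (tensor ?D M) N) = homs N (tensor (tensor ?D M) N)"
    by (rule homs_congruent) (use D M N T t tensor_unit trivial_module(2) in simp_all)
  have "kronecker (1\<^sub>m (mdim ?D)) (bra Z) * kronecker (ket ?W) (1\<^sub>m (mdim N)) \<in> homs N ?D"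
    by (rule homs_comp[OF N T[OF T[OF D(1) M] N] D(1) 2[unfolded e2] 1[unfolded e1]])
  moreover have "kronecker (1\<^sub>m (mdim ?D)) (bra Z) * kronecker (ket ?W) (1\<^sub>m (mdim N)) = ?W * Z"
    by (rule zigzag) (use Z Wc D M in auto)
  ultimately show ?thesis by simp
qed

text \<open>The trivial module is a summand of \<open>M \<otimes> N\<close> through the maps adjoint to an isomorphism of
  \<open>N\<close> with the dual of \<open>M\<close>; the quantum dimension \<open>tr g\<close> of \<open>M\<close> does not vanish.\<close>

lemma mult_trivial_tensor:
  assumes M: "nonproj_indec M" and N: "nonproj_indec N"
  shows "mult trivial_mod (tensor M N) = (if mod_iso N (dual M) then 1 else 0)"
proof -
  note Mm = indec_module(1)[OF conjunct1[OF M]] and Nm = indec_module(1)[OF conjunct1[OF N]]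
  note t = trivial_module(1,2) and D = dual_module(1,2)[OF Mm] and T = tensor_module(1)[OF Mm Nm]
  note Di = conjunct1[OF dual_nonproj_indec[OF M]] and Ni = conjunct1[OF N]
  define d where "d = mdim M"
  define A B \<kappa> where "A = transpose_mat (gr M g)" "B = transpose_mat (gr M (inv g))" "\<kappa> = tr (gr M g)"
  note AB_def = this
  have d0: "d \<noteq> 0" using indec_module(2)[OF conjunct1[OF M]] by (simp add: d_def)
  have \<kappa>: "\<kappa> \<noteq> 0" using trace_g_nonzero[OF M] by (simp add: AB_def)
  have AB: "A \<in> carrier_mat d d" "B \<in> carrier_mat d d" using Mm g_closed by (auto simp: AB_def d_def)
  have A_B: "A * B = 1\<^sub>m d" "B * A = 1\<^sub>m d"
    unfolding AB_def d_def using gr_inv[OF Mm g_closed] Mm g_closed by (simp_all add: transpose_mat_mult[symmetric])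
  have ta: "tr A = \<kappa>" using Mm g_closed by (simp add: AB_def tr_transpose)
  have A_gr: "A = gr (dual M) (inv g)" using dual_module(3)[OF Mm inv_closed[OF g_closed]] g_closed by (simp add: AB_def)
  have trA: "tr (A * u) = \<kappa> * tr u / d" if u: "u \<in> homs (dual M) (dual M)" for u
  proof -
    have "A * u = u * A" using u homs_iff[OF D(1) D(1)] g_closed unfolding A_gr by simp
    then have "tr (A * u) = tr A * tr u / mdim (dual M)"
      by (rule indec_trace_central[OF Di u, rotated]) (use AB(1) D(2) in \<open>simp add: d_def\<close>)
    then show ?thesis using ta D(2) by (simp add: d_def)
  qed
  have adj: "\<exists>X \<in> carrier_mat d (mdim N). f = ket X \<and> transpose_mat X \<in> homs (dual M) N" if f: "f \<in> homs trivial_mod (tensor M N)" for f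
  proof -
    obtain X where X: "X \<in> carrier_mat d (mdim N)" "f = ket X"
      using ket_surj[of f d "mdim N"] homs_carrier[OF f] t(2) by (auto simp: d_def)
    then show ?thesis using hom_trivial_tensor[OF Mm Nm, of X] f by (auto simp: d_def)
  qed
  have adj': "\<exists>Z \<in> carrier_mat d (mdim N). h = bra Z \<and> B * Z \<in> homs N (dual M)" if h: "h \<in> homs (tensor M N) trivial_mod" for h
  proof -
    obtain Z where Z: "Z \<in> carrier_mat d (mdim N)" "h = bra Z"
      using bra_surj[of h d "mdim N"] homs_carrier[OF h] t(2) by (auto simp: d_def)
    then show ?thesis using hom_tensor_trivial[OF Mm Nm, of Z] h by (auto simp: d_def AB_def)
  qed
  \<comment> \<open>The composite of a vector and a form on M \<otimes> N becomes the trace of an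
    endomorphism of the dual of \<open>M\<close>, weighted by \<open>A\<close>. Inserting
    \<open>A * B = 1\<close> makes the adjoint \<open>B * Z\<close> appear, which is a module map,
    while \<open>Z\<close> itself need not be.\<close>
  have pair: "pairing trivial_mod (bra Z) (ket X) = tr (A * (B * Z * transpose_mat X))"
    if X: "X \<in> carrier_mat d (mdim N)" and Z: "Z \<in> carrier_mat d (mdim N)" for X Z
  proof -
    have "pairing trivial_mod (bra Z) (ket X) = (bra Z * ket X) $$ (0, 0)"
      using t(2) by (simp add: pairing_def tr_def)
    also have "\<dots> = tr (transpose_mat Z * X)" using X Z by (intro bra_mult_ket) auto
    also have "\<dots> = tr (transpose_mat (transpose_mat Z * X))" using X Z by (intro tr_transpose[symmetric]) auto
    also have "\<dots> = tr (transpose_mat X * Z)" using X Z by (simp add: transpose_mat_mult)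
    also have "\<dots> = tr (Z * transpose_mat X)" using X Z by (intro tr_mult_comm) auto
    also have "Z * transpose_mat X = (A * B) * (Z * transpose_mat X)" unfolding A_B using X Z by simp
    also have "\<dots> = A * (B * Z * transpose_mat X)" using X Z AB by (simp add: mat_assoc)
    finally show ?thesis .
  qed
  have "has_mult trivial_mod (tensor M N) (of_nat (if mod_iso N (dual M) then 1 else 0))"
  proof (cases "mod_iso N (dual M)")
    case False
    have "has_mult trivial_mod (tensor M N) 0"
    proof (rule has_multI[of 0 "\<lambda>_. 1\<^sub>m 0" _ _ "\<lambda>_. 1\<^sub>m 0"])
      fix f h assume f: "f \<in> homs trivial_mod (tensor M N)" and h: "h \<in> homs (tensor M N) trivial_mod"
      obtain X where X: "X \<in> carrier_mat d (mdim N)" "f = ket X" "transpose_mat X \<in> homs (dual M) N" using adj[OF f] by blast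
      obtain Z where Z: "Z \<in> carrier_mat d (mdim N)" "h = bra Z" "B * Z \<in> homs N (dual M)" using adj'[OF h] by blast
      have "tr (B * Z * transpose_mat X) = 0"
        using indec_iso_if_trace[OF Di Ni X(3) Z(3)] False mod_iso_sym by blast
      then show "pairing trivial_mod h f = (\<Sum>t<0::nat. pairing trivial_mod h (1\<^sub>m 0) * pairing trivial_mod (1\<^sub>m 0) f)"
        unfolding X(2) Z(2) pair[OF X(1) Z(1)] using trA[OF homs_comp[OF D(1) Nm D(1) X(3) Z(3)]] by simp
    qed auto
    then show ?thesis using False by simp
  next
    case True
    then obtain F' F where F: "F' \<in> homs N (dual M)" "F \<in> homs (dual M) N" "F * F' = 1\<^sub>m (mdim N)" "F' * F = 1\<^sub>m d"
      unfolding mod_iso_def using D(2) d_def by auto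
    have Fc: "F' \<in> carrier_mat d (mdim N)" "F \<in> carrier_mat (mdim N) d"
      using homs_carrier[OF F(1)] homs_carrier[OF F(2)] D(2) by (auto simp: d_def)
    note ec = ev_coev[OF Mm]
    \<comment> \<open>Coevaluation followed by \<open>F\<close>, and the twisted evaluation preceded
      by \<open>F'\<close>. Without the factor their composite would be the quantum dimension
      \<kappa>.\<close>
    define \<iota> \<pi> where "\<iota> = ket (transpose_mat F)" "\<pi> = (1 / \<kappa>) \<cdot>\<^sub>m bra (A * F')"
    have "kronecker (1\<^sub>m d) F * ket (1\<^sub>m d) \<in> homs trivial_mod (tensor M N)"
      unfolding d_def by (rule homs_comp[OF t(1) tensor_module(1)[OF Mm D(1)] T ec(2) tensor_hom[OF Mm Mm D(1) Nm homs_one[OF Mm] F(2)]])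
    moreover have "kronecker (1\<^sub>m d) F * ket (1\<^sub>m d) = \<iota>" using Fc by (subst ket_kronecker) (auto simp: \<iota>_\<pi>_def)
    ultimately have \<iota>: "\<iota> \<in> homs trivial_mod (tensor M N)" by simp
    have "bra A * kronecker (1\<^sub>m d) F' \<in> homs (tensor M N) trivial_mod"
      unfolding d_def AB_def by (rule homs_comp[OF T tensor_module(1)[OF Mm D(1)] t(1) tensor_hom[OF Mm Mm Nm D(1) homs_one[OF Mm] F(1)] ec(3)])
    moreover have "bra A * kronecker (1\<^sub>m d) F' = bra (A * F')" using Fc AB by (subst bra_kronecker) auto
    ultimately have bAF: "bra (A * F') \<in> homs (tensor M N) trivial_mod" by simp
    then have \<pi>: "\<pi> \<in> homs (tensor M N) trivial_mod" unfolding \<iota>_\<pi>_def by (rule homs_smult[OF T t(1)])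
    have BAF: "B * (A * F') = F'" using assoc_mult_mat[OF AB(2,1) Fc(1)] A_B(2) Fc by simp
    have p\<pi>: "pairing trivial_mod \<pi> f = pairing trivial_mod (bra (A * F')) f / \<kappa>" if "f \<in> carrier_mat (d * mdim N) 1" for f
      using that AB Fc t(2) by (simp add: \<iota>_\<pi>_def pairing_def mat_smult_left tr_smult)
    have tF: "transpose_mat (transpose_mat F) = F" "transpose_mat F \<in> carrier_mat d (mdim N)" using Fc by auto
    have AFc: "A * F' \<in> carrier_mat d (mdim N)" using AB Fc by simp
    have "has_mult trivial_mod (tensor M N) 1"
    proof (rule has_multI[of 1 "\<lambda>_. \<iota>" _ _ "\<lambda>_. \<pi>"])
      fix f h assume f: "f \<in> homs trivial_mod (tensor M N)" and h: "h \<in> homs (tensor M N) trivial_mod"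
      obtain X where X: "X \<in> carrier_mat d (mdim N)" "f = ket X" "transpose_mat X \<in> homs (dual M) N" using adj[OF f] by blast
      obtain Z where Z: "Z \<in> carrier_mat d (mdim N)" "h = bra Z" "B * Z \<in> homs N (dual M)" using adj'[OF h] by blast
      have BZ: "B * Z \<in> carrier_mat d (mdim N)" using AB Z(1) by simp
      have fc: "f \<in> carrier_mat (d * mdim N) 1" using X(1) unfolding X(2) by (intro carrier_matI) auto
      have e1: "pairing trivial_mod h f = \<kappa> * tr (B * Z * transpose_mat X) / d"
        unfolding X(2) Z(2) pair[OF X(1) Z(1)] by (rule trA[OF homs_comp[OF D(1) Nm D(1) X(3) Z(3)]])
      have e2: "pairing trivial_mod h \<iota> = \<kappa> * tr (B * Z * F) / d"
        unfolding \<iota>_\<pi>_def Z(2) pair[OF tF(2) Z(1)] tF(1) by (rule trA[OF homs_comp[OF D(1) Nm D(1) F(2) Z(3)]])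
      have e3: "pairing trivial_mod \<pi> f = tr (F' * transpose_mat X) / d"
        unfolding p\<pi>[OF fc] unfolding X(2) pair[OF X(1) AFc] BAF
        using trA[OF homs_comp[OF D(1) Nm D(1) X(3) F(1)]] \<kappa> by simp
      \<comment> \<open>Inserting \<open>F * F' = 1\<close> writes the composite as a product of two
        endomorphisms of the dual of \<open>M\<close>. The normalised trace is multiplicative on
        these, so the form has rank one.\<close>
      have "B * Z * transpose_mat X = B * Z * (F * F') * transpose_mat X" unfolding F(3) right_mult_one_mat[OF BZ] ..
      also have "\<dots> = (B * Z * F) * (F' * transpose_mat X)" using AB Z(1) X(1) Fc by (simp add: mat_assoc)
      finally have "B * Z * transpose_mat X = (B * Z * F) * (F' * transpose_mat X)" .
      then have "tr (B * Z * transpose_mat X) = tr (B * Z * F) * tr (F' * transpose_mat X) / d"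
        using indec_trace_mult[OF Di homs_comp[OF D(1) Nm D(1) F(2) Z(3)] homs_comp[OF D(1) Nm D(1) X(3) F(1)]] D(2)
        by (simp add: d_def)
      then show "pairing trivial_mod h f = (\<Sum>t<1::nat. pairing trivial_mod h \<iota> * pairing trivial_mod \<pi> f)"
        unfolding e1 e2 e3 using d0 by (simp add: field_simps)
    next
      have \<iota>c: "\<iota> \<in> carrier_mat (d * mdim N) 1" using Fc by (auto simp: \<iota>_\<pi>_def)
      have "pairing trivial_mod \<pi> \<iota> = tr (A * (F' * F)) / \<kappa>"
        unfolding p\<pi>[OF \<iota>c] unfolding \<iota>_\<pi>_def pair[OF tF(2) AFc] BAF tF(1) ..
      also have "\<dots> = 1" unfolding F(4) using AB ta \<kappa> by simp
      finally show "1 = (\<Sum>t<1::nat. pairing trivial_mod \<pi> \<iota>)" by simp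
    qed (use \<iota> \<pi> in auto)
    then show ?thesis using True by simp
  qed
  then show ?thesis by (rule mult_eqI)
qed

end

subsection \<open>Integral combinations in abelian groups\<close>

context abelian_group
begin

definition int_comb :: "'i set \<Rightarrow> ('i \<Rightarrow> 'a) \<Rightarrow> ('i \<Rightarrow> int) \<Rightarrow> 'a" where
  "int_comb I v f = (\<Oplus>i\<in>I. [f i] \<cdot> v i)"

lemma int_smult_closed: "x \<in> carrier G \<Longrightarrow> add_pow G (k :: int) x \<in> carrier G"
  by (rule add.int_pow_closed)

lemma int_smult_zero: "add_pow G (0 :: int) x = \<zero>"
  by (simp add: add_pow_def)

lemma int_smult_one: "x \<in> carrier G \<Longrightarrow> add_pow G (1 :: int) x = x"
  using group.int_pow_1[OF a_group, of x] by (simp add: add_pow_def)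

lemma int_smult_add: "x \<in> carrier G \<Longrightarrow> add_pow G (k + l :: int) x = add_pow G k x \<oplus> add_pow G l x"
  unfolding add_pow_def using group.int_pow_mult[OF a_group, of x k l] by simp

lemma int_comb_closed: "v \<in> I \<rightarrow> carrier G \<Longrightarrow> int_comb I v f \<in> carrier G"
  unfolding int_comb_def by (rule finsum_closed) (auto intro: int_smult_closed)

lemma int_comb_cong: "v \<in> I \<rightarrow> carrier G \<Longrightarrow> (\<And>i. i \<in> I \<Longrightarrow> f i = f' i) \<Longrightarrow> (\<And>i. i \<in> I \<Longrightarrow> v i = v' i) \<Longrightarrow> int_comb I v f = int_comb I v' f'"
  unfolding int_comb_def by (rule finsum_cong') (auto intro!: int_smult_closed simp: Pi_iff)

lemma int_comb_add: "v \<in> I \<rightarrow> carrier G \<Longrightarrow> int_comb I v (\<lambda>i. f i + f' i) = int_comb I v f \<oplus> int_comb I v f'"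
proof -
  assume v: "v \<in> I \<rightarrow> carrier G"
  have "int_comb I v (\<lambda>i. f i + f' i) = (\<Oplus>i\<in>I. [f i] \<cdot> v i \<oplus> [f' i] \<cdot> v i)"
    unfolding int_comb_def using v by (intro finsum_cong') (auto intro!: int_smult_closed simp: int_smult_add Pi_iff)
  also have "\<dots> = int_comb I v f \<oplus> int_comb I v f'"
    unfolding int_comb_def using v by (intro finsum_addf) (auto intro: int_smult_closed)
  finally show ?thesis .
qed

lemma int_comb_zero: "int_comb I v (\<lambda>_. 0) = \<zero>"
  by (simp add: int_comb_def int_smult_zero)

lemma int_comb_single:
  assumes "finite I" "j \<in> I" "v \<in> I \<rightarrow> carrier G"
  shows "int_comb I v (\<lambda>i. if i = j then 1 else 0) = v j"
proof -
  have "int_comb I v (\<lambda>i. if i = j then 1 else 0) = (\<Oplus>i\<in>I. if j = i then v i else \<zero>)"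
    unfolding int_comb_def using assms(3) by (intro finsum_cong') (auto simp: int_smult_zero int_smult_one Pi_iff)
  also have "\<dots> = v j" using assms by (intro finsum_singleton) auto
  finally show ?thesis .
qed

lemma double_eq_zero: "x \<in> carrier G \<Longrightarrow> x \<oplus> x = x \<Longrightarrow> x = \<zero>"
  using r_neg1[of x x] l_neg[of x] by simp

lemma additive_int_smult:
  fixes h :: "'a \<Rightarrow> int"
  assumes h: "\<And>x y. x \<in> carrier G \<Longrightarrow> y \<in> carrier G \<Longrightarrow> h (x \<oplus> y) = h x + h y" and x: "x \<in> carrier G"
  shows "h (add_pow G (k :: int) x) = k * h x"
proof (induction k rule: int_induct[of _ 0])
  case base
  have "h \<zero> = 0" using h[OF zero_closed zero_closed] by simp
  then show ?case by (simp add: int_smult_zero)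
next
  case (step1 i)
  have "h (add_pow G (i + 1) x) = h (add_pow G i x \<oplus> x)" by (simp only: int_smult_add[OF x] int_smult_one[OF x])
  then show ?case using step1 h[OF int_smult_closed[OF x] x, of i] x by (simp add: algebra_simps)
next
  case (step2 i)
  have "h (add_pow G ((i - 1) + 1) x) = h (add_pow G (i - 1) x \<oplus> x)" by (simp only: int_smult_add[OF x] int_smult_one[OF x])
  then show ?case using step2 h[OF int_smult_closed[OF x] x, of "i - 1"] x by (simp add: algebra_simps)
qed

lemma additive_int_comb:
  fixes h :: "'a \<Rightarrow> int"
  assumes h: "\<And>x y. x \<in> carrier G \<Longrightarrow> y \<in> carrier G \<Longrightarrow> h (x \<oplus> y) = h x + h y" and "finite I" "v \<in> I \<rightarrow> carrier G"
  shows "h (int_comb I v f) = (\<Sum>i\<in>I. f i * h (v i))"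
  using assms(2,3)
proof (induction I rule: finite_induct)
  case empty
  show ?case using h[OF zero_closed zero_closed] by (simp add: int_comb_def)
next
  case (insert i I)
  have "int_comb (insert i I) v f = [f i] \<cdot> v i \<oplus> int_comb I v f"
    unfolding int_comb_def using insert by (intro finsum_insert) (auto intro!: int_smult_closed)
  moreover have "int_comb I v f \<in> carrier G" by (rule int_comb_closed) (use insert in auto)
  moreover have "v i \<in> carrier G" using insert by auto
  ultimately show ?case using insert h additive_int_smult[of h, OF h] by (simp add: int_smult_closed)
qed

end

context nonnilpotent_group_datum
begin

subsection \<open>The stable Green ring\<close>

lemma stable_class_refl: "is_module M \<Longrightarrow> M \<in> stable_class M"
  by (simp add: stable_class_def stable_iso_refl)

lemma stable_iso_tensor_cong:
  assumes "is_module M" "is_module M'" "is_module N" "is_module N'" "stable_iso M M'" "stable_iso N N'"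
  shows "stable_iso (tensor M N) (tensor M' N')"
  by (rule stable_iso_trans[OF tensor_module(1)[OF assms(1,3)] tensor_module(1)[OF assms(2,3)] tensor_module(1)[OF assms(2,4)]
    stable_iso_tensor(1)[OF assms(1,2,3,5)] stable_iso_tensor(2)[OF assms(3,4,2,6)]])

lemma stable_class_iso: "is_module M \<Longrightarrow> is_module N \<Longrightarrow> mod_iso M N \<Longrightarrow> stable_class M = stable_class N"
  using stable_class_eq_iff stable_iso_mod_iso by blast

lemma stable_classes_simps:
  "carrier stable_classes = {stable_class M | M. is_module M}" "one stable_classes = stable_class trivial_mod"
  by (simp_all add: stable_classes_def)

lemma stable_class_closed: "is_module M \<Longrightarrow> stable_class M \<in> carrier stable_classes"
  unfolding stable_classes_simps by blast

text \<open>All classes in the union that defines the product coincide, because the tensor product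
  respects stable isomorphism; this rests on \<open>projective_tensor_left\<close> and
  \<open>projective_tensor_right\<close>.\<close>

lemma stable_class_tensor:
  assumes M: "is_module M" and N: "is_module N"
  shows "stable_class M \<otimes>\<^bsub>stable_classes\<^esub> stable_class N = stable_class (tensor M N)"
proof -
  have "stable_class (tensor M' N') = stable_class (tensor M N)" if "M' \<in> stable_class M" "N' \<in> stable_class N" for M' N'
  proof -
    have m: "is_module M'" "is_module N'" "stable_iso M' M" "stable_iso N' N"
      using that by (auto simp: stable_class_def intro: stable_iso_sym)
    then show ?thesis
      using stable_class_eq_iff[OF tensor_module(1)[OF m(1,2)] tensor_module(1)[OF M N]] stable_iso_tensor_cong[OF m(1) M m(2) N m(3,4)]
      by blast
  qed
  then have "(\<Union>M'\<in>stable_class M. \<Union>N'\<in>stable_class N. stable_class (tensor M' N')) =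
      (\<Union>M'\<in>stable_class M. \<Union>N'\<in>stable_class N. stable_class (tensor M N))" by blast
  also have "\<dots> = stable_class (tensor M N)" using stable_class_refl[OF M] stable_class_refl[OF N] by blast
  finally show ?thesis by (simp add: stable_classes_def)
qed

lemma stable_classes_monoid: "monoid stable_classes"
proof (rule monoidI)
  note T = tensor_module(1) and t = trivial_module(1,2)
  fix A B C assume "A \<in> carrier stable_classes" "B \<in> carrier stable_classes"
  then obtain M N where MN: "is_module M" "A = stable_class M" "is_module N" "B = stable_class N"
    by (auto simp: stable_classes_simps)
  show "A \<otimes>\<^bsub>stable_classes\<^esub> B \<in> carrier stable_classes"
    unfolding MN stable_class_tensor[OF MN(1,3)] stable_classes_simps using T[OF MN(1,3)] by blast
  assume "C \<in> carrier stable_classes"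
  then obtain L where L: "is_module L" "C = stable_class L" by (auto simp: stable_classes_simps)
  have "mod_iso (tensor (tensor M N) L) (tensor M (tensor N L))"
    by (rule mod_iso_same_gens) (use MN L T tensor_assoc in \<open>simp_all add: mult.assoc\<close>)
  then show "A \<otimes>\<^bsub>stable_classes\<^esub> B \<otimes>\<^bsub>stable_classes\<^esub> C = A \<otimes>\<^bsub>stable_classes\<^esub> (B \<otimes>\<^bsub>stable_classes\<^esub> C)"
    unfolding MN L using MN L T by (simp add: stable_class_tensor stable_class_iso)
next
  note T = tensor_module(1) and t = trivial_module(1,2)
  show "\<one>\<^bsub>stable_classes\<^esub> \<in> carrier stable_classes" using stable_class_closed[OF t(1)] by (simp add: stable_classes_simps(2))
  fix A assume "A \<in> carrier stable_classes"
  then obtain M where M: "is_module M" "A = stable_class M" by (auto simp: stable_classes_simps)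
  have "mod_iso (tensor trivial_mod M) M" "mod_iso (tensor M trivial_mod) M"
    by (rule mod_iso_same_gens; use M T t tensor_unit in simp)+
  then show "\<one>\<^bsub>stable_classes\<^esub> \<otimes>\<^bsub>stable_classes\<^esub> A = A" "A \<otimes>\<^bsub>stable_classes\<^esub> \<one>\<^bsub>stable_classes\<^esub> = A"
    unfolding M stable_classes_simps using M t T by (simp_all add: stable_class_tensor stable_class_iso)
qed

abbreviation "SF \<equiv> stable_free_ring"
abbreviation "GR \<equiv> stable_green_ring"

abbreviation st :: "'g hopf_mod \<Rightarrow> 'g hopf_mod set \<Rightarrow>\<^sub>0 int" where
  "st M \<equiv> Poly_Mapping.single (stable_class M) 1"

lemma SF_ring: "ring SF"
  unfolding stable_free_ring_def by (rule monoid_ring_ring[OF stable_classes_monoid])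

lemma SF_simps:
  "p \<in> carrier SF \<longleftrightarrow> Poly_Mapping.keys p \<subseteq> carrier stable_classes" "p \<oplus>\<^bsub>SF\<^esub> q = p + q" "\<zero>\<^bsub>SF\<^esub> = 0" "\<one>\<^bsub>SF\<^esub> = st trivial_mod"
  by (simp_all add: stable_free_ring_def monoid_ring_simps stable_classes_simps)

lemma SF_mult:
  "Poly_Mapping.single A x \<otimes>\<^bsub>SF\<^esub> Poly_Mapping.single B y = Poly_Mapping.single (A \<otimes>\<^bsub>stable_classes\<^esub> B) (x * y)"
  "(p + q) \<otimes>\<^bsub>SF\<^esub> r = p \<otimes>\<^bsub>SF\<^esub> r + q \<otimes>\<^bsub>SF\<^esub> r" "r \<otimes>\<^bsub>SF\<^esub> (p + q) = r \<otimes>\<^bsub>SF\<^esub> p + r \<otimes>\<^bsub>SF\<^esub> q"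
  "0 \<otimes>\<^bsub>SF\<^esub> r = 0" "r \<otimes>\<^bsub>SF\<^esub> 0 = 0"
  unfolding stable_free_ring_def by (simp_all add: mr_mult_add_left mr_mult_add_right)

lemma SF_mult_diff:
  "(p - q) \<otimes>\<^bsub>SF\<^esub> r = p \<otimes>\<^bsub>SF\<^esub> r - q \<otimes>\<^bsub>SF\<^esub> r" "r \<otimes>\<^bsub>SF\<^esub> (p - q) = r \<otimes>\<^bsub>SF\<^esub> p - r \<otimes>\<^bsub>SF\<^esub> q"
  using SF_mult(2)[of "p - q" q r] SF_mult(3)[of r "p - q" q] by simp_all

lemma st_closed: "is_module M \<Longrightarrow> Poly_Mapping.single (stable_class M) c \<in> carrier SF"
  by (simp add: SF_simps stable_class_closed)

definition sum_relators :: "('g hopf_mod set \<Rightarrow>\<^sub>0 int) set" where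
  "sum_relators = {st (local.direct_sum M N) - st M - st N | M N. is_module M \<and> is_module N}"

lemma SF_diff_closed: "p \<in> carrier SF \<Longrightarrow> q \<in> carrier SF \<Longrightarrow> p - q \<in> carrier SF"
  using keys_diff[of p q] by (auto simp: SF_simps)

lemma sum_relators_carrier: "sum_relators \<subseteq> carrier SF"
proof
  fix r assume "r \<in> sum_relators"
  then obtain M N where MN: "is_module M" "is_module N" "r = st (local.direct_sum M N) - st M - st N"
    unfolding sum_relators_def by blast
  show "r \<in> carrier SF" unfolding MN(3)
    by (rule SF_diff_closed[OF SF_diff_closed[OF st_closed[OF direct_sum_module(1)[OF MN(1,2)]] st_closed[OF MN(1)]] st_closed[OF MN(2)]])
qed

lemma direct_sum_ideal_eq: "direct_sum_ideal = Idl\<^bsub>SF\<^esub> sum_relators"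
  unfolding direct_sum_ideal_def sum_relators_def ..

lemma direct_sum_ideal: "ideal direct_sum_ideal SF"
  unfolding direct_sum_ideal_eq by (rule ring.genideal_ideal[OF SF_ring sum_relators_carrier])

lemma GR_ring: "ring GR"
  unfolding stable_green_ring_def by (rule ideal.quotient_is_ring[OF direct_sum_ideal])

lemma GR_hom: "(\<lambda>p. direct_sum_ideal +>\<^bsub>SF\<^esub> p) \<in> Ring.ring_hom SF GR"
  unfolding stable_green_ring_def by (rule ideal.rcos_ring_hom[OF direct_sum_ideal])

definition green :: "'g hopf_mod \<Rightarrow> ('g hopf_mod set \<Rightarrow>\<^sub>0 int) set" where
  "green M = direct_sum_ideal +>\<^bsub>SF\<^esub> st M"

lemma green_closed: "is_module M \<Longrightarrow> green M \<in> carrier GR"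
  unfolding green_def by (rule ring_hom_closed[OF GR_hom]) (rule st_closed)

lemma green_stable: "is_module M \<Longrightarrow> is_module N \<Longrightarrow> stable_iso M N \<Longrightarrow> green M = green N"
  using stable_class_eq_iff[of M N] by (simp add: green_def)

lemma green_iso: "is_module M \<Longrightarrow> is_module N \<Longrightarrow> mod_iso M N \<Longrightarrow> green M = green N"
  using green_stable stable_iso_mod_iso by blast

lemma green_tensor: "is_module M \<Longrightarrow> is_module N \<Longrightarrow> green M \<otimes>\<^bsub>GR\<^esub> green N = green (tensor M N)"
  unfolding green_def
  by (subst ring_hom_mult[OF GR_hom, symmetric]) (simp_all add: st_closed SF_mult stable_class_tensor)

lemma green_one: "green trivial_mod = \<one>\<^bsub>GR\<^esub>"
  unfolding green_def using ring_hom_one[OF GR_hom] by (simp add: SF_simps)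

lemma green_direct_sum:
  assumes M: "is_module M" and N: "is_module N"
  shows "green (local.direct_sum M N) = green M \<oplus>\<^bsub>GR\<^esub> green N"
proof -
  interpret ring GR by (rule GR_ring)
  let ?q = "\<lambda>p. direct_sum_ideal +>\<^bsub>SF\<^esub> p"
  let ?r = "st (local.direct_sum M N) - st M - st N"
  have rg: "?r \<in> sum_relators" unfolding sum_relators_def using M N by blast
  then have r: "?r \<in> direct_sum_ideal" unfolding direct_sum_ideal_eq
    using ring.genideal_self[OF SF_ring sum_relators_carrier] by blast
  have rc: "?r \<in> carrier SF" using rg sum_relators_carrier by blast
  have "?q ?r = direct_sum_ideal"
    by (rule abelian_subgroup.a_rcos_const[OF _ r]) (rule abelian_subgroupI3[OF ideal.axioms(1)[OF direct_sum_ideal] ring.is_abelian_group[OF SF_ring]])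
  then have z: "?q ?r = \<zero>\<^bsub>GR\<^esub>" by (simp add: stable_green_ring_def FactRing_def)
  have "st (local.direct_sum M N) = ?r \<oplus>\<^bsub>SF\<^esub> (st M \<oplus>\<^bsub>SF\<^esub> st N)" by (simp add: SF_simps)
  then have "green (local.direct_sum M N) = ?q ?r \<oplus>\<^bsub>GR\<^esub> (green M \<oplus>\<^bsub>GR\<^esub> green N)"
    unfolding green_def
    using ring_hom_add[OF GR_hom rc ring.ring_simprules(1)[OF SF_ring st_closed[OF M, of 1] st_closed[OF N, of 1]]]
      ring_hom_add[OF GR_hom st_closed[OF M, of 1] st_closed[OF N, of 1]] by simp
  then show ?thesis unfolding z using green_closed M N by simp
qed

text \<open>A zero module is stably isomorphic to its double, so its class satisfies x + x =
  x.\<close>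

lemma green_zero:
  assumes M: "is_module M" and z: "mdim M = 0"
  shows "green M = \<zero>\<^bsub>GR\<^esub>"
proof -
  interpret ring GR by (rule GR_ring)
  have S: "is_module (local.direct_sum M M)" "mdim (local.direct_sum M M) = 0" using direct_sum_module(1,2)[OF M M] z by auto
  have "stable_iso (local.direct_sum M M) M"
    using projective_stable_zero[OF dim_0_projective[OF S]] projective_stable_zero[OF dim_0_projective[OF M z]]
      stable_iso_trans[OF S(1) zero_mod(1) M] stable_iso_sym by blast
  then have "green M \<oplus>\<^bsub>GR\<^esub> green M = green M"
    using green_direct_sum[OF M M] green_stable[OF S(1) M] by simp
  then show ?thesis by (rule double_eq_zero[OF green_closed[OF M]])
qed

lemma green_projective: "projective M \<Longrightarrow> green M = \<zero>\<^bsub>GR\<^esub>"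
  using green_stable[OF projective_module zero_mod(1) projective_stable_zero] green_zero[OF zero_mod] by simp

lemma green_class_eq:
  assumes M: "is_module M"
  shows "green_class (iso_class M) = green M"
proof -
  have "(\<Union>N\<in>iso_class M. stable_class N) = stable_class M"
  proof
    show "(\<Union>N\<in>iso_class M. stable_class N) \<subseteq> stable_class M"
      using stable_class_iso[OF M] by (fastforce simp: iso_class_def)
    show "stable_class M \<subseteq> (\<Union>N\<in>iso_class M. stable_class N)"
      using M mod_iso_refl[OF M] by (auto simp: iso_class_def)
  qed
  then show ?thesis by (simp add: green_class_def green_def)
qed

text \<open>The ring is additively generated by the classes of modules; integral multiples of one
  class are built up and down by steps of one.\<close>

lemma GR_induct [consumes 1, case_names green add uminus]:
  assumes x: "x \<in> carrier GR" and g: "\<And>M. is_module M \<Longrightarrow> P (green M)"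
    and a: "\<And>x y. x \<in> carrier GR \<Longrightarrow> y \<in> carrier GR \<Longrightarrow> P x \<Longrightarrow> P y \<Longrightarrow> P (x \<oplus>\<^bsub>GR\<^esub> y)"
    and u: "\<And>x. x \<in> carrier GR \<Longrightarrow> P x \<Longrightarrow> P (\<ominus>\<^bsub>GR\<^esub> x)"
  shows "P x"
proof -
  interpret ring GR by (rule GR_ring)
  let ?q = "\<lambda>p. direct_sum_ideal +>\<^bsub>SF\<^esub> p"
  have qa: "?q (p + p') = ?q p \<oplus>\<^bsub>GR\<^esub> ?q p'" if "p \<in> carrier SF" "p' \<in> carrier SF" for p p'
    using ring_hom_add[OF GR_hom that] by (simp add: SF_simps)
  have q0: "?q 0 = \<zero>\<^bsub>GR\<^esub>"
  proof -
    have c: "0 \<in> carrier SF" by (simp add: SF_simps)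
    have "?q 0 \<oplus>\<^bsub>GR\<^esub> ?q 0 = ?q 0" using qa[OF c c] by simp
    then show ?thesis by (rule double_eq_zero[OF ring_hom_closed[OF GR_hom c]])
  qed
  have P0: "P (?q 0)" using g[OF zero_mod(1)] unfolding q0 green_zero[OF zero_mod] .
  have s: "P (?q (Poly_Mapping.single (stable_class M) c))" if M: "is_module M" for M c
  proof (induction c rule: int_induct[of _ 0])
    case base
    show ?case using P0 by simp
  next
    case (step1 i)
    have "?q (Poly_Mapping.single (stable_class M) (i + 1)) = ?q (Poly_Mapping.single (stable_class M) i) \<oplus>\<^bsub>GR\<^esub> green M"
      unfolding green_def by (subst qa[symmetric]) (simp_all add: st_closed[OF M] single_add)
    then show ?case using a[OF ring_hom_closed[OF GR_hom st_closed[OF M]] green_closed[OF M] step1(2) g[OF M]] by simp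
  next
    case (step2 i)
    have "?q (Poly_Mapping.single (stable_class M) i) = ?q (Poly_Mapping.single (stable_class M) (i - 1)) \<oplus>\<^bsub>GR\<^esub> green M"
      unfolding green_def by (subst qa[symmetric]) (simp_all add: st_closed[OF M] single_add[symmetric])
    then have "?q (Poly_Mapping.single (stable_class M) (i - 1)) =
        ?q (Poly_Mapping.single (stable_class M) i) \<oplus>\<^bsub>GR\<^esub> (\<ominus>\<^bsub>GR\<^esub> green M)"
      using ring_hom_closed[OF GR_hom st_closed[OF M, of "i - 1"]] green_closed[OF M] by (simp add: a_assoc r_neg)
    then show ?case
      using a[OF ring_hom_closed[OF GR_hom st_closed[OF M]] a_inv_closed[OF green_closed[OF M]] step2(2) u[OF green_closed[OF M] g[OF M]]] by simp
  qed
  from x have "x \<in> ?q ` carrier SF" unfolding stable_green_ring_def carrier_quotient .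
  then obtain p where p: "p \<in> carrier SF" "x = ?q p" by blast
  from p(1) have "Poly_Mapping.keys p \<subseteq> carrier stable_classes" by (simp add: SF_simps)
  then have "P (?q p)"
  proof (induction p rule: poly_mapping_span_induct)
    case (single A c)
    then show ?case using s by (auto simp: stable_classes_simps)
  next
    case (add p p')
    then have c: "p \<in> carrier SF" "p' \<in> carrier SF" by (simp_all add: SF_simps)
    show ?case unfolding qa[OF c] by (rule a[OF ring_hom_closed[OF GR_hom c(1)] ring_hom_closed[OF GR_hom c(2)] add.IH])
  qed (rule P0)
  then show ?thesis using p by simp
qed

definition additive_GR :: "(('g hopf_mod set \<Rightarrow>\<^sub>0 int) set \<Rightarrow> ('g hopf_mod set \<Rightarrow>\<^sub>0 int) set) \<Rightarrow> bool" where
  "additive_GR f \<longleftrightarrow> f \<in> carrier GR \<rightarrow> carrier GR \<and>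
     (\<forall>x\<in>carrier GR. \<forall>y\<in>carrier GR. f (x \<oplus>\<^bsub>GR\<^esub> y) = f x \<oplus>\<^bsub>GR\<^esub> f y)"

text \<open>Identities in the ring that are additive in a variable thereby become statements about
  modules, such as the compatibility of the dual with tensor products.\<close>

lemma additive_GR_eq:
  assumes f: "additive_GR f" and h: "additive_GR h" and e: "\<And>M. is_module M \<Longrightarrow> f (green M) = h (green M)" and x: "x \<in> carrier GR"
  shows "f x = h x"
proof -
  interpret ring GR by (rule GR_ring)
  have u: "k (\<ominus>\<^bsub>GR\<^esub> y) = \<ominus>\<^bsub>GR\<^esub> k y" if k: "additive_GR k" and y: "y \<in> carrier GR" for k y
  proof -
    have c: "k z \<in> carrier GR" if "z \<in> carrier GR" for z using k that by (auto simp: additive_GR_def)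
    have a: "k (z \<oplus>\<^bsub>GR\<^esub> w) = k z \<oplus>\<^bsub>GR\<^esub> k w" if "z \<in> carrier GR" "w \<in> carrier GR" for z w
      using k that by (auto simp: additive_GR_def)
    have "k \<zero>\<^bsub>GR\<^esub> \<oplus>\<^bsub>GR\<^esub> k \<zero>\<^bsub>GR\<^esub> = k \<zero>\<^bsub>GR\<^esub>" using a[OF zero_closed zero_closed] by simp
    then have z: "k \<zero>\<^bsub>GR\<^esub> = \<zero>\<^bsub>GR\<^esub>" by (rule double_eq_zero[OF c[OF zero_closed]])
    have "k (\<ominus>\<^bsub>GR\<^esub> y) \<oplus>\<^bsub>GR\<^esub> k y = \<zero>\<^bsub>GR\<^esub>" using a[of "\<ominus>\<^bsub>GR\<^esub> y" y] y z by (simp add: l_neg)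
    then show ?thesis using minus_equality c y by simp
  qed
  from x show ?thesis
    by (induction x rule: GR_induct) (use e f h in \<open>auto simp: u, auto simp: additive_GR_def\<close>)
qed

subsection \<open>Multiplicities as functionals on the Green ring\<close>

text \<open>A representative of each stable class is chosen; by \<open>mult_stable\<close> the
  choice does not affect the value for non-projective indecomposable \<open>M\<close>.\<close>

definition mult_fun :: "'g hopf_mod \<Rightarrow> ('g hopf_mod set \<Rightarrow>\<^sub>0 int) \<Rightarrow> int" where
  "mult_fun M p = pm_sum (\<lambda>A c. c * int (local.mult M (SOME X. X \<in> A))) p"

lemma mult_fun_coeff: "additive_coeff (\<lambda>A c. c * int (local.mult M (SOME X. X \<in> A)))"
  by unfold_locales (simp add: distrib_right)

lemma mult_fun_linear: "mult_fun M (p + q) = mult_fun M p + mult_fun M q" "mult_fun M (p - q) = mult_fun M p - mult_fun M q"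
  "mult_fun M 0 = 0" "mult_fun M (- p) = - mult_fun M p"
  unfolding mult_fun_def
  using additive_coeff.pm_sum_add[OF mult_fun_coeff] additive_coeff.pm_sum_diff[OF mult_fun_coeff]
    additive_coeff.pm_sum_zero[OF mult_fun_coeff] additive_coeff.pm_sum_uminus[OF mult_fun_coeff] by blast+

lemma mult_fun_single:
  assumes M: "nonproj_indec M" and X: "is_module X"
  shows "mult_fun M (Poly_Mapping.single (stable_class X) c) = c * int (local.mult M X)"
proof -
  have "(SOME Z. Z \<in> stable_class X) \<in> stable_class X" by (rule someI[of "\<lambda>Z. Z \<in> stable_class X"]) (rule stable_class_refl[OF X])
  then have "local.mult M (SOME Z. Z \<in> stable_class X) = local.mult M X"
    using mult_stable[OF M X, of "SOME Z. Z \<in> stable_class X"] by (simp add: stable_class_def)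
  then show ?thesis unfolding mult_fun_def additive_coeff.pm_sum_single[OF mult_fun_coeff] by simp
qed

text \<open>The functional is additive but not multiplicative, so vanishing on the generators of the
  ideal does not suffice. The set \<open>K\<close> asks for vanishing after multiplication by
  classes on both sides, which makes it a two-sided ideal. It contains the generators because
  tensoring on either side preserves direct sums, and taking unit classes on both sides gives the
  claim.\<close>

lemma mult_fun_ideal:
  assumes M: "nonproj_indec M" and p: "p \<in> direct_sum_ideal"
  shows "mult_fun M p = 0"
proof -
  interpret S: ring SF by (rule SF_ring)
  interpret C: monoid stable_classes by (rule stable_classes_monoid)
  let ?s = "Poly_Mapping.single :: 'g hopf_mod set \<Rightarrow> int \<Rightarrow> _"
  have sc: "?s A c \<in> carrier SF" if "A \<in> carrier stable_classes" for A c
    using that st_closed by (auto simp: stable_classes_simps)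
  define K where "K = {p \<in> carrier SF. \<forall>A\<in>carrier stable_classes. \<forall>B\<in>carrier stable_classes. \<forall>c d.
    mult_fun M (?s A c \<otimes>\<^bsub>SF\<^esub> p \<otimes>\<^bsub>SF\<^esub> ?s B d) = 0}"
  have "ideal K SF"
  proof (rule idealI[OF SF_ring])
    show "subgroup K (add_monoid SF)"
    proof (rule subgroup.intro)
      fix x assume x: "x \<in> K"
      then have xc: "x \<in> carrier SF" by (simp add: K_def)
      have "\<ominus>\<^bsub>SF\<^esub> x = - x" unfolding stable_free_ring_def
        by (rule monoid_ring_uminus[OF stable_classes_monoid]) (use xc in \<open>simp add: stable_free_ring_def\<close>)
      moreover have "\<ominus>\<^bsub>SF\<^esub> x \<in> K"
        using x xc unfolding K_def calculation
        by (auto simp: SF_simps(1) SF_mult_diff[of 0, simplified] SF_mult(4,5) mult_fun_linear SF_mult_diff(2)[of _ 0, simplified SF_mult(5), simplified])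
      ultimately show "inv\<^bsub>add_monoid SF\<^esub> x \<in> K" by (simp add: a_inv_def)
    qed (auto simp: K_def SF_simps(2,3) SF_mult mult_fun_linear S.add.m_closed[unfolded SF_simps(2)] S.zero_closed[unfolded SF_simps(3)])
  next
    fix x r assume x: "x \<in> K" and r: "r \<in> carrier SF"
    have xc: "x \<in> carrier SF" and xz: "\<And>A B c d. A \<in> carrier stable_classes \<Longrightarrow> B \<in> carrier stable_classes \<Longrightarrow>
        mult_fun M (?s A c \<otimes>\<^bsub>SF\<^esub> x \<otimes>\<^bsub>SF\<^esub> ?s B d) = 0" using x by (auto simp: K_def)
    have rk: "Poly_Mapping.keys r \<subseteq> carrier stable_classes" using r by (simp add: SF_simps)
    have "mult_fun M (?s A c \<otimes>\<^bsub>SF\<^esub> (r \<otimes>\<^bsub>SF\<^esub> x) \<otimes>\<^bsub>SF\<^esub> ?s B d) = 0 \<and> mult_fun M (?s A c \<otimes>\<^bsub>SF\<^esub> (x \<otimes>\<^bsub>SF\<^esub> r) \<otimes>\<^bsub>SF\<^esub> ?s B d) = 0"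
      if AB: "A \<in> carrier stable_classes" "B \<in> carrier stable_classes" for A B c d
      using rk
    proof (induction r rule: poly_mapping_span_induct)
      case (single E e)
      have "?s A c \<otimes>\<^bsub>SF\<^esub> (?s E e \<otimes>\<^bsub>SF\<^esub> x) = ?s (A \<otimes>\<^bsub>stable_classes\<^esub> E) (c * e) \<otimes>\<^bsub>SF\<^esub> x"
        using S.m_assoc[OF sc[OF AB(1)] sc[OF single] xc] by (simp add: SF_mult)
      moreover have "?s A c \<otimes>\<^bsub>SF\<^esub> (x \<otimes>\<^bsub>SF\<^esub> ?s E e) \<otimes>\<^bsub>SF\<^esub> ?s B d = ?s A c \<otimes>\<^bsub>SF\<^esub> x \<otimes>\<^bsub>SF\<^esub> ?s (E \<otimes>\<^bsub>stable_classes\<^esub> B) (e * d)"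
        using S.m_assoc[OF sc[OF AB(1)] xc sc[OF single]] S.m_assoc[OF S.m_closed[OF sc[OF AB(1)] xc] sc[OF single] sc[OF AB(2)]] by (simp add: SF_mult)
      ultimately show ?case using xz C.m_closed AB single by simp
    qed (simp_all add: SF_mult mult_fun_linear)
    then show "r \<otimes>\<^bsub>SF\<^esub> x \<in> K" "x \<otimes>\<^bsub>SF\<^esub> r \<in> K" using r xc by (auto simp: K_def)
  qed
  moreover have "sum_relators \<subseteq> K"
  proof
    fix r assume r: "r \<in> sum_relators"
    then obtain X Z where XZ: "is_module X" "is_module Z" "r = st (local.direct_sum X Z) - st X - st Z" by (auto simp: sum_relators_def)
    have "mult_fun M (?s A c \<otimes>\<^bsub>SF\<^esub> r \<otimes>\<^bsub>SF\<^esub> ?s B d) = 0" if AB: "A \<in> carrier stable_classes" "B \<in> carrier stable_classes" for A B c d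
    proof -
      obtain U V where UV: "is_module U" "A = stable_class U" "is_module V" "B = stable_class V"
        using AB by (auto simp: stable_classes_simps)
      note T = tensor_module(1) and D = direct_sum_module(1)
      have e: "?s A c \<otimes>\<^bsub>SF\<^esub> st W \<otimes>\<^bsub>SF\<^esub> ?s B d = ?s (stable_class (tensor (tensor U W) V)) (c * d)" if "is_module W" for W
        using that UV T by (simp add: SF_mult stable_class_tensor)
      have "mod_iso (tensor U (local.direct_sum X Z)) (local.direct_sum (tensor U X) (tensor U Z))"
        by (rule tensor_direct_sum(2)[OF XZ(1,2) UV(1)])
      then have "stable_iso (tensor (tensor U (local.direct_sum X Z)) V) (tensor (local.direct_sum (tensor U X) (tensor U Z)) V)"
        by (intro stable_iso_tensor(1) stable_iso_mod_iso) (use T D UV XZ in auto)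
      moreover have "stable_iso (tensor (local.direct_sum (tensor U X) (tensor U Z)) V) (local.direct_sum (tensor (tensor U X) V) (tensor (tensor U Z) V))"
        by (intro stable_iso_mod_iso tensor_direct_sum(1)) (use T D UV XZ in auto)
      ultimately have "local.mult M (tensor (tensor U (local.direct_sum X Z)) V) = local.mult M (local.direct_sum (tensor (tensor U X) V) (tensor (tensor U Z) V))"
        using mult_stable[OF M] T D UV XZ by metis
      also have "\<dots> = local.mult M (tensor (tensor U X) V) + local.mult M (tensor (tensor U Z) V)"
        by (rule mult_direct_sum[OF M]) (use T UV XZ in auto)
      finally show ?thesis
        unfolding XZ(3) SF_mult_diff mult_fun_linear e[OF D[OF XZ(1,2)]] e[OF XZ(1)] e[OF XZ(2)]
          mult_fun_single[OF M T[OF T[OF UV(1) D[OF XZ(1,2)]] UV(3)]] mult_fun_single[OF M T[OF T[OF UV(1) XZ(1)] UV(3)]]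
          mult_fun_single[OF M T[OF T[OF UV(1) XZ(2)] UV(3)]]
        by (simp add: algebra_simps)
    qed
    then show "r \<in> K" using r sum_relators_carrier by (auto simp: K_def)
  qed
  ultimately have "p \<in> K" using S.genideal_minimal p unfolding direct_sum_ideal_eq by blast
  then have pc: "p \<in> carrier SF" and "mult_fun M (?s \<one>\<^bsub>stable_classes\<^esub> 1 \<otimes>\<^bsub>SF\<^esub> p \<otimes>\<^bsub>SF\<^esub> ?s \<one>\<^bsub>stable_classes\<^esub> 1) = 0"
    using C.one_closed by (auto simp: K_def)
  moreover have "?s \<one>\<^bsub>stable_classes\<^esub> 1 = \<one>\<^bsub>SF\<^esub>" by (simp add: SF_simps stable_classes_simps)
  ultimately show ?thesis by simp
qed

definition green_mult :: "'g hopf_mod \<Rightarrow> ('g hopf_mod set \<Rightarrow>\<^sub>0 int) set \<Rightarrow> int" where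
  "green_mult M x = the_elem (mult_fun M ` x)"

lemma green_mult_coset:
  assumes M: "nonproj_indec M" and p: "p \<in> carrier SF"
  shows "green_mult M (direct_sum_ideal +>\<^bsub>SF\<^esub> p) = mult_fun M p"
proof -
  have "mult_fun M ` (direct_sum_ideal +>\<^bsub>SF\<^esub> p) = {mult_fun M p}"
  proof
    show "mult_fun M ` (direct_sum_ideal +>\<^bsub>SF\<^esub> p) \<subseteq> {mult_fun M p}"
      using mult_fun_ideal[OF M] by (auto simp: a_r_coset_def' SF_simps mult_fun_linear)
    have "p \<in> direct_sum_ideal +>\<^bsub>SF\<^esub> p"
      using additive_subgroup.zero_closed[OF ideal.axioms(1)[OF direct_sum_ideal]] by (force simp: a_r_coset_def' SF_simps)
    then show "{mult_fun M p} \<subseteq> mult_fun M ` (direct_sum_ideal +>\<^bsub>SF\<^esub> p)" by blast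
  qed
  then show ?thesis by (simp add: green_mult_def)
qed

lemma green_mult_add:
  assumes M: "nonproj_indec M" and xy: "x \<in> carrier GR" "y \<in> carrier GR"
  shows "green_mult M (x \<oplus>\<^bsub>GR\<^esub> y) = green_mult M x + green_mult M y"
proof -
  let ?q = "\<lambda>p. direct_sum_ideal +>\<^bsub>SF\<^esub> p"
  from xy have "x \<in> ?q ` carrier SF" "y \<in> ?q ` carrier SF" unfolding stable_green_ring_def carrier_quotient .
  then obtain p p' where p: "p \<in> carrier SF" "x = ?q p" "p' \<in> carrier SF" "y = ?q p'" by blast
  have "x \<oplus>\<^bsub>GR\<^esub> y = ?q (p \<oplus>\<^bsub>SF\<^esub> p')" unfolding p using ring_hom_add[OF GR_hom p(1,3)] by simp
  then show ?thesis
    unfolding p green_mult_coset[OF M p(1)] green_mult_coset[OF M p(3)]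
    using green_mult_coset[OF M ring.ring_simprules(1)[OF SF_ring p(1,3)]] by (simp add: SF_simps mult_fun_linear)
qed

lemma green_mult_green: "nonproj_indec M \<Longrightarrow> is_module X \<Longrightarrow> green_mult M (green X) = int (local.mult M X)"
  unfolding green_def by (simp add: green_mult_coset st_closed mult_fun_single)

end

context nonnilpotent_group_datum
begin

subsection \<open>The basis of non-projective indecomposable modules\<close>

definition rep :: "'g hopf_mod set \<Rightarrow> 'g hopf_mod" where
  "rep C = (SOME M. nonproj_indec M \<and> C = iso_class M)"

lemma rep:
  assumes C: "C \<in> nonproj_indec_classes"
  shows "nonproj_indec (rep C)" "iso_class (rep C) = C" "is_module (rep C)" "green_class C = green (rep C)"
proof -
  have "\<exists>M. nonproj_indec M \<and> C = iso_class M" using C unfolding nonproj_indec_classes_def by blast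
  then have *: "nonproj_indec (rep C) \<and> C = iso_class (rep C)" unfolding rep_def by (rule someI_ex)
  then show "nonproj_indec (rep C)" "iso_class (rep C) = C" by simp_all
  show m: "is_module (rep C)" using * indec_module(1) by blast
  show "green_class C = green (rep C)" using * green_class_eq[OF m] by metis
qed

lemma iso_class_mem: "nonproj_indec M \<Longrightarrow> iso_class M \<in> nonproj_indec_classes"
  unfolding nonproj_indec_classes_def by blast

lemma rep_iso_class:
  assumes M: "nonproj_indec M"
  shows "mod_iso (rep (iso_class M)) M" "green_class (iso_class M) = green M"
proof -
  note r = rep[OF iso_class_mem[OF M]] and m = indec_module(1)[OF conjunct1[OF M]]
  show "mod_iso (rep (iso_class M)) M" using r(2) iso_class_eq_iff[OF r(3) m] by blast
  show "green_class (iso_class M) = green M" by (rule green_class_eq[OF m])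
qed

lemma green_class_closed: "green_class \<in> nonproj_indec_classes \<rightarrow> carrier GR"
  using rep green_closed by simp

definition green_coeff :: "'g hopf_mod set \<Rightarrow> ('g hopf_mod set \<Rightarrow>\<^sub>0 int) set \<Rightarrow> int" where
  "green_coeff C x = green_mult (rep C) x"

lemma coeff_add: "C \<in> nonproj_indec_classes \<Longrightarrow> x \<in> carrier GR \<Longrightarrow> y \<in> carrier GR \<Longrightarrow> green_coeff C (x \<oplus>\<^bsub>GR\<^esub> y) = green_coeff C x + green_coeff C y"
  unfolding green_coeff_def by (rule green_mult_add[OF rep(1)])

lemma coeff_green: "C \<in> nonproj_indec_classes \<Longrightarrow> is_module X \<Longrightarrow> green_coeff C (green X) = int (local.mult (rep C) X)"
  unfolding green_coeff_def by (rule green_mult_green[OF rep(1)])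

lemma coeff_indec:
  assumes C: "C \<in> nonproj_indec_classes" and X: "nonproj_indec X"
  shows "green_coeff C (green X) = (if C = iso_class X then 1 else 0)"
proof -
  note m = indec_module(1)[OF conjunct1[OF X]]
  have "mod_iso (rep C) X \<longleftrightarrow> C = iso_class X" using iso_class_eq_iff[OF rep(3)[OF C] m] rep(2)[OF C] by simp
  then show ?thesis using coeff_green[OF C m] mult_indec[OF rep(1)[OF C] conjunct1[OF X]] by simp
qed

lemma coeff_basis: "C \<in> nonproj_indec_classes \<Longrightarrow> D \<in> nonproj_indec_classes \<Longrightarrow> green_coeff C (green_class D) = (if C = D then 1 else 0)"
  using coeff_indec[OF _ rep(1)] rep(2,4) by simp

abbreviation "comb \<equiv> abelian_group.int_comb GR nonproj_indec_classes"

lemma GR_abelian: "abelian_group GR"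
  using GR_ring by (rule ring.is_abelian_group)

lemma comb_coeff_additive:
  assumes v: "v \<in> nonproj_indec_classes \<rightarrow> carrier GR"
  shows "additive_GR (\<lambda>x. comb v (\<lambda>C. green_coeff C x))"
  unfolding additive_GR_def
proof (intro conjI ballI funcsetI)
  note A = GR_abelian
  show "comb v (\<lambda>C. green_coeff C x) \<in> carrier GR" for x by (rule abelian_group.int_comb_closed[OF A v])
  fix x y assume xy: "x \<in> carrier GR" "y \<in> carrier GR"
  have "comb v (\<lambda>C. green_coeff C (x \<oplus>\<^bsub>GR\<^esub> y)) = comb v (\<lambda>C. green_coeff C x + green_coeff C y)"
    by (rule abelian_group.int_comb_cong[OF A v]) (use coeff_add xy in auto)
  then show "comb v (\<lambda>C. green_coeff C (x \<oplus>\<^bsub>GR\<^esub> y)) = comb v (\<lambda>C. green_coeff C x) \<oplus>\<^bsub>GR\<^esub> comb v (\<lambda>C. green_coeff C y)"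
    using abelian_group.int_comb_add[OF A v] by simp
qed

text \<open>Both the expansion in the basis and the involution are of this form; \<open>F X\<close> is \<open>X\<close> and
  the dual of \<open>X\<close>, respectively.\<close>

lemma comb_coeff_green:
  assumes v: "v \<in> nonproj_indec_classes \<rightarrow> carrier GR"
    and i: "\<And>X. nonproj_indec X \<Longrightarrow> v (iso_class X) = green (F X)"
    and F: "\<And>X. is_module X \<Longrightarrow> is_module (F X)" "\<And>X. is_module X \<Longrightarrow> mdim X = 0 \<Longrightarrow> mdim (F X) = 0"
      "\<And>X. indecomposable X \<Longrightarrow> projective X \<Longrightarrow> projective (F X)"
      "\<And>X A B. is_module X \<Longrightarrow> is_module A \<Longrightarrow> is_module B \<Longrightarrow> mod_iso X (local.direct_sum A B) \<Longrightarrow>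
         mod_iso (F X) (local.direct_sum (F A) (F B))"
    and X: "is_module X"
  shows "comb v (\<lambda>C. green_coeff C (green X)) = green (F X)"
proof -
  note A = GR_abelian
  have z: "comb v (\<lambda>C. green_coeff C (green X)) = \<zero>\<^bsub>GR\<^esub>" if p: "projective X" for X
  proof -
    have X: "is_module X" by (rule projective_module[OF p])
    have "green_coeff C (green X) = 0" if C: "C \<in> nonproj_indec_classes" for C
    proof -
      have "local.mult (rep C) X = local.mult (rep C) zero_mod"
        by (rule mult_stable[OF rep(1)[OF C] X zero_mod(1) projective_stable_zero[OF p]])
      also have "\<dots> = 0" by (rule mult_eqI) (use has_mult_dim_0[OF zero_mod] in simp)
      finally show ?thesis by (simp add: coeff_green[OF C X])
    qed
    then have "comb v (\<lambda>C. green_coeff C (green X)) = comb v (\<lambda>C. 0)" by (intro abelian_group.int_comb_cong[OF A v]) auto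
    then show ?thesis using abelian_group.int_comb_zero[OF A] by simp
  qed
  from X show ?thesis
  proof (induction X rule: module_induct)
    case (zero X)
    then show ?case using z[OF dim_0_projective[OF zero]] green_zero F(1,2) by simp
  next
    case (indecomposable X)
    show ?case
    proof (cases "projective X")
      case True
      then show ?thesis using z[OF True] green_projective[OF F(3)[OF indecomposable True]] by simp
    next
      case False
      then have X: "nonproj_indec X" using indecomposable by simp
      have "comb v (\<lambda>C. green_coeff C (green X)) = comb v (\<lambda>C. if C = iso_class X then 1 else 0)"
        by (rule abelian_group.int_comb_cong[OF A v]) (use coeff_indec X in auto)
      also have "\<dots> = v (iso_class X)"
        by (rule abelian_group.int_comb_single[OF A finite_nonproj_indec_classes iso_class_mem[OF X] v])
      finally show ?thesis unfolding i[OF X] .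
    qed
  next
    case (sum X A B)
    have "green X = green A \<oplus>\<^bsub>GR\<^esub> green B"
      using green_iso[OF sum.hyps(1) direct_sum_module(1)[OF sum.hyps(2,3)] sum.hyps(4)] green_direct_sum[OF sum.hyps(2,3)] by simp
    moreover have "green (F X) = green (F A) \<oplus>\<^bsub>GR\<^esub> green (F B)"
      using green_iso[OF F(1)[OF sum.hyps(1)] direct_sum_module(1)[OF F(1)[OF sum.hyps(2)] F(1)[OF sum.hyps(3)]] F(4)[OF sum.hyps]]
        green_direct_sum[OF F(1)[OF sum.hyps(2)] F(1)[OF sum.hyps(3)]] by simp
    moreover have "comb v (\<lambda>C. green_coeff C (green A \<oplus>\<^bsub>GR\<^esub> green B)) = comb v (\<lambda>C. green_coeff C (green A)) \<oplus>\<^bsub>GR\<^esub> comb v (\<lambda>C. green_coeff C (green B))"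
      using comb_coeff_additive[OF v] green_closed sum.hyps(2,3) unfolding additive_GR_def by blast
    ultimately show ?case using sum.IH by simp
  qed
qed

lemma green_expansion:
  assumes x: "x \<in> carrier GR"
  shows "x = comb green_class (\<lambda>C. green_coeff C x)"
proof (rule additive_GR_eq[OF _ comb_coeff_additive[OF green_class_closed] _ x])
  show "additive_GR (\<lambda>x. x)" by (simp add: additive_GR_def)
  show "green M = comb green_class (\<lambda>C. green_coeff C (green M))" if "is_module M" for M
    by (rule comb_coeff_green[where F = "\<lambda>X. X", symmetric]) (use that green_class_closed rep_iso_class(2) in auto)
qed

text \<open>The functionals are dual to the basis, so a combination determines its coefficients;
  this is linear independence of the classes.\<close>

lemma coeff_comb:
  assumes C: "C \<in> nonproj_indec_classes"
  shows "green_coeff C (comb green_class f) = f C"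
proof -
  have "green_coeff C (comb green_class f) = (\<Sum>D\<in>nonproj_indec_classes. f D * green_coeff C (green_class D))"
    by (rule abelian_group.additive_int_comb[OF GR_abelian coeff_add[OF C] finite_nonproj_indec_classes green_class_closed])
  also have "\<dots> = (\<Sum>D\<in>nonproj_indec_classes. if D = C then f C else 0)"
    by (intro sum.cong refl) (use coeff_basis[OF C] in auto)
  also have "\<dots> = f C" using C finite_nonproj_indec_classes by simp
  finally show ?thesis .
qed

lemma green_coords_unique:
  assumes x: "x \<in> carrier GR"
  shows "c \<in> extensional nonproj_indec_classes \<and> x = comb green_class c \<longleftrightarrow> c = restrict (\<lambda>C. green_coeff C x) nonproj_indec_classes"
proof
  assume c: "c \<in> extensional nonproj_indec_classes \<and> x = comb green_class c"
  then show "c = restrict (\<lambda>C. green_coeff C x) nonproj_indec_classes"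
    using coeff_comb[of _ c] by (intro extensionalityI[of _ nonproj_indec_classes]) auto
next
  assume c: "c = restrict (\<lambda>C. green_coeff C x) nonproj_indec_classes"
  have "comb green_class c = comb green_class (\<lambda>C. green_coeff C x)"
    unfolding c by (rule abelian_group.int_comb_cong[OF GR_abelian green_class_closed]) auto
  then show "c \<in> extensional nonproj_indec_classes \<and> x = comb green_class c" using green_expansion[OF x] c by simp
qed

lemma green_basis: "is_Z_basis GR nonproj_indec_classes green_class"
  unfolding is_Z_basis_def abelian_group.int_comb_def[OF GR_abelian, symmetric]
  using finite_nonproj_indec_classes green_class_closed green_coords_unique by simp

lemma green_coords:
  assumes x: "x \<in> carrier GR" and C: "C \<in> nonproj_indec_classes"
  shows "coords GR nonproj_indec_classes green_class x C = green_coeff C x"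
  unfolding coords_def abelian_group.int_comb_def[OF GR_abelian, symmetric] green_coords_unique[OF x] using C by simp

subsection \<open>Duality on the Green ring\<close>

definition class_dual :: "'g hopf_mod set \<Rightarrow> 'g hopf_mod set" where
  "class_dual C = iso_class (dual (rep C))"

abbreviation "green_star \<equiv> star_map GR nonproj_indec_classes green_class class_dual"

lemma class_dual_mem: "C \<in> nonproj_indec_classes \<Longrightarrow> class_dual C \<in> nonproj_indec_classes"
  unfolding class_dual_def by (rule iso_class_mem[OF dual_nonproj_indec[OF rep(1)]])

lemma class_dual_iso_class:
  assumes M: "nonproj_indec M"
  shows "class_dual (iso_class M) = iso_class (dual M)"
proof -
  note r = rep[OF iso_class_mem[OF M]] and m = indec_module(1)[OF conjunct1[OF M]]
  have "mod_iso (dual (rep (iso_class M))) (dual M)" by (rule dual_iso[OF r(3) m rep_iso_class(1)[OF M]])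
  then show ?thesis unfolding class_dual_def using iso_class_eq_iff[OF dual_module(1)[OF r(3)] dual_module(1)[OF m]] by simp
qed

lemma class_dual_dual:
  assumes C: "C \<in> nonproj_indec_classes"
  shows "class_dual (class_dual C) = C"
proof -
  note r = rep[OF C]
  have "class_dual (class_dual C) = iso_class (dual (dual (rep C)))"
    unfolding class_dual_def[of C] by (rule class_dual_iso_class[OF dual_nonproj_indec[OF r(1)]])
  also have "\<dots> = iso_class (rep C)"
    using iso_class_eq_iff[OF r(3) dual_module(1)[OF dual_module(1)[OF r(3)]]] dual_dual[OF r(3)] by simp
  finally show ?thesis using r(2) by simp
qed

lemma dual_class_closed: "(\<lambda>C. green_class (class_dual C)) \<in> nonproj_indec_classes \<rightarrow> carrier GR"
  using green_class_closed class_dual_mem by (simp add: Pi_iff)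

lemma green_star_comb:
  assumes x: "x \<in> carrier GR"
  shows "green_star x = comb (\<lambda>C. green_class (class_dual C)) (\<lambda>C. green_coeff C x)"
  unfolding star_map_def abelian_group.int_comb_def[OF GR_abelian, symmetric]
  by (rule abelian_group.int_comb_cong[OF GR_abelian dual_class_closed]) (use green_coords[OF x] in auto)

lemma green_star_additive: "additive_GR green_star"
proof -
  have "x \<oplus>\<^bsub>GR\<^esub> y \<in> carrier GR" if "x \<in> carrier GR" "y \<in> carrier GR" for x y
    by (rule ring.ring_simprules(1)[OF GR_ring that])
  then show ?thesis
    using comb_coeff_additive[OF dual_class_closed] by (simp add: additive_GR_def green_star_comb Pi_iff)
qed

lemma green_star_green:
  assumes M: "is_module M"
  shows "green_star (green M) = green (dual M)"
  unfolding green_star_comb[OF green_closed[OF M]]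
proof (rule comb_coeff_green[OF dual_class_closed _ _ _ _ _ M])
  show "green_class (class_dual (iso_class X)) = green (dual X)" if "nonproj_indec X" for X
    unfolding class_dual_iso_class[OF that] by (rule rep_iso_class(2)[OF dual_nonproj_indec[OF that]])
  fix X A B assume h: "is_module X" "is_module A" "is_module B" "mod_iso X (local.direct_sum A B)"
  note S = direct_sum_module(1)[OF h(2,3)] and D = dual_module(1)
  obtain i p j q where b: "biproduct (local.direct_sum A B) A B i p j q" by (rule direct_sum_biproduct[OF h(2,3)])
  show "mod_iso (dual X) (local.direct_sum (dual A) (dual B))"
    by (rule mod_iso_trans[OF D[OF h(1)] D[OF S] direct_sum_module(1)[OF D[OF h(2)] D[OF h(3)]] dual_iso[OF h(1) S h(4)]
      biproduct_iso[OF D[OF S] D[OF h(2)] D[OF h(3)] dual_biproduct[OF S h(2,3) b]]])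
qed (use dual_module(1,2) dual_projective_indec in auto)

lemma green_star_anti_involution: "anti_involution GR green_star"
proof -
  interpret ring GR by (rule GR_ring)
  note D = dual_module(1) and T = tensor_module(1) and t = trivial_module(1)
  have cl: "green_star x \<in> carrier GR" if "x \<in> carrier GR" for x using green_star_additive that by (auto simp: additive_GR_def)
  have ad: "green_star (x \<oplus>\<^bsub>GR\<^esub> y) = green_star x \<oplus>\<^bsub>GR\<^esub> green_star y" if "x \<in> carrier GR" "y \<in> carrier GR" for x y
    using green_star_additive that by (auto simp: additive_GR_def)
  have one: "green_star \<one>\<^bsub>GR\<^esub> = \<one>\<^bsub>GR\<^esub>"
    unfolding green_one[symmetric] green_star_green[OF t] by (rule green_iso[OF D[OF t] t dual_trivial])
  have inv: "green_star (green_star x) = x" if x: "x \<in> carrier GR" for x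
  proof (rule additive_GR_eq[OF _ _ _ x])
    show "additive_GR (\<lambda>x. green_star (green_star x))" by (simp add: additive_GR_def cl ad)
    show "additive_GR (\<lambda>x. x)" by (simp add: additive_GR_def)
    show "green_star (green_star (green M)) = green M" if "is_module M" for M
      unfolding green_star_green[OF that] green_star_green[OF D[OF that]]
      by (rule green_iso[OF that D[OF D[OF that]] dual_dual[OF that], symmetric])
  qed
  \<comment> \<open>Multiplicativity is biadditive, so it is extended from classes to arbitrary
    elements in one factor at a time; between two classes it is \<open>dual_tensor\<close>.\<close>
  have gm: "green_star (green M \<otimes>\<^bsub>GR\<^esub> y) = green_star y \<otimes>\<^bsub>GR\<^esub> green_star (green M)" if M: "is_module M" and y: "y \<in> carrier GR" for M y
  proof (rule additive_GR_eq[OF _ _ _ y])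
    show "additive_GR (\<lambda>y. green_star (green M \<otimes>\<^bsub>GR\<^esub> y))"
      by (simp add: additive_GR_def cl ad green_closed[OF M] r_distr)
    show "additive_GR (\<lambda>y. green_star y \<otimes>\<^bsub>GR\<^esub> green_star (green M))"
      by (simp add: additive_GR_def cl ad green_closed[OF M] l_distr)
    show "green_star (green M \<otimes>\<^bsub>GR\<^esub> green N) = green_star (green N) \<otimes>\<^bsub>GR\<^esub> green_star (green M)" if N: "is_module N" for N
      unfolding green_tensor[OF M N] green_star_green[OF M] green_star_green[OF N] green_star_green[OF T[OF M N]]
        green_tensor[OF D[OF N] D[OF M]]
      by (rule green_iso[OF D[OF T[OF M N]] T[OF D[OF N] D[OF M]] dual_tensor[OF M N]])
  qed
  have mu: "green_star (x \<otimes>\<^bsub>GR\<^esub> y) = green_star y \<otimes>\<^bsub>GR\<^esub> green_star x" if x: "x \<in> carrier GR" and y: "y \<in> carrier GR" for x y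
  proof (rule additive_GR_eq[OF _ _ _ x])
    show "additive_GR (\<lambda>x. green_star (x \<otimes>\<^bsub>GR\<^esub> y))"
      by (simp add: additive_GR_def cl ad y l_distr)
    show "additive_GR (\<lambda>x. green_star y \<otimes>\<^bsub>GR\<^esub> green_star x)"
      by (simp add: additive_GR_def cl ad y r_distr)
  qed (use gm y in simp)
  show ?thesis unfolding anti_involution_def by (intro conjI ballI funcsetI cl one inv ad mu)
qed

subsection \<open>Structure constants\<close>

lemma coeff_product:
  assumes "i \<in> nonproj_indec_classes" "j \<in> nonproj_indec_classes" "k \<in> nonproj_indec_classes"
  shows "green_coeff k (green_class i \<otimes>\<^bsub>GR\<^esub> green_class j) = int (local.mult (rep k) (tensor (rep i) (rep j)))"
  using assms rep(3,4) green_tensor coeff_green tensor_module(1) by simp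

text \<open>\<open>green_coeff\<close> refers to the chosen representative of the class, which need
  not be \<open>trivial_mod\<close> itself. The two functionals agree on the basis.\<close>

lemma coeff_trivial:
  assumes x: "x \<in> carrier GR"
  shows "green_coeff (iso_class trivial_mod) x = green_mult trivial_mod x"
proof -
  note t = trivial_nonproj_indec
  have "green_mult trivial_mod x = green_mult trivial_mod (comb green_class (\<lambda>C. green_coeff C x))" using green_expansion[OF x] by simp
  also have "\<dots> = (\<Sum>D\<in>nonproj_indec_classes. green_coeff D x * green_mult trivial_mod (green_class D))"
    by (rule abelian_group.additive_int_comb[OF GR_abelian green_mult_add[OF t] finite_nonproj_indec_classes green_class_closed])
  also have "\<dots> = (\<Sum>D\<in>nonproj_indec_classes. if D = iso_class trivial_mod then green_coeff D x else 0)"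
  proof (rule sum.cong[OF refl])
    fix D assume D: "D \<in> nonproj_indec_classes"
    note r = rep[OF D]
    have "mod_iso trivial_mod (rep D) \<longleftrightarrow> D = iso_class trivial_mod"
      using iso_class_eq_iff[OF trivial_module(1) r(3)] r(2) by auto
    then show "green_coeff D x * green_mult trivial_mod (green_class D) = (if D = iso_class trivial_mod then green_coeff D x else 0)"
      unfolding r(4) green_mult_green[OF t r(3)] using mult_indec[OF t conjunct1[OF r(1)]] by simp
  qed
  also have "\<dots> = green_coeff (iso_class trivial_mod) x"
    using finite_nonproj_indec_classes iso_class_mem[OF t] by simp
  finally show ?thesis by simp
qed

lemma coeff_trivial_product:
  assumes i: "i \<in> nonproj_indec_classes" and j: "j \<in> nonproj_indec_classes"
  shows "green_coeff (iso_class trivial_mod) (green_class i \<otimes>\<^bsub>GR\<^esub> green_class j) = (if i = class_dual j then 1 else 0)"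
proof -
  note r = rep[OF i] rep[OF j]
  have T: "is_module (tensor (rep i) (rep j))" by (rule tensor_module(1)[OF r(3,7)])
  have "green_coeff (iso_class trivial_mod) (green_class i \<otimes>\<^bsub>GR\<^esub> green_class j) = int (local.mult trivial_mod (tensor (rep i) (rep j)))"
    unfolding r(4,8) green_tensor[OF r(3,7)] coeff_trivial[OF green_closed[OF T]] by (rule green_mult_green[OF trivial_nonproj_indec T])
  moreover have "mod_iso (rep j) (dual (rep i)) \<longleftrightarrow> j = class_dual i"
    using iso_class_eq_iff[OF r(7) dual_module(1)[OF r(3)]] r(6) by (simp add: class_dual_def)
  moreover have "j = class_dual i \<longleftrightarrow> i = class_dual j" using class_dual_dual i j by metis
  ultimately show ?thesis using mult_trivial_tensor[OF r(1,5)] by simp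
qed

section \<open>The fusion ring axioms and transitivity\<close>

lemma green_fusion_ring: "fusion_ring GR nonproj_indec_classes green_class"
  unfolding fusion_ring_def
proof (intro conjI ballI exI[of _ "{iso_class trivial_mod}"] exI[of _ class_dual])
  interpret ring GR by (rule GR_ring)
  let ?I = nonproj_indec_classes and ?e = "iso_class trivial_mod"
  note t = trivial_nonproj_indec
  \<comment> \<open>The unit is a single basis element because the trivial module is indecomposable
    and not projective; hence the set of the second axiom is a singleton.\<close>
  have e: "?e \<in> ?I" "green_class ?e = \<one>\<^bsub>GR\<^esub>" using iso_class_mem[OF t] rep_iso_class(2)[OF t] green_one by auto
  show "ring GR" by (rule GR_ring)
  show "is_Z_basis GR ?I green_class" by (rule green_basis)
  show "\<one>\<^bsub>GR\<^esub> \<in> green_class ` ?I" using e by (metis image_eqI)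
  show "{?e} \<subseteq> ?I" using e by simp
  show "(\<Oplus>\<^bsub>GR\<^esub>i\<in>{?e}. green_class i) = \<one>\<^bsub>GR\<^esub>" using e(2) by simp
  show "anti_involution GR green_star" by (rule green_star_anti_involution)
  have pc: "green_class i \<otimes>\<^bsub>GR\<^esub> green_class j \<in> carrier GR" if "i \<in> ?I" "j \<in> ?I" for i j
    using that green_class_closed by auto
  show "0 \<le> structure_const GR ?I green_class i j k" if "i \<in> ?I" "j \<in> ?I" "k \<in> ?I" for i j k
    unfolding structure_const_def green_coords[OF pc[OF that(1,2)] that(3)] coeff_product[OF that] by simp
  show "class_dual i \<in> ?I" "class_dual (class_dual i) = i" if "i \<in> ?I" for i
    using class_dual_mem class_dual_dual that by auto
  show "fusion_psi GR ?I green_class {?e} (green_class i \<otimes>\<^bsub>GR\<^esub> green_class j) = (if i = class_dual j then 1 else 0)"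
    if "i \<in> ?I" "j \<in> ?I" for i j
    unfolding fusion_psi_def using green_coords[OF pc[OF that] e(1)] coeff_trivial_product[OF that] by simp
qed

text \<open>In the basis, \<open>h x\<close> is a sum of products of nonnegative integers, so no
  cancellation can occur. \<open>h\<close> will be the coefficient at a basis element of a left or
  right multiple.\<close>

lemma coeff_sum_positive:
  assumes h: "\<And>x y. x \<in> carrier GR \<Longrightarrow> y \<in> carrier GR \<Longrightarrow> h (x \<oplus>\<^bsub>GR\<^esub> y) = h x + h y"
    and x: "x \<in> carrier GR" "\<And>C. C \<in> nonproj_indec_classes \<Longrightarrow> 0 \<le> green_coeff C x"
    and p: "\<And>C. C \<in> nonproj_indec_classes \<Longrightarrow> 0 \<le> h (green_class C)"
  shows "h x \<noteq> (0::int) \<longleftrightarrow> (\<exists>C\<in>nonproj_indec_classes. 0 < green_coeff C x \<and> 0 < h (green_class C))"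
proof -
  have "h x = h (comb green_class (\<lambda>C. green_coeff C x))" using green_expansion[OF x(1)] by simp
  also have "\<dots> = (\<Sum>D\<in>nonproj_indec_classes. green_coeff D x * h (green_class D))"
    by (rule abelian_group.additive_int_comb[OF GR_abelian h finite_nonproj_indec_classes green_class_closed])
  finally have "h x \<noteq> 0 \<longleftrightarrow> (\<exists>C\<in>nonproj_indec_classes. green_coeff C x * h (green_class C) \<noteq> 0)"
    using x(2) p finite_nonproj_indec_classes by (simp add: sum_nonneg_eq_0_iff)
  also have "\<dots> \<longleftrightarrow> (\<exists>C\<in>nonproj_indec_classes. 0 < green_coeff C x \<and> 0 < h (green_class C))"
    using x(2) p by (force simp: less_le)
  finally show ?thesis .
qed

text \<open>Since \<open>i i\<^sup>*\<close> contains \<open>1\<close>, the product \<open>(i i\<^sup>*) j = i (i\<^sup>* j)\<close> contains \<open>j\<close>: nonnegative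
  coefficients do not cancel.\<close>

lemma green_transitive:
  assumes i: "i \<in> nonproj_indec_classes" and j: "j \<in> nonproj_indec_classes"
  shows "\<exists>k\<in>nonproj_indec_classes. 0 < green_coeff j (green_class i \<otimes>\<^bsub>GR\<^esub> green_class k)"
    and "\<exists>k\<in>nonproj_indec_classes. 0 < green_coeff j (green_class k \<otimes>\<^bsub>GR\<^esub> green_class i)"
proof -
  interpret ring GR by (rule GR_ring)
  let ?I = nonproj_indec_classes and ?e = "iso_class trivial_mod" and ?b = green_class
  have e: "?e \<in> ?I" "?b ?e = \<one>\<^bsub>GR\<^esub>" using iso_class_mem[OF trivial_nonproj_indec] rep_iso_class(2)[OF trivial_nonproj_indec] green_one by auto
  have bc: "?b C \<in> carrier GR" if "C \<in> ?I" for C using that green_class_closed by auto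
  have pc: "?b C \<otimes>\<^bsub>GR\<^esub> ?b D \<in> carrier GR" if "C \<in> ?I" "D \<in> ?I" for C D using that bc by simp
  have nn: "0 \<le> green_coeff E (?b C \<otimes>\<^bsub>GR\<^esub> ?b D)" if "C \<in> ?I" "D \<in> ?I" "E \<in> ?I" for C D E
    unfolding coeff_product[OF that] by simp
  define s where "s = class_dual i"
  have s: "s \<in> ?I" "class_dual s = i" "class_dual i = s" using class_dual_mem class_dual_dual i by (auto simp: s_def)
  have L: "green_coeff j (?b C \<otimes>\<^bsub>GR\<^esub> (x \<oplus>\<^bsub>GR\<^esub> y)) = green_coeff j (?b C \<otimes>\<^bsub>GR\<^esub> x) + green_coeff j (?b C \<otimes>\<^bsub>GR\<^esub> y)"
    and R: "green_coeff j ((x \<oplus>\<^bsub>GR\<^esub> y) \<otimes>\<^bsub>GR\<^esub> ?b C) = green_coeff j (x \<otimes>\<^bsub>GR\<^esub> ?b C) + green_coeff j (y \<otimes>\<^bsub>GR\<^esub> ?b C)"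
    if "C \<in> ?I" "x \<in> carrier GR" "y \<in> carrier GR" for C x y
    using that bc coeff_add[OF j] by (simp_all add: l_distr r_distr)
  have one: "0 < green_coeff j (?b j)" using coeff_basis[OF j j] by simp
  have ee: "0 < green_coeff ?e (?b i \<otimes>\<^bsub>GR\<^esub> ?b s)" "0 < green_coeff ?e (?b s \<otimes>\<^bsub>GR\<^esub> ?b i)"
    using coeff_trivial_product[OF i s(1)] coeff_trivial_product[OF s(1) i] s by auto
  have "green_coeff j ((?b i \<otimes>\<^bsub>GR\<^esub> ?b s) \<otimes>\<^bsub>GR\<^esub> ?b j) \<noteq> 0"
  proof (subst coeff_sum_positive[where h = "\<lambda>x. green_coeff j (x \<otimes>\<^bsub>GR\<^esub> ?b j)"])
    show "\<exists>C\<in>?I. 0 < green_coeff C (?b i \<otimes>\<^bsub>GR\<^esub> ?b s) \<and> 0 < green_coeff j (?b C \<otimes>\<^bsub>GR\<^esub> ?b j)"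
      using e ee(1) one bc[OF j] by (intro bexI[of _ ?e]) auto
  qed (use R[OF j] pc nn i j s(1) in auto)
  then have "green_coeff j (?b i \<otimes>\<^bsub>GR\<^esub> (?b s \<otimes>\<^bsub>GR\<^esub> ?b j)) \<noteq> 0" using bc i j s(1) by (simp add: m_assoc)
  then show "\<exists>k\<in>?I. 0 < green_coeff j (?b i \<otimes>\<^bsub>GR\<^esub> ?b k)"
    by (subst (asm) coeff_sum_positive[where h = "\<lambda>x. green_coeff j (?b i \<otimes>\<^bsub>GR\<^esub> x)"]) (use L[OF i] pc nn i j s(1) in auto)
  have "green_coeff j (?b j \<otimes>\<^bsub>GR\<^esub> (?b s \<otimes>\<^bsub>GR\<^esub> ?b i)) \<noteq> 0"
  proof (subst coeff_sum_positive[where h = "\<lambda>x. green_coeff j (?b j \<otimes>\<^bsub>GR\<^esub> x)"])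
    show "\<exists>C\<in>?I. 0 < green_coeff C (?b s \<otimes>\<^bsub>GR\<^esub> ?b i) \<and> 0 < green_coeff j (?b j \<otimes>\<^bsub>GR\<^esub> ?b C)"
      using e ee(2) one bc[OF j] by (intro bexI[of _ ?e]) auto
  qed (use L[OF j] pc nn i j s(1) in auto)
  then have "green_coeff j ((?b j \<otimes>\<^bsub>GR\<^esub> ?b s) \<otimes>\<^bsub>GR\<^esub> ?b i) \<noteq> 0" using bc i j s(1) by (simp add: m_assoc)
  then show "\<exists>k\<in>?I. 0 < green_coeff j (?b k \<otimes>\<^bsub>GR\<^esub> ?b i)"
    by (subst (asm) coeff_sum_positive[where h = "\<lambda>x. green_coeff j (x \<otimes>\<^bsub>GR\<^esub> ?b i)"]) (use R[OF i] pc nn i j s(1) in auto)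
qed

lemma green_transitive_fusion_ring: "transitive_fusion_ring GR nonproj_indec_classes green_class"
  unfolding transitive_fusion_ring_def
proof (intro conjI ballI green_fusion_ring)
  let ?I = nonproj_indec_classes
  fix i j assume ij: "i \<in> ?I" "j \<in> ?I"
  have pc: "green_class C \<otimes>\<^bsub>GR\<^esub> green_class D \<in> carrier GR" if "C \<in> ?I" "D \<in> ?I" for C D
    using that green_class_closed ring.ring_simprules(5)[OF GR_ring] by auto
  show "\<exists>k\<in>?I. structure_const GR ?I green_class i k j \<noteq> 0"
  proof -
    obtain k where k: "k \<in> ?I" "0 < green_coeff j (green_class i \<otimes>\<^bsub>GR\<^esub> green_class k)"
      using green_transitive(1)[OF ij] by blast
    then show ?thesis unfolding structure_const_def
      by (intro bexI[of _ k]) (simp_all add: green_coords[OF pc[OF ij(1) k(1)] ij(2)])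
  qed
  show "\<exists>l\<in>?I. structure_const GR ?I green_class l i j \<noteq> 0"
  proof -
    obtain k where k: "k \<in> ?I" "0 < green_coeff j (green_class k \<otimes>\<^bsub>GR\<^esub> green_class i)"
      using green_transitive(2)[OF ij] by blast
    then show ?thesis unfolding structure_const_def
      by (intro bexI[of _ k]) (simp_all add: green_coords[OF pc[OF k(1) ij(1)] ij(2)])
  qed
qed

end

theorem proposition7p1:
  fixes G :: "('g, 'm) monoid_scheme" (structure)
    and \<chi> :: "'g \<Rightarrow> complex" and g :: 'g and n :: nat
  assumes "nonnilpotent_group_datum G \<chi> g n"
  shows "transitive_fusion_ring
           (group_data.stable_green_ring G \<chi> g n)
           (group_data.nonproj_indec_classes G \<chi> g n)
           (group_data.green_class G \<chi> g n)"
  by (rule nonnilpotent_group_datum.green_transitive_fusion_ring[OF assms])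

end
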